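(* Let $\Omega\subset\mathbb{R}^n$, $n\ge 3$, be a bounded domain with smooth boundary, let $\lambda_1$ be the first Dirichlet eigenvalue of $-\Delta$ on $\Omega$, and let $\alpha,b,\tau,\gamma\in\mathbb{R}$ satisfy $b>\tau>0$, $0<|\alpha|<\lambda_1$, $2<\gamma<\frac{2(n-1)}{n-2}$. Let $u_0,v_0,v_1\in H_0^1(\Omega)$, $u_1,v_2\in L^2(\Omega)$, put $w_0:=v_0+\tau v_1$, $w_1:=v_1+\tau v_2$, and assume $\mathcal{E}(0)<d_\alpha$ and $\mathcal{I}_\alpha(u_0,w_0)>0$ (notation in the context). Let $(u,v)$ be the (unique) global weak solution of the system (S) of the context with these initial data, let $w=v+\tau v_t$, and let $Y(t)=(u(t),u_t(t),w(t),w_t(t),v_t(t))$. If the trajectory $\{Y(t):t\ge 0\}$ is relatively compact in $$\mathcal{H}=H_0^1(\Omega)\times L^2(\Omega)\times H_0^1(\Omega)\times L^2(\Omega)\times H_0^1(\Omega),$$ then $$\lim_{t\to\infty}\mathcal{E}(t)=0 .$$ Equivalently, $$\lim_{t\to\infty}\bigl(\|u_t(t)\|_2^2+\|w_t(t)\|_2^2+\|\nabla v_t(t)\|_2^2+\|\nabla u(t)\|_2^2+\|\nabla w(t)\|_2^2\bigr)=0,$$ and $(u(t),w(t))\to(0,0)$ in $H_0^1(\Omega)\times H_0^1(\Omega)$.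
   Context: $\|\cdot\|_p$ is the $L^p(\Omega)$ norm, $(\cdot,\cdot)$ the $L^2(\Omega)$ inner product, $\langle\cdot,\cdot\rangle$ the $H^{-1}(\Omega)$–$H_0^1(\Omega)$ duality. $C_w([0,T];X)$ denotes weakly continuous functions with values in $X$. $|s|^\gamma\ln|s|$ and similar expressions are taken to be $0$ at $s=0$. Set $$f(s)=|s|^{\gamma-2}s\ln|s|,\qquad F(s)=\int_0^s f(\xi)\,d\xi=\tfrac1\gamma|s|^\gamma\ln|s|-\tfrac1{\gamma^2}|s|^\gamma,\quad F(0)=0.$$ System (S): $$u_{tt}-\Delta u+\alpha(v+\tau v_t)=f(u),\qquad \tau v_{ttt}+v_{tt}-\Delta v-b\Delta v_t+\alpha u=0\quad\text{in }\Omega\times(0,\infty),$$ with $u=v=0$ on $\partial\Omega\times(0,\infty)$ and $u(0)=u_0$, $u_t(0)=u_1$, $v(0)=v_0$, $v_t(0)=v_1$, $v_{tt}(0)=v_2$. Weak solution on $[0,T]$: a pair $(u,v)$ such that, with $w=v+\tau v_t$, $u,w\in L^\infty(0,T;H_0^1(\Omega))\cap C([0,T];L^2(\Omega))$; $u_t,w_t\in L^\infty(0,T;L^2(\Omega))\cap C_w([0,T];L^2(\Omega))$; $u_{tt},w_{tt}\in L^\infty(0,T;H^{-1}(\Omega))$; $v_t\in L^\infty(0,T;H_0^1(\Omega))\cap C_w([0,T];H_0^1(\Omega))$; and for a.e. $t\in(0,T)$ $$\langle u_{tt},\phi\rangle+(\nabla u,\nabla\phi)+\alpha(w,\phi)=(f(u),\phi)\quad\forall\phi\in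 H_0^1(\Omega),$$ $$\langle w_{tt},\psi\rangle+(\nabla w,\nabla\psi)+(b-\tau)(\nabla v_t,\nabla\psi)+\alpha(u,\psi)=0\quad\forall\psi\in H_0^1(\Omega);$$ the initial conditions are attained as $u(0)=u_0$, $w(0)=w_0$ in $L^2(\Omega)$, and $u_t(0)=u_1$, $w_t(0)=w_1$ in the weak $L^2(\Omega)$ sense, together with $v(0)=v_0$, $v_t(0)=v_1$. A global weak solution is a weak solution on $[0,T]$ for every $T>0$. Under the stated hypotheses on the parameters and data, the paper proves that a unique global weak solution exists and that $Y\in C([0,\infty);\mathcal H)$. Energy: $$\mathcal{E}(t)=\tfrac12\|u_t\|_2^2+\tfrac12\|w_t\|_2^2+\tfrac{\tau(b-\tau)}2\|\nabla v_t\|_2^2+\tfrac12\|\nabla u\|_2^2+\tfrac12\|\nabla w\|_2^2+\alpha(u,w)-\int_\Omega F(u)\,dx,$$ and $\mathcal E(0)$ is this expression evaluated at $(u,u_t,w,w_t,v_t)=(u_0,u_1,w_0,w_1,v_1)$. For $(u,w)\in H_0^1(\Omega)\times H_0^1(\Omega)$: $$Q_\alpha(u,w)=\|\nabla u\|_2^2+\|\nabla w\|_2^2+2\alpha(u,w),$$ $$\mathcal{J}_\alpha(u,w)=\tfrac12Q_\alpha(u,w)-\tfrac1\gamma\int_\Omega|u|^\gamma\ln|u|\,dx+\tfrac1{\gamma^2}\|u\|_\gamma^\gamma,\qquad \mathcal{I}_\alpha(u,w)=Q_\alpha(u,w)-\int_\Omega|u|^\gamma\ln|u|\,dx,$$ $$\mathcal{N}_\alpha=\{(u,w)\neq(0,0):\mathcal{I}_\alpha(u,w)=0\},\qquad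 d_\alpha=\inf_{\mathcal{N}_\alpha}\mathcal{J}_\alpha.$$ *)

theory Defs
  imports "HOL-Analysis.Analysis"
begin

section \<open>Smooth functions and domains with smooth boundary\<close>

primrec C_k :: "nat \<Rightarrow> ('a::euclidean_space \<Rightarrow> real) \<Rightarrow> bool" where
  "C_k 0 f \<longleftrightarrow> continuous_on UNIV f"
| "C_k (Suc k) f \<longleftrightarrow> (\<forall>x. f differentiable (at x)) \<and>
     (\<forall>i\<in>Basis. C_k k (\<lambda>x. frechet_derivative f (at x) i))"

definition smooth :: "('a::euclidean_space \<Rightarrow> real) \<Rightarrow> bool" where
  "smooth f \<longleftrightarrow> (\<forall>k. C_k k f)"

text \<open>Near each boundary point the domain is the strict epigraph of a smooth function in a rotated
  coordinate system; the unit vector \<open>e\<close> is its last axis, and \<open>x - (x \<bullet> e) *\<^sub>R e\<close> collects the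
  remaining coordinates of \<open>x\<close>.\<close>

definition smooth_boundary :: "'a::euclidean_space set \<Rightarrow> bool" where
  "smooth_boundary \<Omega> \<longleftrightarrow>
     (\<forall>p\<in>frontier \<Omega>. \<exists>r>0. \<exists>e g. norm e = 1 \<and> smooth g \<and>
        \<Omega> \<inter> ball p r = {x \<in> ball p r. g (x - (x \<bullet> e) *\<^sub>R e) < x \<bullet> e})"

definition smooth_bounded_domain :: "'a::euclidean_space set \<Rightarrow> bool" where
  "smooth_bounded_domain \<Omega> \<longleftrightarrow>
     open \<Omega> \<and> connected \<Omega> \<and> \<Omega> \<noteq> {} \<and> bounded \<Omega> \<and> smooth_boundary \<Omega>"

definition test_functions :: "'a::euclidean_space set \<Rightarrow> ('a \<Rightarrow> real) set" where
  "test_functions \<Omega> =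
     {\<phi>. smooth \<phi> \<and> compact (closure {x. \<phi> x \<noteq> 0}) \<and> closure {x. \<phi> x \<noteq> 0} \<subseteq> \<Omega>}"


section \<open>Seminormed spaces of real-valued functions\<close>

text \<open>Elements of Lebesgue and Sobolev spaces are represented by functions rather than by classes of
  functions modulo equality almost everywhere, so their norms are only seminorms here. A space is
  given by a carrier \<open>X\<close> and a seminorm \<open>N\<close>; the index type \<open>'b\<close> is the underlying Euclidean space
  for function spaces, and a function type for spaces of functionals.\<close>

definition seminorm_topology ::
    "('b \<Rightarrow> real) set \<Rightarrow> (('b \<Rightarrow> real) \<Rightarrow> real) \<Rightarrow> ('b \<Rightarrow> real) topology" where
  "seminorm_topology X N =
     topology (\<lambda>U. U \<subseteq> X \<and> (\<forall>f\<in>U. \<exists>\<epsilon>>0. \<forall>g\<in>X. N (g - f) < \<epsilon> \<longrightarrow> g \<in> U))"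

lemma istopology_seminorm:
  "istopology (\<lambda>U. U \<subseteq> X \<and> (\<forall>f\<in>U. \<exists>\<epsilon>>0. \<forall>g\<in>X. N (g - f) < (\<epsilon>::real) \<longrightarrow> g \<in> U))"
  unfolding istopology_def
proof (intro conjI allI impI ballI)
  fix S T f
  assume S: "S \<subseteq> X \<and> (\<forall>f\<in>S. \<exists>\<epsilon>>0. \<forall>g\<in>X. N (g - f) < \<epsilon> \<longrightarrow> g \<in> S)"
    and T: "T \<subseteq> X \<and> (\<forall>f\<in>T. \<exists>\<epsilon>>0. \<forall>g\<in>X. N (g - f) < \<epsilon> \<longrightarrow> g \<in> T)"
    and f: "f \<in> S \<inter> T"
  from S f obtain d where "d > 0" "\<forall>g\<in>X. N (g - f) < d \<longrightarrow> g \<in> S" by blast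
  moreover from T f obtain e where "e > 0" "\<forall>g\<in>X. N (g - f) < e \<longrightarrow> g \<in> T" by blast
  ultimately show "\<exists>\<epsilon>>0. \<forall>g\<in>X. N (g - f) < \<epsilon> \<longrightarrow> g \<in> S \<inter> T"
    by (intro exI[of _ "min d e"]) auto
next
  fix K f
  assume "\<forall>U\<in>K. U \<subseteq> X \<and> (\<forall>f\<in>U. \<exists>\<epsilon>>0. \<forall>g\<in>X. N (g - f) < \<epsilon> \<longrightarrow> g \<in> U)" "f \<in> \<Union>K"
  then show "\<exists>\<epsilon>>0. \<forall>g\<in>X. N (g - f) < \<epsilon> \<longrightarrow> g \<in> \<Union>K"
    by (meson UnionE UnionI)
qed auto

lemma topspace_seminorm_topology: "topspace (seminorm_topology X N) = X"
proof -
  have "openin (seminorm_topology X N) U \<longleftrightarrow>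
      U \<subseteq> X \<and> (\<forall>f\<in>U. \<exists>\<epsilon>>0. \<forall>g\<in>X. N (g - f) < \<epsilon> \<longrightarrow> g \<in> U)" for U
    unfolding seminorm_topology_def by (simp add: topology_inverse' istopology_seminorm)
  then show ?thesis
    unfolding topspace_def using zero_less_one by blast
qed

definition dual_space ::
    "('b \<Rightarrow> real) set \<Rightarrow> (('b \<Rightarrow> real) \<Rightarrow> real) \<Rightarrow> (('b \<Rightarrow> real) \<Rightarrow> real) set" where
  "dual_space X N =
     {\<l>. (\<forall>f\<in>X. \<forall>g\<in>X. \<forall>a c. \<l> (\<lambda>x. a * f x + c * g x) = a * \<l> f + c * \<l> g) \<and>
          (\<exists>C. \<forall>f\<in>X. \<bar>\<l> f\<bar> \<le> C * N f)}"

definition dual_norm ::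
    "('b \<Rightarrow> real) set \<Rightarrow> (('b \<Rightarrow> real) \<Rightarrow> real) \<Rightarrow> (('b \<Rightarrow> real) \<Rightarrow> real) \<Rightarrow> real" where
  "dual_norm X N \<l> = Sup {\<bar>\<l> f\<bar> | f. f \<in> X \<and> N f \<le> 1}"

text \<open>Bochner (strong) measurability on \<open>(0,T)\<close>: almost everywhere limits of simple functions.\<close>

definition strongly_measurable ::
    "('b \<Rightarrow> real) set \<Rightarrow> (('b \<Rightarrow> real) \<Rightarrow> real) \<Rightarrow> real \<Rightarrow> (real \<Rightarrow> 'b \<Rightarrow> real) \<Rightarrow> bool" where
  "strongly_measurable X N T g \<longleftrightarrow>
     (\<exists>s :: nat \<Rightarrow> real \<Rightarrow> 'b \<Rightarrow> real.
        (\<forall>k. finite (s k ` {0<..<T}) \<and> s k ` {0<..<T} \<subseteq> X \<and>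
             (\<forall>y. {t \<in> {0<..<T}. s k t = y} \<in> sets lebesgue)) \<and>
        (AE t in lebesgue_on {0<..<T}. g t \<in> X \<and> (\<lambda>k. N (s k t - g t)) \<longlonglongrightarrow> 0))"

definition Linfty ::
    "('b \<Rightarrow> real) set \<Rightarrow> (('b \<Rightarrow> real) \<Rightarrow> real) \<Rightarrow> real \<Rightarrow> (real \<Rightarrow> 'b \<Rightarrow> real) set" where
  "Linfty X N T = {g. strongly_measurable X N T g \<and>
     (\<exists>C. AE t in lebesgue_on {0<..<T}. g t \<in> X \<and> N (g t) \<le> C)}"

definition strongly_continuous ::
    "('b \<Rightarrow> real) set \<Rightarrow> (('b \<Rightarrow> real) \<Rightarrow> real) \<Rightarrow> real \<Rightarrow> (real \<Rightarrow> 'b \<Rightarrow> real) set" where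
  "strongly_continuous X N T = {g. (\<forall>t\<in>{0..T}. g t \<in> X) \<and>
     (\<forall>t\<in>{0..T}. ((\<lambda>s. N (g s - g t)) \<longlongrightarrow> 0) (at t within {0..T}))}"

definition weakly_continuous ::
    "('b \<Rightarrow> real) set \<Rightarrow> (('b \<Rightarrow> real) \<Rightarrow> real) \<Rightarrow> real \<Rightarrow> (real \<Rightarrow> 'b \<Rightarrow> real) set" where
  "weakly_continuous X N T = {g. (\<forall>t\<in>{0..T}. g t \<in> X) \<and>
     (\<forall>\<l>\<in>dual_space X N. continuous_on {0..T} (\<lambda>t. \<l> (g t)))}"


section \<open>The spaces \<open>L\<^sup>2\<close>, \<open>H\<^sup>1\<^sub>0\<close> and its dual\<close>

definition L2 :: "'a::euclidean_space set \<Rightarrow> ('a \<Rightarrow> 'c::euclidean_space) set" where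
  "L2 \<Omega> = {f \<in> borel_measurable (lebesgue_on \<Omega>). integrable (lebesgue_on \<Omega>) (\<lambda>x. (norm (f x))\<^sup>2)}"

definition L2_inner ::
    "'a::euclidean_space set \<Rightarrow> ('a \<Rightarrow> 'c::euclidean_space) \<Rightarrow> ('a \<Rightarrow> 'c) \<Rightarrow> real" where
  "L2_inner \<Omega> f g = (\<integral>x. f x \<bullet> g x \<partial>lebesgue_on \<Omega>)"

definition L2_norm :: "'a::euclidean_space set \<Rightarrow> ('a \<Rightarrow> 'c::euclidean_space) \<Rightarrow> real" where
  "L2_norm \<Omega> f = sqrt (\<integral>x. (norm (f x))\<^sup>2 \<partial>lebesgue_on \<Omega>)"

definition is_weak_gradient ::
    "'a::euclidean_space set \<Rightarrow> ('a \<Rightarrow> real) \<Rightarrow> ('a \<Rightarrow> 'a) \<Rightarrow> bool" where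
  "is_weak_gradient \<Omega> u g \<longleftrightarrow> (\<forall>\<phi>\<in>test_functions \<Omega>. \<forall>i\<in>Basis.
     (\<integral>x. u x * frechet_derivative \<phi> (at x) i \<partial>lebesgue_on \<Omega>) =
     - (\<integral>x. (g x \<bullet> i) * \<phi> x \<partial>lebesgue_on \<Omega>))"

definition H1 :: "'a::euclidean_space set \<Rightarrow> ('a \<Rightarrow> real) set" where
  "H1 \<Omega> = {u \<in> L2 \<Omega>. \<exists>g\<in>L2 \<Omega>. is_weak_gradient \<Omega> u g}"

text \<open>The choice is unique up to a null set for \<open>u \<in> H1 \<Omega>\<close>.\<close>

definition grad :: "'a::euclidean_space set \<Rightarrow> ('a \<Rightarrow> real) \<Rightarrow> 'a \<Rightarrow> 'a" where
  "grad \<Omega> u = (SOME g. g \<in> L2 \<Omega> \<and> is_weak_gradient \<Omega> u g)"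

definition H1_norm :: "'a::euclidean_space set \<Rightarrow> ('a \<Rightarrow> real) \<Rightarrow> real" where
  "H1_norm \<Omega> u = sqrt ((L2_norm \<Omega> u)\<^sup>2 + (L2_norm \<Omega> (grad \<Omega> u))\<^sup>2)"

definition H10 :: "'a::euclidean_space set \<Rightarrow> ('a \<Rightarrow> real) set" where
  "H10 \<Omega> = {u \<in> H1 \<Omega>. \<exists>\<phi> :: nat \<Rightarrow> 'a \<Rightarrow> real.
     (\<forall>k. \<phi> k \<in> test_functions \<Omega>) \<and> (\<lambda>k. H1_norm \<Omega> (u - \<phi> k)) \<longlonglongrightarrow> 0}"

abbreviation Hm1 :: "'a::euclidean_space set \<Rightarrow> (('a \<Rightarrow> real) \<Rightarrow> real) set" where
  "Hm1 \<Omega> \<equiv> dual_space (H10 \<Omega>) (H1_norm \<Omega>)"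

abbreviation Hm1_norm :: "'a::euclidean_space set \<Rightarrow> (('a \<Rightarrow> real) \<Rightarrow> real) \<Rightarrow> real" where
  "Hm1_norm \<Omega> \<equiv> dual_norm (H10 \<Omega>) (H1_norm \<Omega>)"

abbreviation L2_topology :: "'a::euclidean_space set \<Rightarrow> ('a \<Rightarrow> real) topology" where
  "L2_topology \<Omega> \<equiv> seminorm_topology (L2 \<Omega>) (L2_norm \<Omega>)"

abbreviation H10_topology :: "'a::euclidean_space set \<Rightarrow> ('a \<Rightarrow> real) topology" where
  "H10_topology \<Omega> \<equiv> seminorm_topology (H10 \<Omega>) (H1_norm \<Omega>)"

definition phase_space :: "'a::euclidean_space set \<Rightarrow>
    (('a \<Rightarrow> real) \<times> ('a \<Rightarrow> real) \<times> ('a \<Rightarrow> real) \<times> ('a \<Rightarrow> real) \<times> ('a \<Rightarrow> real)) topology" where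
  "phase_space \<Omega> = prod_topology (H10_topology \<Omega>) (prod_topology (L2_topology \<Omega>)
     (prod_topology (H10_topology \<Omega>) (prod_topology (L2_topology \<Omega>) (H10_topology \<Omega>))))"

definition relatively_compactin :: "'b topology \<Rightarrow> 'b set \<Rightarrow> bool" where
  "relatively_compactin X S \<longleftrightarrow> S \<subseteq> topspace X \<and> compactin X (X closure_of S)"

definition ae_eq :: "'a::euclidean_space set \<Rightarrow> ('a \<Rightarrow> real) \<Rightarrow> ('a \<Rightarrow> real) \<Rightarrow> bool" where
  "ae_eq \<Omega> f g \<longleftrightarrow> (AE x in lebesgue_on \<Omega>. f x = g x)"

definition dirichlet_eigenvalue :: "'a::euclidean_space set \<Rightarrow> real \<Rightarrow> bool" where
  "dirichlet_eigenvalue \<Omega> \<mu> \<longleftrightarrow> (\<exists>\<phi>\<in>H10 \<Omega>. \<not> ae_eq \<Omega> \<phi> (\<lambda>x. 0) \<and>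
     (\<forall>\<psi>\<in>H10 \<Omega>. L2_inner \<Omega> (grad \<Omega> \<phi>) (grad \<Omega> \<psi>) = \<mu> * L2_inner \<Omega> \<phi> \<psi>))"

definition first_dirichlet_eigenvalue :: "'a::euclidean_space set \<Rightarrow> real" where
  "first_dirichlet_eigenvalue \<Omega> = (LEAST \<mu>. dirichlet_eigenvalue \<Omega> \<mu>)"


section \<open>Nonlinearity, energy and potential well\<close>

definition src :: "real \<Rightarrow> real \<Rightarrow> real" where
  "src \<gamma> s = \<bar>s\<bar> powr (\<gamma> - 2) * s * ln \<bar>s\<bar>"

definition Src :: "real \<Rightarrow> real \<Rightarrow> real" where
  "Src \<gamma> s = (LBINT \<xi>=0..s. src \<gamma> \<xi>)"

definition energy :: "'a::euclidean_space set \<Rightarrow> real \<Rightarrow> real \<Rightarrow> real \<Rightarrow> real \<Rightarrow>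
    ('a \<Rightarrow> real) \<Rightarrow> ('a \<Rightarrow> real) \<Rightarrow> ('a \<Rightarrow> real) \<Rightarrow> ('a \<Rightarrow> real) \<Rightarrow> ('a \<Rightarrow> real) \<Rightarrow> real" where
  "energy \<Omega> \<alpha> b \<tau> \<gamma> u ut w wt vt =
     1/2 * (L2_norm \<Omega> ut)\<^sup>2 + 1/2 * (L2_norm \<Omega> wt)\<^sup>2 + \<tau> * (b - \<tau>) / 2 * (L2_norm \<Omega> (grad \<Omega> vt))\<^sup>2
     + 1/2 * (L2_norm \<Omega> (grad \<Omega> u))\<^sup>2 + 1/2 * (L2_norm \<Omega> (grad \<Omega> w))\<^sup>2 + \<alpha> * L2_inner \<Omega> u w
     - (\<integral>x. Src \<gamma> (u x) \<partial>lebesgue_on \<Omega>)"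

definition Q_form :: "'a::euclidean_space set \<Rightarrow> real \<Rightarrow> ('a \<Rightarrow> real) \<Rightarrow> ('a \<Rightarrow> real) \<Rightarrow> real" where
  "Q_form \<Omega> \<alpha> u w =
     (L2_norm \<Omega> (grad \<Omega> u))\<^sup>2 + (L2_norm \<Omega> (grad \<Omega> w))\<^sup>2 + 2 * \<alpha> * L2_inner \<Omega> u w"

definition J_fun :: "'a::euclidean_space set \<Rightarrow> real \<Rightarrow> real \<Rightarrow> ('a \<Rightarrow> real) \<Rightarrow> ('a \<Rightarrow> real) \<Rightarrow> real" where
  "J_fun \<Omega> \<alpha> \<gamma> u w = 1/2 * Q_form \<Omega> \<alpha> u w
     - 1/\<gamma> * (\<integral>x. \<bar>u x\<bar> powr \<gamma> * ln \<bar>u x\<bar> \<partial>lebesgue_on \<Omega>)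
     + 1/\<gamma>\<^sup>2 * (\<integral>x. \<bar>u x\<bar> powr \<gamma> \<partial>lebesgue_on \<Omega>)"

definition I_fun :: "'a::euclidean_space set \<Rightarrow> real \<Rightarrow> real \<Rightarrow> ('a \<Rightarrow> real) \<Rightarrow> ('a \<Rightarrow> real) \<Rightarrow> real" where
  "I_fun \<Omega> \<alpha> \<gamma> u w = Q_form \<Omega> \<alpha> u w - (\<integral>x. \<bar>u x\<bar> powr \<gamma> * ln \<bar>u x\<bar> \<partial>lebesgue_on \<Omega>)"

definition nehari :: "'a::euclidean_space set \<Rightarrow> real \<Rightarrow> real \<Rightarrow> (('a \<Rightarrow> real) \<times> ('a \<Rightarrow> real)) set" where
  "nehari \<Omega> \<alpha> \<gamma> = {(u, w). u \<in> H10 \<Omega> \<and> w \<in> H10 \<Omega> \<and>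
     \<not> (ae_eq \<Omega> u (\<lambda>x. 0) \<and> ae_eq \<Omega> w (\<lambda>x. 0)) \<and> I_fun \<Omega> \<alpha> \<gamma> u w = 0}"

definition well_depth :: "'a::euclidean_space set \<Rightarrow> real \<Rightarrow> real \<Rightarrow> real" where
  "well_depth \<Omega> \<alpha> \<gamma> = (INF (u, w)\<in>nehari \<Omega> \<alpha> \<gamma>. J_fun \<Omega> \<alpha> \<gamma> u w)"


section \<open>Weak solutions\<close>

text \<open>\<open>h\<close> is the derivative of \<open>g\<close> in the sense of distributions on \<open>(0,T)\<close> with values in the dual
  of \<open>H10 \<Omega>\<close>. Functions with values in \<open>L2 \<Omega>\<close> enter through the embedding \<open>L2_emb\<close>.\<close>

definition weak_time_derivative ::
    "'a::euclidean_space set \<Rightarrow> real \<Rightarrow> (real \<Rightarrow> ('a \<Rightarrow> real) \<Rightarrow> real)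
      \<Rightarrow> (real \<Rightarrow> ('a \<Rightarrow> real) \<Rightarrow> real) \<Rightarrow> bool" where
  "weak_time_derivative \<Omega> T g h \<longleftrightarrow> (\<forall>\<phi>\<in>H10 \<Omega>. \<forall>\<theta>\<in>test_functions {0<..<T}.
     (\<integral>t. g t \<phi> * deriv \<theta> t \<partial>lebesgue_on {0<..<T}) =
     - (\<integral>t. h t \<phi> * \<theta> t \<partial>lebesgue_on {0<..<T}))"

definition L2_emb ::
    "'a::euclidean_space set \<Rightarrow> (real \<Rightarrow> 'a \<Rightarrow> real) \<Rightarrow> real \<Rightarrow> ('a \<Rightarrow> real) \<Rightarrow> real" where
  "L2_emb \<Omega> g = (\<lambda>t \<phi>. L2_inner \<Omega> (g t) \<phi>)"

definition w_comb :: "real \<Rightarrow> ('a \<Rightarrow> real) \<Rightarrow> ('a \<Rightarrow> real) \<Rightarrow> 'a \<Rightarrow> real" where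
  "w_comb \<tau> v v' = (\<lambda>x. v x + \<tau> * v' x)"

text \<open>The solution is the pair \<open>(u, v)\<close>; \<open>ut\<close>, \<open>vt\<close>, \<open>wt\<close> denote the time derivatives of \<open>u\<close>, \<open>v\<close>
  and \<open>w = v + \<tau> v\<^sub>t\<close>. Weak continuity determines their values at every time up to null sets.\<close>

definition weak_solution :: "'a::euclidean_space set \<Rightarrow> real \<Rightarrow> real \<Rightarrow> real \<Rightarrow> real \<Rightarrow>
    ('a \<Rightarrow> real) \<Rightarrow> ('a \<Rightarrow> real) \<Rightarrow> ('a \<Rightarrow> real) \<Rightarrow> ('a \<Rightarrow> real) \<Rightarrow> ('a \<Rightarrow> real) \<Rightarrow> real \<Rightarrow>
    (real \<Rightarrow> 'a \<Rightarrow> real) \<Rightarrow> (real \<Rightarrow> 'a \<Rightarrow> real) \<Rightarrow> (real \<Rightarrow> 'a \<Rightarrow> real) \<Rightarrow> (real \<Rightarrow> 'a \<Rightarrow> real) \<Rightarrow>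
    (real \<Rightarrow> 'a \<Rightarrow> real) \<Rightarrow> bool" where
  "weak_solution \<Omega> \<alpha> b \<tau> \<gamma> u0 u1 v0 v1 v2 T u ut v vt wt \<longleftrightarrow>
    (let w = (\<lambda>t. w_comb \<tau> (v t) (vt t)) in
     u \<in> Linfty (H10 \<Omega>) (H1_norm \<Omega>) T \<inter> strongly_continuous (L2 \<Omega>) (L2_norm \<Omega>) T \<and>
     w \<in> Linfty (H10 \<Omega>) (H1_norm \<Omega>) T \<inter> strongly_continuous (L2 \<Omega>) (L2_norm \<Omega>) T \<and>
     ut \<in> Linfty (L2 \<Omega>) (L2_norm \<Omega>) T \<inter> weakly_continuous (L2 \<Omega>) (L2_norm \<Omega>) T \<and>
     wt \<in> Linfty (L2 \<Omega>) (L2_norm \<Omega>) T \<inter> weakly_continuous (L2 \<Omega>) (L2_norm \<Omega>) T \<and>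
     vt \<in> Linfty (H10 \<Omega>) (H1_norm \<Omega>) T \<inter> weakly_continuous (H10 \<Omega>) (H1_norm \<Omega>) T \<and>
     weak_time_derivative \<Omega> T (L2_emb \<Omega> u) (L2_emb \<Omega> ut) \<and>
     weak_time_derivative \<Omega> T (L2_emb \<Omega> v) (L2_emb \<Omega> vt) \<and>
     weak_time_derivative \<Omega> T (L2_emb \<Omega> w) (L2_emb \<Omega> wt) \<and>
     (\<exists>utt\<in>Linfty (Hm1 \<Omega>) (Hm1_norm \<Omega>) T. \<exists>wtt\<in>Linfty (Hm1 \<Omega>) (Hm1_norm \<Omega>) T.
        weak_time_derivative \<Omega> T (L2_emb \<Omega> ut) utt \<and>
        weak_time_derivative \<Omega> T (L2_emb \<Omega> wt) wtt \<and>
        (AE t in lebesgue_on {0<..<T}.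
          (\<forall>\<phi>\<in>H10 \<Omega>. utt t \<phi> + L2_inner \<Omega> (grad \<Omega> (u t)) (grad \<Omega> \<phi>) + \<alpha> * L2_inner \<Omega> (w t) \<phi>
             = L2_inner \<Omega> (\<lambda>x. src \<gamma> (u t x)) \<phi>) \<and>
          (\<forall>\<psi>\<in>H10 \<Omega>. wtt t \<psi> + L2_inner \<Omega> (grad \<Omega> (w t)) (grad \<Omega> \<psi>)
             + (b - \<tau>) * L2_inner \<Omega> (grad \<Omega> (vt t)) (grad \<Omega> \<psi>) + \<alpha> * L2_inner \<Omega> (u t) \<psi> = 0))) \<and>
     ae_eq \<Omega> (u 0) u0 \<and> ae_eq \<Omega> (w 0) (w_comb \<tau> v0 v1) \<and>
     (\<forall>\<phi>\<in>L2 \<Omega>. ((\<lambda>t. L2_inner \<Omega> (ut t) \<phi>) \<longlongrightarrow> L2_inner \<Omega> u1 \<phi>) (at_right 0)) \<and>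
     (\<forall>\<phi>\<in>L2 \<Omega>. ((\<lambda>t. L2_inner \<Omega> (wt t) \<phi>) \<longlongrightarrow> L2_inner \<Omega> (w_comb \<tau> v1 v2) \<phi>) (at_right 0)) \<and>
     ae_eq \<Omega> (v 0) v0 \<and> ae_eq \<Omega> (vt 0) v1)"

definition global_weak_solution :: "'a::euclidean_space set \<Rightarrow> real \<Rightarrow> real \<Rightarrow> real \<Rightarrow> real \<Rightarrow>
    ('a \<Rightarrow> real) \<Rightarrow> ('a \<Rightarrow> real) \<Rightarrow> ('a \<Rightarrow> real) \<Rightarrow> ('a \<Rightarrow> real) \<Rightarrow> ('a \<Rightarrow> real) \<Rightarrow>
    (real \<Rightarrow> 'a \<Rightarrow> real) \<Rightarrow> (real \<Rightarrow> 'a \<Rightarrow> real) \<Rightarrow> (real \<Rightarrow> 'a \<Rightarrow> real) \<Rightarrow> (real \<Rightarrow> 'a \<Rightarrow> real) \<Rightarrow>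
    (real \<Rightarrow> 'a \<Rightarrow> real) \<Rightarrow> bool" where
  "global_weak_solution \<Omega> \<alpha> b \<tau> \<gamma> u0 u1 v0 v1 v2 u ut v vt wt \<longleftrightarrow>
     (\<forall>T>0. weak_solution \<Omega> \<alpha> b \<tau> \<gamma> u0 u1 v0 v1 v2 T u ut v vt wt)"

end

theory Submission
  imports Defs
begin

text \<open>
  The orbit is relatively compact and weakly continuous, hence strongly continuous, so that Steklov
  averaging in time justifies the energy identity
  \<open>E(t) - E(s) = - (b - \<tau>) * \<integral> \<parallel>\<nabla> v\<^sub>t\<parallel>\<^sup>2\<close>. Thus \<open>E\<close> decreases to a limit, and Barbalat's lemma
  gives \<open>v\<^sub>t \<rightarrow> 0\<close>. Applying Barbalat's lemma repeatedly to the weak equations yields in turn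
  \<open>w\<^sub>t \<rightarrow> 0\<close>, \<open>w\<^sub>t\<^sub>t \<rightarrow> 0\<close>, \<open>u\<^sub>t \<rightarrow> 0\<close> (this uses \<open>\<alpha> \<noteq> 0\<close>) and \<open>u\<^sub>t\<^sub>t \<rightarrow> 0\<close>, so every cluster point of
  \<open>(u, w)\<close> is a stationary solution. A nonzero one lies on the Nehari manifold and hence has energy at
  least the well depth, which exceeds \<open>E(0)\<close>; so the only cluster point is zero.
\<close>

subsection \<open>Smooth functions\<close>

text \<open>The statement speaks of functions, seminorms and a gradient picked by choice, whereas
  the dynamics wants a Hilbert space. So \<open>L2\<close> is passed to classes and
  \<open>H10\<close> becomes a closed subspace of pairs (function, gradient), whose elements are
  determined by their first component. On a compact part of it, closeness in L2 forces closeness of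
  the gradients; this is how L2 information along the trajectory is upgraded. The bound on \<gamma>
  says that f grows more slowly than the power n/(n-2), the logarithm costing only an arbitrarily
  small exponent. Hence f maps H10 continuously into L2 by an embedding strictly below the critical
  exponent. The first eigenvalue is a \<open>LEAST\<close> and says something only once a least
  eigenvalue has been found; this is where Rellich compactness enters. While the velocities are
  being shown to vanish, no limit of u or w is known yet. Barbalat's lemma is therefore used in a
  form that asks only for vanishing increments over each fixed time step.\<close>

lemma C_k_SucI:
  assumes "\<And>x. (f has_derivative f' x) (at x)"
    and "\<And>i. i \<in> Basis \<Longrightarrow> C_k k (\<lambda>x. f' x i)"
  shows "C_k (Suc k) f"
proof -
  have "frechet_derivative f (at x) = f' x" for x
    using frechet_derivative_at[OF assms(1)] by simp
  then show ?thesis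
    using assms by (auto simp: differentiable_def)
qed

lemma C_k_SucD: "C_k (Suc k) f \<Longrightarrow> C_k k f"
proof (induction k arbitrary: f)
  case 0
  then show ?case
    by (auto simp: continuous_on_eq_continuous_within intro!: differentiable_imp_continuous_within)
qed auto

lemma C_k_const [simp]: "C_k k (\<lambda>x. c)"
proof (induction k arbitrary: c)
  case (Suc k)
  show ?case by (rule C_k_SucI[where f' = "\<lambda>x h. 0"]) (auto intro: Suc)
qed simp

lemma C_k_add: "C_k k f \<Longrightarrow> C_k k g \<Longrightarrow> C_k k (\<lambda>x. f x + g x)"
proof (induction k arbitrary: f g)
  case 0
  then show ?case by (auto intro: continuous_on_add)
next
  case (Suc k)
  show ?case
  proof (rule C_k_SucI)
    show "((\<lambda>x. f x + g x) has_derivative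
        (\<lambda>h. frechet_derivative f (at x) h + frechet_derivative g (at x) h)) (at x)" for x
      using Suc.prems by (intro has_derivative_add) (auto simp: frechet_derivative_works)
  qed (use Suc in auto)
qed

lemma C_k_mult: "C_k k f \<Longrightarrow> C_k k g \<Longrightarrow> C_k k (\<lambda>x. f x * g x)"
proof (induction k arbitrary: f g)
  case 0
  then show ?case by (auto intro: continuous_on_mult)
next
  case (Suc k)
  show ?case
  proof (rule C_k_SucI)
    show "((\<lambda>x. f x * g x) has_derivative
        (\<lambda>h. f x * frechet_derivative g (at x) h + frechet_derivative f (at x) h * g x)) (at x)" for x
      using Suc.prems by (intro has_derivative_mult) (auto simp: frechet_derivative_works)
    show "C_k k (\<lambda>x. f x * frechet_derivative g (at x) i + frechet_derivative f (at x) i * g x)"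
      if "i \<in> Basis" for i
      using C_k_SucD[OF Suc.prems(1)] C_k_SucD[OF Suc.prems(2)] Suc.prems that
      by (intro C_k_add Suc.IH) auto
  qed
qed

lemma C_k_prod: "(\<And>i. i \<in> I \<Longrightarrow> C_k k (f i)) \<Longrightarrow> C_k k (\<lambda>x. \<Prod>i\<in>I. f i x)"
  by (induction I rule: infinite_finite_induct) (auto intro: C_k_mult)

lemma C_k_real_SucI:
  fixes h :: "real \<Rightarrow> real"
  assumes "\<And>t. (h has_real_derivative h' t) (at t)" and "C_k k h'"
  shows "C_k (Suc k) h"
  by (rule C_k_SucI[where f' = "\<lambda>t s. h' t * s"])
     (use assms in \<open>auto simp: has_field_derivative_def\<close>)

lemma C_k_affine:
  fixes h :: "real \<Rightarrow> real"
  assumes "C_k k h"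
  shows "C_k k (\<lambda>x. h (x \<bullet> e + c))"
  using assms
proof (induction k arbitrary: h)
  case 0
  then have h: "continuous_on UNIV h" by simp
  show ?case
    by (auto intro!: continuous_on_compose2[OF h] continuous_intros)
next
  case (Suc k)
  show ?case
  proof (rule C_k_SucI)
    show "((\<lambda>x. h (x \<bullet> e + c)) has_derivative
        (\<lambda>s. frechet_derivative h (at (x \<bullet> e + c)) (s \<bullet> e))) (at x)" for x
    proof (rule has_derivative_compose[of "\<lambda>x. x \<bullet> e + c" "\<lambda>s. s \<bullet> e" x UNIV h, unfolded o_def])
      show "((\<lambda>x. x \<bullet> e + c) has_derivative (\<lambda>s. s \<bullet> e)) (at x)"
        by (auto intro!: derivative_eq_intros)
      show "(h has_derivative frechet_derivative h (at (x \<bullet> e + c))) (at (x \<bullet> e + c))"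
        using Suc.prems by (simp add: frechet_derivative_works)
    qed
    fix i :: 'a assume "i \<in> Basis"
    \<comment> \<open>On the real line the derivative is multiplication by its value at 1. This
      turns the directional derivative into a constant times a function of the same affine form, to
      which the induction hypothesis applies.\<close>
    have lin: "frechet_derivative h (at t) s = s * frechet_derivative h (at t) 1" for t s
    proof -
      have "linear (frechet_derivative h (at t))"
        using Suc.prems by (intro linear_frechet_derivative) auto
      from linear_cmul[OF this, of s 1] show ?thesis by simp
    qed
    have "C_k k (\<lambda>x. frechet_derivative h (at (x \<bullet> e + c)) 1)"
      using Suc.prems by (intro Suc.IH) auto
    then have "C_k k (\<lambda>x. (i \<bullet> e) * frechet_derivative h (at (x \<bullet> e + c)) 1)"
      by (intro C_k_mult) auto
    then show "C_k k (\<lambda>x. frechet_derivative h (at (x \<bullet> e + c)) (i \<bullet> e))"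
      by (subst lin)
  qed
qed

lemma smooth_const [simp]: "smooth (\<lambda>x. c)"
  and smooth_add: "smooth f \<Longrightarrow> smooth g \<Longrightarrow> smooth (\<lambda>x. f x + g x)"
  and smooth_mult: "smooth f \<Longrightarrow> smooth g \<Longrightarrow> smooth (\<lambda>x. f x * g x)"
  and smooth_prod: "(\<And>i. i \<in> I \<Longrightarrow> smooth (p i)) \<Longrightarrow> smooth (\<lambda>x. \<Prod>i\<in>I. p i x)"
  and smooth_affine: "smooth h \<Longrightarrow> smooth (\<lambda>x. h (x \<bullet> e + c))"
  by (simp_all add: smooth_def C_k_add C_k_mult C_k_prod C_k_affine)

lemma smooth_continuous: "smooth f \<Longrightarrow> continuous_on UNIV f"
  unfolding smooth_def by (metis C_k.simps(1))

lemma smooth_differentiable: "smooth f \<Longrightarrow> f differentiable (at x)"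
  unfolding smooth_def by (metis C_k.simps(2))

lemma smooth_frechet_derivative:
  "smooth f \<Longrightarrow> i \<in> Basis \<Longrightarrow> smooth (\<lambda>x. frechet_derivative f (at x) i)"
  unfolding smooth_def by (metis C_k.simps(2))

lemma smooth_real_primitive:
  fixes h :: "real \<Rightarrow> real"
  assumes "\<And>t. (h has_real_derivative h' t) (at t)" and "smooth h'"
  shows "smooth h"
  unfolding smooth_def
proof
  fix k
  show "C_k k h"
    using assms C_k_real_SucI[of h h' k] C_k_SucD[of k h] by (auto simp: smooth_def)
qed

subsection \<open>The flat function\<close>

text \<open>For m = 0 this is the classical function exp(-1/t), flat at 0. The powers of 1/t are
  included because the family is then closed under differentiation up to linear combinations, so
  that smoothness is an induction over the order for all m at once.\<close>

definition flat :: "nat \<Rightarrow> real \<Rightarrow> real" where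
  "flat m t = (if t > 0 then inverse t ^ m * exp (- inverse t) else 0)"

text \<open>A single term of the exponential series at s = 1/t already beats s^m. The term of order
  m + 2 is taken because its two surplus powers leave t^2, enough to make the difference quotient at
  0 vanish.\<close>

lemma flat_le: "t > 0 \<Longrightarrow> flat m t \<le> fact (m + 2) * t ^ 2"
proof -
  assume t: "t > 0"
  define s where "s = inverse t"
  have s: "s > 0" using t by (simp add: s_def)
  have "s ^ (m + 2) / fact (m + 2) \<le> exp s"
  proof -
    have "(\<Sum>n\<in>{m + 2}. s ^ n /\<^sub>R fact n) \<le> exp s"
      unfolding exp_def using s by (intro sum_le_suminf summable_exp_generic) auto
    then show ?thesis by (simp add: divide_inverse mult.commute)
  qed
  then have "s ^ m * s ^ 2 \<le> fact (m + 2) * exp s"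
    by (simp add: pos_divide_le_eq power_add mult.commute del: fact_Suc add_2_eq_Suc')
  then have "s ^ m * exp (- s) \<le> fact (m + 2) * inverse (s ^ 2)"
    using s by (simp add: exp_minus field_simps)
  moreover have "inverse (s ^ 2) = t ^ 2" by (simp add: s_def power_inverse)
  ultimately show ?thesis using t by (simp add: flat_def s_def)
qed

lemma flat_nonneg: "0 \<le> flat m t" by (simp add: flat_def)

lemma flat_has_derivative:
  "(flat m has_real_derivative (flat (m + 2) t - real m * flat (m + 1) t)) (at t)"
proof -
  consider "t > 0" | "t < 0" | "t = 0" by linarith
  then show ?thesis
  proof cases
    case 1
    have "((\<lambda>t. inverse t ^ m * exp (- inverse t)) has_real_derivative
        (flat (m + 2) t - real m * flat (m + 1) t)) (at t)"
    proof (cases m)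
      case (Suc k)
      have "((\<lambda>t. inverse t ^ m * exp (- inverse t)) has_real_derivative
          real m * inverse t ^ k * - (inverse t ^ 2) * exp (- inverse t)
          + inverse t ^ m * (exp (- inverse t) * inverse t ^ 2)) (at t)"
        unfolding Suc using 1
        by (auto intro!: derivative_eq_intros simp: power2_eq_square algebra_simps)
           (cases k; simp)
      then show ?thesis
        using 1 by (simp add: Suc flat_def power_add power2_eq_square algebra_simps)
    qed (use 1 in \<open>auto intro!: derivative_eq_intros simp: flat_def field_simps power2_eq_square\<close>)
    then show ?thesis
      by (rule has_field_derivative_transform_within_open[of _ _ _ "{0<..}"])
        (use 1 in \<open>auto simp: flat_def\<close>)
  next
    case 2
    have "((\<lambda>t. 0::real) has_real_derivative (flat (m + 2) t - real m * flat (m + 1) t)) (at t)"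
      using 2 by (auto simp: flat_def)
    then show ?thesis
      by (rule has_field_derivative_transform_within_open[of _ _ _ "{..<0}"])
        (use 2 in \<open>auto simp: flat_def\<close>)
  next
    case 3
    have "(\<lambda>h. (flat m (0 + h) - flat m 0) / h) \<midarrow>0\<rightarrow> 0"
    proof (rule Lim_null_comparison[where g = "\<lambda>h. fact (m + 2) * \<bar>h\<bar>"])
      show "\<forall>\<^sub>F h in at 0. norm ((flat m (0 + h) - flat m 0) / h) \<le> fact (m + 2) * \<bar>h\<bar>"
      proof (rule always_eventually, rule allI)
        fix h :: real
        show "norm ((flat m (0 + h) - flat m 0) / h) \<le> fact (m + 2) * \<bar>h\<bar>"
        proof (cases "h > 0")
          case True
          then show ?thesis
            using flat_le[of h m] flat_nonneg[of m h]
            by (simp add: flat_def[of m 0] field_simps power2_eq_square del: fact_Suc)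
        qed (auto simp: flat_def intro!: mult_nonneg_nonpos)
      qed
      show "(\<lambda>h. fact (m + 2) * \<bar>h\<bar>) \<midarrow>0\<rightarrow> (0::real)"
        by (auto intro!: tendsto_eq_intros simp del: fact_Suc)
    qed
    then show ?thesis
      using 3 by (simp add: DERIV_def flat_def[of _ 0])
  qed
qed

lemma smooth_flat: "smooth (flat m)"
  unfolding smooth_def
proof
  fix k show "C_k k (flat m)"
  proof (induction k arbitrary: m)
    case 0
    show ?case
      using flat_has_derivative[THEN DERIV_isCont] by (simp add: continuous_at_imp_continuous_on)
  next
    case (Suc k)
    have "C_k k (\<lambda>t. flat (m + 2) t + (- real m) * flat (m + 1) t)"
      by (intro C_k_add C_k_mult C_k_const Suc)
    then show ?case
      by (intro C_k_real_SucI[OF flat_has_derivative]) simp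
  qed
qed

lemma smooth_scale_flat: "smooth (\<lambda>x. flat m (c * (x \<bullet> e + d)))"
  using smooth_affine[OF smooth_flat, of m "c *\<^sub>R e" "c * d"] by (simp add: algebra_simps)

text \<open>The factor m stretches the arguments: since \<open>flat 0\<close> tends to 1 at
  infinity, the bumps tend pointwise to the indicator of the open box while staying between 0 and 1.
  Indicators are thus reached from test functions by dominated convergence.\<close>

definition box_bump :: "'a::euclidean_space \<Rightarrow> 'a \<Rightarrow> nat \<Rightarrow> 'a \<Rightarrow> real" where
  "box_bump a b m x =
     (\<Prod>i\<in>Basis. flat 0 (real m * (x \<bullet> i - a \<bullet> i)) * flat 0 (real m * (b \<bullet> i - x \<bullet> i)))"

lemma smooth_box_bump: "smooth (box_bump a b m)"
proof -
  have "smooth (\<lambda>x. flat 0 (real m * (x \<bullet> i - a \<bullet> i)) * flat 0 (real m * (b \<bullet> i - x \<bullet> i)))" for i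
    using smooth_mult[OF smooth_scale_flat[of 0 "real m" i "- (a \<bullet> i)"]
        smooth_scale_flat[of 0 "real m" "- i" "b \<bullet> i"]] by (simp add: algebra_simps)
  then show ?thesis
    unfolding box_bump_def[abs_def] by (intro smooth_prod) 
qed

lemma flat0_le1: "flat 0 t \<le> 1" by (simp add: flat_def)

lemma box_bump_bounds: "0 \<le> box_bump a b m x" "box_bump a b m x \<le> 1"
  unfolding box_bump_def
  by (auto intro!: prod_nonneg prod_le_1 mult_nonneg_nonneg mult_le_one flat_nonneg flat0_le1)

lemma box_bump_nz_iff: "m > 0 \<Longrightarrow> box_bump a b m x \<noteq> 0 \<longleftrightarrow> x \<in> box a b"
  by (auto simp: box_bump_def flat_def box_def zero_less_mult_iff)

lemma box_bump_test:
  assumes "cbox a b \<subseteq> \<Omega>"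
  shows "box_bump a b (Suc m) \<in> test_functions \<Omega>"
proof -
  have "closure {x. box_bump a b (Suc m) x \<noteq> 0} \<subseteq> cbox a b"
    by (rule closure_minimal) (use box_subset_cbox in \<open>auto simp: box_bump_nz_iff\<close>)
  moreover have "compact (closure {x. box_bump a b (Suc m) x \<noteq> 0})"
    by (auto simp: box_bump_nz_iff)
  ultimately show ?thesis
    using assms smooth_box_bump by (auto simp: test_functions_def)
qed

lemma flat0_scale_tendsto:
  assumes "t > 0" shows "(\<lambda>m. flat 0 (real (Suc m) * t)) \<longlonglongrightarrow> 1"
proof -
  have "(\<lambda>m. exp (- (inverse (real (Suc m)) * inverse t))) \<longlonglongrightarrow> exp (- (0 * inverse t))"
    by (intro tendsto_intros LIMSEQ_inverse_real_of_nat)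
  then show ?thesis using assms by (simp add: flat_def)
qed

lemma box_bump_tendsto: "(\<lambda>m. box_bump a b (Suc m) x) \<longlonglongrightarrow> indicator (box a b) x"
proof (cases "x \<in> box a b")
  case True
  then have "(\<lambda>m. box_bump a b (Suc m) x) \<longlonglongrightarrow> (\<Prod>i\<in>(Basis::'a set). 1 * 1)"
    unfolding box_bump_def
    by (intro tendsto_prod tendsto_mult flat0_scale_tendsto) (auto simp: mem_box)
  then show ?thesis using True by simp
next
  case False
  then have "box_bump a b (Suc m) x = 0" for m
    using box_bump_nz_iff[of "Suc m" a b x] by auto
  then show ?thesis using False by simp
qed

text \<open>A normalised primitive of a bump on the unit interval. The step \<open>\<Phi>\<close>
  later builds cutoffs in time, and its density \<open>\<rho>\<close> serves as the mollifying
  kernel.\<close>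

lemma smooth_step_exists:
  obtains \<Phi> \<rho> :: "real \<Rightarrow> real" where "smooth \<Phi>" "\<And>t. (\<Phi> has_real_derivative \<rho> t) (at t)"
    "continuous_on UNIV \<rho>" "\<And>t. \<rho> t \<ge> 0" "\<And>t. t \<notin> {0<..<1} \<Longrightarrow> \<rho> t = 0"
    "\<And>t. t \<le> 0 \<Longrightarrow> \<Phi> t = 0" "\<And>t. t \<ge> 1 \<Longrightarrow> \<Phi> t = 1" "\<And>t. 0 \<le> \<Phi> t" "\<And>t. \<Phi> t \<le> 1"
proof -
  define r where "r = box_bump 0 (1::real) 1"
  have sr: "smooth r" unfolding r_def by (rule smooth_box_bump)
  then have cr: "continuous_on UNIV r" by (rule smooth_continuous)
  have r0: "r t \<ge> 0" for t by (simp add: r_def box_bump_bounds)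
  have rnz: "r t \<noteq> 0 \<longleftrightarrow> t \<in> {0<..<1}" for t
    by (simp add: r_def box_bump_nz_iff box_real)
  obtain F where F: "\<And>t. (F has_real_derivative r t) (at t)"
    using einterval_antiderivative[of "-\<infinity>" "\<infinity>" r] cr
    by (auto simp: continuous_on_eq_continuous_at has_real_derivative_iff_has_vector_derivative)
  have mono: "F s \<le> F t" if "s \<le> t" for s t
    using DERIV_nonneg_imp_nondecreasing[OF that] F r0 by blast
  have le0: "F t = F 0" if "t \<le> 0" for t
  proof (cases "t = 0")
    case False
    obtain z where "z > t" "z < 0" "F 0 - F t = (0 - t) * r z"
      using MVT2[of t 0 F r] F False \<open>t \<le> 0\<close> by auto
    then show ?thesis using rnz[of z] by auto
  qed simp
  have ge1: "F t = F 1" if "t \<ge> 1" for t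
  proof (cases "t = 1")
    case False
    obtain z where "z > 1" "z < t" "F t - F 1 = (t - 1) * r z"
      using MVT2[of 1 t F r] F False \<open>t \<ge> 1\<close> by auto
    then show ?thesis using rnz[of z] by auto
  qed simp
  \<comment> \<open>The total mass of the bump is positive because the mean value theorem equates it
    with a value of \<open>r\<close> inside the open interval.\<close>
  obtain z where z: "z > 0" "z < 1" "F 1 - F 0 = (1 - 0) * r z"
    using MVT2[of 0 1 F r] F by auto
  then have pos: "F 1 - F 0 > 0" using rnz[of z] r0[of z] by auto
  define c where "c = F 1 - F 0"
  define \<Phi> where "\<Phi> = (\<lambda>t. (F t - F 0) / c)"
  define \<rho> where "\<rho> = (\<lambda>t. r t / c)"
  have c: "c > 0" using pos by (simp add: c_def)
  have d: "(\<Phi> has_real_derivative \<rho> t) (at t)" for t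
    unfolding \<Phi>_def \<rho>_def using c
    by (auto intro!: derivative_eq_intros F)
  have s\<rho>: "smooth \<rho>"
    using smooth_mult[OF sr smooth_const[of "inverse c"]] by (simp add: \<rho>_def divide_inverse)
  show ?thesis
  proof (rule that[of \<Phi> \<rho>])
    show "smooth \<Phi>" using smooth_real_primitive[OF d s\<rho>] .
    show "continuous_on UNIV \<rho>" using s\<rho> by (rule smooth_continuous)
    show "\<rho> t = 0" if "t \<notin> {0<..<1}" for t using rnz[of t] that by (auto simp: \<rho>_def)
    show "\<Phi> t = 1" if "t \<ge> 1" for t using ge1[OF that] c by (simp add: \<Phi>_def c_def)
    show "0 \<le> \<Phi> t" for t using mono[of 0 t] le0[of t] c by (cases "t \<le> 0") (auto simp: \<Phi>_def)
    show "\<Phi> t \<le> 1" for t using mono[of t 1] ge1[of t] c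
      by (cases "t \<le> 1") (auto simp: \<Phi>_def c_def)
    show "\<Phi> t = 0" if "t \<le> 0" for t using le0[OF that] by (simp add: \<Phi>_def)
  qed (use d r0 c in \<open>auto simp: \<rho>_def\<close>)
qed

subsection \<open>The Hilbert space of square integrable functions\<close>

definition square_integrable :: "'a measure \<Rightarrow> ('a \<Rightarrow> 'c::euclidean_space) \<Rightarrow> bool" where
  "square_integrable M f \<longleftrightarrow> f \<in> borel_measurable M \<and> integrable M (\<lambda>x. (norm (f x))\<^sup>2)"

lemma L2_iff: "f \<in> L2 \<Omega> \<longleftrightarrow> square_integrable (lebesgue_on \<Omega>) f"
  by (simp add: L2_def square_integrable_def)

lemma square_integrable_nn_integral:
  "square_integrable M f \<longleftrightarrow> f \<in> borel_measurable M \<and> (\<integral>\<^sup>+x. ennreal ((norm (f x))\<^sup>2) \<partial>M) < \<infinity>"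
  unfolding square_integrable_def by (auto simp: integrable_iff_bounded)

lemma square_integrable_add:
  assumes f: "square_integrable M f" and g: "square_integrable M g"
  shows "square_integrable M (\<lambda>x. f x + g x)"
proof -
  have [measurable]: "f \<in> borel_measurable M" "g \<in> borel_measurable M"
    using assms by (auto simp: square_integrable_def)
  have "integrable M (\<lambda>x. (norm (f x + g x))\<^sup>2)"
  proof (rule Bochner_Integration.integrable_bound)
    show "integrable M (\<lambda>x. 2 * (norm (f x))\<^sup>2 + 2 * (norm (g x))\<^sup>2)"
      using f g by (auto simp: square_integrable_def)
    have "(norm (f x + g x))\<^sup>2 \<le> 2 * (norm (f x))\<^sup>2 + 2 * (norm (g x))\<^sup>2" for x
    proof -
      have "(norm (f x + g x))\<^sup>2 \<le> (norm (f x) + norm (g x))\<^sup>2"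
        by (intro power_mono norm_triangle_ineq) auto
      also have "\<dots> \<le> 2 * (norm (f x))\<^sup>2 + 2 * (norm (g x))\<^sup>2"
        using sum_squares_bound[of "norm (f x)" "norm (g x)"] by (simp add: power2_sum)
      finally show ?thesis .
    qed
    then show "AE x in M. norm ((norm (f x + g x))\<^sup>2)
        \<le> norm (2 * (norm (f x))\<^sup>2 + 2 * (norm (g x))\<^sup>2)"
      by (auto intro!: AE_I2)
  qed simp
  then show ?thesis by (simp add: square_integrable_def)
qed

lemma square_integrable_scaleR:
  "square_integrable M f \<Longrightarrow> square_integrable M (\<lambda>x. c *\<^sub>R f x)"
  by (auto simp: square_integrable_def power_mult_distrib)

lemma square_integrable_minus:
  "square_integrable M f \<Longrightarrow> square_integrable M (\<lambda>x. - f x)"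
  by (auto simp: square_integrable_def)

lemma square_integrable_diff:
  "square_integrable M f \<Longrightarrow> square_integrable M g \<Longrightarrow> square_integrable M (\<lambda>x. f x - g x)"
  using square_integrable_add[OF _ square_integrable_minus, of M f g] by simp

lemma square_integrable_zero: "square_integrable M (\<lambda>x. 0)"
  by (simp add: square_integrable_def)

lemma square_integrable_inner:
  assumes f: "square_integrable M f" and g: "square_integrable M g"
  shows "integrable M (\<lambda>x. f x \<bullet> g x)"
proof (rule Bochner_Integration.integrable_bound)
  have [measurable]: "f \<in> borel_measurable M" "g \<in> borel_measurable M"
    using assms by (auto simp: square_integrable_def)
  show "(\<lambda>x. f x \<bullet> g x) \<in> borel_measurable M" by measurable
  show "integrable M (\<lambda>x. (norm (f x))\<^sup>2 + (norm (g x))\<^sup>2)"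
    using f g by (auto simp: square_integrable_def)
  have "\<bar>f x \<bullet> g x\<bar> \<le> (norm (f x))\<^sup>2 + (norm (g x))\<^sup>2" for x
    using Cauchy_Schwarz_ineq2[of "f x" "g x"] sum_squares_bound[of "norm (f x)" "norm (g x)"]
      mult_nonneg_nonneg[of "norm (f x)" "norm (g x)"] by (simp; linarith)
  then show "AE x in M. norm (f x \<bullet> g x) \<le> norm ((norm (f x))\<^sup>2 + (norm (g x))\<^sup>2)"
    by (auto intro!: AE_I2)
qed

lemma LIMSEQ_norm_diff_bound:
  fixes X :: "nat \<Rightarrow> 'v::real_normed_vector"
  assumes "\<And>k. norm (X k - L) \<le> b k" "b \<longlonglongrightarrow> 0"
  shows "X \<longlonglongrightarrow> L"
proof -
  have "(\<lambda>k. X k - L) \<longlonglongrightarrow> 0"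
    by (rule Lim_null_comparison[OF always_eventually assms(2)], rule allI, rule assms(1))
  then show ?thesis by (simp add: LIM_zero_iff)
qed

text \<open>The reflexive elements of this partial equivalence are the square integrable functions
  on the whole space. Functions on \<Omega> will be extended by zero, so that one type, not
  depending on \<Omega>, serves for every domain.\<close>

definition l2_rel :: "('a::euclidean_space \<Rightarrow> 'c::euclidean_space) \<Rightarrow> ('a \<Rightarrow> 'c) \<Rightarrow> bool" where
  "l2_rel f g \<longleftrightarrow> square_integrable lebesgue f \<and> square_integrable lebesgue g \<and>
     (AE x in lebesgue. f x = g x)"

lemma part_equivp_l2_rel: "part_equivp l2_rel"
proof (rule part_equivpI)
  show "\<exists>f. l2_rel f f" by (rule exI[of _ "\<lambda>x. 0"]) (simp add: l2_rel_def square_integrable_zero)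
  show "symp l2_rel" by (auto simp: symp_def l2_rel_def)
  show "transp l2_rel" by (auto simp: transp_def l2_rel_def)
qed

quotient_type (overloaded) ('a, 'c) l2 = "'a::euclidean_space \<Rightarrow> 'c::euclidean_space" / partial: l2_rel
  by (rule part_equivp_l2_rel)

instantiation l2 :: (euclidean_space, euclidean_space) real_vector
begin

lift_definition zero_l2 :: "('a, 'b) l2" is "\<lambda>x. 0"
  by (simp add: l2_rel_def square_integrable_zero)

lift_definition plus_l2 :: "('a, 'b) l2 \<Rightarrow> ('a, 'b) l2 \<Rightarrow> ('a, 'b) l2" is "\<lambda>f g x. f x + g x"
  by (auto simp: l2_rel_def square_integrable_add elim!: eventually_elim2)

lift_definition minus_l2 :: "('a, 'b) l2 \<Rightarrow> ('a, 'b) l2 \<Rightarrow> ('a, 'b) l2" is "\<lambda>f g x. f x - g x"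
  by (auto simp: l2_rel_def square_integrable_diff elim!: eventually_elim2)

lift_definition uminus_l2 :: "('a, 'b) l2 \<Rightarrow> ('a, 'b) l2" is "\<lambda>f x. - f x"
  by (auto simp: l2_rel_def square_integrable_minus)

lift_definition scaleR_l2 :: "real \<Rightarrow> ('a, 'b) l2 \<Rightarrow> ('a, 'b) l2" is "\<lambda>c f x. c *\<^sub>R f x"
  by (auto simp: l2_rel_def square_integrable_scaleR)

instance
proof
  fix x y z :: "('a, 'b) l2" and a b :: real
  show "x + y + z = x + (y + z)"
    by transfer (simp add: l2_rel_def square_integrable_add add.assoc)
  show "x + y = y + x"
    by transfer (simp add: l2_rel_def square_integrable_add add.commute)
  show "0 + x = x" by transfer (simp add: l2_rel_def)
  show "- x + x = 0" by transfer (simp add: l2_rel_def square_integrable_zero)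
  show "x - y = x + - y" by transfer (simp add: l2_rel_def square_integrable_diff)
  show "a *\<^sub>R (x + y) = a *\<^sub>R x + a *\<^sub>R y"
    by transfer (simp add: l2_rel_def square_integrable_add square_integrable_scaleR scaleR_add_right)
  show "(a + b) *\<^sub>R x = a *\<^sub>R x + b *\<^sub>R x"
    by transfer (simp add: l2_rel_def square_integrable_add square_integrable_scaleR scaleR_add_left)
  show "a *\<^sub>R b *\<^sub>R x = (a * b) *\<^sub>R x"
    by transfer (simp add: l2_rel_def square_integrable_scaleR)
  show "1 *\<^sub>R x = x" by transfer (simp add: l2_rel_def)
qed

end

instantiation l2 :: (euclidean_space, euclidean_space) real_inner
begin

lift_definition inner_l2 :: "('a, 'b) l2 \<Rightarrow> ('a, 'b) l2 \<Rightarrow> real"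
  is "\<lambda>f g. \<integral>x. f x \<bullet> g x \<partial>lebesgue"
proof -
  fix f f' g g' :: "'a \<Rightarrow> 'b"
  assume *: "l2_rel f f'" "l2_rel g g'"
  show "(\<integral>x. f x \<bullet> g x \<partial>lebesgue) = (\<integral>x. f' x \<bullet> g' x \<partial>lebesgue)"
  proof (rule integral_cong_AE)
    show "AE x in lebesgue. f x \<bullet> g x = f' x \<bullet> g' x"
      using * by (auto simp: l2_rel_def elim!: eventually_elim2)
  qed (use * in \<open>auto simp: l2_rel_def square_integrable_def\<close>)
qed

definition norm_l2 :: "('a, 'b) l2 \<Rightarrow> real" where "norm_l2 x = sqrt (x \<bullet> x)"
definition sgn_l2 :: "('a, 'b) l2 \<Rightarrow> ('a, 'b) l2" where "sgn_l2 x = x /\<^sub>R norm x"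
definition dist_l2 :: "('a, 'b) l2 \<Rightarrow> ('a, 'b) l2 \<Rightarrow> real" where "dist_l2 x y = norm (x - y)"
definition uniformity_l2 :: "(('a, 'b) l2 \<times> ('a, 'b) l2) filter" where
  "uniformity_l2 = (INF e\<in>{0<..}. principal {(x, y). dist x y < e})"
definition open_l2 :: "('a, 'b) l2 set \<Rightarrow> bool" where
  "open_l2 U = (\<forall>x\<in>U. \<forall>\<^sub>F (x', y) in uniformity. x' = x \<longrightarrow> y \<in> U)"

instance
proof
  fix x y z :: "('a, 'b) l2" and a b :: real
  show "dist x y = norm (x - y)" by (rule dist_l2_def)
  show "sgn x = x /\<^sub>R norm x" by (rule sgn_l2_def)
  show "uniformity = (INF e\<in>{0<..}. principal {(x, y::('a, 'b) l2). dist x y < e})"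
    by (rule uniformity_l2_def)
  show "open U = (\<forall>x\<in>U. \<forall>\<^sub>F (x', y) in uniformity. x' = x \<longrightarrow> y \<in> U)" for U :: "('a, 'b) l2 set"
    by (rule open_l2_def)
  show "x \<bullet> y = y \<bullet> x" by transfer (simp add: inner_commute)
  show "(x + y) \<bullet> z = x \<bullet> z + y \<bullet> z"
    by transfer (simp add: l2_rel_def inner_add_left square_integrable_inner)
  show "a *\<^sub>R x \<bullet> y = a * (x \<bullet> y)"
    by transfer simp
  show "0 \<le> x \<bullet> x" by transfer simp
  show "x \<bullet> x = 0 \<longleftrightarrow> x = 0"
  proof transfer
    fix f :: "'a \<Rightarrow> 'b" assume f: "l2_rel f f"
    then have "integrable lebesgue (\<lambda>x. f x \<bullet> f x)"
      by (auto simp: l2_rel_def intro: square_integrable_inner)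
    then show "((\<integral>x. f x \<bullet> f x \<partial>lebesgue) = 0) = l2_rel f (\<lambda>x. 0)"
      using f by (subst integral_nonneg_eq_0_iff_AE) (auto simp: l2_rel_def square_integrable_zero)
  qed
  show "norm x = sqrt (x \<bullet> x)" by (rule norm_l2_def)
qed

end

text \<open>Distances written as nonnegative integrals, the form in which Fatou's lemma and infinite
  sums can be applied without integrability side conditions.\<close>

lemma norm_diff_l2_nn_integral:
  assumes "l2_rel f f" "l2_rel g g"
  shows "(\<integral>\<^sup>+x. ennreal ((norm (f x - g x))\<^sup>2) \<partial>lebesgue) = ennreal ((norm (abs_l2 f - abs_l2 g))\<^sup>2)"
proof -
  have "square_integrable lebesgue (\<lambda>x. f x - g x)"
    using assms by (auto simp: l2_rel_def intro: square_integrable_diff)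
  then have "(\<integral>\<^sup>+x. ennreal ((norm (f x - g x))\<^sup>2) \<partial>lebesgue) = ennreal (\<integral>x. (norm (f x - g x))\<^sup>2 \<partial>lebesgue)"
    by (intro nn_integral_eq_integral) (auto simp: square_integrable_def)
  moreover have "abs_l2 f - abs_l2 g = abs_l2 (\<lambda>x. f x - g x)"
    using assms by (rule minus_l2.abs_eq)
  moreover have "l2_rel (\<lambda>x. f x - g x) (\<lambda>x. f x - g x)"
    using assms by (auto simp: l2_rel_def intro: square_integrable_diff)
  then have "(norm (abs_l2 (\<lambda>x. f x - g x)))\<^sup>2 = (\<integral>x. (norm (f x - g x))\<^sup>2 \<partial>lebesgue)"
    by (simp add: power2_norm_eq_inner inner_l2.abs_eq)
  ultimately show ?thesis by simp
qed

lemma abs_rep_l2: "abs_l2 (rep_l2 X) = X" and rep_l2_rel: "l2_rel (rep_l2 X) (rep_l2 X)"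
  using Quotient_l2 by (auto simp: Quotient_def)

text \<open>Riesz-Fischer: a rapidly converging subsequence converges almost everywhere, and Fatou's
  lemma shows that the pointwise limit is also the limit in norm.\<close>

instance l2 :: (euclidean_space, euclidean_space) banach
proof
  fix X :: "nat \<Rightarrow> ('a, 'b) l2"
  assume "Cauchy X"
  define f where "f = (\<lambda>n. rep_l2 (X n))"
  have rel: "l2_rel (f n) (f n)" for n by (simp add: f_def rep_l2_rel)
  have absf: "abs_l2 (f n) = X n" for n by (simp add: f_def abs_rep_l2)
  have [measurable]: "f n \<in> borel_measurable lebesgue" for n
    using rel[of n] by (simp add: l2_rel_def square_integrable_def)
  have nd: "(\<integral>\<^sup>+x. ennreal ((norm (f m x - f n x))\<^sup>2) \<partial>lebesgue) = ennreal ((norm (X m - X n))\<^sup>2)" for m n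
    using norm_diff_l2_nn_integral[OF rel rel, of m n] by (simp add: absf)
  have "\<forall>j. \<exists>N. \<forall>m\<ge>N. \<forall>n\<ge>N. norm (X m - X n) < (1/2) ^ j"
    using \<open>Cauchy X\<close> by (simp add: Cauchy_iff)
  then obtain N where N: "\<And>j m n. m \<ge> N j \<Longrightarrow> n \<ge> N j \<Longrightarrow> norm (X m - X n) < (1/2) ^ j"
    by metis
  \<comment> \<open>Summing the successors of the thresholds gives indices that increase strictly
    and dominate every earlier threshold.\<close>
  define r where "r = (\<lambda>j. (\<Sum>i\<le>j. Suc (N i)))"
  have rN: "r i \<ge> N j" if "i \<ge> j" for i j
  proof -
    have "Suc (N j) \<le> (\<Sum>i\<le>i. Suc (N i))"
      using that by (intro member_le_sum) auto
    then show ?thesis by (simp add: r_def)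
  qed
  have smr: "strict_mono r" by (auto simp: strict_mono_Suc_iff r_def)
  have small: "(norm (X (r m) - X (r n)))\<^sup>2 \<le> (1/4) ^ j" if "m \<ge> j" "n \<ge> j" for m n j
  proof -
    have "(norm (X (r m) - X (r n)))\<^sup>2 \<le> ((1/2) ^ j)\<^sup>2"
      using N[OF rN[OF that(1)] rN[OF that(2)]] by (intro power_mono) auto
    also have "\<dots> = (1/4) ^ j" by (simp add: power2_eq_square flip: power_mult_distrib)
    finally show ?thesis .
  qed
  define d where "d = (\<lambda>j x. norm (f (r (Suc j)) x - f (r j) x))"
  \<comment> \<open>The weights grow slowly enough for the weighted squared increments, at most 2^j
    * 4^-j, to be summable, and fast enough for their reciprocals to be summable. With y <= 1/s + s
    * y^2 the increments themselves are then summable almost everywhere.\<close>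
  define s where "s = (\<lambda>j::nat. sqrt 2 ^ j)"
  have s0: "s j > 0" for j by (simp add: s_def)
  have [measurable]: "d j \<in> borel_measurable lebesgue" for j unfolding d_def by measurable
  have "(\<integral>\<^sup>+x. (\<Sum>j. ennreal (s j * (d j x)\<^sup>2)) \<partial>lebesgue)
      = (\<Sum>j. \<integral>\<^sup>+x. ennreal (s j * (d j x)\<^sup>2) \<partial>lebesgue)"
    by (rule nn_integral_suminf) measurable
  also have "\<dots> = (\<Sum>j. ennreal (s j * (norm (X (r (Suc j)) - X (r j)))\<^sup>2))"
    using s0 by (simp add: ennreal_mult nn_integral_cmult less_imp_le d_def nd)
  also have "\<dots> \<le> (\<Sum>j. ennreal ((1/2) ^ j))"
  proof (intro suminf_le ennreal_leI)
    fix j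
    have "s j * (norm (X (r (Suc j)) - X (r j)))\<^sup>2 \<le> 2 ^ j * (1/4) ^ j"
      using small[of j "Suc j" j] sqrt2_less_2 unfolding s_def
      by (intro mult_mono power_mono) auto
    also have "\<dots> = (1/2) ^ j" by (simp flip: power_mult_distrib)
    finally show "s j * (norm (X (r (Suc j)) - X (r j)))\<^sup>2 \<le> (1/2) ^ j" .
  qed auto
  also have "\<dots> = ennreal (\<Sum>j. (1/2) ^ j)"
    by (rule suminf_ennreal2) (auto intro: summable_geometric)
  also have "\<dots> < \<infinity>" by simp
  finally have "AE x in lebesgue. (\<Sum>j. ennreal (s j * (d j x)\<^sup>2)) \<noteq> \<infinity>"
    by (intro nn_integral_PInf_AE) auto
  then have conv: "AE x in lebesgue. convergent (\<lambda>j. f (r j) x)"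
  proof eventually_elim
    fix x assume "(\<Sum>j. ennreal (s j * (d j x)\<^sup>2)) \<noteq> \<infinity>"
    then have "summable (\<lambda>j. s j * (d j x)\<^sup>2)"
      using s0 by (intro summable_suminf_not_top) (auto simp: less_imp_le)
    moreover have "summable (\<lambda>j. inverse (s j))"
      unfolding s_def power_inverse[symmetric]
      by (rule summable_geometric) (auto simp: real_sqrt_gt_1_iff inverse_less_1_iff)
    ultimately have "summable (\<lambda>j. inverse (s j) + s j * (d j x)\<^sup>2)"
      by (intro summable_add)
    then have "summable (\<lambda>j. f (r (Suc j)) x - f (r j) x)"
    proof (rule summable_comparison_test'[of _ 0])
      fix j
      define y where "y = d j x"
      have "y \<le> inverse (s j) + s j * y\<^sup>2"
      proof -
        have "0 \<le> (s j * y - 1)\<^sup>2" by simp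
        then have "2 * s j * y \<le> 1 + (s j)\<^sup>2 * y\<^sup>2" by (simp add: power2_diff power_mult_distrib)
        moreover have "y \<ge> 0" by (simp add: y_def d_def)
        ultimately have "s j * y \<le> 1 + (s j)\<^sup>2 * y\<^sup>2"
          using s0[of j] mult_nonneg_nonneg[of "s j" y] by linarith
        then show ?thesis using s0[of j] by (simp add: field_simps power2_eq_square)
      qed
      then show "norm (f (r (Suc j)) x - f (r j) x) \<le> inverse (s j) + s j * (d j x)\<^sup>2"
        by (simp add: y_def d_def)
    qed
    then have "convergent (\<lambda>n. \<Sum>j<n. f (r (Suc j)) x - f (r j) x)"
      by (simp add: summable_iff_convergent)
    then have "convergent (\<lambda>n. (f (r n) x - f (r 0) x) + f (r 0) x)"
      by (subst (asm) sum_lessThan_telescope) (intro convergent_add convergent_const)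
    then show "convergent (\<lambda>n. f (r n) x)" by simp
  qed
  define g where "g = (\<lambda>x. lim (\<lambda>j. f (r j) x))"
  have gm[measurable]: "g \<in> borel_measurable lebesgue"
    unfolding g_def by (rule borel_measurable_lim_metric) simp
  have fatou: "(\<integral>\<^sup>+x. ennreal ((norm (g x - f (r m) x))\<^sup>2) \<partial>lebesgue) \<le> ennreal ((1/4) ^ m)" for m
  proof -
    have "(\<integral>\<^sup>+x. ennreal ((norm (g x - f (r m) x))\<^sup>2) \<partial>lebesgue)
        = (\<integral>\<^sup>+x. liminf (\<lambda>j. ennreal ((norm (f (r j) x - f (r m) x))\<^sup>2)) \<partial>lebesgue)"
    proof (rule nn_integral_cong_AE, use conv in eventually_elim)
      fix x assume "convergent (\<lambda>j. f (r j) x)"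
      then have "(\<lambda>j. f (r j) x) \<longlonglongrightarrow> g x" by (simp add: g_def convergent_LIMSEQ_iff)
      then have "(\<lambda>j. ennreal ((norm (f (r j) x - f (r m) x))\<^sup>2)) \<longlonglongrightarrow> ennreal ((norm (g x - f (r m) x))\<^sup>2)"
        by (intro tendsto_intros tendsto_ennrealI)
      then show "ennreal ((norm (g x - f (r m) x))\<^sup>2)
          = liminf (\<lambda>j. ennreal ((norm (f (r j) x - f (r m) x))\<^sup>2))"
        by (rule lim_imp_Liminf[symmetric, rotated]) simp
    qed
    also have "\<dots> \<le> liminf (\<lambda>j. \<integral>\<^sup>+x. ennreal ((norm (f (r j) x - f (r m) x))\<^sup>2) \<partial>lebesgue)"
      by (rule nn_integral_liminf) measurable
    also have "\<dots> \<le> ennreal ((1/4) ^ m)"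
    proof (rule Liminf_le)
      show "\<forall>\<^sub>F j in sequentially. (\<integral>\<^sup>+x. ennreal ((norm (f (r j) x - f (r m) x))\<^sup>2) \<partial>lebesgue) \<le> ennreal ((1/4) ^ m)"
        using eventually_ge_at_top[of m]
        by eventually_elim (simp add: nd small ennreal_leI)
    qed simp
    finally show ?thesis .
  qed
  have "square_integrable lebesgue (\<lambda>x. g x - f (r 0) x)"
    unfolding square_integrable_nn_integral using fatou[of 0] by (auto simp: le_less_trans)
  then have "square_integrable lebesgue (\<lambda>x. (g x - f (r 0) x) + f (r 0) x)"
    by (rule square_integrable_add) (use rel in \<open>simp add: l2_rel_def\<close>)
  then have g: "l2_rel g g" by (simp add: l2_rel_def)
  have "(norm (abs_l2 g - X (r m)))\<^sup>2 \<le> (1/4) ^ m" for m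
    using fatou[of m] norm_diff_l2_nn_integral[OF g rel, of "r m"] by (simp add: absf)
  then have le: "norm (X (r m) - abs_l2 g) \<le> sqrt ((1/4) ^ m)" for m
    by (metis norm_minus_commute real_le_rsqrt)
  have lim: "(\<lambda>m. sqrt ((1/4) ^ m)) \<longlonglongrightarrow> 0"
    using tendsto_real_sqrt[OF LIMSEQ_realpow_zero[of "1/4"]] by simp
  have "(X \<circ> r) \<longlonglongrightarrow> abs_l2 g"
    by (rule LIMSEQ_norm_diff_bound[OF _ lim]) (simp add: le)
  with \<open>Cauchy X\<close> smr have "X \<longlonglongrightarrow> abs_l2 g" by (rule Cauchy_converges_subseq)
  then show "convergent X" by (rule convergentI)
qed


section \<open>Classes of functions on \<Omega>, extended by zero\<close>

definition cls :: "'a::euclidean_space set \<Rightarrow> ('a \<Rightarrow> 'c::euclidean_space) \<Rightarrow> ('a, 'c) l2" where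
  "cls \<Omega> f = abs_l2 (\<lambda>x. indicator \<Omega> x *\<^sub>R f x)"

lemma square_integrable_indicator_iff:
  assumes "\<Omega> \<in> sets lebesgue"
  shows "square_integrable lebesgue (\<lambda>x. indicator \<Omega> x *\<^sub>R f x) \<longleftrightarrow> f \<in> L2 \<Omega>"
proof -
  have "(norm (indicator \<Omega> x *\<^sub>R f x))\<^sup>2 = indicator \<Omega> x *\<^sub>R (norm (f x))\<^sup>2" for x
    by (auto simp: indicator_def)
  then show ?thesis
    using assms unfolding square_integrable_def L2_def
    by (simp add: borel_measurable_restrict_space_iff integrable_restrict_space)
qed

lemma L2_add: "f \<in> L2 \<Omega> \<Longrightarrow> g \<in> L2 \<Omega> \<Longrightarrow> (\<lambda>x. f x + g x) \<in> L2 \<Omega>"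
  and L2_diff: "f \<in> L2 \<Omega> \<Longrightarrow> g \<in> L2 \<Omega> \<Longrightarrow> (\<lambda>x. f x - g x) \<in> L2 \<Omega>"
  and L2_scaleR: "f \<in> L2 \<Omega> \<Longrightarrow> (\<lambda>x. c *\<^sub>R f x) \<in> L2 \<Omega>"
  and L2_zero: "(\<lambda>x. 0) \<in> L2 \<Omega>"
  by (simp_all add: L2_iff square_integrable_add square_integrable_diff square_integrable_scaleR
      square_integrable_zero)

lemma L2_cmult: "f \<in> L2 \<Omega> \<Longrightarrow> (\<lambda>x. c * f x) \<in> L2 \<Omega>" for f :: "'a::euclidean_space \<Rightarrow> real"
  using L2_scaleR[of f \<Omega> c] by simp

lemma L2_minus: "f \<in> L2 \<Omega> \<Longrightarrow> g \<in> L2 \<Omega> \<Longrightarrow> f - g \<in> L2 \<Omega>"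
  unfolding fun_diff_def by (rule L2_diff)

lemma integrable_L2_inner:
  "f \<in> L2 \<Omega> \<Longrightarrow> g \<in> L2 \<Omega> \<Longrightarrow> integrable (lebesgue_on \<Omega>) (\<lambda>x. f x \<bullet> g x)"
  by (simp add: L2_iff square_integrable_inner)

lemma cls_rel:
  assumes "\<Omega> \<in> sets lebesgue" "f \<in> L2 \<Omega>"
  shows "l2_rel (\<lambda>x. indicator \<Omega> x *\<^sub>R f x) (\<lambda>x. indicator \<Omega> x *\<^sub>R f x)"
  using assms by (simp add: l2_rel_def square_integrable_indicator_iff)

lemma cls_eq_iff:
  assumes "\<Omega> \<in> sets lebesgue" "f \<in> L2 \<Omega>" "g \<in> L2 \<Omega>"
  shows "cls \<Omega> f = cls \<Omega> g \<longleftrightarrow> (AE x in lebesgue_on \<Omega>. f x = g x)"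
proof -
  have "cls \<Omega> f = cls \<Omega> g \<longleftrightarrow> l2_rel (\<lambda>x. indicator \<Omega> x *\<^sub>R f x) (\<lambda>x. indicator \<Omega> x *\<^sub>R g x)"
    unfolding cls_def
    using Quotient_rel[OF Quotient_l2] cls_rel[OF assms(1,2)] cls_rel[OF assms(1,3)] by blast
  also have "\<dots> \<longleftrightarrow> (AE x in lebesgue. x \<in> \<Omega> \<longrightarrow> f x = g x)"
    using assms unfolding l2_rel_def square_integrable_indicator_iff[OF assms(1)]
    by (auto simp: indicator_def elim!: eventually_mono)
  also have "\<dots> \<longleftrightarrow> (AE x in lebesgue_on \<Omega>. f x = g x)"
    using assms(1) by (simp add: AE_restrict_space_iff)
  finally show ?thesis .
qed

lemma cls_add:
  assumes "\<Omega> \<in> sets lebesgue" "f \<in> L2 \<Omega>" "g \<in> L2 \<Omega>"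
  shows "cls \<Omega> (\<lambda>x. f x + g x) = cls \<Omega> f + cls \<Omega> g"
  unfolding cls_def using assms by (simp add: plus_l2.abs_eq cls_rel scaleR_add_right)

lemma cls_diff:
  assumes "\<Omega> \<in> sets lebesgue" "f \<in> L2 \<Omega>" "g \<in> L2 \<Omega>"
  shows "cls \<Omega> (\<lambda>x. f x - g x) = cls \<Omega> f - cls \<Omega> g"
  unfolding cls_def using assms by (simp add: minus_l2.abs_eq cls_rel scaleR_diff_right)

lemma cls_scaleR:
  assumes "\<Omega> \<in> sets lebesgue" "f \<in> L2 \<Omega>"
  shows "cls \<Omega> (\<lambda>x. c *\<^sub>R f x) = c *\<^sub>R cls \<Omega> f"
  unfolding cls_def using assms by (simp add: scaleR_l2.abs_eq cls_rel mult.commute)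

lemma cls_cmult:
  fixes f :: "'a::euclidean_space \<Rightarrow> real"
  assumes "\<Omega> \<in> sets lebesgue" "f \<in> L2 \<Omega>"
  shows "cls \<Omega> (\<lambda>x. c * f x) = c *\<^sub>R cls \<Omega> f"
  using cls_scaleR[OF assms, of c] by simp

lemma cls_zero: "cls \<Omega> (\<lambda>x. 0) = 0"
  by (simp add: cls_def zero_l2_def)

lemma inner_cls:
  assumes "\<Omega> \<in> sets lebesgue" "f \<in> L2 \<Omega>" "g \<in> L2 \<Omega>"
  shows "cls \<Omega> f \<bullet> cls \<Omega> g = L2_inner \<Omega> f g"
proof -
  have "cls \<Omega> f \<bullet> cls \<Omega> g = (\<integral>x. (indicator \<Omega> x *\<^sub>R f x) \<bullet> (indicator \<Omega> x *\<^sub>R g x) \<partial>lebesgue)"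
    unfolding cls_def using assms by (simp add: inner_l2.abs_eq cls_rel del: inner_scaleR_left inner_scaleR_right)
  also have "\<dots> = (\<integral>x. indicator \<Omega> x *\<^sub>R (f x \<bullet> g x) \<partial>lebesgue)"
    by (intro Bochner_Integration.integral_cong) (auto simp: indicator_def)
  also have "\<dots> = L2_inner \<Omega> f g"
    using assms by (simp add: L2_inner_def integral_restrict_space)
  finally show ?thesis .
qed

lemma norm_cls:
  assumes "\<Omega> \<in> sets lebesgue" "f \<in> L2 \<Omega>"
  shows "norm (cls \<Omega> f) = L2_norm \<Omega> f"
  using inner_cls[OF assms assms(2)]
  by (simp add: norm_eq_sqrt_inner L2_norm_def L2_inner_def power2_norm_eq_inner)

text \<open>The classes coming from \<Omega> form a closed set: cutting a representative of the
  limit off outside \<Omega> does not increase its distance to functions that already vanish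
  there.\<close>

lemma cls_limit:
  assumes \<Omega>: "\<Omega> \<in> sets lebesgue" and f: "\<And>k. f k \<in> L2 \<Omega>" and lim: "(\<lambda>k. cls \<Omega> (f k)) \<longlonglongrightarrow> X"
  obtains g where "g \<in> L2 \<Omega>" "X = cls \<Omega> g"
proof -
  define g where "g = rep_l2 X"
  have relg: "l2_rel g g" by (simp add: g_def rep_l2_rel)
  have [measurable]: "g \<in> borel_measurable lebesgue" "\<Omega> \<in> sets lebesgue"
    using relg \<Omega> by (auto simp: l2_rel_def square_integrable_def)
  have "square_integrable lebesgue (\<lambda>x. indicator \<Omega> x *\<^sub>R g x)"
    unfolding square_integrable_def
  proof
    show "integrable lebesgue (\<lambda>x. (norm (indicator \<Omega> x *\<^sub>R g x))\<^sup>2)"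
      by (rule Bochner_Integration.integrable_bound[of _ "\<lambda>x. (norm (g x))\<^sup>2"])
         (use relg in \<open>auto simp: l2_rel_def square_integrable_def indicator_def\<close>)
  qed measurable
  then have gL2: "g \<in> L2 \<Omega>" using square_integrable_indicator_iff[OF \<Omega>] by blast
  have le: "norm (cls \<Omega> (f k) - cls \<Omega> g) \<le> norm (cls \<Omega> (f k) - X)" for k
  proof -
    have "ennreal ((norm (cls \<Omega> (f k) - cls \<Omega> g))\<^sup>2)
        = (\<integral>\<^sup>+x. ennreal ((norm (indicator \<Omega> x *\<^sub>R f k x - indicator \<Omega> x *\<^sub>R g x))\<^sup>2) \<partial>lebesgue)"
      unfolding cls_def by (rule norm_diff_l2_nn_integral[symmetric]) (auto intro: cls_rel \<Omega> f gL2)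
    also have "\<dots> \<le> (\<integral>\<^sup>+x. ennreal ((norm (indicator \<Omega> x *\<^sub>R f k x - g x))\<^sup>2) \<partial>lebesgue)"
      by (intro nn_integral_mono ennreal_leI) (auto simp: indicator_def)
    also have "\<dots> = ennreal ((norm (cls \<Omega> (f k) - abs_l2 g))\<^sup>2)"
      unfolding cls_def by (rule norm_diff_l2_nn_integral) (auto intro: cls_rel \<Omega> f relg)
    finally show ?thesis by (simp add: g_def abs_rep_l2)
  qed
  have "(\<lambda>k. norm (cls \<Omega> (f k) - X)) \<longlonglongrightarrow> 0"
    using lim by (simp add: LIM_zero tendsto_norm_zero)
  with le have "(\<lambda>k. cls \<Omega> (f k)) \<longlonglongrightarrow> cls \<Omega> g"
    by (rule LIMSEQ_norm_diff_bound)
  then have "X = cls \<Omega> g"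
    using LIMSEQ_unique[OF lim] by simp
  with gL2 show ?thesis by (rule that)
qed

lemma open_lebesgue: "open \<Omega> \<Longrightarrow> \<Omega> \<in> sets lebesgue" by auto

subsection \<open>Test functions\<close>

lemma test_smooth: "\<phi> \<in> test_functions \<Omega> \<Longrightarrow> smooth \<phi>"
  by (simp add: test_functions_def)

lemma test_support:
  assumes "\<phi> \<in> test_functions \<Omega>"
  obtains K where "compact K" "K \<subseteq> \<Omega>" "\<And>x. x \<notin> K \<Longrightarrow> \<phi> x = 0"
    "\<And>x i. x \<notin> K \<Longrightarrow> frechet_derivative \<phi> (at x) i = 0"
proof -
  define K where "K = closure {x. \<phi> x \<noteq> 0}"
  have K: "compact K" "K \<subseteq> \<Omega>" using assms by (auto simp: K_def test_functions_def)
  have z: "\<phi> x = 0" if "x \<notin> K" for x using that closure_subset[of "{x. \<phi> x \<noteq> 0}"] by (auto simp: K_def)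
  have "frechet_derivative \<phi> (at x) = (\<lambda>i. 0)" if "x \<notin> K" for x
  proof -
    have "((\<lambda>x. 0::real) has_derivative (\<lambda>i. 0)) (at x)" by simp
    then have "(\<phi> has_derivative (\<lambda>i. 0)) (at x)"
      by (rule has_derivative_transform_within_open[of _ _ _ UNIV "- K"])
         (use K that z in \<open>auto simp: compact_imp_closed open_Compl\<close>)
    from frechet_derivative_at[OF this] show ?thesis by simp
  qed
  then show ?thesis using that K z by metis
qed

lemma test_functionsI:
  assumes "smooth \<phi>" "compact K" "K \<subseteq> \<Omega>" "\<And>x. x \<notin> K \<Longrightarrow> \<phi> x = 0"
  shows "\<phi> \<in> test_functions \<Omega>"
proof -
  have "closure {x. \<phi> x \<noteq> 0} \<subseteq> K"
    by (rule closure_minimal) (use assms in \<open>auto simp: compact_imp_closed\<close>)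
  then show ?thesis
    using assms compact_Int_closed[of K "closure {x. \<phi> x \<noteq> 0}"]
    by (auto simp: test_functions_def Int_absorb1)
qed

lemma test_add:
  assumes "\<phi> \<in> test_functions \<Omega>" "\<psi> \<in> test_functions \<Omega>"
  shows "(\<lambda>x. \<phi> x + \<psi> x) \<in> test_functions \<Omega>"
proof -
  obtain K where K: "compact K" "K \<subseteq> \<Omega>" "\<And>x. x \<notin> K \<Longrightarrow> \<phi> x = 0"
    using test_support[OF assms(1)] by metis
  obtain L where L: "compact L" "L \<subseteq> \<Omega>" "\<And>x. x \<notin> L \<Longrightarrow> \<psi> x = 0"
    using test_support[OF assms(2)] by metis
  show ?thesis
    by (rule test_functionsI[of _ "K \<union> L"]) (use K L assms in \<open>auto intro: smooth_add test_smooth\<close>)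
qed

lemma test_mult_smooth:
  assumes "\<phi> \<in> test_functions \<Omega>" "smooth \<psi>"
  shows "(\<lambda>x. \<psi> x * \<phi> x) \<in> test_functions \<Omega>"
proof -
  obtain K where K: "compact K" "K \<subseteq> \<Omega>" "\<And>x. x \<notin> K \<Longrightarrow> \<phi> x = 0"
    using test_support[OF assms(1)] by metis
  show ?thesis
    by (rule test_functionsI[of _ K]) (use K assms in \<open>auto intro: smooth_mult test_smooth\<close>)
qed

lemma test_derivative:
  assumes "\<phi> \<in> test_functions \<Omega>" "i \<in> Basis"
  shows "(\<lambda>x. frechet_derivative \<phi> (at x) i) \<in> test_functions \<Omega>"
proof -
  obtain K where K: "compact K" "K \<subseteq> \<Omega>" "\<And>x. x \<notin> K \<Longrightarrow> frechet_derivative \<phi> (at x) i = 0"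
    using test_support[OF assms(1)] by metis
  show ?thesis
    by (rule test_functionsI[of _ K])
       (use K assms test_smooth[OF assms(1)] in \<open>auto intro: smooth_frechet_derivative\<close>)
qed

lemma test_bounded:
  assumes "\<phi> \<in> test_functions \<Omega>"
  obtains B where "\<And>x. \<bar>\<phi> x\<bar> \<le> B" "B \<ge> 0"
proof -
  obtain K where K: "compact K" "\<And>x. x \<notin> K \<Longrightarrow> \<phi> x = 0"
    using test_support[OF assms] by metis
  have "continuous_on K \<phi>"
    using smooth_continuous[OF test_smooth[OF assms]] continuous_on_subset by blast
  then have "bounded (\<phi> ` K)" using K compact_continuous_image compact_imp_bounded by blast
  then obtain B where B: "\<And>x. x \<in> K \<Longrightarrow> \<bar>\<phi> x\<bar> \<le> B" by (auto simp: bounded_iff)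
  show ?thesis
  proof (rule that[of "max B 0"])
    show "\<bar>\<phi> x\<bar> \<le> max B 0" for x using B[of x] K(2)[of x] by (cases "x \<in> K") auto
  qed simp
qed

lemma test_borel: "\<phi> \<in> test_functions \<Omega> \<Longrightarrow> \<phi> \<in> borel_measurable borel"
  by (simp add: borel_measurable_continuous_onI smooth_continuous test_smooth)

lemma test_lborel_integrable:
  assumes "\<phi> \<in> test_functions \<Omega>"
  shows "integrable lborel \<phi>"
proof -
  obtain K where K: "compact K" "\<And>x. x \<notin> K \<Longrightarrow> \<phi> x = 0"
    using test_support[OF assms] by metis
  have "integrable lborel (\<lambda>x. indicator K x *\<^sub>R \<phi> x)"
    by (rule borel_integrable_compact[OF K(1)])
      (rule continuous_on_subset[OF smooth_continuous[OF test_smooth[OF assms]]], simp)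
  moreover have "(\<lambda>x. indicator K x *\<^sub>R \<phi> x) = \<phi>"
    using K(2) by (auto simp: fun_eq_iff indicator_def)
  ultimately show ?thesis by simp
qed

lemma test_square_test: "\<phi> \<in> test_functions \<Omega> \<Longrightarrow> (\<lambda>x. (\<phi> x)\<^sup>2) \<in> test_functions \<Omega>"
  using test_mult_smooth[OF _ test_smooth, of \<phi> \<Omega> \<phi> \<Omega>] by (simp add: power2_eq_square)

lemma test_scaleR_L2:
  assumes "open \<Omega>" "\<phi> \<in> test_functions \<Omega>"
  shows "(\<lambda>x. \<phi> x *\<^sub>R c) \<in> L2 \<Omega>"
proof -
  have "integrable lborel (\<lambda>x. (norm c)\<^sup>2 * (\<phi> x)\<^sup>2)"
    using test_lborel_integrable[OF test_square_test[OF assms(2)]] by simp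
  then have "integrable lebesgue (\<lambda>x. (norm c)\<^sup>2 * (\<phi> x)\<^sup>2)"
    using integrable_completion by (metis borel_measurable_integrable)
  then have "square_integrable lebesgue (\<lambda>x. \<phi> x *\<^sub>R c)"
    using test_borel[OF assms(2)] unfolding square_integrable_def
    by (auto simp: power_mult_distrib mult.commute intro!: borel_measurable_scaleR measurable_completion)
  moreover have "(\<lambda>x. \<phi> x *\<^sub>R c) = (\<lambda>x. indicator \<Omega> x *\<^sub>R (\<phi> x *\<^sub>R c))"
  proof -
    obtain K where K: "K \<subseteq> \<Omega>" "\<And>x. x \<notin> K \<Longrightarrow> \<phi> x = 0"
      using test_support[OF assms(2)] by metis
    then show ?thesis by (force simp: indicator_def fun_eq_iff)
  qed
  ultimately show ?thesis
    using square_integrable_indicator_iff[OF open_lebesgue[OF assms(1)]] by metis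
qed

lemma test_L2: "open \<Omega> \<Longrightarrow> \<phi> \<in> test_functions \<Omega> \<Longrightarrow> \<phi> \<in> L2 \<Omega>"
  using test_scaleR_L2[of \<Omega> \<phi> "1::real"] by simp

text \<open>By translation invariance every difference quotient has integral zero, and dominated
  convergence passes this to the derivative. Applied to a product, this is the integration by parts
  that identifies classical with weak gradients.\<close>

lemma integral_test_derivative_0:
  fixes \<psi> :: "'a::euclidean_space \<Rightarrow> real"
  assumes \<psi>: "\<psi> \<in> test_functions \<Omega>" and i: "i \<in> Basis"
  shows "(\<integral>x. frechet_derivative \<psi> (at x) i \<partial>lborel) = 0"
proof -
  let ?D = "\<lambda>x. frechet_derivative \<psi> (at x) i"
  obtain K where K: "compact K" "\<And>x. x \<notin> K \<Longrightarrow> \<psi> x = 0"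
    using test_support[OF \<psi>] by metis
  obtain R where R: "\<And>x. x \<in> K \<Longrightarrow> norm x \<le> R"
    using compact_imp_bounded[OF K(1)] by (auto simp: bounded_iff)
  obtain B where B: "\<And>x. \<bar>?D x\<bar> \<le> B" "B \<ge> 0"
    using test_bounded[OF test_derivative[OF \<psi> i]] by metis
  have [measurable]: "\<psi> \<in> borel_measurable borel" using \<psi> by (rule test_borel)
  define h where "h = (\<lambda>n::nat. inverse (real (Suc n)))"
  have h0: "h n > 0" "h n \<le> 1" for n by (auto simp: h_def inverse_le_1_iff)
  have line: "((\<lambda>t. \<psi> (x + t *\<^sub>R i)) has_real_derivative ?D (x + t *\<^sub>R i)) (at t)" for x t
  proof -
    have d: "(\<psi> has_derivative frechet_derivative \<psi> (at (x + t *\<^sub>R i))) (at (x + t *\<^sub>R i))"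
      using smooth_differentiable[OF test_smooth[OF \<psi>]] by (simp add: frechet_derivative_works)
    have "((\<lambda>t. \<psi> (x + t *\<^sub>R i)) has_derivative (\<lambda>s. frechet_derivative \<psi> (at (x + t *\<^sub>R i)) (s *\<^sub>R i))) (at t)"
      by (rule has_derivative_compose[of "\<lambda>t. x + t *\<^sub>R i" "\<lambda>s. s *\<^sub>R i" t UNIV \<psi>, OF _ d])
         (auto intro!: derivative_eq_intros)
    moreover have "frechet_derivative \<psi> (at (x + t *\<^sub>R i)) (s *\<^sub>R i) = s * ?D (x + t *\<^sub>R i)" for s
      using linear_cmul[OF linear_frechet_derivative[OF smooth_differentiable[OF test_smooth[OF \<psi>]]]]
      by simp
    ultimately show ?thesis by (simp add: has_field_derivative_def mult.commute[of _ "?D _"])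
  qed
  \<comment> \<open>The steps \<open>h n\<close> are at most 1, so the translated supports stay in
    the ball of radius R + 1. There the mean value theorem bounds the quotients by the supremum B of
    the derivative.\<close>
  have "(\<lambda>n. \<integral>x. (\<psi> (x + h n *\<^sub>R i) - \<psi> x) / h n \<partial>lborel) \<longlonglongrightarrow> (\<integral>x. ?D x \<partial>lborel)"
  proof (rule integral_dominated_convergence[where w = "\<lambda>x. indicator (cball 0 (R + 1)) x * B"])
    show "?D \<in> borel_measurable lborel"
      using test_borel[OF test_derivative[OF \<psi> i]] by simp
    show "integrable lborel (\<lambda>x::'a. indicator (cball 0 (R + 1)) x * B)"
    proof (rule integrable_mult_left)
      show "integrable lborel (indicator (cball (0::'a) (R + 1)) :: 'a \<Rightarrow> real)"
        by (rule integrable_real_indicator[OF _ emeasure_bounded_finite]) auto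
    qed
    show "AE x in lborel. (\<lambda>n. (\<psi> (x + h n *\<^sub>R i) - \<psi> x) / h n) \<longlonglongrightarrow> ?D x"
    proof (rule AE_I2)
      fix x
      have "((\<lambda>t. (\<psi> (x + t *\<^sub>R i) - \<psi> x) / t) \<longlongrightarrow> ?D x) (at 0)"
        using line[of x 0] by (simp add: DERIV_def)
      moreover have "filterlim h (at 0) sequentially"
        using LIMSEQ_inverse_real_of_nat by (auto simp: filterlim_at h_def)
      ultimately show "(\<lambda>n. (\<psi> (x + h n *\<^sub>R i) - \<psi> x) / h n) \<longlonglongrightarrow> ?D x"
        by (rule filterlim_compose)
    qed
    fix n
    show "AE x in lborel. norm ((\<psi> (x + h n *\<^sub>R i) - \<psi> x) / h n) \<le> indicator (cball 0 (R + 1)) x * B"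
    proof (rule AE_I2)
      fix x
      show "norm ((\<psi> (x + h n *\<^sub>R i) - \<psi> x) / h n) \<le> indicator (cball 0 (R + 1)) x * B"
      proof (cases "norm x \<le> R + 1")
        case True
        obtain z where "\<psi> (x + h n *\<^sub>R i) - \<psi> (x + 0 *\<^sub>R i) = (h n - 0) * ?D (x + z *\<^sub>R i)"
          using MVT2[of 0 "h n" "\<lambda>t. \<psi> (x + t *\<^sub>R i)" "\<lambda>t. ?D (x + t *\<^sub>R i)"] line h0 by metis
        then show ?thesis using True B h0[of n] by (simp add: abs_mult)
      next
        case False
        have "norm x \<le> norm (x + h n *\<^sub>R i) + norm (h n *\<^sub>R i)"
          using norm_triangle_ineq4[of "x + h n *\<^sub>R i" "h n *\<^sub>R i"] by simp
        then have "\<psi> (x + h n *\<^sub>R i) = 0" "\<psi> x = 0"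
          using False h0[of n] i R[of x] R[of "x + h n *\<^sub>R i"] K(2) by fastforce+
        then show ?thesis using False by simp
      qed
    qed
  qed measurable
  moreover have "(\<integral>x. (\<psi> (x + h n *\<^sub>R i) - \<psi> x) / h n \<partial>lborel) = 0" for n
  proof -
    have int: "integrable lborel \<psi>" by (rule test_lborel_integrable[OF \<psi>])
    have eq: "distr lborel borel (\<lambda>x. h n *\<^sub>R i + x) = lborel" by (rule lborel_distr_plus)
    have i2: "integrable lborel (\<lambda>x. \<psi> (h n *\<^sub>R i + x))"
      using int by (subst (asm) eq[symmetric]) (simp add: integrable_distr_eq)
    have "(\<integral>x. \<psi> x \<partial>lborel) = (\<integral>x. \<psi> (h n *\<^sub>R i + x) \<partial>lborel)"
      by (subst eq[symmetric]) (simp add: integral_distr)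
    then show ?thesis using int i2 by (simp add: add.commute)
  qed
  ultimately show ?thesis by (simp only: LIMSEQ_const_iff)
qed

subsection \<open>Weak gradients\<close>

lemma bounded_L2_const:
  assumes "\<Omega> \<in> sets lebesgue" "bounded \<Omega>" shows "(\<lambda>x. c) \<in> L2 \<Omega>"
proof -
  have "finite_measure (lebesgue_on \<Omega>)"
    using assms bounded_set_imp_lmeasurable by (intro finite_measure_lebesgue_on) auto
  then show ?thesis
    by (simp add: L2_def finite_measure.integrable_const)
qed

text \<open>The fundamental lemma of the calculus of variations. Bumps tending to indicators show
  that each component of g has integral zero over every box whose closure lies in \<Omega>. Lebesgue
  differentiation along small cubes with corner x then gives g = 0 almost everywhere.\<close>

lemma l2_test_orthogonal_zero:
  fixes g :: "'a::euclidean_space \<Rightarrow> 'c::euclidean_space"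
  assumes \<Omega>: "open \<Omega>" "bounded \<Omega>" and g: "g \<in> L2 \<Omega>"
    and orth: "\<And>\<phi> i. \<phi> \<in> test_functions \<Omega> \<Longrightarrow> i \<in> Basis \<Longrightarrow> cls \<Omega> g \<bullet> cls \<Omega> (\<lambda>x. \<phi> x *\<^sub>R i) = 0"
  shows "cls \<Omega> g = 0"
proof -
  have m\<Omega>: "\<Omega> \<in> sets lebesgue" using \<Omega> by auto
  have ae: "AE x in lebesgue_on \<Omega>. g x \<bullet> i = 0" if i: "i \<in> Basis" for i
  proof -
    define G where "G = (\<lambda>x. indicator \<Omega> x *\<^sub>R (g x \<bullet> i))"
    have intg: "integrable (lebesgue_on \<Omega>) (\<lambda>x. g x \<bullet> i)"
      using integrable_L2_inner[OF g bounded_L2_const[OF m\<Omega> \<Omega>(2), of i]] .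
    then have intG: "integrable lebesgue G"
      using m\<Omega> by (simp add: G_def integrable_restrict_space)
    have zero: "(\<integral>x. indicator (box a b) x * (g x \<bullet> i) \<partial>lebesgue_on \<Omega>) = 0" if ab: "cbox a b \<subseteq> \<Omega>" for a b
    proof -
      have "(\<lambda>m. \<integral>x. box_bump a b (Suc m) x * (g x \<bullet> i) \<partial>lebesgue_on \<Omega>)
          \<longlonglongrightarrow> (\<integral>x. indicator (box a b) x * (g x \<bullet> i) \<partial>lebesgue_on \<Omega>)"
      proof (rule integral_dominated_convergence[where w = "\<lambda>x. \<bar>g x \<bullet> i\<bar>"])
        have bm: "box_bump a b (Suc m) \<in> borel_measurable (lebesgue_on \<Omega>)" for m
          using test_L2[OF \<Omega>(1) box_bump_test[OF ab]] by (auto simp: L2_def)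
        show "(\<lambda>x. box_bump a b (Suc m) x * (g x \<bullet> i)) \<in> borel_measurable (lebesgue_on \<Omega>)" for m
          using bm intg by (intro borel_measurable_times) auto
        have "indicator (box a b) \<in> borel_measurable lebesgue"
          by (rule borel_measurable_indicator) simp
        then have "(indicator (box a b) :: 'a \<Rightarrow> real) \<in> borel_measurable (lebesgue_on \<Omega>)"
          by (rule measurable_restrict_space1)
        then show "(\<lambda>x. indicator (box a b) x * (g x \<bullet> i)) \<in> borel_measurable (lebesgue_on \<Omega>)"
          using intg by (intro borel_measurable_times) auto
        show "AE x in lebesgue_on \<Omega>. (\<lambda>m. box_bump a b (Suc m) x * (g x \<bullet> i)) \<longlonglongrightarrow> indicator (box a b) x * (g x \<bullet> i)"
          by (intro AE_I2 tendsto_mult box_bump_tendsto tendsto_const)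
        show "AE x in lebesgue_on \<Omega>. norm (box_bump a b (Suc m) x * (g x \<bullet> i)) \<le> \<bar>g x \<bullet> i\<bar>" for m
          using box_bump_bounds[of a b "Suc m"] by (auto intro!: AE_I2 mult_left_le_one_le simp: abs_mult)
      qed (use intg in auto)
      moreover have "(\<integral>x. box_bump a b (Suc m) x * (g x \<bullet> i) \<partial>lebesgue_on \<Omega>) = 0" for m
        using orth[OF box_bump_test[OF ab] i]
        by (simp add: inner_cls[OF m\<Omega> g test_scaleR_L2[OF \<Omega>(1) box_bump_test[OF ab]]] L2_inner_def)
      ultimately show ?thesis by (simp add: LIMSEQ_const_iff)
    qed
    have int0: "integral (cbox a b) G = 0" if ab: "cbox a b \<subseteq> \<Omega>" for a b
    proof -
      have "integral (cbox a b) G = integral (box a b) G" by (rule integral_open_interval[symmetric])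
      also have "\<dots> = (\<integral>x. G x \<partial>lebesgue_on (box a b))"
        using integrable_mult_indicator[OF _ intG, of "box a b"]
        by (intro lebesgue_integral_eq_integral[symmetric]) (auto simp: integrable_restrict_space)
      also have "\<dots> = (\<integral>x. indicator \<Omega> x *\<^sub>R (indicator (box a b) x * (g x \<bullet> i)) \<partial>lebesgue)"
        by (subst integral_restrict_space) (auto simp: G_def mult.left_commute)
      also have "\<dots> = 0" using zero[OF ab] m\<Omega> by (simp add: integral_restrict_space)
      finally show ?thesis .
    qed
    have "G integrable_on UNIV" using intG integrable_on_lebesgue by blast
    then have "G integrable_on cbox a b" for a b by (rule integrable_on_subcbox) simp
    then obtain N where N: "negligible N" "\<And>x e. \<lbrakk>x \<notin> N; 0 < e\<rbrakk> \<Longrightarrow>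
        \<exists>d>0. \<forall>h. 0 < h \<and> h < d \<longrightarrow> norm (integral (cbox x (x + h *\<^sub>R One)) G /\<^sub>R h ^ DIM('a) - G x) < e"
      using integrable_ccontinuous_explicit[of G] by metis
    have "g x \<bullet> i = 0" if x: "x \<in> \<Omega>" "x \<notin> N" for x
    proof (rule ccontr)
      assume ne: "g x \<bullet> i \<noteq> 0"
      obtain d where d: "d > 0" "\<And>h. 0 < h \<Longrightarrow> h < d \<Longrightarrow>
          norm (integral (cbox x (x + h *\<^sub>R One)) G /\<^sub>R h ^ DIM('a) - G x) < \<bar>g x \<bullet> i\<bar>"
        using N(2)[OF x(2), of "\<bar>g x \<bullet> i\<bar>"] ne by auto
      obtain r where r: "r > 0" "ball x r \<subseteq> \<Omega>" using \<Omega>(1) x(1) open_contains_ball by blast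
      have O: "norm (One :: 'a) > 0" by simp
      \<comment> \<open>Every point of the cube of side h with corner x is within h times the norm
        of \<open>One\<close> of x, so this side keeps the cube inside the ball of radius r
        contained in \<Omega>, and also below the threshold d of the differentiation
        theorem.\<close>
      define h where "h = min (d / 2) (r / (2 * norm (One :: 'a)))"
      have h: "0 < h" "h < d" "h * norm (One :: 'a) < r"
        using d(1) r(1) O unfolding h_def
        by (auto simp: min_def field_simps simp del: norm_le_zero_iff zero_less_norm_iff)
      have "cbox x (x + h *\<^sub>R One) \<subseteq> ball x r"
      proof
        fix y assume y: "y \<in> cbox x (x + h *\<^sub>R One)"
        have "norm (y - x) \<le> norm (h *\<^sub>R (One :: 'a))"
        proof (rule norm_le_componentwise)
          fix j :: 'a assume "j \<in> Basis"
          then show "\<bar>(y - x) \<bullet> j\<bar> \<le> \<bar>(h *\<^sub>R One) \<bullet> j\<bar>"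
            using y h(1) by (auto simp: mem_box algebra_simps dest: bspec[of _ _ j])
        qed
        then show "y \<in> ball x r" using h by (simp add: dist_norm norm_minus_commute)
      qed
      then have "integral (cbox x (x + h *\<^sub>R One)) G = 0" using int0 r(2) by blast
      with d(2)[OF h(1,2)] x(1) show False by (simp add: G_def)
    qed
    then have "AE x in lebesgue. x \<in> \<Omega> \<longrightarrow> g x \<bullet> i = 0"
      using N(1) by (intro AE_I'[of N]) (auto simp: negligible_iff_null_sets)
    then show ?thesis using m\<Omega> by (simp add: AE_restrict_space_iff)
  qed
  have "AE x in lebesgue_on \<Omega>. \<forall>i\<in>Basis. g x \<bullet> i = 0"
    using ae by (intro AE_finite_allI) auto
  then have "AE x in lebesgue_on \<Omega>. g x = 0"
    by eventually_elim (simp add: euclidean_eq_iff[where 'a='c])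
  then show ?thesis
    using cls_eq_iff[OF m\<Omega> g L2_zero] by (simp add: cls_zero)
qed

text \<open>The graph of the weak gradient as a subset of a product of Hilbert spaces. Written as an
  intersection of kernels of continuous linear functionals, it is visibly a closed subspace.\<close>

definition wgraph :: "'a::euclidean_space set \<Rightarrow> (('a, real) l2 \<times> ('a, 'a) l2) set" where
  "wgraph \<Omega> = {z. \<forall>\<phi>\<in>test_functions \<Omega>. \<forall>i\<in>Basis.
     fst z \<bullet> cls \<Omega> (\<lambda>x. frechet_derivative \<phi> (at x) i) = - (snd z \<bullet> cls \<Omega> (\<lambda>x. \<phi> x *\<^sub>R i))}"

lemma wgraph_subspace: "subspace (wgraph \<Omega>)"
  by (auto simp: wgraph_def subspace_def inner_add_left)

lemma wgraph_closed: "closed (wgraph \<Omega>)"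
proof -
  have "closed {z :: ('a, real) l2 \<times> ('a, 'a) l2. fst z \<bullet> p = - (snd z \<bullet> q)}" for p q
    by (intro closed_Collect_eq continuous_intros)
  moreover have "wgraph \<Omega> = (\<Inter>\<phi>\<in>test_functions \<Omega>. \<Inter>i\<in>Basis.
      {z. fst z \<bullet> cls \<Omega> (\<lambda>x. frechet_derivative \<phi> (at x) i) = - (snd z \<bullet> cls \<Omega> (\<lambda>x. \<phi> x *\<^sub>R i))})"
    by (auto simp: wgraph_def)
  ultimately show ?thesis by (auto intro!: closed_INT)
qed

definition cgrad :: "('a::euclidean_space \<Rightarrow> real) \<Rightarrow> 'a \<Rightarrow> 'a" where
  "cgrad \<phi> x = (\<Sum>i\<in>Basis. frechet_derivative \<phi> (at x) i *\<^sub>R i)"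

locale bounded_open_set =
  fixes \<Omega> :: "'a::euclidean_space set"
  assumes \<Omega>: "open \<Omega>" "bounded \<Omega>"
begin

lemma m\<Omega>: "\<Omega> \<in> sets lebesgue" using \<Omega> by auto

lemma inner_cls_test:
  assumes "\<phi> \<in> test_functions \<Omega>" "g \<in> L2 \<Omega>"
  shows "cls \<Omega> g \<bullet> cls \<Omega> (\<lambda>x. \<phi> x *\<^sub>R c) = (\<integral>x. (g x \<bullet> c) * \<phi> x \<partial>lebesgue_on \<Omega>)"
  by (simp add: inner_cls[OF m\<Omega> assms(2) test_scaleR_L2[OF \<Omega>(1) assms(1)]] L2_inner_def mult.commute)

lemma inner_cls_test_derivative:
  assumes "\<phi> \<in> test_functions \<Omega>" "i \<in> Basis" "u \<in> L2 \<Omega>"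
  shows "cls \<Omega> u \<bullet> cls \<Omega> (\<lambda>x. frechet_derivative \<phi> (at x) i)
    = (\<integral>x. u x * frechet_derivative \<phi> (at x) i \<partial>lebesgue_on \<Omega>)"
  using assms test_L2[OF \<Omega>(1) test_derivative] by (simp add: inner_cls m\<Omega> L2_inner_def)

lemma is_weak_gradient_iff:
  assumes "u \<in> L2 \<Omega>" "g \<in> L2 \<Omega>"
  shows "is_weak_gradient \<Omega> u g \<longleftrightarrow> (cls \<Omega> u, cls \<Omega> g) \<in> wgraph \<Omega>"
  using assms by (simp add: is_weak_gradient_def wgraph_def inner_cls_test inner_cls_test_derivative)

lemma wgraph_unique:
  assumes "u \<in> L2 \<Omega>" "g \<in> L2 \<Omega>" "h \<in> L2 \<Omega>" "is_weak_gradient \<Omega> u g" "is_weak_gradient \<Omega> u h"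
  shows "cls \<Omega> g = cls \<Omega> h"
proof -
  have "cls \<Omega> (\<lambda>x. g x - h x) = 0"
    by (rule l2_test_orthogonal_zero[OF \<Omega> L2_diff[OF assms(2,3)]])
       (use assms in \<open>auto simp: is_weak_gradient_iff wgraph_def cls_diff m\<Omega> inner_diff_left\<close>)
  then show ?thesis using assms by (simp add: cls_diff m\<Omega>)
qed

lemma grad_props:
  assumes "u \<in> H1 \<Omega>"
  shows "grad \<Omega> u \<in> L2 \<Omega>" "is_weak_gradient \<Omega> u (grad \<Omega> u)"
proof -
  have "\<exists>g. g \<in> L2 \<Omega> \<and> is_weak_gradient \<Omega> u g" using assms by (auto simp: H1_def)
  from someI_ex[OF this] show "grad \<Omega> u \<in> L2 \<Omega>" "is_weak_gradient \<Omega> u (grad \<Omega> u)"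
    by (auto simp: grad_def)
qed

text \<open>\<open>hc\<close> turns functions of \<open>H1 \<Omega>\<close> into elements of a Hilbert space, where \<open>H10 \<Omega>\<close> becomes the closed
  subspace \<open>HS\<close> below and \<open>H1_norm \<Omega>\<close> becomes the norm.\<close>

definition hc :: "('a \<Rightarrow> real) \<Rightarrow> ('a, real) l2 \<times> ('a, 'a) l2" where
  "hc u = (cls \<Omega> u, cls \<Omega> (grad \<Omega> u))"

lemma H1_L2: "u \<in> H1 \<Omega> \<Longrightarrow> u \<in> L2 \<Omega>" by (simp add: H1_def)

lemma H10_H1: "u \<in> H10 \<Omega> \<Longrightarrow> u \<in> H1 \<Omega>" by (simp add: H10_def)

lemma hc_wgraph: "u \<in> H1 \<Omega> \<Longrightarrow> hc u \<in> wgraph \<Omega>"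
  using is_weak_gradient_iff[of u "grad \<Omega> u"] grad_props[of u] H1_L2[of u] by (simp add: hc_def)

text \<open>This makes the choice inside \<open>grad\<close> harmless: weak gradients are unique up
  to null sets, so any square integrable weak gradient represents the class of the chosen
  one.\<close>

lemma hc_eqI:
  assumes "u \<in> L2 \<Omega>" "g \<in> L2 \<Omega>" "(cls \<Omega> u, cls \<Omega> g) \<in> wgraph \<Omega>"
  shows "u \<in> H1 \<Omega>" "hc u = (cls \<Omega> u, cls \<Omega> g)"
proof -
  have g: "is_weak_gradient \<Omega> u g" using assms is_weak_gradient_iff by blast
  then show u: "u \<in> H1 \<Omega>" using assms by (auto simp: H1_def)
  show "hc u = (cls \<Omega> u, cls \<Omega> g)"
    unfolding hc_def using wgraph_unique[OF assms(1) _ assms(2) _ g] grad_props[OF u] by auto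
qed

text \<open>\<open>grad\<close> is chosen for each function separately, so linearity is available
  only after passing to classes.\<close>

lemma hc_lincomb:
  assumes "u \<in> H1 \<Omega>" "v \<in> H1 \<Omega>"
  shows "(\<lambda>x. a * u x + b * v x) \<in> H1 \<Omega>" "hc (\<lambda>x. a * u x + b * v x) = a *\<^sub>R hc u + b *\<^sub>R hc v"
proof -
  let ?u = "\<lambda>x. a * u x + b * v x" and ?g = "\<lambda>x. a *\<^sub>R grad \<Omega> u x + b *\<^sub>R grad \<Omega> v x"
  have L: "u \<in> L2 \<Omega>" "v \<in> L2 \<Omega>" "grad \<Omega> u \<in> L2 \<Omega>" "grad \<Omega> v \<in> L2 \<Omega>"
    using assms H1_L2 grad_props by auto
  have LL: "?u \<in> L2 \<Omega>" "?g \<in> L2 \<Omega>"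
    using L by (auto intro!: L2_add L2_scaleR L2_cmult)
  have c: "cls \<Omega> ?u = a *\<^sub>R cls \<Omega> u + b *\<^sub>R cls \<Omega> v"
    using cls_add[OF m\<Omega> L2_cmult[OF L(1), of a] L2_cmult[OF L(2), of b]] L
    by (simp add: cls_cmult[OF m\<Omega>])
  have "cls \<Omega> ?g = a *\<^sub>R cls \<Omega> (grad \<Omega> u) + b *\<^sub>R cls \<Omega> (grad \<Omega> v)"
    using cls_add[OF m\<Omega> L2_scaleR[OF L(3), of a] L2_scaleR[OF L(4), of b]] L
    by (simp add: cls_scaleR[OF m\<Omega>])
  with c have e: "(cls \<Omega> ?u, cls \<Omega> ?g) = a *\<^sub>R hc u + b *\<^sub>R hc v" by (simp add: hc_def)
  have "a *\<^sub>R hc u + b *\<^sub>R hc v \<in> wgraph \<Omega>"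
    using wgraph_subspace hc_wgraph assms by (intro subspace_add subspace_scale)
  then show "?u \<in> H1 \<Omega>" "hc ?u = a *\<^sub>R hc u + b *\<^sub>R hc v"
    using hc_eqI[OF LL] e by auto
qed

lemma hc_diff:
  assumes "u \<in> H1 \<Omega>" "v \<in> H1 \<Omega>"
  shows "u - v \<in> H1 \<Omega>" "hc (u - v) = hc u - hc v"
  using hc_lincomb[OF assms, of 1 "- 1"] by (simp_all add: fun_diff_def)

lemma norm_hc: "u \<in> H1 \<Omega> \<Longrightarrow> norm (hc u) = H1_norm \<Omega> u"
  by (simp add: hc_def norm_prod_def H1_norm_def norm_cls[OF m\<Omega>] H1_L2 grad_props)

lemma cgrad_L2: "\<phi> \<in> test_functions \<Omega> \<Longrightarrow> cgrad \<phi> \<in> L2 \<Omega>"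
proof -
  assume "\<phi> \<in> test_functions \<Omega>"
  then have L: "(\<lambda>x. frechet_derivative \<phi> (at x) i *\<^sub>R i) \<in> L2 \<Omega>" if "i \<in> Basis" for i
    using test_scaleR_L2[OF \<Omega>(1) test_derivative] that by blast
  have "(\<lambda>x. \<Sum>i\<in>B. frechet_derivative \<phi> (at x) i *\<^sub>R i) \<in> L2 \<Omega>" if "finite B" "B \<subseteq> Basis" for B
    using that by (induction B rule: finite_induct) (auto intro: L2_zero L2_add L)
  then show ?thesis unfolding cgrad_def[abs_def] by simp
qed

lemma integral_\<Omega>_lborel:
  assumes "\<psi> \<in> test_functions \<Omega>" shows "(\<integral>x. \<psi> x \<partial>lebesgue_on \<Omega>) = (\<integral>x. \<psi> x \<partial>lborel)"
proof -
  obtain K where K: "K \<subseteq> \<Omega>" "\<And>x. x \<notin> K \<Longrightarrow> \<psi> x = 0"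
    using test_support[OF assms] by metis
  have "(\<lambda>x. indicator \<Omega> x *\<^sub>R \<psi> x) = \<psi>"
  proof
    show "indicator \<Omega> x *\<^sub>R \<psi> x = \<psi> x" for x using K by (cases "x \<in> \<Omega>") auto
  qed
  then have "(\<integral>x. \<psi> x \<partial>lebesgue_on \<Omega>) = (\<integral>x. \<psi> x \<partial>lebesgue)"
    using m\<Omega> by (simp add: integral_restrict_space)
  also have "\<dots> = (\<integral>x. \<psi> x \<partial>lborel)"
    using test_borel[OF assms] by (intro integral_completion) simp
  finally show ?thesis .
qed

text \<open>The derivative of the product of two test functions integrates to zero, and the product
  rule splits it into the two integrals that define a weak gradient.\<close>

lemma test_H1:
  assumes \<phi>: "\<phi> \<in> test_functions \<Omega>"
  shows "\<phi> \<in> H1 \<Omega>" "hc \<phi> = (cls \<Omega> \<phi>, cls \<Omega> (cgrad \<phi>))"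
proof -
  have "is_weak_gradient \<Omega> \<phi> (cgrad \<phi>)"
    unfolding is_weak_gradient_def
  proof (intro ballI)
    fix \<psi> and i :: 'a assume \<psi>: "\<psi> \<in> test_functions \<Omega>" and i: "i \<in> Basis"
    let ?D = "\<lambda>\<phi> x. frechet_derivative \<phi> (at x) i"
    have cg: "cgrad \<phi> x \<bullet> i = ?D \<phi> x" for x
      using i by (simp add: cgrad_def inner_sum_left inner_Basis if_distrib cong: if_cong)
    have t: "(\<lambda>x. \<phi> x * ?D \<psi> x) \<in> test_functions \<Omega>" "(\<lambda>x. ?D \<phi> x * \<psi> x) \<in> test_functions \<Omega>"
      using test_mult_smooth[OF test_derivative[OF \<psi> i] test_smooth[OF \<phi>]]
        test_mult_smooth[OF \<psi> test_smooth[OF test_derivative[OF \<phi> i]]] by simp_all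
    have prod: "?D (\<lambda>x. \<phi> x * \<psi> x) x = \<phi> x * ?D \<psi> x + ?D \<phi> x * \<psi> x" for x
    proof -
      have "((\<lambda>x. \<phi> x * \<psi> x) has_derivative
        (\<lambda>h. \<phi> x * frechet_derivative \<psi> (at x) h + frechet_derivative \<phi> (at x) h * \<psi> x)) (at x)"
        using smooth_differentiable[OF test_smooth] \<phi> \<psi>
        by (intro has_derivative_mult) (auto simp: frechet_derivative_works)
      from frechet_derivative_at[OF this] show ?thesis by metis
    qed
    have "(\<integral>x. ?D (\<lambda>x. \<phi> x * \<psi> x) x \<partial>lborel) = 0"
      by (rule integral_test_derivative_0[OF test_mult_smooth[OF \<psi> test_smooth[OF \<phi>]] i])
    then have "(\<integral>x. \<phi> x * ?D \<psi> x \<partial>lborel) + (\<integral>x. ?D \<phi> x * \<psi> x \<partial>lborel) = 0"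
      unfolding prod using t by (simp add: test_lborel_integrable)
    then show "(\<integral>x. \<phi> x * ?D \<psi> x \<partial>lebesgue_on \<Omega>) = - (\<integral>x. (cgrad \<phi> x \<bullet> i) * \<psi> x \<partial>lebesgue_on \<Omega>)"
      unfolding cg using integral_\<Omega>_lborel[OF t(1)] integral_\<Omega>_lborel[OF t(2)] by simp
  qed
  then have "(cls \<Omega> \<phi>, cls \<Omega> (cgrad \<phi>)) \<in> wgraph \<Omega>"
    using is_weak_gradient_iff test_L2[OF \<Omega>(1) \<phi>] cgrad_L2[OF \<phi>] by blast
  then show "\<phi> \<in> H1 \<Omega>" "hc \<phi> = (cls \<Omega> \<phi>, cls \<Omega> (cgrad \<phi>))"
    using hc_eqI[OF test_L2[OF \<Omega>(1) \<phi>] cgrad_L2[OF \<phi>]] by auto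
qed

definition HS :: "(('a, real) l2 \<times> ('a, 'a) l2) set" where "HS = hc ` H10 \<Omega>"

text \<open>The substantial inclusion needs a function behind a limit of pairs. Both components of
  the limit come from functions on \<Omega> by \<open>cls_limit\<close>, and closedness of
  \<open>wgraph\<close> makes the second a weak gradient of the first.\<close>

lemma HS_eq: "HS = closure (hc ` test_functions \<Omega>)"
proof
  show "HS \<subseteq> closure (hc ` test_functions \<Omega>)"
  proof
    fix z assume "z \<in> HS"
    then obtain u \<phi> where u: "z = hc u" "u \<in> H1 \<Omega>" "\<And>k. \<phi> k \<in> test_functions \<Omega>"
      and lim: "(\<lambda>k. H1_norm \<Omega> (u - \<phi> k)) \<longlonglongrightarrow> 0"
      by (auto simp: HS_def H10_def)
    have "norm (hc (\<phi> k) - z) \<le> H1_norm \<Omega> (u - \<phi> k)" for k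
      using u norm_hc[OF hc_diff(1)[OF u(2) test_H1(1)[OF u(3)]]] hc_diff(2)[OF u(2) test_H1(1)[OF u(3)]]
      by (simp add: norm_minus_commute)
    from LIMSEQ_norm_diff_bound[OF this lim] u(3) show "z \<in> closure (hc ` test_functions \<Omega>)"
      unfolding closure_sequential by (intro exI[of _ "\<lambda>k. hc (\<phi> k)"]) auto
  qed
  show "closure (hc ` test_functions \<Omega>) \<subseteq> HS"
  proof
    fix z assume "z \<in> closure (hc ` test_functions \<Omega>)"
    then obtain X where X: "\<And>k. X k \<in> hc ` test_functions \<Omega>" "X \<longlonglongrightarrow> z"
      unfolding closure_sequential by blast
    from X(1) have "\<forall>k. \<exists>\<phi>. \<phi> \<in> test_functions \<Omega> \<and> X k = hc \<phi>" by (simp add: image_iff Bex_def)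
    then obtain \<phi> where "\<forall>k. \<phi> k \<in> test_functions \<Omega> \<and> X k = hc (\<phi> k)"
      unfolding choice_iff by blast
    then have \<phi>: "\<And>k. \<phi> k \<in> test_functions \<Omega>" "\<And>k. X k = hc (\<phi> k)" by auto
    have L: "\<phi> k \<in> L2 \<Omega>" "cgrad (\<phi> k) \<in> L2 \<Omega>" for k using \<phi> test_L2[OF \<Omega>(1)] cgrad_L2 by auto
    have f: "(\<lambda>k. cls \<Omega> (\<phi> k)) \<longlonglongrightarrow> fst z" "(\<lambda>k. cls \<Omega> (cgrad (\<phi> k))) \<longlonglongrightarrow> snd z"
      using tendsto_fst[OF X(2)] tendsto_snd[OF X(2)] test_H1(2)[OF \<phi>(1)] by (simp_all add: \<phi>(2))
    obtain u where u: "u \<in> L2 \<Omega>" "fst z = cls \<Omega> u" using cls_limit[OF m\<Omega> L(1) f(1)] by blast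
    obtain g where g: "g \<in> L2 \<Omega>" "snd z = cls \<Omega> g" using cls_limit[OF m\<Omega> L(2) f(2)] by blast
    have "z \<in> wgraph \<Omega>"
      using closed_sequentially[OF wgraph_closed _ X(2)] hc_wgraph[OF test_H1(1)[OF \<phi>(1)]] \<phi>(2) by simp
    then have uH: "u \<in> H1 \<Omega>" "hc u = z"
      using hc_eqI[OF u(1) g(1)] u(2) g(2) by (metis prod.collapse)+
    have "H1_norm \<Omega> (u - \<phi> k) = norm (X k - z)" for k
      using norm_hc[OF hc_diff(1)[OF uH(1) test_H1(1)[OF \<phi>(1)]]] hc_diff(2)[OF uH(1) test_H1(1)[OF \<phi>(1)]] uH \<phi>
      by (simp add: norm_minus_commute)
    moreover have "(\<lambda>k. norm (X k - z)) \<longlonglongrightarrow> 0"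
      using X(2) by (simp add: LIM_zero tendsto_norm_zero)
    ultimately have "u \<in> H10 \<Omega>" using uH \<phi>(1) by (auto simp: H10_def intro!: exI[of _ \<phi>])
    then show "z \<in> HS" using uH by (auto simp: HS_def)
  qed
qed

lemma HS_closed: "closed HS" by (simp add: HS_eq)

lemma test_lincomb:
  assumes "\<phi> \<in> test_functions \<Omega>" "\<psi> \<in> test_functions \<Omega>"
  shows "(\<lambda>x. a * \<phi> x + b * \<psi> x) \<in> test_functions \<Omega>"
  using test_add[OF test_mult_smooth[OF assms(1) smooth_const, of a] test_mult_smooth[OF assms(2) smooth_const, of b]] .

lemma HS_lincomb:
  assumes "y \<in> HS" "z \<in> HS" shows "a *\<^sub>R y + b *\<^sub>R z \<in> HS"
proof -
  obtain Y where Y: "\<And>k. Y k \<in> hc ` test_functions \<Omega>" "Y \<longlonglongrightarrow> y"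
    using assms(1) unfolding HS_eq closure_sequential by blast
  obtain Z where Z: "\<And>k. Z k \<in> hc ` test_functions \<Omega>" "Z \<longlonglongrightarrow> z"
    using assms(2) unfolding HS_eq closure_sequential by blast
  have "a *\<^sub>R Y k + b *\<^sub>R Z k \<in> hc ` test_functions \<Omega>" for k
  proof -
    obtain \<phi> \<psi> where "\<phi> \<in> test_functions \<Omega>" "Y k = hc \<phi>" "\<psi> \<in> test_functions \<Omega>" "Z k = hc \<psi>"
      using Y(1)[of k] Z(1)[of k] by auto
    then show ?thesis
      using hc_lincomb(2)[OF test_H1(1) test_H1(1), of \<phi> \<psi> a b] test_lincomb[of \<phi> \<psi> a b]
      by (intro image_eqI[of _ hc "\<lambda>x. a * \<phi> x + b * \<psi> x"]) simp_all
  qed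
  moreover have "(\<lambda>k. a *\<^sub>R Y k + b *\<^sub>R Z k) \<longlonglongrightarrow> a *\<^sub>R y + b *\<^sub>R z"
    by (intro tendsto_intros Y Z)
  ultimately show ?thesis
    unfolding HS_eq closure_sequential by (intro exI[of _ "\<lambda>k. a *\<^sub>R Y k + b *\<^sub>R Z k"]) auto
qed

lemma HS_subspace: "subspace HS"
proof (rule subspaceI)
  have "(\<lambda>x. 0) \<in> test_functions \<Omega>"
    by (rule test_functionsI[of _ "{}"]) auto
  then have "hc (\<lambda>x. 0) \<in> HS" unfolding HS_eq by (intro closure_subset[THEN subsetD] imageI)
  then show "0 \<in> HS" using HS_lincomb[of "hc (\<lambda>x. 0)" "hc (\<lambda>x. 0)" 0 0] by simp
  show "x + y \<in> HS" if "x \<in> HS" "y \<in> HS" for x y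
    using HS_lincomb[OF that, of 1 1] by simp
  show "c *\<^sub>R x \<in> HS" if "x \<in> HS" for c x
    using HS_lincomb[OF that that, of c 0] by simp
qed

text \<open>Uniqueness of the weak gradient. The subspace can thus be regarded as a part of L2 with
  a stronger norm, and cluster points in it can be told apart by their first components
  alone.\<close>

lemma HS_fst_inj:
  assumes "y \<in> HS" "z \<in> HS" "fst y = fst z" shows "y = z"
proof -
  from assms obtain u v where "u \<in> H10 \<Omega>" "v \<in> H10 \<Omega>" and yz: "y = hc u" "z = hc v"
    by (auto simp: HS_def)
  with yz have uv: "u \<in> H1 \<Omega>" "v \<in> H1 \<Omega>" "y = hc u" "z = hc v" by (auto simp: H10_H1)
  have "hc v = (cls \<Omega> v, cls \<Omega> (grad \<Omega> u))"
    using hc_eqI(2)[OF H1_L2[OF uv(2)] grad_props(1)[OF uv(1)]] hc_wgraph[OF uv(1)] assms(3)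
    by (simp add: uv hc_def)
  then show ?thesis using assms(3) by (simp add: uv hc_def)
qed

text \<open>The combination shares its image under \<open>hc\<close> with some member z of
  \<open>H10\<close>, and the test functions approximating z approximate the combination equally
  well.\<close>

lemma H10_lincomb:
  assumes "u \<in> H10 \<Omega>" "v \<in> H10 \<Omega>" shows "(\<lambda>x. a * u x + b * v x) \<in> H10 \<Omega>"
proof -
  have h: "hc (\<lambda>x. a * u x + b * v x) \<in> HS"
    using hc_lincomb(2)[OF H10_H1 H10_H1, OF assms] HS_lincomb assms by (auto simp: HS_def)
  then obtain z where z: "z \<in> H10 \<Omega>" "hc (\<lambda>x. a * u x + b * v x) = hc z" by (auto simp: HS_def)
  let ?f = "\<lambda>x. a * u x + b * v x"
  have f: "?f \<in> H1 \<Omega>" using hc_lincomb(1)[OF H10_H1 H10_H1, OF assms] .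
  obtain \<phi> where \<phi>: "\<And>k. \<phi> k \<in> test_functions \<Omega>" "(\<lambda>k. H1_norm \<Omega> (z - \<phi> k)) \<longlonglongrightarrow> 0"
    using z(1) by (auto simp: H10_def)
  have "H1_norm \<Omega> (?f - \<phi> k) = H1_norm \<Omega> (z - \<phi> k)" for k
    using hc_diff[OF f test_H1(1)[OF \<phi>(1)]] hc_diff[OF H10_H1[OF z(1)] test_H1(1)[OF \<phi>(1)]] norm_hc z(2)
    by metis
  then show ?thesis using f \<phi> by (auto simp: H10_def intro!: exI[of _ \<phi>])
qed

lemma test_H10: "\<phi> \<in> test_functions \<Omega> \<Longrightarrow> \<phi> \<in> H10 \<Omega>"
proof -
  assume \<phi>: "\<phi> \<in> test_functions \<Omega>"
  have "H1_norm \<Omega> (\<phi> - \<phi>) = 0"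
    using norm_hc[OF hc_diff(1)[OF test_H1(1)[OF \<phi>] test_H1(1)[OF \<phi>]]] hc_diff(2)[OF test_H1(1)[OF \<phi>] test_H1(1)[OF \<phi>]]
    by simp
  then show ?thesis using test_H1(1)[OF \<phi>] \<phi> by (auto simp: H10_def intro!: exI[of _ "\<lambda>k. \<phi>"])
qed

lemma HS_dense:
  assumes "f \<in> L2 \<Omega>" "\<And>z. z \<in> HS \<Longrightarrow> cls \<Omega> f \<bullet> fst z = 0"
  shows "cls \<Omega> f = 0"
proof (rule l2_test_orthogonal_zero[OF \<Omega> assms(1)])
  fix \<phi> and i :: real assume \<phi>: "\<phi> \<in> test_functions \<Omega>" and "i \<in> Basis"
  have "cls \<Omega> f \<bullet> fst (hc \<phi>) = 0" using test_H10[OF \<phi>] by (intro assms(2)) (auto simp: HS_def)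
  then show "cls \<Omega> f \<bullet> cls \<Omega> (\<lambda>x. \<phi> x *\<^sub>R i) = 0"
    using \<open>i \<in> Basis\<close> by (simp add: hc_def)
qed

end


section \<open>Translation estimate for test functions\<close>

lemma continuous_on_cgrad:
  assumes "\<phi> \<in> test_functions \<Omega>" shows "continuous_on UNIV (cgrad \<phi>)"
  unfolding cgrad_def[abs_def]
  by (intro continuous_on_sum continuous_on_scaleR continuous_on_const
      smooth_continuous smooth_frechet_derivative test_smooth[OF assms])

lemma cgrad_borel: "\<phi> \<in> test_functions \<Omega> \<Longrightarrow> cgrad \<phi> \<in> borel_measurable borel"
  by (simp add: borel_measurable_continuous_onI continuous_on_cgrad)

lemma frechet_derivative_cgrad:
  assumes "\<phi> differentiable (at x)" shows "frechet_derivative \<phi> (at x) h = cgrad \<phi> x \<bullet> h"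
proof -
  have lin: "linear (frechet_derivative \<phi> (at x))"
    using linear_frechet_derivative[OF assms] .
  have "frechet_derivative \<phi> (at x) h = frechet_derivative \<phi> (at x) (\<Sum>i\<in>Basis. (h \<bullet> i) *\<^sub>R i)"
    by (simp add: euclidean_representation)
  also have "\<dots> = (\<Sum>i\<in>Basis. (h \<bullet> i) * frechet_derivative \<phi> (at x) i)"
    by (simp add: linear_sum[OF lin] linear_cmul[OF lin])
  also have "\<dots> = cgrad \<phi> x \<bullet> h"
    by (simp add: cgrad_def inner_sum_left inner_commute[of h] mult.commute)
  finally show ?thesis .
qed

text \<open>The fundamental theorem along the segment from x to x + h, followed by Cauchy-Schwarz on
  the unit interval. The result is stated with nonnegative integrals so that it can be integrated
  over x and exchanged by Fubini freely.\<close>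

lemma square_increment_le:
  assumes "\<phi> \<in> test_functions \<Omega>"
  shows "ennreal ((\<phi> (x + h) - \<phi> x)\<^sup>2)
    \<le> ennreal ((norm h)\<^sup>2) * (\<integral>\<^sup>+s. indicator {0..1} s * ennreal ((norm (cgrad \<phi> (x + s *\<^sub>R h)))\<^sup>2) \<partial>lborel)"
proof -
  define g where "g = (\<lambda>s::real. cgrad \<phi> (x + s *\<^sub>R h) \<bullet> h)"
  have gc: "continuous_on UNIV g"
    unfolding g_def
    by (intro continuous_intros continuous_on_compose2[OF continuous_on_cgrad[OF assms]]) auto
  then have [measurable]: "g \<in> borel_measurable borel" by (rule borel_measurable_continuous_onI)
  have [measurable]: "cgrad \<phi> \<in> borel_measurable borel" using assms by (rule cgrad_borel)
  have der: "((\<lambda>s. \<phi> (x + s *\<^sub>R h)) has_vector_derivative g s) (at s)" for s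
  proof -
    have dif: "\<phi> differentiable (at y)" for y using smooth_differentiable[OF test_smooth[OF assms]] .
    then have d: "(\<phi> has_derivative frechet_derivative \<phi> (at (x + s *\<^sub>R h))) (at (x + s *\<^sub>R h))"
      by (simp add: frechet_derivative_works)
    have "((\<lambda>s. \<phi> (x + s *\<^sub>R h)) has_derivative (\<lambda>r. frechet_derivative \<phi> (at (x + s *\<^sub>R h)) (r *\<^sub>R h))) (at s)"
      by (rule has_derivative_compose[of "\<lambda>s. x + s *\<^sub>R h" "\<lambda>r. r *\<^sub>R h" s UNIV \<phi>, OF _ d])
         (auto intro!: derivative_eq_intros)
    then show ?thesis
      by (simp add: has_vector_derivative_def frechet_derivative_cgrad[OF dif] g_def)
  qed
  have int: "integrable lborel (\<lambda>s. indicator {0..1} s *\<^sub>R g s)"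
    by (rule borel_integrable_compact) (auto intro: continuous_on_subset[OF gc])
  have "\<phi> (x + 1 *\<^sub>R h) - \<phi> (x + 0 *\<^sub>R h) = (\<integral>s. indicator {0..1} s *\<^sub>R g s \<partial>lborel)"
    by (rule integral_FTC_Icc[symmetric])
       (auto intro: der[THEN has_vector_derivative_at_within] continuous_on_subset[OF gc])
  then have "\<bar>\<phi> (x + h) - \<phi> x\<bar> \<le> (\<integral>s. \<bar>indicator {0..1} s *\<^sub>R g s\<bar> \<partial>lborel)"
    using integral_abs_bound[of lborel "\<lambda>s. indicator {0..1} s *\<^sub>R g s"] by simp
  then have "ennreal \<bar>\<phi> (x + h) - \<phi> x\<bar> \<le> (\<integral>\<^sup>+s. ennreal \<bar>indicator {0..1} s *\<^sub>R g s\<bar> \<partial>lborel)"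
    using int by (subst nn_integral_eq_integral) (auto intro: ennreal_leI)
  \<comment> \<open>The indicator is duplicated so that Cauchy-Schwarz pairs the integrand with a
    function whose square has integral 1.\<close>
  also have "\<dots> = (\<integral>\<^sup>+s. (indicator {0..1} s * ennreal \<bar>g s\<bar>) * indicator {0..1} s \<partial>lborel)"
    by (intro nn_integral_cong) (auto simp: indicator_def)
  finally have "(ennreal \<bar>\<phi> (x + h) - \<phi> x\<bar>)\<^sup>2
      \<le> (\<integral>\<^sup>+s. (indicator {0..1} s * ennreal \<bar>g s\<bar>) * indicator {0..1} s \<partial>lborel)\<^sup>2"
    by (rule power_mono) simp
  also have "\<dots> \<le> (\<integral>\<^sup>+s. (indicator {0..1} s * ennreal \<bar>g s\<bar>)\<^sup>2 \<partial>lborel)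
      * (\<integral>\<^sup>+s. (indicator {0..1::real} s)\<^sup>2 \<partial>lborel)"
    by (rule Cauchy_Schwarz_nn_integral) measurable
  also have "(\<integral>\<^sup>+s. (indicator {0..1::real} s :: ennreal)\<^sup>2 \<partial>lborel) = (\<integral>\<^sup>+s. indicator {0..1::real} s \<partial>lborel)"
    by (intro nn_integral_cong) (auto simp: indicator_def)
  also have "\<dots> = 1" by simp
  also have "(\<integral>\<^sup>+s. (indicator {0..1} s * ennreal \<bar>g s\<bar>)\<^sup>2 \<partial>lborel) * 1
      \<le> (\<integral>\<^sup>+s. ennreal ((norm h)\<^sup>2) * (indicator {0..1} s * ennreal ((norm (cgrad \<phi> (x + s *\<^sub>R h)))\<^sup>2)) \<partial>lborel)"
  proof (unfold mult_1_right, rule nn_integral_mono)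
    fix s :: real
    have "\<bar>g s\<bar>\<^sup>2 \<le> (norm (cgrad \<phi> (x + s *\<^sub>R h)) * norm h)\<^sup>2"
      unfolding g_def by (intro power_mono Cauchy_Schwarz_ineq2) auto
    then have "ennreal (\<bar>g s\<bar>\<^sup>2) \<le> ennreal ((norm h)\<^sup>2) * ennreal ((norm (cgrad \<phi> (x + s *\<^sub>R h)))\<^sup>2)"
      by (subst ennreal_mult[symmetric]) (auto intro!: ennreal_leI simp: power_mult_distrib mult.commute)
    then show "(indicator {0..1} s * ennreal \<bar>g s\<bar>)\<^sup>2
        \<le> ennreal ((norm h)\<^sup>2) * (indicator {0..1} s * ennreal ((norm (cgrad \<phi> (x + s *\<^sub>R h)))\<^sup>2))"
      by (auto simp: indicator_def ennreal_power)
  qed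
  also have "\<dots> = ennreal ((norm h)\<^sup>2) * (\<integral>\<^sup>+s. indicator {0..1} s * ennreal ((norm (cgrad \<phi> (x + s *\<^sub>R h)))\<^sup>2) \<partial>lborel)"
    by (intro nn_integral_cmult) measurable
  finally show ?thesis by (simp add: ennreal_power)
qed

lemma nn_integral_lborel_translate:
  fixes a :: "'a::euclidean_space"
  assumes [measurable]: "f \<in> borel_measurable borel"
  shows "(\<integral>\<^sup>+x. f (a + x) \<partial>lborel) = (\<integral>\<^sup>+x. f x \<partial>lborel)"
  by (subst (2) lborel_distr_plus[of a, symmetric], subst nn_integral_distr) auto

text \<open>After exchanging the integrals, all translates of the squared gradient have the same
  integral, so the segment parameter contributes only the length 1 of its interval.\<close>

lemma translation_estimate:
  assumes "\<phi> \<in> test_functions \<Omega>"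
  shows "(\<integral>\<^sup>+x. ennreal ((\<phi> (x + h) - \<phi> x)\<^sup>2) \<partial>lborel)
    \<le> ennreal ((norm h)\<^sup>2) * (\<integral>\<^sup>+x. ennreal ((norm (cgrad \<phi> x))\<^sup>2) \<partial>lborel)"
proof -
  have [measurable]: "cgrad \<phi> \<in> borel_measurable borel" using assms by (rule cgrad_borel)
  let ?G = "\<lambda>x. ennreal ((norm (cgrad \<phi> x))\<^sup>2)"
  have "(\<integral>\<^sup>+x. ennreal ((\<phi> (x + h) - \<phi> x)\<^sup>2) \<partial>lborel)
      \<le> (\<integral>\<^sup>+x. ennreal ((norm h)\<^sup>2) * (\<integral>\<^sup>+s. indicator {0..1} s * ?G (x + s *\<^sub>R h) \<partial>lborel) \<partial>lborel)"
    by (intro nn_integral_mono square_increment_le[OF assms])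
  also have "\<dots> = ennreal ((norm h)\<^sup>2) * (\<integral>\<^sup>+x. (\<integral>\<^sup>+s. indicator {0..1} s * ?G (x + s *\<^sub>R h) \<partial>lborel) \<partial>lborel)"
    by (intro nn_integral_cmult) measurable
  also have "(\<integral>\<^sup>+x. (\<integral>\<^sup>+s. indicator {0..1} s * ?G (x + s *\<^sub>R h) \<partial>lborel) \<partial>lborel)
      = (\<integral>\<^sup>+s. (\<integral>\<^sup>+x. indicator {0..1} s * ?G (x + s *\<^sub>R h) \<partial>lborel) \<partial>lborel)"
    by (rule lborel_pair.Fubini') measurable
  also have "\<dots> = (\<integral>\<^sup>+s. indicator {0..1::real} s * (\<integral>\<^sup>+x. ?G x \<partial>lborel) \<partial>lborel)"
  proof (rule nn_integral_cong)
    fix s :: real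
    have "(\<integral>\<^sup>+x. ?G (x + s *\<^sub>R h) \<partial>lborel) = (\<integral>\<^sup>+x. ?G x \<partial>lborel)"
      using nn_integral_lborel_translate[of ?G "s *\<^sub>R h"] by (simp add: add.commute)
    then show "(\<integral>\<^sup>+x. indicator {0..1} s * ?G (x + s *\<^sub>R h) \<partial>lborel)
        = indicator {0..1} s * (\<integral>\<^sup>+x. ?G x \<partial>lborel)"
      by (subst nn_integral_cmult) measurable
  qed
  also have "\<dots> = (\<integral>\<^sup>+x. ?G x \<partial>lborel)" by (subst nn_integral_multc) auto
  finally show ?thesis .
qed

subsection \<open>Averages over dyadic cubes\<close>

text \<open>The half-open dyadic cube of side 2^-k that contains x. Coding it by integer parts makes
  lying in the same cube an equivalence relation, and makes nesting of levels an integer division by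
  2.\<close>

definition cube :: "nat \<Rightarrow> 'a::euclidean_space \<Rightarrow> 'a set" where
  "cube k x = {y. \<forall>i\<in>Basis. \<lfloor>2 ^ k * (y \<bullet> i)\<rfloor> = \<lfloor>2 ^ k * (x \<bullet> i)\<rfloor>}"

definition cube_avg :: "nat \<Rightarrow> ('a::euclidean_space \<Rightarrow> real) \<Rightarrow> 'a \<Rightarrow> real" where
  "cube_avg k \<phi> x = 2 ^ (k * DIM('a)) * (\<integral>y. indicator (cube k x) y * \<phi> y \<partial>lborel)"

lemma cube_eq: "y \<in> cube k x \<Longrightarrow> cube k y = cube k x" by (simp add: cube_def)

lemma cube_mono: "cube (Suc k) x \<subseteq> cube k x"
proof
  fix y assume y: "y \<in> cube (Suc k) x"
  have half: "\<lfloor>2 ^ k * t\<rfloor> = \<lfloor>2 ^ Suc k * t\<rfloor> div 2" for t :: real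
    using floor_divide_real_eq_div[of 2 "2 ^ Suc k * t"] by simp
  show "y \<in> cube k x" using y unfolding cube_def half by simp
qed

lemma cube_coordinate_diff:
  assumes "y \<in> cube k x" "i \<in> Basis" shows "\<bar>(y - x) \<bullet> i\<bar> \<le> (1/2) ^ k"
proof -
  have "\<lfloor>2 ^ k * (y \<bullet> i)\<rfloor> = \<lfloor>2 ^ k * (x \<bullet> i)\<rfloor>" using assms by (simp add: cube_def)
  then have "\<bar>2 ^ k * (y \<bullet> i) - 2 ^ k * (x \<bullet> i)\<bar> \<le> 1" by linarith
  then have "2 ^ k * \<bar>(y - x) \<bullet> i\<bar> \<le> 1"
    by (simp add: inner_diff_left abs_mult flip: right_diff_distrib)
  then show ?thesis by (simp add: field_simps)
qed

text \<open>Joint measurability in both points makes the cube average a measurable function of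
  x.\<close>

lemma cube_rel_measurable [measurable]:
  "{z. fst z \<in> cube k (snd z :: 'a::euclidean_space)} \<in> sets (borel \<Otimes>\<^sub>M borel)"
proof -
  have "{z \<in> space (borel \<Otimes>\<^sub>M borel). \<forall>i\<in>Basis. \<lfloor>2 ^ k * (fst z \<bullet> i)\<rfloor> = \<lfloor>2 ^ k * (snd z \<bullet> (i::'a))\<rfloor>}
      \<in> sets (borel \<Otimes>\<^sub>M borel)" (is "?A \<in> _")
  proof (rule sets.sets_Collect_finite_All)
    fix i :: 'a assume "i \<in> Basis"
    have "{z \<in> space (borel \<Otimes>\<^sub>M borel). real_of_int \<lfloor>2 ^ k * (fst z \<bullet> i)\<rfloor> = real_of_int \<lfloor>2 ^ k * (snd z \<bullet> i)\<rfloor>}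
      \<in> sets (borel \<Otimes>\<^sub>M borel)" by measurable
    then show "{z \<in> space (borel \<Otimes>\<^sub>M borel). \<lfloor>2 ^ k * (fst z \<bullet> i)\<rfloor> = \<lfloor>2 ^ k * (snd z \<bullet> i)\<rfloor>}
      \<in> sets (borel \<Otimes>\<^sub>M borel)" by simp
  qed simp
  moreover have "?A = {z. fst z \<in> cube k (snd z :: 'a)}" by (auto simp: cube_def space_pair_measure)
  ultimately show ?thesis by simp
qed

lemma cube_pred_measurable [measurable (raw)]:
  assumes [measurable]: "f \<in> borel_measurable M" "g \<in> borel_measurable M"
  shows "Measurable.pred M (\<lambda>x. f x \<in> cube k (g x))"
proof -
  have "(\<lambda>x. (f x, g x)) \<in> M \<rightarrow>\<^sub>M borel \<Otimes>\<^sub>M borel" by measurable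
  from measurable_sets[OF this cube_rel_measurable[of k]]
  show ?thesis by (simp add: vimage_def Int_def pred_def conj_commute)
qed

lemma cube_borel [measurable]: "cube k x \<in> sets borel"
  using cube_pred_measurable[of "\<lambda>y. y" borel "\<lambda>_. x" k] by (simp add: pred_def)

text \<open>The half-open cube is squeezed between the open and the closed box with the same
  corners, which have equal volume.\<close>

lemma emeasure_cube: "emeasure lborel (cube k (x :: 'a::euclidean_space)) = ennreal ((1/2) ^ (k * DIM('a)))"
proof -
  define l where "l = (\<Sum>i\<in>Basis. (real_of_int \<lfloor>2 ^ k * (x \<bullet> i)\<rfloor> / 2 ^ k) *\<^sub>R i)"
  define u where "u = (\<Sum>i\<in>Basis. ((real_of_int \<lfloor>2 ^ k * (x \<bullet> i)\<rfloor> + 1) / 2 ^ k) *\<^sub>R i)"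
  have l: "l \<bullet> i = real_of_int \<lfloor>2 ^ k * (x \<bullet> i)\<rfloor> / 2 ^ k"
    and u: "u \<bullet> i = (real_of_int \<lfloor>2 ^ k * (x \<bullet> i)\<rfloor> + 1) / 2 ^ k" if "i \<in> Basis" for i
    using that by (simp_all add: l_def u_def)
  have 1: "box l u \<subseteq> cube k x"
  proof
    fix y assume y: "y \<in> box l u"
    show "y \<in> cube k x" unfolding cube_def
    proof (intro CollectI ballI floor_unique)
      fix i :: 'a assume i: "i \<in> Basis"
      then have "l \<bullet> i < y \<bullet> i" "y \<bullet> i < u \<bullet> i" using y by (auto simp: mem_box)
      then show "real_of_int \<lfloor>2 ^ k * (x \<bullet> i)\<rfloor> \<le> 2 ^ k * (y \<bullet> i)"
        "2 ^ k * (y \<bullet> i) < real_of_int \<lfloor>2 ^ k * (x \<bullet> i)\<rfloor> + 1"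
        using i by (simp_all add: l u field_simps)
    qed
  qed
  have 2: "cube k x \<subseteq> cbox l u"
  proof
    fix y assume y: "y \<in> cube k x"
    show "y \<in> cbox l u" unfolding mem_box
    proof (intro ballI conjI)
      fix i :: 'a assume i: "i \<in> Basis"
      then have e: "\<lfloor>2 ^ k * (x \<bullet> i)\<rfloor> = \<lfloor>2 ^ k * (y \<bullet> i)\<rfloor>" using y by (simp add: cube_def)
      have "real_of_int \<lfloor>2 ^ k * (y \<bullet> i)\<rfloor> \<le> 2 ^ k * (y \<bullet> i)" "2 ^ k * (y \<bullet> i) \<le> real_of_int \<lfloor>2 ^ k * (y \<bullet> i)\<rfloor> + 1"
        by linarith+
      then show "l \<bullet> i \<le> y \<bullet> i" "y \<bullet> i \<le> u \<bullet> i"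
        unfolding l[OF i] u[OF i] e by (simp_all add: field_simps)
    qed
  qed
  have w: "(u - l) \<bullet> i = (1/2) ^ k" "l \<bullet> i \<le> u \<bullet> i" if "i \<in> Basis" for i
    using that by (simp_all add: l u inner_diff_left field_simps)
  have v: "(\<Prod>i\<in>Basis. (u - l) \<bullet> i) = (1/2) ^ (k * DIM('a))"
    using w by (simp add: power_mult)
  have "emeasure lborel (box l u) = ennreal ((1/2) ^ (k * DIM('a)))"
    "emeasure lborel (cbox l u) = ennreal ((1/2) ^ (k * DIM('a)))"
    using emeasure_lborel_box[of l u] emeasure_lborel_cbox[of l u] w v by auto
  then show ?thesis
    using emeasure_mono[OF 1, of lborel] emeasure_mono[OF 2, of lborel] by (simp add: antisym)
qed

lemma integrable_cube_test:
  assumes "\<phi> \<in> test_functions \<Omega>" shows "integrable lborel (\<lambda>y. indicator (cube k x) y * \<phi> y)"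
  using integrable_mult_indicator[OF _ test_lborel_integrable[OF assms], of "cube k x"] by simp

lemma integrable_indicator_cube: "integrable lborel (indicator (cube k x) :: 'a::euclidean_space \<Rightarrow> real)"
  by (rule integrable_real_indicator) (simp_all add: emeasure_cube)

lemma cube_avg_cong: "y \<in> cube k x \<Longrightarrow> cube_avg k \<phi> y = cube_avg k \<phi> x"
  by (simp add: cube_avg_def cube_eq)

lemma cube_avg_measurable:
  assumes "\<phi> \<in> test_functions \<Omega>" shows "cube_avg k \<phi> \<in> borel_measurable borel"
proof -
  have [measurable]: "\<phi> \<in> borel_measurable borel" using assms by (rule test_borel)
  have "(\<lambda>x. \<integral>y. indicator (cube k x) y * \<phi> y \<partial>lborel) \<in> borel_measurable borel"
    by (rule lborel.borel_measurable_lebesgue_integral) (unfold indicator_def, measurable)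
  then show ?thesis unfolding cube_avg_def[abs_def] by measurable
qed

lemma cube_avg_diff_le:
  fixes x :: "'a::euclidean_space"
  assumes "\<phi> \<in> test_functions \<Omega>"
  shows "ennreal \<bar>c - cube_avg k \<phi> x\<bar>
    \<le> ennreal (2 ^ (k * DIM('a))) * (\<integral>\<^sup>+y. indicator (cube k x) y * ennreal \<bar>c - \<phi> y\<bar> \<partial>lborel)"
proof -
  have [measurable]: "\<phi> \<in> borel_measurable borel" using assms by (rule test_borel)
  have m: "measure lborel (cube k x) = (1/2) ^ (k * DIM('a))"
    by (simp add: measure_def emeasure_cube)
  have i1: "integrable lborel (\<lambda>y. indicator (cube k x) y * (c - \<phi> y))"
    using integrable_cube_test[OF assms, of k x] integrable_mult_left[OF integrable_indicator_cube[of k x], where c = c]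
    by (simp add: right_diff_distrib)
  have J: "(\<integral>y. indicator (cube k x) y * (c - \<phi> y) \<partial>lborel)
      = (1/2) ^ (k * DIM('a)) * c - (\<integral>y. indicator (cube k x) y * \<phi> y \<partial>lborel)"
    using integrable_cube_test[OF assms, of k x] integrable_mult_left[OF integrable_indicator_cube[of k x], where c = c]
    by (simp add: right_diff_distrib m)
  have "c - cube_avg k \<phi> x = 2 ^ (k * DIM('a)) * (\<integral>y. indicator (cube k x) y * (c - \<phi> y) \<partial>lborel)"
    unfolding cube_avg_def J by (simp add: algebra_simps power_one_over)
  then have "\<bar>c - cube_avg k \<phi> x\<bar> \<le> 2 ^ (k * DIM('a)) * (\<integral>y. \<bar>indicator (cube k x) y * (c - \<phi> y)\<bar> \<partial>lborel)"
    using integral_abs_bound[of lborel "\<lambda>y. indicator (cube k x) y * (c - \<phi> y)"]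
    by (simp add: abs_mult)
  then have "ennreal \<bar>c - cube_avg k \<phi> x\<bar>
      \<le> ennreal (2 ^ (k * DIM('a))) * ennreal (\<integral>y. \<bar>indicator (cube k x) y * (c - \<phi> y)\<bar> \<partial>lborel)"
    by (subst ennreal_mult[symmetric]) (auto intro: ennreal_leI)
  also have "ennreal (\<integral>y. \<bar>indicator (cube k x) y * (c - \<phi> y)\<bar> \<partial>lborel)
      = (\<integral>\<^sup>+y. ennreal \<bar>indicator (cube k x) y * (c - \<phi> y)\<bar> \<partial>lborel)"
    using i1 by (intro nn_integral_eq_integral[symmetric]) auto
  also have "\<dots> = (\<integral>\<^sup>+y. indicator (cube k x) y * ennreal \<bar>c - \<phi> y\<bar> \<partial>lborel)"
    by (intro nn_integral_cong) (auto simp: indicator_def)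
  finally show ?thesis .
qed

text \<open>Jensen's inequality for the normalised measure of a cube. Cauchy-Schwarz produces the
  square of the normalising factor, one copy of which is cancelled by the volume of the
  cube.\<close>

lemma cube_avg_diff_square_le:
  fixes x :: "'a::euclidean_space"
  assumes "\<phi> \<in> test_functions \<Omega>"
  shows "ennreal ((c - cube_avg k \<phi> x)\<^sup>2)
    \<le> ennreal (2 ^ (k * DIM('a))) * (\<integral>\<^sup>+y. indicator (cube k x) y * ennreal ((c - \<phi> y)\<^sup>2) \<partial>lborel)"
proof -
  let ?V = "ennreal (2 ^ (k * DIM('a)))"
  have [measurable]: "\<phi> \<in> borel_measurable borel" using assms by (rule test_borel)
  have "ennreal ((c - cube_avg k \<phi> x)\<^sup>2) = (ennreal \<bar>c - cube_avg k \<phi> x\<bar>)\<^sup>2"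
    by (simp add: ennreal_power)
  also have "\<dots> \<le> (?V * (\<integral>\<^sup>+y. (indicator (cube k x) y * ennreal \<bar>c - \<phi> y\<bar>) * indicator (cube k x) y \<partial>lborel))\<^sup>2"
  proof (rule power_mono)
    have "(\<integral>\<^sup>+y. indicator (cube k x) y * ennreal \<bar>c - \<phi> y\<bar> \<partial>lborel)
      = (\<integral>\<^sup>+y. (indicator (cube k x) y * ennreal \<bar>c - \<phi> y\<bar>) * indicator (cube k x) y \<partial>lborel)"
      by (intro nn_integral_cong) (auto simp: indicator_def)
    with cube_avg_diff_le[OF assms, of c k x]
    show "ennreal \<bar>c - cube_avg k \<phi> x\<bar>
      \<le> ?V * (\<integral>\<^sup>+y. (indicator (cube k x) y * ennreal \<bar>c - \<phi> y\<bar>) * indicator (cube k x) y \<partial>lborel)" by simp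
  qed simp
  also have "\<dots> = ?V\<^sup>2 * (\<integral>\<^sup>+y. (indicator (cube k x) y * ennreal \<bar>c - \<phi> y\<bar>) * indicator (cube k x) y \<partial>lborel)\<^sup>2"
    by (rule power_mult_distrib)
  also have "\<dots> \<le> ?V\<^sup>2 * ((\<integral>\<^sup>+y. (indicator (cube k x) y * ennreal \<bar>c - \<phi> y\<bar>)\<^sup>2 \<partial>lborel)
      * (\<integral>\<^sup>+y. (indicator (cube k x) y)\<^sup>2 \<partial>lborel))"
    by (intro mult_left_mono Cauchy_Schwarz_nn_integral) auto
  also have "(\<integral>\<^sup>+y. (indicator (cube k x) y :: ennreal)\<^sup>2 \<partial>lborel) = (\<integral>\<^sup>+y. indicator (cube k x) y \<partial>lborel)"
    by (intro nn_integral_cong) (auto simp: indicator_def)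
  also have "\<dots> = ennreal ((1/2) ^ (k * DIM('a)))" by (simp add: emeasure_cube)
  also have "(\<integral>\<^sup>+y. (indicator (cube k x) y * ennreal \<bar>c - \<phi> y\<bar>)\<^sup>2 \<partial>lborel)
      = (\<integral>\<^sup>+y. indicator (cube k x) y * ennreal ((c - \<phi> y)\<^sup>2) \<partial>lborel)" (is "_ = ?I")
    by (intro nn_integral_cong) (auto simp: indicator_def ennreal_power)
  also have "?V\<^sup>2 * (?I * ennreal ((1/2) ^ (k * DIM('a)))) = (?V * ennreal ((1/2) ^ (k * DIM('a)))) * (?V * ?I)"
    by (simp add: power2_eq_square mult_ac)
  also have "?V * ennreal ((1/2) ^ (k * DIM('a))) = 1"
    by (subst ennreal_mult[symmetric]) (auto simp flip: power_mult_distrib)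
  finally show ?thesis by simp
qed

text \<open>With n the dimension, 2^n is the volume ratio between the box of increments used in
  \<open>cube_avg_error\<close> and a dyadic cube. The factor n^2 comes from bounding the Euclidean
  norm on that box by the sum of the coordinates.\<close>

definition avg_const :: "'a::euclidean_space itself \<Rightarrow> real" where
  "avg_const _ = 2 ^ DIM('a) * (real DIM('a))\<^sup>2"

text \<open>A Poincare inequality on dyadic cubes, summed over the cubes. The cube around x is
  enlarged to x + C with a box C that does not depend on x, so that Fubini reduces everything to the
  translation estimate for each increment in C.\<close>

lemma cube_avg_error:
  fixes \<phi> :: "'a::euclidean_space \<Rightarrow> real"
  assumes "\<phi> \<in> test_functions \<Omega>"
  shows "(\<integral>\<^sup>+x. ennreal ((\<phi> x - cube_avg k \<phi> x)\<^sup>2) \<partial>lborel)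
    \<le> ennreal (avg_const TYPE('a) * (1/4) ^ k) * (\<integral>\<^sup>+x. ennreal ((norm (cgrad \<phi> x))\<^sup>2) \<partial>lborel)"
proof -
  let ?V = "ennreal (2 ^ (k * DIM('a)))" and ?\<delta> = "(1/2) ^ k :: real"
  let ?G = "\<integral>\<^sup>+x. ennreal ((norm (cgrad \<phi> x))\<^sup>2) \<partial>lborel"
  define C :: "'a set" where "C = cbox (- ?\<delta> *\<^sub>R One) (?\<delta> *\<^sub>R One)"
  have [measurable]: "C \<in> sets borel" by (simp add: C_def)
  have [measurable]: "\<phi> \<in> borel_measurable borel" using assms by (rule test_borel)
  have inC: "y - x \<in> C" if "y \<in> cube k x" for x y
    using cube_coordinate_diff[OF that] by (auto simp: C_def mem_box abs_le_iff minus_le_iff)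
  have normC: "(norm h)\<^sup>2 \<le> (real DIM('a))\<^sup>2 * (1/4) ^ k" if "h \<in> C" for h
  proof -
    have "norm h \<le> (\<Sum>i\<in>Basis. \<bar>h \<bullet> i\<bar>)" by (rule norm_le_l1)
    also have "\<dots> \<le> (\<Sum>i\<in>(Basis::'a set). ?\<delta>)"
      using that by (intro sum_mono) (auto simp: C_def mem_box abs_le_iff dest: bspec)
    finally have "(norm h)\<^sup>2 \<le> (real DIM('a) * ?\<delta>)\<^sup>2" by (intro power_mono) auto
    also have "\<dots> = (real DIM('a))\<^sup>2 * (1/4) ^ k"
      by (simp add: power_mult_distrib power2_eq_square flip: power_mult_distrib)
    finally show ?thesis .
  qed
  have eC: "emeasure lborel C = ennreal (2 ^ DIM('a) * (1/2) ^ (k * DIM('a)))"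
  proof -
    have "emeasure lborel C = ennreal (\<Prod>i\<in>(Basis::'a set). (?\<delta> *\<^sub>R One - (- ?\<delta> *\<^sub>R One)) \<bullet> i)"
      unfolding C_def by (rule emeasure_lborel_cbox) (simp add: order_trans[of _ 0])
    also have "(\<Prod>i\<in>(Basis::'a set). (?\<delta> *\<^sub>R One - (- ?\<delta> *\<^sub>R One)) \<bullet> i) = (\<Prod>i\<in>(Basis::'a set). 2 * ?\<delta>)"
      by (intro prod.cong) (auto simp: inner_diff_left inner_add_left)
    also have "\<dots> = 2 ^ DIM('a) * (1/2) ^ (k * DIM('a))" by (simp add: power_mult power_mult_distrib)
    finally show ?thesis .
  qed
  have "(\<integral>\<^sup>+x. ennreal ((\<phi> x - cube_avg k \<phi> x)\<^sup>2) \<partial>lborel)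
      \<le> (\<integral>\<^sup>+x. ?V * (\<integral>\<^sup>+y. indicator (cube k x) y * ennreal ((\<phi> x - \<phi> y)\<^sup>2) \<partial>lborel) \<partial>lborel)"
    by (intro nn_integral_mono cube_avg_diff_square_le[OF assms])
  also have "\<dots> \<le> (\<integral>\<^sup>+x. ?V * (\<integral>\<^sup>+y. indicator C (y - x) * ennreal ((\<phi> y - \<phi> x)\<^sup>2) \<partial>lborel) \<partial>lborel)"
    using inC by (intro nn_integral_mono mult_left_mono) (auto simp: indicator_def power2_commute)
  also have "\<dots> = (\<integral>\<^sup>+x. ?V * (\<integral>\<^sup>+h. indicator C h * ennreal ((\<phi> (x + h) - \<phi> x)\<^sup>2) \<partial>lborel) \<partial>lborel)"
  proof (rule nn_integral_cong)
    fix x :: 'a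
    show "?V * (\<integral>\<^sup>+y. indicator C (y - x) * ennreal ((\<phi> y - \<phi> x)\<^sup>2) \<partial>lborel)
      = ?V * (\<integral>\<^sup>+h. indicator C h * ennreal ((\<phi> (x + h) - \<phi> x)\<^sup>2) \<partial>lborel)"
      by (subst nn_integral_lborel_translate[of _ x, symmetric]) auto
  qed
  also have "\<dots> = ?V * (\<integral>\<^sup>+x. (\<integral>\<^sup>+h. indicator C h * ennreal ((\<phi> (x + h) - \<phi> x)\<^sup>2) \<partial>lborel) \<partial>lborel)"
    by (intro nn_integral_cmult) measurable
  also have "(\<integral>\<^sup>+x. (\<integral>\<^sup>+h. indicator C h * ennreal ((\<phi> (x + h) - \<phi> x)\<^sup>2) \<partial>lborel) \<partial>lborel)
      = (\<integral>\<^sup>+h. (\<integral>\<^sup>+x. indicator C h * ennreal ((\<phi> (x + h) - \<phi> x)\<^sup>2) \<partial>lborel) \<partial>lborel)"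
    by (rule lborel_pair.Fubini') measurable
  also have "\<dots> \<le> (\<integral>\<^sup>+h. indicator C h * (ennreal ((real DIM('a))\<^sup>2 * (1/4) ^ k) * ?G) \<partial>lborel)"
  proof (rule nn_integral_mono)
    fix h :: 'a
    have "(\<integral>\<^sup>+x. ennreal ((\<phi> (x + h) - \<phi> x)\<^sup>2) \<partial>lborel) \<le> ennreal ((real DIM('a))\<^sup>2 * (1/4) ^ k) * ?G" if "h \<in> C"
      using translation_estimate[OF assms, of h] mult_right_mono[OF ennreal_leI[OF normC[OF that]], of ?G]
      by (meson order_trans zero_le)
    then show "(\<integral>\<^sup>+x. indicator C h * ennreal ((\<phi> (x + h) - \<phi> x)\<^sup>2) \<partial>lborel)
      \<le> indicator C h * (ennreal ((real DIM('a))\<^sup>2 * (1/4) ^ k) * ?G)"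
      by (auto simp: indicator_def)
  qed
  also have "\<dots> = ennreal (2 ^ DIM('a) * (1/2) ^ (k * DIM('a))) * (ennreal ((real DIM('a))\<^sup>2 * (1/4) ^ k) * ?G)"
    by (subst nn_integral_multc) (auto simp: eC)
  also have "?V * \<dots> = ennreal (2 ^ (k * DIM('a)) * (2 ^ DIM('a) * (1/2) ^ (k * DIM('a))) * ((real DIM('a))\<^sup>2 * (1/4) ^ k)) * ?G"
    by (simp add: ennreal_mult mult.assoc)
  also have "2 ^ (k * DIM('a)) * (2 ^ DIM('a) * (1/2) ^ (k * DIM('a))) * ((real DIM('a))\<^sup>2 * (1/4) ^ k)
      = avg_const TYPE('a) * (1/4) ^ k"
    by (simp add: avg_const_def power_one_over)
  finally show ?thesis by (simp add: mult_left_mono)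
qed

text \<open>The value at x is taken on a whole cube of volume 2^(-k n), n the dimension, so the
  integral over that cube alone controls it.\<close>

lemma cube_constant_sup_le:
  fixes D :: "'a::euclidean_space \<Rightarrow> real"
  assumes [measurable]: "D \<in> borel_measurable borel" and "\<And>y. y \<in> cube k x \<Longrightarrow> D y = D x"
  shows "ennreal ((D x)\<^sup>2) \<le> ennreal (2 ^ (k * DIM('a))) * (\<integral>\<^sup>+y. ennreal ((D y)\<^sup>2) \<partial>lborel)"
proof -
  have "ennreal ((D x)\<^sup>2) * ennreal ((1/2) ^ (k * DIM('a))) = (\<integral>\<^sup>+y. ennreal ((D x)\<^sup>2) * indicator (cube k x) y \<partial>lborel)"
    by (subst nn_integral_cmult) (auto simp: emeasure_cube)
  also have "\<dots> \<le> (\<integral>\<^sup>+y. ennreal ((D y)\<^sup>2) \<partial>lborel)"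
    using assms(2) by (intro nn_integral_mono) (auto simp: indicator_def)
  finally have "ennreal (2 ^ (k * DIM('a))) * (ennreal ((D x)\<^sup>2) * ennreal ((1/2) ^ (k * DIM('a))))
      \<le> ennreal (2 ^ (k * DIM('a))) * (\<integral>\<^sup>+y. ennreal ((D y)\<^sup>2) \<partial>lborel)"
    by (intro mult_left_mono) auto
  moreover have "ennreal (2 ^ (k * DIM('a))) * (ennreal ((D x)\<^sup>2) * ennreal ((1/2) ^ (k * DIM('a)))) = ennreal ((D x)\<^sup>2)"
    by (simp add: power_one_over flip: ennreal_mult)
  ultimately show ?thesis by simp
qed


context bounded_open_set
begin

lemma HS_sequence:
  assumes "z \<in> HS"
  shows "\<exists>\<phi>. (\<forall>k::nat. \<phi> k \<in> test_functions \<Omega>) \<and> (\<lambda>k. hc (\<phi> k)) \<longlonglongrightarrow> z"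
proof -
  have "\<exists>X. (\<forall>k. X k \<in> hc ` test_functions \<Omega>) \<and> X \<longlonglongrightarrow> z"
    using assms unfolding HS_eq closure_sequential .
  then obtain X where X: "\<forall>k. \<exists>\<phi>. \<phi> \<in> test_functions \<Omega> \<and> X k = hc \<phi>" "X \<longlonglongrightarrow> z"
    by (auto simp: image_iff Bex_def)
  from X(1) obtain \<phi> where \<phi>: "\<forall>k. \<phi> k \<in> test_functions \<Omega> \<and> X k = hc (\<phi> k)"
    unfolding choice_iff by blast
  then have "X = (\<lambda>k. hc (\<phi> k))" by auto
  then show ?thesis using X(2) \<phi> by (intro exI[of _ \<phi>]) auto
qed

lemma nn_integral_test_square:
  assumes "\<phi> \<in> test_functions \<Omega>"
  shows "(\<integral>\<^sup>+x. ennreal ((\<phi> x)\<^sup>2) \<partial>lborel) = ennreal ((norm (cls \<Omega> \<phi>))\<^sup>2)"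
proof -
  have t: "(\<lambda>x. (\<phi> x)\<^sup>2) \<in> test_functions \<Omega>" by (rule test_square_test[OF assms])
  have "(norm (cls \<Omega> \<phi>))\<^sup>2 = (\<integral>x. (\<phi> x)\<^sup>2 \<partial>lebesgue_on \<Omega>)"
    by (simp add: norm_cls m\<Omega> test_L2 \<Omega> assms L2_norm_def)
  also have "\<dots> = (\<integral>x. (\<phi> x)\<^sup>2 \<partial>lborel)" by (rule integral_\<Omega>_lborel[OF t])
  finally show ?thesis
    using nn_integral_eq_integral[OF test_lborel_integrable[OF t]] by simp
qed

lemma nn_integral_cgrad_square:
  assumes "\<phi> \<in> test_functions \<Omega>"
  shows "(\<integral>\<^sup>+x. ennreal ((norm (cgrad \<phi> x))\<^sup>2) \<partial>lborel) = ennreal ((norm (cls \<Omega> (cgrad \<phi>)))\<^sup>2)"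
proof -
  have eq: "(norm (cgrad \<phi> x))\<^sup>2 = (\<Sum>i\<in>Basis. (frechet_derivative \<phi> (at x) i)\<^sup>2)" for x
  proof -
    have "cgrad \<phi> x \<bullet> i = frechet_derivative \<phi> (at x) i" if "i \<in> Basis" for i
      using that by (simp add: cgrad_def inner_sum_left inner_Basis if_distrib cong: if_cong)
    then have "(\<Sum>i\<in>Basis. (cgrad \<phi> x \<bullet> i) * (cgrad \<phi> x \<bullet> i)) = (\<Sum>i\<in>Basis. (frechet_derivative \<phi> (at x) i)\<^sup>2)"
      by (simp add: power2_eq_square)
    then show ?thesis by (subst power2_norm_eq_inner, subst euclidean_inner)
  qed
  have "(\<lambda>x. \<Sum>i\<in>B. (frechet_derivative \<phi> (at x) i)\<^sup>2) \<in> test_functions \<Omega>" if "finite B" "B \<subseteq> Basis" for B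
    using that
  proof (induction B rule: finite_induct)
    case empty
    show ?case by (simp, rule test_functionsI[of _ "{}"]) auto
  next
    case (insert i B)
    then show ?case using test_add[OF test_square_test[OF test_derivative[OF assms]]] by simp
  qed
  then have t: "(\<lambda>x. (norm (cgrad \<phi> x))\<^sup>2) \<in> test_functions \<Omega>" unfolding eq by simp
  have "(norm (cls \<Omega> (cgrad \<phi>)))\<^sup>2 = (\<integral>x. (norm (cgrad \<phi> x))\<^sup>2 \<partial>lebesgue_on \<Omega>)"
    by (simp add: norm_cls m\<Omega> cgrad_L2 \<Omega> assms L2_norm_def)
  also have "\<dots> = (\<integral>x. (norm (cgrad \<phi> x))\<^sup>2 \<partial>lborel)" by (rule integral_\<Omega>_lborel[OF t])
  finally show ?thesis
    using nn_integral_eq_integral[OF test_lborel_integrable[OF t]] by simp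
qed

lemma norm_hc_test_square:
  "\<phi> \<in> test_functions \<Omega> \<Longrightarrow> (norm (hc \<phi>))\<^sup>2 = (norm (cls \<Omega> \<phi>))\<^sup>2 + (norm (cls \<Omega> (cgrad \<phi>)))\<^sup>2"
  by (simp add: test_H1(2) norm_prod_def)

lemma AC_nonneg: "avg_const TYPE('a) \<ge> 0" by (simp add: avg_const_def)

lemma cube_avg_error_hc:
  assumes "\<phi> \<in> test_functions \<Omega>"
  shows "(\<integral>\<^sup>+x. ennreal ((\<phi> x - cube_avg k \<phi> x)\<^sup>2) \<partial>lborel) \<le> ennreal (avg_const TYPE('a) * (1/4) ^ k * (norm (hc \<phi>))\<^sup>2)"
proof -
  have "avg_const TYPE('a) * (1/4) ^ k * (norm (cls \<Omega> (cgrad \<phi>)))\<^sup>2 \<le> avg_const TYPE('a) * (1/4) ^ k * (norm (hc \<phi>))\<^sup>2"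
    using AC_nonneg by (intro mult_left_mono) (auto simp: norm_hc_test_square[OF assms])
  then show ?thesis
    using cube_avg_error[OF assms, of k] AC_nonneg
    by (simp add: nn_integral_cgrad_square[OF assms] flip: ennreal_mult')
       (meson ennreal_leI order_trans)
qed

lemma cube_avg_bound:
  assumes "\<phi> \<in> test_functions \<Omega>"
  shows "(cube_avg k \<phi> x)\<^sup>2 \<le> 2 ^ (k * DIM('a)) * (norm (hc \<phi>))\<^sup>2"
proof -
  have "ennreal ((cube_avg k \<phi> x)\<^sup>2)
      \<le> ennreal (2 ^ (k * DIM('a))) * (\<integral>\<^sup>+y. indicator (cube k x) y * ennreal ((\<phi> y)\<^sup>2) \<partial>lborel)"
    using cube_avg_diff_square_le[OF assms, of 0 k x] by simp
  also have "\<dots> \<le> ennreal (2 ^ (k * DIM('a))) * (\<integral>\<^sup>+y. ennreal ((\<phi> y)\<^sup>2) \<partial>lborel)"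
    by (intro mult_left_mono nn_integral_mono) (auto simp: indicator_def)
  also have "\<dots> = ennreal (2 ^ (k * DIM('a)) * (norm (cls \<Omega> \<phi>))\<^sup>2)"
    by (simp add: nn_integral_test_square[OF assms] ennreal_mult)
  also have "\<dots> \<le> ennreal (2 ^ (k * DIM('a)) * (norm (hc \<phi>))\<^sup>2)"
    by (intro ennreal_leI mult_left_mono) (auto simp: norm_hc_test_square[OF assms])
  finally show ?thesis by (subst (asm) ennreal_le_iff) auto
qed

subsection \<open>Rellich's theorem\<close>

text \<open>Counting principle for the quantisation below. It is applied to the dyadic cubes meeting
  \<Omega> and again to the rounded averages over them.\<close>

lemma finite_code_PiE:
  fixes f :: "'x \<Rightarrow> 'y \<Rightarrow> real"
  assumes "finite Z" "\<And>x z. x \<in> X \<Longrightarrow> z \<in> Z \<Longrightarrow> \<bar>f x z\<bar> \<le> B"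
  shows "finite ((\<lambda>x. restrict (\<lambda>z. \<lfloor>f x z\<rfloor>) Z) ` X)"
proof (rule finite_subset)
  show "(\<lambda>x. restrict (\<lambda>z. \<lfloor>f x z\<rfloor>) Z) ` X \<subseteq> PiE Z (\<lambda>_. {\<lfloor>-B\<rfloor>..\<lfloor>B\<rfloor>})"
    using assms(2) by (force intro!: floor_mono simp: abs_le_iff)
  show "finite (PiE Z (\<lambda>_. {\<lfloor>-B\<rfloor>..\<lfloor>B\<rfloor>}))" using assms(1) by (intro finite_PiE) auto
qed

text \<open>On a ball of \<open>H10\<close>, averages over sufficiently fine dyadic cubes are
  uniformly close to the function in L2. Only finitely many cubes meet \<Omega> and the averages
  over them are bounded, so rounding them to multiples of \<eta> leaves finitely many codes.
  Functions with the same code are within e of each other.\<close>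

lemma test_totally_bounded:
  assumes e: "e > 0"
  shows "\<exists>T. finite T \<and> cls \<Omega> ` {\<phi> \<in> test_functions \<Omega>. norm (hc \<phi>) \<le> C} \<subseteq> (\<Union>x\<in>T. ball x e)"
proof -
  define \<Phi> where "\<Phi> = {\<phi> \<in> test_functions \<Omega>. norm (hc \<phi>) \<le> C}"
  \<comment> \<open>The 6 collects the averaging errors of two functions, each with the factor 3
    from squaring a sum of three terms. This half of the budget fixes the level k.\<close>
  have "(\<lambda>k. 6 * avg_const TYPE('a) * C\<^sup>2 * (1/4) ^ k) \<longlonglongrightarrow> 6 * avg_const TYPE('a) * C\<^sup>2 * 0"
    by (intro tendsto_intros LIMSEQ_realpow_zero) auto
  then have "\<forall>\<^sub>F k in sequentially. 6 * avg_const TYPE('a) * C\<^sup>2 * (1/4) ^ k < e\<^sup>2 / 2"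
    by (rule order_tendstoD) (use e in simp)
  then obtain k where k: "6 * avg_const TYPE('a) * C\<^sup>2 * (1/4) ^ k < e\<^sup>2 / 2" by (auto simp: eventually_sequentially)
  define \<mu> where "\<mu> = measure lborel \<Omega>"
  have fin\<Omega>: "emeasure lborel \<Omega> < \<infinity>" using \<Omega>(2) by (rule emeasure_bounded_finite)
  then have e\<mu>: "emeasure lborel \<Omega> = ennreal \<mu>" by (simp add: \<mu>_def emeasure_eq_ennreal_measure)
  have \<mu>0: "\<mu> \<ge> 0" by (simp add: \<mu>_def)
  \<comment> \<open>The other half of the budget pays for rounding: 3 * \<eta>^2 * \<mu> equals
    e^2/2 times \<mu>/(\<mu> + 1), a factor below 1.\<close>
  define \<eta> where "\<eta> = e / sqrt (6 * (\<mu> + 1))"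
  have \<eta>: "\<eta> > 0" using e \<mu>0 by (simp add: \<eta>_def)
  have \<eta>2: "3 * \<eta>\<^sup>2 * \<mu> < e\<^sup>2 / 2"
  proof -
    have "3 * \<eta>\<^sup>2 * \<mu> = (e\<^sup>2 / 2) * (\<mu> / (\<mu> + 1))"
      using \<mu>0 by (simp add: \<eta>_def power_divide field_simps)
    also have "\<dots> < (e\<^sup>2 / 2) * 1" using e \<mu>0 by (intro mult_strict_left_mono) auto
    finally show ?thesis by simp
  qed
  \<comment> \<open>The key names the dyadic cube containing x, and \<open>pt\<close> will pick one
    point of \<Omega> in each such cube. Averages depend only on the cube, so evaluating them at the
    picked point loses nothing.\<close>
  define key where "key = (\<lambda>x::'a. restrict (\<lambda>i. \<lfloor>2 ^ k * (x \<bullet> i)\<rfloor>) Basis)"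
  obtain R where R: "\<And>x. x \<in> \<Omega> \<Longrightarrow> norm x \<le> R" using \<Omega>(2) by (auto simp: bounded_iff)
  have finZ: "finite (key ` \<Omega>)"
    unfolding key_def
  proof (rule finite_code_PiE[where B = "2 ^ k * R"])
    fix x i :: 'a assume "x \<in> \<Omega>" "i \<in> Basis"
    then have "\<bar>x \<bullet> i\<bar> \<le> R" using R Basis_le_norm order_trans by blast
    then show "\<bar>2 ^ k * (x \<bullet> i)\<bar> \<le> 2 ^ k * R" by (simp add: abs_mult)
  qed simp
  define pt where "pt = inv_into \<Omega> key"
  have pt: "pt (key x) \<in> cube k x" if "x \<in> \<Omega>" for x
  proof -
    have "key (pt (key x)) = key x" using that by (simp add: pt_def f_inv_into_f)
    then have eq: "key (pt (key x)) i = key x i" for i by simp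
    have kv: "key y i = \<lfloor>2 ^ k * (y \<bullet> i)\<rfloor>" if "i \<in> Basis" for y i
      using that by (simp add: key_def)
    show ?thesis
      unfolding cube_def
    proof (intro CollectI ballI)
      fix i :: 'a assume i: "i \<in> Basis"
      show "\<lfloor>2 ^ k * (pt (key x) \<bullet> i)\<rfloor> = \<lfloor>2 ^ k * (x \<bullet> i)\<rfloor>"
        using eq[of i] by (simp add: kv[OF i])
    qed
  qed
  define code where "code = (\<lambda>\<phi>. restrict (\<lambda>z. \<lfloor>cube_avg k \<phi> (pt z) / \<eta>\<rfloor>) (key ` \<Omega>))"
  have finc: "finite (code ` \<Phi>)"
    unfolding code_def
  proof (rule finite_code_PiE[where B = "sqrt (2 ^ (k * DIM('a)) * C\<^sup>2) / \<eta>", OF finZ])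
    fix \<phi> z assume "\<phi> \<in> \<Phi>" "z \<in> key ` \<Omega>"
    then have a: "(cube_avg k \<phi> (pt z))\<^sup>2 \<le> 2 ^ (k * DIM('a)) * (norm (hc \<phi>))\<^sup>2" and "norm (hc \<phi>) \<le> C"
      using cube_avg_bound by (auto simp: \<Phi>_def)
    have b: "2 ^ (k * DIM('a)) * (norm (hc \<phi>))\<^sup>2 \<le> 2 ^ (k * DIM('a)) * C\<^sup>2"
      using \<open>norm (hc \<phi>) \<le> C\<close> by (intro mult_left_mono power_mono) auto
    have "\<bar>cube_avg k \<phi> (pt z)\<bar> \<le> sqrt (2 ^ (k * DIM('a)) * C\<^sup>2)"
      by (rule real_le_rsqrt) (use order_trans[OF a b] in \<open>simp only: power2_abs\<close>)
    then show "\<bar>cube_avg k \<phi> (pt z) / \<eta>\<bar> \<le> sqrt (2 ^ (k * DIM('a)) * C\<^sup>2) / \<eta>"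
      using \<eta> by (simp add: divide_right_mono)
  qed
  have close: "dist (cls \<Omega> \<phi>) (cls \<Omega> \<psi>) < e" if \<phi>: "\<phi> \<in> \<Phi>" and \<psi>: "\<psi> \<in> \<Phi>" and eq: "code \<phi> = code \<psi>" for \<phi> \<psi>
  proof -
    have t: "\<phi> \<in> test_functions \<Omega>" "\<psi> \<in> test_functions \<Omega>" and nn: "norm (hc \<phi>) \<le> C" "norm (hc \<psi>) \<le> C"
      using \<phi> \<psi> by (auto simp: \<Phi>_def)
    have [measurable]: "\<phi> \<in> borel_measurable borel" "\<psi> \<in> borel_measurable borel"
      "cube_avg k \<phi> \<in> borel_measurable borel" "cube_avg k \<psi> \<in> borel_measurable borel" "\<Omega> \<in> sets borel"
      using t \<Omega> by (auto intro: test_borel cube_avg_measurable)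
    have avg: "\<bar>cube_avg k \<phi> x - cube_avg k \<psi> x\<bar> \<le> \<eta>" if "x \<in> \<Omega>" for x
    proof -
      have "code \<phi> (key x) = code \<psi> (key x)" using eq by simp
      then have "\<lfloor>cube_avg k \<phi> x / \<eta>\<rfloor> = \<lfloor>cube_avg k \<psi> x / \<eta>\<rfloor>"
        using that pt[OF that] by (simp add: code_def cube_avg_cong)
      then have "\<bar>cube_avg k \<phi> x / \<eta> - cube_avg k \<psi> x / \<eta>\<bar> \<le> 1" by linarith
      then show ?thesis using \<eta> by (simp add: field_simps abs_le_iff)
    qed
    have out: "\<phi> x = 0" "\<psi> x = 0" if "x \<notin> \<Omega>" for x
      using that test_support[OF t(1)] test_support[OF t(2)] by (metis subsetD)+
    define a where "a = avg_const TYPE('a) * (1/4) ^ k * C\<^sup>2"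
    have a0: "a \<ge> 0" using AC_nonneg by (simp add: a_def)
    let ?d = "\<lambda>x. 1 * \<phi> x + (- 1) * \<psi> x"
    have td: "?d \<in> test_functions \<Omega>" by (rule test_lincomb[OF t])
    have "cls \<Omega> \<phi> - cls \<Omega> \<psi> = cls \<Omega> ?d"
      using cls_diff[OF m\<Omega> test_L2 test_L2] \<Omega> t by simp
    then have "ennreal ((dist (cls \<Omega> \<phi>) (cls \<Omega> \<psi>))\<^sup>2) = (\<integral>\<^sup>+x. ennreal ((?d x)\<^sup>2) \<partial>lborel)"
      by (simp only: nn_integral_test_square[OF td] dist_norm)
    also have "\<dots> \<le> (\<integral>\<^sup>+x. (ennreal 3 * ennreal ((\<phi> x - cube_avg k \<phi> x)\<^sup>2)
        + ennreal 3 * ennreal ((\<psi> x - cube_avg k \<psi> x)\<^sup>2)) + ennreal (3 * \<eta>\<^sup>2) * indicator \<Omega> x \<partial>lborel)"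
    proof (rule nn_integral_mono)
      fix x
      show "ennreal ((?d x)\<^sup>2) \<le> (ennreal 3 * ennreal ((\<phi> x - cube_avg k \<phi> x)\<^sup>2)
        + ennreal 3 * ennreal ((\<psi> x - cube_avg k \<psi> x)\<^sup>2)) + ennreal (3 * \<eta>\<^sup>2) * indicator \<Omega> x"
      proof (cases "x \<in> \<Omega>")
        case True
        have sq3: "(a - b + c)\<^sup>2 \<le> 3 * a\<^sup>2 + 3 * b\<^sup>2 + 3 * c\<^sup>2" for a b c :: real
        proof -
          have "0 \<le> (a + b)\<^sup>2 + (a - c)\<^sup>2 + (b + c)\<^sup>2" by simp
          then show ?thesis by (simp add: power2_eq_square algebra_simps)
        qed
        have "(cube_avg k \<phi> x - cube_avg k \<psi> x)\<^sup>2 \<le> \<eta>\<^sup>2"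
          using avg[OF True] \<eta> by (simp add: abs_le_square_iff[symmetric])
        then have "(?d x)\<^sup>2 \<le> 3 * (\<phi> x - cube_avg k \<phi> x)\<^sup>2 + 3 * (\<psi> x - cube_avg k \<psi> x)\<^sup>2 + 3 * \<eta>\<^sup>2"
          using sq3[of "\<phi> x - cube_avg k \<phi> x" "\<psi> x - cube_avg k \<psi> x" "cube_avg k \<phi> x - cube_avg k \<psi> x"]
          by simp
        from ennreal_leI[OF this] show ?thesis using True by (simp add: ennreal_mult)
      qed (simp add: out)
    qed
    also have "\<dots> = ennreal 3 * (\<integral>\<^sup>+x. ennreal ((\<phi> x - cube_avg k \<phi> x)\<^sup>2) \<partial>lborel)
        + ennreal 3 * (\<integral>\<^sup>+x. ennreal ((\<psi> x - cube_avg k \<psi> x)\<^sup>2) \<partial>lborel) + ennreal (3 * \<eta>\<^sup>2) * ennreal \<mu>"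
      by (simp add: nn_integral_add nn_integral_cmult e\<mu>)
    also have "\<dots> \<le> ennreal 3 * ennreal (avg_const TYPE('a) * (1/4) ^ k * C\<^sup>2) + ennreal 3 * ennreal (avg_const TYPE('a) * (1/4) ^ k * C\<^sup>2)
        + ennreal (3 * \<eta>\<^sup>2) * ennreal \<mu>"
    proof -
      have "(\<integral>\<^sup>+x. ennreal ((\<theta> x - cube_avg k \<theta> x)\<^sup>2) \<partial>lborel) \<le> ennreal (avg_const TYPE('a) * (1/4) ^ k * C\<^sup>2)"
        if "\<theta> \<in> test_functions \<Omega>" "norm (hc \<theta>) \<le> C" for \<theta>
        using AC_nonneg that(2)
        by (intro order_trans[OF cube_avg_error_hc[OF that(1)]] ennreal_leI mult_left_mono power_mono) auto
      then show ?thesis using t nn by (intro add_mono mult_left_mono) auto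
    qed
    also have "\<dots> = ennreal (3 * a + 3 * a + 3 * \<eta>\<^sup>2 * \<mu>)"
    proof -
      have "3 * ennreal a + 3 * ennreal a = 6 * ennreal a" by (simp flip: distrib_right)
      then show ?thesis using a0 \<mu>0 by (simp add: ennreal_mult flip: a_def)
    qed
    also have "3 * a + 3 * a + 3 * \<eta>\<^sup>2 * \<mu> = 6 * avg_const TYPE('a) * C\<^sup>2 * (1/4) ^ k + 3 * \<eta>\<^sup>2 * \<mu>"
      by (simp add: a_def)
    finally have "(dist (cls \<Omega> \<phi>) (cls \<Omega> \<psi>))\<^sup>2 \<le> 6 * avg_const TYPE('a) * C\<^sup>2 * (1/4) ^ k + 3 * \<eta>\<^sup>2 * \<mu>"
      using AC_nonneg \<mu>0 by (subst (asm) ennreal_le_iff) auto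
    also have "\<dots> < e\<^sup>2" using k \<eta>2 by linarith
    finally show ?thesis using e by (simp add: power2_less_imp_less)
  qed
  show ?thesis
  proof (intro exI conjI)
    show "finite ((\<lambda>c. cls \<Omega> (inv_into \<Phi> code c)) ` code ` \<Phi>)" using finc by simp
    show "cls \<Omega> ` {\<phi> \<in> test_functions \<Omega>. norm (hc \<phi>) \<le> C}
        \<subseteq> (\<Union>x\<in>(\<lambda>c. cls \<Omega> (inv_into \<Phi> code c)) ` code ` \<Phi>. ball x e)"
    proof
      fix z assume "z \<in> cls \<Omega> ` {\<phi> \<in> test_functions \<Omega>. norm (hc \<phi>) \<le> C}"
      then obtain \<phi> where \<phi>: "\<phi> \<in> \<Phi>" "z = cls \<Omega> \<phi>" by (auto simp: \<Phi>_def)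
      have "inv_into \<Phi> code (code \<phi>) \<in> \<Phi>" "code (inv_into \<Phi> code (code \<phi>)) = code \<phi>"
        using \<phi> by (auto intro: inv_into_into intro!: f_inv_into_f[of "code \<phi>" code \<Phi>])
      then have "dist (cls \<Omega> (inv_into \<Phi> code (code \<phi>))) z < e" using close \<phi> by auto
      then show "z \<in> (\<Union>x\<in>(\<lambda>c. cls \<Omega> (inv_into \<Phi> code c)) ` code ` \<Phi>. ball x e)" using \<phi> by auto
    qed
  qed
qed

lemma rellich: "compact (closure (cls \<Omega> ` {\<phi> \<in> test_functions \<Omega>. norm (hc \<phi>) \<le> C}))"
proof -
  let ?A = "cls \<Omega> ` {\<phi> \<in> test_functions \<Omega>. norm (hc \<phi>) \<le> C}"
  have "\<exists>T. finite T \<and> closure ?A \<subseteq> (\<Union>x\<in>T. ball x e)" if "e > 0" for e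
  proof -
    obtain T where T: "finite T" "?A \<subseteq> (\<Union>x\<in>T. ball x (e/2))"
      using test_totally_bounded[of "e/2" C] \<open>e > 0\<close> by auto
    have "closure ?A \<subseteq> (\<Union>x\<in>T. cball x (e/2))"
    proof (rule closure_minimal)
      show "?A \<subseteq> (\<Union>x\<in>T. cball x (e/2))" using T(2) ball_subset_cball by blast
      show "closed (\<Union>x\<in>T. cball x (e/2))" using T(1) by (intro closed_UN) auto
    qed
    also have "\<dots> \<subseteq> (\<Union>x\<in>T. ball x e)" using \<open>e > 0\<close> by force
    finally show ?thesis using T(1) by blast
  qed
  then show ?thesis unfolding compact_eq_totally_bounded by (simp add: complete_eq_closed)
qed

text \<open>Elements of norm at most C are limits of test functions whose norms may exceed C
  slightly. Compactness is therefore used for the ball of radius C + 1.\<close>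

lemma rellich_HS:
  fixes z :: "nat \<Rightarrow> ('a, real) l2 \<times> ('a, 'a) l2"
  assumes "\<And>k. z k \<in> HS" "\<And>k. norm (z k) \<le> C"
  obtains r f where "strict_mono r" "(\<lambda>k. fst (z (r k))) \<longlonglongrightarrow> f"
proof -
  let ?A = "cls \<Omega> ` {\<phi> \<in> test_functions \<Omega>. norm (hc \<phi>) \<le> C + 1}"
  have "fst y \<in> closure ?A" if "y \<in> HS" "norm y \<le> C" for y
  proof -
    obtain \<phi> where \<phi>: "\<And>k. \<phi> k \<in> test_functions \<Omega>" "(\<lambda>k. hc (\<phi> k)) \<longlonglongrightarrow> y"
      using HS_sequence[OF \<open>y \<in> HS\<close>] by metis
    have "(\<lambda>k. norm (hc (\<phi> k))) \<longlonglongrightarrow> norm y" using \<phi>(2) by (rule tendsto_norm)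
    then have "\<forall>\<^sub>F k in sequentially. norm (hc (\<phi> k)) < C + 1"
      by (rule order_tendstoD) (use that(2) in linarith)
    then have ev: "\<forall>\<^sub>F k in sequentially. fst (hc (\<phi> k)) \<in> closure ?A"
    proof eventually_elim
      case (elim k)
      then have "fst (hc (\<phi> k)) \<in> ?A" using \<phi>(1)[of k] by (auto simp: hc_def)
      then show ?case by (rule closure_subset[THEN subsetD])
    qed
    show ?thesis
      by (rule Lim_in_closed_set[OF closed_closure ev _ tendsto_fst[OF \<phi>(2)]]) simp
  qed
  then have mem: "\<forall>k. fst (z k) \<in> closure ?A" using assms by simp
  obtain f r where "strict_mono (r :: nat \<Rightarrow> nat)" "((\<lambda>k. fst (z k)) \<circ> r) \<longlonglongrightarrow> f"
    by (rule seq_compactE[OF compact_imp_seq_compact[OF rellich[of "C + 1"]] mem])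
  then show ?thesis by (intro that[of r f]) (simp_all add: o_def)
qed

subsection \<open>The first Dirichlet eigenvalue\<close>

lemma HS_nontrivial:
  assumes "\<Omega> \<noteq> {}"
  obtains z where "z \<in> HS" "fst z \<noteq> 0"
proof -
  obtain p where "p \<in> \<Omega>" using assms by auto
  then obtain a b where ab: "p \<in> box a b" "cbox a b \<subseteq> \<Omega>"
    using open_contains_cbox[OF \<Omega>(1) \<open>p \<in> \<Omega>\<close>] by metis
  let ?\<phi> = "box_bump a b (Suc 0)"
  have t: "?\<phi> \<in> test_functions \<Omega>" by (rule box_bump_test[OF ab(2)])
  have "cls \<Omega> ?\<phi> \<noteq> 0"
  proof
    assume "cls \<Omega> ?\<phi> = 0"
    then have "AE x in lebesgue_on \<Omega>. ?\<phi> x = 0"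
      using cls_eq_iff[OF m\<Omega> test_L2[OF \<Omega>(1) t] L2_zero] by (simp add: cls_zero)
    then have "AE x in lebesgue. x \<in> \<Omega> \<longrightarrow> ?\<phi> x = 0" using m\<Omega> by (simp add: AE_restrict_space_iff)
    then have "AE x in lebesgue. x \<notin> box a b"
      by eventually_elim (use ab box_subset_cbox[of a b] box_bump_nz_iff[of "Suc 0" a b] in auto)
    then have "negligible (box a b)"
      by (simp add: AE_iff_null_sets negligible_iff_null_sets)
    then show False using open_not_negligible[OF open_box] ab(1) by auto
  qed
  then show ?thesis
    using that[of "hc ?\<phi>"] test_H10[OF t] by (auto simp: HS_def hc_def)
qed

text \<open>Moving against the sign of b by a step of size proportional to b, the linear gain
  outweighs the quadratic cost. The bound C is made strictly positive so that it can be divided by.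
  This yields the Euler-Lagrange equation.\<close>

lemma linear_coefficient_zero:
  fixes b c :: real
  assumes "\<And>t. 0 \<le> 2 * t * b + t\<^sup>2 * c" shows "b = 0"
proof (rule ccontr)
  assume b: "b \<noteq> 0"
  define C where "C = \<bar>c\<bar> + 1"
  have C: "C > 0" "c \<le> C" by (auto simp: C_def)
  have "0 \<le> 2 * (- b / C) * b + (- b / C)\<^sup>2 * c" by (rule assms)
  also have "\<dots> \<le> 2 * (- b / C) * b + (- b / C)\<^sup>2 * C" using C by (intro add_left_mono mult_left_mono) auto
  also have "\<dots> = - (b\<^sup>2 / C)" using C by (simp add: power2_eq_square field_simps)
  also have "\<dots> < 0" using b C by simp
  finally show False by simp
qed

text \<open>\<open>LEAST\<close> has content only if a least eigenvalue exists. The infimum m of the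
  Rayleigh quotient is attained by the direct method, the Euler-Lagrange equation makes it an
  eigenvalue, and testing any eigenfunction with itself shows that no eigenvalue is smaller. The
  inequality is then the definition of the infimum.\<close>

lemma rayleigh:
  assumes "\<Omega> \<noteq> {}" "z \<in> HS"
  shows "first_dirichlet_eigenvalue \<Omega> * (norm (fst z))\<^sup>2 \<le> (norm (snd z))\<^sup>2"
proof -
  define U where "U = {(norm (snd z))\<^sup>2 | z. z \<in> HS \<and> norm (fst z) = 1}"
  define m where "m = Inf U"
  have bdd: "bdd_below U" by (rule bdd_belowI[of _ 0]) (auto simp: U_def)
  have scale: "z /\<^sub>R norm (fst z) \<in> HS" "norm (fst (z /\<^sub>R norm (fst z))) = 1"
    if "z \<in> HS" "fst z \<noteq> 0" for z
    using that HS_subspace by (auto intro: subspace_scale)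
  obtain z0 where "z0 \<in> HS" "fst z0 \<noteq> 0" using HS_nontrivial[OF assms(1)] by metis
  from scale[OF this] have ne: "U \<noteq> {}" unfolding U_def by blast
  have ray: "m * (norm (fst z))\<^sup>2 \<le> (norm (snd z))\<^sup>2" if z: "z \<in> HS" for z
  proof (cases "fst z = 0")
    case False
    have "(norm (snd (z /\<^sub>R norm (fst z))))\<^sup>2 \<in> U" unfolding U_def using scale[OF z False] by blast
    then have "m \<le> (norm (snd (z /\<^sub>R norm (fst z))))\<^sup>2" unfolding m_def by (rule cInf_lower) (rule bdd)
    also have "\<dots> = (norm (snd z))\<^sup>2 / (norm (fst z))\<^sup>2"
      by (simp add: power_mult_distrib divide_inverse power_inverse mult.commute)
    finally show ?thesis using False by (simp add: field_simps)
  qed simp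
  have "\<exists>y\<in>HS. norm (fst y) = 1 \<and> (norm (snd y))\<^sup>2 < m + inverse (real (Suc k))" for k
  proof -
    have "\<exists>x\<in>U. x < m + inverse (real (Suc k))"
      using cInf_lessD[OF ne, of "m + inverse (real (Suc k))"] by (simp add: m_def)
    then obtain z where "z \<in> HS" "norm (fst z) = 1" "(norm (snd z))\<^sup>2 < m + inverse (real (Suc k))"
      unfolding U_def by blast
    then show ?thesis by blast
  qed
  then obtain y where y: "\<And>k. y k \<in> HS" "\<And>k. norm (fst (y k)) = 1"
      "\<And>k. (norm (snd (y k)))\<^sup>2 < m + inverse (real (Suc k))" by metis
  have yb: "norm (y k) \<le> sqrt (m + 2)" for k
  proof (rule real_le_rsqrt)
    have "inverse (real (Suc k)) \<le> 1" by (simp add: inverse_le_1_iff)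
    moreover have "(norm (y k))\<^sup>2 = 1 + (norm (snd (y k)))\<^sup>2" using y(2)[of k] by (simp add: norm_prod_def)
    ultimately show "(norm (y k))\<^sup>2 \<le> m + 2" using y(3)[of k] by linarith
  qed
  obtain r f where r: "strict_mono r" and f: "(\<lambda>k. fst (y (r k))) \<longlonglongrightarrow> f"
    by (rule rellich_HS[OF y(1) yb])
  \<comment> \<open>Rellich gives convergence of the functions only. The gradients follow from the
    parallelogram law: the midpoint cannot have a quotient below m, so two nearly minimal gradients
    cannot be far apart when the functions are close.\<close>
  have "Cauchy (\<lambda>k. y (r k))"
  proof (rule metric_CauchyI)
    fix e :: real assume e: "e > 0"
    \<comment> \<open>This d makes (|m| + 2) * d equal to e^2/2. The remaining e^2/2 comes from the
      two excesses of e^2/8 over m, each doubled by the parallelogram law.\<close>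
    define d where "d = e\<^sup>2 / (2 * (\<bar>m\<bar> + 2))"
    have d: "d > 0" using e by (simp add: d_def)
    have "(\<lambda>k. inverse (real (Suc k))) \<longlonglongrightarrow> 0" by (rule LIMSEQ_inverse_real_of_nat)
    then have "\<forall>\<^sub>F k in sequentially. inverse (real (Suc k)) < e\<^sup>2 / 8"
      by (rule order_tendstoD) (use e in simp)
    then obtain N1 where N1: "\<And>k. k \<ge> N1 \<Longrightarrow> inverse (real (Suc k)) < e\<^sup>2 / 8"
      by (auto simp: eventually_sequentially)
    obtain N2 where N2: "\<And>k l. k \<ge> N2 \<Longrightarrow> l \<ge> N2 \<Longrightarrow> dist (fst (y (r k))) (fst (y (r l))) < sqrt d"
      using metric_CauchyD[OF LIMSEQ_imp_Cauchy[OF f], of "sqrt d"] d by auto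
    show "\<exists>M. \<forall>k\<ge>M. \<forall>l\<ge>M. dist (y (r k)) (y (r l)) < e"
    proof (intro exI allI impI)
      fix k l assume kl: "k \<ge> max N1 N2" "l \<ge> max N1 N2"
      let ?p = "y (r k)" and ?q = "y (r l)"
      have "r k \<ge> N1" "r l \<ge> N1" using kl seq_suble[OF r, of k] seq_suble[OF r, of l] by auto
      then have s: "(norm (snd ?p))\<^sup>2 < m + e\<^sup>2 / 8" "(norm (snd ?q))\<^sup>2 < m + e\<^sup>2 / 8"
        using y(3)[of "r k"] y(3)[of "r l"] N1[of "r k"] N1[of "r l"] by linarith+
      have par: "(norm (a - b))\<^sup>2 = 2 * (norm a)\<^sup>2 + 2 * (norm b)\<^sup>2 - (norm (a + b))\<^sup>2" for a b :: "'v::real_inner"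
        by (simp add: power2_norm_eq_inner algebra_simps inner_commute)
      have "m * (norm (fst ?p + fst ?q))\<^sup>2 \<le> (norm (snd ?p + snd ?q))\<^sup>2"
        using ray[OF subspace_add[OF HS_subspace y(1)[of "r k"] y(1)[of "r l"]]] by simp
      moreover have "(norm (fst ?p + fst ?q))\<^sup>2 = 4 - (norm (fst ?p - fst ?q))\<^sup>2"
        using par[of "fst ?p" "fst ?q"] y(2)[of "r k"] y(2)[of "r l"] by simp
      ultimately have "(norm (snd ?p - snd ?q))\<^sup>2 < e\<^sup>2 / 2 + m * (norm (fst ?p - fst ?q))\<^sup>2"
        using par[of "snd ?p" "snd ?q"] s by (simp add: algebra_simps)
      moreover have df: "(norm (fst ?p - fst ?q))\<^sup>2 < d"
      proof -
        have "norm (fst ?p - fst ?q) < sqrt d" using N2[of k l] kl by (simp add: dist_norm)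
        then have "(norm (fst ?p - fst ?q))\<^sup>2 < (sqrt d)\<^sup>2" by (intro power_strict_mono) auto
        then show ?thesis using d by simp
      qed
      ultimately have "(norm (?p - ?q))\<^sup>2 < e\<^sup>2 / 2 + (\<bar>m\<bar> + 1) * (norm (fst ?p - fst ?q))\<^sup>2"
        using mult_right_mono[OF abs_ge_self[of m], of "(norm (fst ?p - fst ?q))\<^sup>2"]
        by (simp add: norm_prod_def algebra_simps)
      also have "(\<bar>m\<bar> + 1) * (norm (fst ?p - fst ?q))\<^sup>2 \<le> (\<bar>m\<bar> + 2) * d"
        using df by (intro mult_mono) auto
      also have "e\<^sup>2 / 2 + (\<bar>m\<bar> + 2) * d = e\<^sup>2"
      proof -
        have "0 < 2 * (\<bar>m\<bar> + 2)" by (simp add: add_nonneg_pos)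
        then have "2 * (\<bar>m\<bar> + 2) \<noteq> 0" by (rule not_sym[OF less_imp_neq])
        then have "d * (2 * (\<bar>m\<bar> + 2)) = e\<^sup>2" unfolding d_def by (rule nonzero_eq_divide_eq[THEN iffD1]) simp
        then show ?thesis by (simp add: algebra_simps)
      qed
      finally show "dist (y (r k)) (y (r l)) < e" using e by (simp add: dist_norm power2_less_imp_less)
    qed
  qed
  then obtain w where w: "(\<lambda>k. y (r k)) \<longlonglongrightarrow> w" using Cauchy_convergent convergent_def by blast
  have wH: "w \<in> HS" by (rule closed_sequentially[OF HS_closed _ w]) (rule y(1))
  have "(\<lambda>k. norm (fst (y (r k)))) \<longlonglongrightarrow> norm (fst w)" by (intro tendsto_intros w)
  then have w1: "norm (fst w) = 1" by (simp add: y(2) LIMSEQ_const_iff)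
  have "(\<lambda>k. (norm (snd (y (r k))))\<^sup>2) \<longlonglongrightarrow> (norm (snd w))\<^sup>2" by (intro tendsto_intros w)
  moreover have "(\<lambda>k. m + inverse (real (Suc (r k)))) \<longlonglongrightarrow> m + 0"
    using LIMSEQ_subseq_LIMSEQ[OF LIMSEQ_inverse_real_of_nat r]
    by (intro tendsto_add tendsto_const) (simp add: o_def)
  ultimately have "(norm (snd w))\<^sup>2 \<le> m + 0"
    by (rule LIMSEQ_le) (use y(3) less_imp_le in blast)
  then have wm: "(norm (snd w))\<^sup>2 = m" using ray[OF wH] w1 by simp
  \<comment> \<open>The perturbation w + t z satisfies the Rayleigh inequality for every t, with
    equality at t = 0, so the coefficient of t vanishes.\<close>
  have EL: "snd w \<bullet> snd z = m * (fst w \<bullet> fst z)" if z: "z \<in> HS" for z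
  proof -
    have "0 \<le> 2 * t * (snd w \<bullet> snd z - m * (fst w \<bullet> fst z)) + t\<^sup>2 * ((norm (snd z))\<^sup>2 - m * (norm (fst z))\<^sup>2)" for t
    proof -
      have "w + t *\<^sub>R z \<in> HS" using wH z HS_subspace by (intro subspace_add subspace_scale)
      then have le: "m * (norm (fst w + t *\<^sub>R fst z))\<^sup>2 \<le> (norm (snd w + t *\<^sub>R snd z))\<^sup>2"
        using ray by fastforce
      have ex: "(norm (a + t *\<^sub>R b))\<^sup>2 = (norm a)\<^sup>2 + 2 * t * (a \<bullet> b) + t\<^sup>2 * (norm b)\<^sup>2"
        for a b :: "'v::real_inner"
        unfolding power2_norm_eq_inner
        by (simp add: inner_add_left inner_add_right inner_commute power2_eq_square algebra_simps)
      show ?thesis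
        using le wm w1 unfolding ex[of "fst w" "fst z"] ex[of "snd w" "snd z"] by (simp add: algebra_simps)
    qed
    from linear_coefficient_zero[OF this] show ?thesis by simp
  qed
  obtain \<phi> where \<phi>: "\<phi> \<in> H10 \<Omega>" "w = hc \<phi>" using wH by (auto simp: HS_def)
  have ip: "hc u = z \<Longrightarrow> hc v = y \<Longrightarrow> u \<in> H10 \<Omega> \<Longrightarrow> v \<in> H10 \<Omega> \<Longrightarrow>
      L2_inner \<Omega> (grad \<Omega> u) (grad \<Omega> v) = snd z \<bullet> snd y \<and> L2_inner \<Omega> u v = fst z \<bullet> fst y" for u v z y
    using grad_props(1)[OF H10_H1, of u] grad_props(1)[OF H10_H1, of v] H1_L2[OF H10_H1, of u] H1_L2[OF H10_H1, of v]
    by (auto simp: hc_def inner_cls m\<Omega>)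
  have nz: "\<not> ae_eq \<Omega> u (\<lambda>x. 0) \<longleftrightarrow> fst (hc u) \<noteq> 0" if "u \<in> H10 \<Omega>" for u
    using cls_eq_iff[OF m\<Omega> H1_L2[OF H10_H1[OF that]] L2_zero] by (simp add: hc_def ae_eq_def cls_zero)
  have "dirichlet_eigenvalue \<Omega> m"
    unfolding dirichlet_eigenvalue_def
  proof (intro bexI[of _ \<phi>] conjI ballI)
    show "\<not> ae_eq \<Omega> \<phi> (\<lambda>x. 0)" using nz[OF \<phi>(1)] w1 \<phi>(2) by auto
    fix \<psi> assume "\<psi> \<in> H10 \<Omega>"
    then show "L2_inner \<Omega> (grad \<Omega> \<phi>) (grad \<Omega> \<psi>) = m * L2_inner \<Omega> \<phi> \<psi>"
      using ip[OF refl refl \<phi>(1), of \<psi>] EL[of "hc \<psi>"] \<phi>(2) by (auto simp: HS_def)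
  qed (rule \<phi>(1))
  moreover have "m \<le> \<mu>" if ev: "dirichlet_eigenvalue \<Omega> \<mu>" for \<mu>
  proof -
    obtain u where u: "u \<in> H10 \<Omega>" "\<not> ae_eq \<Omega> u (\<lambda>x. 0)"
      "L2_inner \<Omega> (grad \<Omega> u) (grad \<Omega> u) = \<mu> * L2_inner \<Omega> u u"
      using ev unfolding dirichlet_eigenvalue_def by blast
    have "hc u \<in> HS" using u(1) by (auto simp: HS_def)
    have "m * (norm (fst (hc u)))\<^sup>2 \<le> \<mu> * (norm (fst (hc u)))\<^sup>2"
    proof -
      have "snd (hc u) \<bullet> snd (hc u) = \<mu> * (fst (hc u) \<bullet> fst (hc u))"
        using ip[OF refl refl u(1) u(1)] u(3) by metis
      then show ?thesis using ray[OF \<open>hc u \<in> HS\<close>] by (simp add: power2_norm_eq_inner)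
    qed
    then show ?thesis using nz[OF u(1)] u(2) by simp
  qed
  ultimately have "first_dirichlet_eigenvalue \<Omega> = m"
    unfolding first_dirichlet_eigenvalue_def by (rule Least_equality)
  then show ?thesis using ray[OF assms(2)] by simp
qed

subsection \<open>Subcritical Sobolev embedding\<close>

text \<open>Interpolating the decay of the differences of dyadic averages in \<open>L2\<close> with their growth in the
  supremum norm makes the telescoping series converge in \<open>Lq\<close> for subcritical \<open>q\<close>. The critical
  exponent, which would need a different argument, is not required.\<close>

definition davg :: "('a \<Rightarrow> real) \<Rightarrow> nat \<Rightarrow> 'a \<Rightarrow> real" where
  "davg \<phi> k x = (case k of 0 \<Rightarrow> cube_avg 0 \<phi> x | Suc j \<Rightarrow> cube_avg (Suc j) \<phi> x - cube_avg j \<phi> x)"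

lemma sum_davg: "(\<Sum>k\<le>m. davg \<phi> k x) = cube_avg m \<phi> x"
  by (induction m) (auto simp: davg_def)

lemma davg_measurable: "\<phi> \<in> test_functions \<Omega> \<Longrightarrow> davg \<phi> k \<in> borel_measurable borel"
  unfolding davg_def[abs_def] by (cases k) (auto intro!: cube_avg_measurable borel_measurable_diff)

lemma davg_cong: "y \<in> cube k x \<Longrightarrow> davg \<phi> k y = davg \<phi> k x"
  using cube_mono by (cases k) (auto simp: davg_def cube_avg_cong dest!: subsetD[OF cube_mono])

text \<open>The 10 is what level k = j + 1 costs: 2 * 4^-j + 2 * 4^-k equals 10 * 4^-k. At level 0
  the requirement is the smaller 2 + 2 * \<open>avg_const\<close>.\<close>

definition dconst :: real where "dconst = 10 * (1 + avg_const TYPE('a))"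

lemma dconst_pos: "dconst > 0" using AC_nonneg by (simp add: dconst_def)

text \<open>Consecutive averages are compared through the function itself, for which
  \<open>cube_avg_error\<close> gives the decay.\<close>

lemma davg_L2:
  assumes t: "\<phi> \<in> test_functions \<Omega>"
  shows "(\<integral>\<^sup>+x. ennreal ((davg \<phi> k x)\<^sup>2) \<partial>lborel) \<le> ennreal (dconst * (1/4) ^ k * (norm (hc \<phi>))\<^sup>2)"
proof -
  let ?M = "(norm (hc \<phi>))\<^sup>2" and ?A = "avg_const TYPE('a)"
  have [measurable]: "\<phi> \<in> borel_measurable borel" "cube_avg k \<phi> \<in> borel_measurable borel" for k
    using t by (auto intro: test_borel cube_avg_measurable)
  have split: "(\<integral>\<^sup>+x. ennreal ((d x)\<^sup>2) \<partial>lborel) \<le> ennreal (2 * A + 2 * B)"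
    if "\<And>x. d x = e x - f x" "(\<integral>\<^sup>+x. ennreal ((e x)\<^sup>2) \<partial>lborel) \<le> ennreal A" "(\<integral>\<^sup>+x. ennreal ((f x)\<^sup>2) \<partial>lborel) \<le> ennreal B"
      "A \<ge> 0" "B \<ge> 0" and [measurable]: "e \<in> borel_measurable borel" "f \<in> borel_measurable borel"
    for d e f :: "'a \<Rightarrow> real" and A B
  proof -
    have "(\<integral>\<^sup>+x. ennreal ((d x)\<^sup>2) \<partial>lborel) \<le> (\<integral>\<^sup>+x. ennreal 2 * ennreal ((e x)\<^sup>2) + ennreal 2 * ennreal ((f x)\<^sup>2) \<partial>lborel)"
    proof (rule nn_integral_mono)
      fix x
      have "0 \<le> (e x + f x)\<^sup>2" by simp
      then have "(d x)\<^sup>2 \<le> 2 * (e x)\<^sup>2 + 2 * (f x)\<^sup>2" by (simp add: that(1) power2_eq_square algebra_simps)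
      from ennreal_leI[OF this]
      show "ennreal ((d x)\<^sup>2) \<le> ennreal 2 * ennreal ((e x)\<^sup>2) + ennreal 2 * ennreal ((f x)\<^sup>2)"
        by (simp add: ennreal_mult)
    qed
    also have "\<dots> = ennreal 2 * (\<integral>\<^sup>+x. ennreal ((e x)\<^sup>2) \<partial>lborel) + ennreal 2 * (\<integral>\<^sup>+x. ennreal ((f x)\<^sup>2) \<partial>lborel)"
      by (simp add: nn_integral_add nn_integral_cmult)
    also have "\<dots> \<le> ennreal 2 * ennreal A + ennreal 2 * ennreal B"
      using that by (intro add_mono mult_left_mono) auto
    also have "\<dots> = ennreal (2 * A + 2 * B)" using that by (simp add: ennreal_mult)
    finally show ?thesis .
  qed
  show ?thesis
  proof (cases k)
    case 0
    have "(\<integral>\<^sup>+x. ennreal ((\<phi> x)\<^sup>2) \<partial>lborel) \<le> ennreal ?M"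
      by (simp add: nn_integral_test_square[OF t] norm_hc_test_square[OF t] ennreal_leI)
    then have "(\<integral>\<^sup>+x. ennreal ((davg \<phi> k x)\<^sup>2) \<partial>lborel) \<le> ennreal (2 * ?M + 2 * (?A * (1/4) ^ 0 * ?M))"
      using cube_avg_error_hc[OF t, of 0] AC_nonneg
      by (intro split[of _ \<phi> "\<lambda>x. \<phi> x - cube_avg 0 \<phi> x"]) (auto simp: davg_def 0)
    also have "\<dots> \<le> ennreal (dconst * (1/4) ^ k * ?M)"
      using AC_nonneg by (intro ennreal_leI) (simp add: dconst_def 0 algebra_simps)
    finally show ?thesis .
  next
    case (Suc j)
    have "(\<integral>\<^sup>+x. ennreal ((davg \<phi> k x)\<^sup>2) \<partial>lborel) \<le> ennreal (2 * (?A * (1/4) ^ j * ?M) + 2 * (?A * (1/4) ^ Suc j * ?M))"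
      using cube_avg_error_hc[OF t, of j] cube_avg_error_hc[OF t, of "Suc j"] AC_nonneg
      by (intro split[of _ "\<lambda>x. \<phi> x - cube_avg j \<phi> x" "\<lambda>x. \<phi> x - cube_avg (Suc j) \<phi> x"]) (auto simp: davg_def Suc)
    also have "\<dots> \<le> ennreal (dconst * (1/4) ^ k * ?M)"
      using AC_nonneg by (intro ennreal_leI) (simp add: dconst_def Suc algebra_simps)
    finally show ?thesis .
  qed
qed

lemma davg_sup:
  assumes t: "\<phi> \<in> test_functions \<Omega>"
  shows "(davg \<phi> k x)\<^sup>2 \<le> 2 ^ (k * DIM('a)) * (dconst * (1/4) ^ k * (norm (hc \<phi>))\<^sup>2)"
proof -
  have "ennreal ((davg \<phi> k x)\<^sup>2) \<le> ennreal (2 ^ (k * DIM('a))) * (\<integral>\<^sup>+y. ennreal ((davg \<phi> k y)\<^sup>2) \<partial>lborel)"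
    by (rule cube_constant_sup_le[OF davg_measurable[OF t] davg_cong])
  also have "\<dots> \<le> ennreal (2 ^ (k * DIM('a))) * ennreal (dconst * (1/4) ^ k * (norm (hc \<phi>))\<^sup>2)"
    by (intro mult_left_mono davg_L2[OF t]) auto
  also have "\<dots> = ennreal (2 ^ (k * DIM('a)) * (dconst * (1/4) ^ k * (norm (hc \<phi>))\<^sup>2))"
    using dconst_pos by (subst ennreal_mult) auto
  finally show ?thesis using dconst_pos by (subst (asm) ennreal_le_iff) auto
qed

text \<open>Interpolation: |d|^q is at most the supremum of |d|^(q-2) times |d|^2. The supremum
  costs a factor 2^(k n) inside the power (q-2)/2, while both bounds gain 4^-k. The resulting
  exponent of 2^k is negative exactly in the subcritical range.\<close>

lemma davg_Lq:
  fixes q :: real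
  assumes t: "\<phi> \<in> test_functions \<Omega>" and q: "q \<ge> 2"
  shows "(\<integral>\<^sup>+x. ennreal (\<bar>davg \<phi> k x\<bar> powr q) \<partial>lborel)
    \<le> ennreal (dconst powr (q/2) * norm (hc \<phi>) powr q * 2 powr (- (q - DIM('a) * (q - 2) / 2) * k))"
proof (cases "norm (hc \<phi>) = 0")
  case True
  then have "davg \<phi> k x = 0" for x using davg_sup[OF t, of k x] by simp
  then show ?thesis by simp
next
  case False
  define M where "M = norm (hc \<phi>)"
  have M: "M > 0" using False by (simp add: M_def)
  define A where "A = 2 ^ (k * DIM('a)) * (dconst * (1/4) ^ k * M\<^sup>2)"
  have A: "A > 0" using M dconst_pos by (simp add: A_def)
  have [measurable]: "davg \<phi> k \<in> borel_measurable borel" by (rule davg_measurable[OF t])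
  have "(\<integral>\<^sup>+x. ennreal (\<bar>davg \<phi> k x\<bar> powr q) \<partial>lborel)
      \<le> (\<integral>\<^sup>+x. ennreal (A powr ((q - 2) / 2)) * ennreal ((davg \<phi> k x)\<^sup>2) \<partial>lborel)"
  proof (rule nn_integral_mono)
    fix x
    define d where "d = \<bar>davg \<phi> k x\<bar>"
    have "d powr q \<le> A powr ((q - 2) / 2) * d\<^sup>2"
    proof (cases "d = 0")
      case False
      then have d: "d > 0" by (simp add: d_def)
      have "d powr (q - 2) = (d\<^sup>2) powr ((q - 2) / 2)"
      proof -
        have "(d powr 2) powr ((q - 2) / 2) = d powr (2 * ((q - 2) / 2))" by (rule powr_powr)
        also have "2 * ((q - 2) / 2) = q - 2" by simp
        finally show ?thesis using d by simp
      qed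
      also have "\<dots> \<le> A powr ((q - 2) / 2)"
        using davg_sup[OF t, of k x] q by (intro powr_mono2) (auto simp: A_def d_def M_def)
      finally have "d powr (q - 2) * d powr 2 \<le> A powr ((q - 2) / 2) * d powr 2"
        by (rule mult_right_mono) simp
      moreover have "d powr q = d powr (q - 2) * d powr 2" by (simp flip: powr_add)
      ultimately show ?thesis using d by simp
    qed (use q in simp)
    then show "ennreal (\<bar>davg \<phi> k x\<bar> powr q) \<le> ennreal (A powr ((q - 2) / 2)) * ennreal ((davg \<phi> k x)\<^sup>2)"
      by (simp add: d_def ennreal_leI flip: ennreal_mult)
  qed
  also have "\<dots> = ennreal (A powr ((q - 2) / 2)) * (\<integral>\<^sup>+x. ennreal ((davg \<phi> k x)\<^sup>2) \<partial>lborel)"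
    by (simp add: nn_integral_cmult)
  also have "\<dots> \<le> ennreal (A powr ((q - 2) / 2)) * ennreal (dconst * (1/4) ^ k * M\<^sup>2)"
    unfolding M_def by (intro mult_left_mono davg_L2[OF t]) auto
  also have "\<dots> = ennreal (A powr ((q - 2) / 2) * (dconst * (1/4) ^ k * M\<^sup>2))"
    using dconst_pos by (subst ennreal_mult) auto
  also have "A powr ((q - 2) / 2) * (dconst * (1/4) ^ k * M\<^sup>2)
      = dconst powr (q/2) * M powr q * 2 powr (- (q - DIM('a) * (q - 2) / 2) * k)"
  proof -
    define r where "r = (q - 2) / 2"
    have c: "dconst > 0" by (rule dconst_pos)
    have e4: "(1/4::real) ^ k = 2 powr (- 2 * real k)"
    proof -
      have "(1/4::real) = 2 powr (- 2)" by (simp add: powr_minus)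
      then have "(1/4::real) ^ k = (2 powr (- 2)) ^ k" by (rule arg_cong)
      also have "\<dots> = 2 powr (- 2 * real k)" by (subst powr_power) (auto simp: mult.commute)
      finally show ?thesis .
    qed
    have e2: "(2::real) ^ (k * DIM('a)) = 2 powr (real k * DIM('a))"
      by (simp flip: powr_realpow)
    have M2: "M\<^sup>2 = M powr 2" using M by simp
    have "A powr r * (dconst * (1/4) ^ k * M\<^sup>2)
      = (2 powr (real k * DIM('a)) * (dconst * 2 powr (- 2 * real k) * M powr 2)) powr r * (dconst powr 1 * 2 powr (- 2 * real k) * M powr 2)"
      using c by (simp add: A_def e4 e2 M2)
    also have "\<dots> = (dconst powr r * dconst powr 1) * (M powr (2 * r) * M powr 2)
        * (2 powr (real k * DIM('a) * r) * 2 powr (- 2 * real k * r) * 2 powr (- 2 * real k))"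
    proof -
      have "(M\<^sup>2) powr r = M powr (2 * r)" using powr_powr[of M 2 r] M by simp
      then show ?thesis using c M by (simp add: powr_mult powr_powr)
    qed
    also have "\<dots> = dconst powr (q/2) * M powr q * 2 powr (- (q - DIM('a) * (q - 2) / 2) * k)"
    proof -
      have "r + 1 = q / 2" "2 * r + 2 = q" by (simp_all add: r_def field_simps)
      then have "dconst powr r * dconst powr 1 = dconst powr (q/2)" "M powr (2 * r) * M powr 2 = M powr q"
        by (simp_all only: powr_add[symmetric])
      moreover have "(2::real) powr (real k * DIM('a) * r) * 2 powr (- 2 * real k * r) * 2 powr (- 2 * real k)
        = 2 powr (- (q - DIM('a) * (q - 2) / 2) * k)"
        unfolding powr_add[symmetric] by (rule arg_cong[where f = "\<lambda>x. 2 powr x"]) (simp add: r_def field_simps)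
      ultimately show ?thesis by (simp only:)
    qed
    finally show ?thesis by (simp only: r_def)
  qed
  finally show ?thesis by (simp add: M_def)
qed


lemma cube_avg_tendsto:
  assumes t: "\<phi> \<in> test_functions \<Omega>"
  shows "(\<lambda>k. cube_avg k \<phi> x) \<longlonglongrightarrow> \<phi> x"
proof (rule LIMSEQ_I)
  fix e :: real assume e: "e > 0"
  have "isCont \<phi> x"
    using smooth_continuous[OF test_smooth[OF t]] by (simp add: continuous_on_eq_continuous_at)
  then obtain d where d: "d > 0" "\<And>y. dist y x < d \<Longrightarrow> dist (\<phi> y) (\<phi> x) < e / 2"
    using e unfolding continuous_at_eps_delta by (metis half_gt_zero)
  have "(\<lambda>k. real DIM('a) * (1/2) ^ k) \<longlonglongrightarrow> real DIM('a) * 0"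
    by (intro tendsto_intros LIMSEQ_realpow_zero) auto
  then have "\<forall>\<^sub>F k in sequentially. real DIM('a) * (1/2) ^ k < d"
    by (rule order_tendstoD) (use d in simp)
  then obtain N where N: "\<And>k. k \<ge> N \<Longrightarrow> real DIM('a) * (1/2) ^ k < d" by (auto simp: eventually_sequentially)
  show "\<exists>N. \<forall>k\<ge>N. norm (cube_avg k \<phi> x - \<phi> x) < e"
  proof (intro exI allI impI)
    fix k assume k: "k \<ge> N"
    have small: "(\<phi> x - \<phi> y)\<^sup>2 \<le> (e / 2)\<^sup>2" if "y \<in> cube k x" for y
    proof -
      have "norm (y - x) \<le> (\<Sum>i\<in>Basis. \<bar>(y - x) \<bullet> i\<bar>)" by (rule norm_le_l1)
      also have "\<dots> \<le> (\<Sum>i\<in>(Basis::'a set). (1/2) ^ k)"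
        by (intro sum_mono cube_coordinate_diff[OF that])
      also have "\<dots> < d" using N[OF k] by simp
      finally have "\<bar>\<phi> x - \<phi> y\<bar> < e / 2" using d(2)[of y] by (simp add: dist_norm abs_minus_commute)
      then have "\<bar>\<phi> x - \<phi> y\<bar>\<^sup>2 \<le> (e / 2)\<^sup>2" by (intro power_mono) auto
      then show ?thesis by simp
    qed
    have "ennreal ((\<phi> x - cube_avg k \<phi> x)\<^sup>2)
        \<le> ennreal (2 ^ (k * DIM('a))) * (\<integral>\<^sup>+y. indicator (cube k x) y * ennreal ((\<phi> x - \<phi> y)\<^sup>2) \<partial>lborel)"
      by (rule cube_avg_diff_square_le[OF t])
    also have "\<dots> \<le> ennreal (2 ^ (k * DIM('a))) * (\<integral>\<^sup>+y. indicator (cube k x) y * ennreal ((e / 2)\<^sup>2) \<partial>lborel)"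
    proof (rule mult_left_mono, rule nn_integral_mono)
      fix y
      show "indicator (cube k x) y * ennreal ((\<phi> x - \<phi> y)\<^sup>2) \<le> indicator (cube k x) y * ennreal ((e / 2)\<^sup>2)"
        using ennreal_leI[OF small, of y] by (cases "y \<in> cube k x") auto
    qed simp
    also have "\<dots> = ennreal (2 ^ (k * DIM('a)) * ((1/2) ^ (k * DIM('a)) * (e / 2)\<^sup>2))"
      by (simp add: nn_integral_multc emeasure_cube ennreal_mult)
    also have "2 ^ (k * DIM('a)) * ((1/2) ^ (k * DIM('a)) * (e / 2)\<^sup>2) = (e / 2)\<^sup>2"
      by (simp add: power_one_over)
    finally have "(\<phi> x - cube_avg k \<phi> x)\<^sup>2 \<le> (e / 2)\<^sup>2" by (subst (asm) ennreal_le_iff) auto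
    then have "\<bar>\<phi> x - cube_avg k \<phi> x\<bar> \<le> e / 2" using e by (simp add: abs_le_square_iff[symmetric])
    then show "norm (cube_avg k \<phi> x - \<phi> x) < e" using e by (simp add: abs_minus_commute)
  qed
qed

text \<open>Each weighted term is at most the weighted sum S, so the k-th summand is at most a
  geometric factor times S^(1/q). Summing the geometric series replaces a discrete Hoelder
  inequality.\<close>

lemma sum_powr_le:
  fixes d :: "nat \<Rightarrow> real" and q \<epsilon> :: real
  assumes d: "\<And>k. d k \<ge> 0" and "q > 0" "\<epsilon> > 0"
  shows "(\<Sum>k\<le>m. d k) powr q
    \<le> (1 / (1 - 2 powr - \<epsilon>)) powr q * (\<Sum>k\<le>m. 2 powr (\<epsilon> * q * k) * d k powr q)"
proof -
  define S where "S = (\<Sum>k\<le>m. 2 powr (\<epsilon> * q * k) * d k powr q)"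
  define \<rho> where "\<rho> = (2::real) powr - \<epsilon>"
  have \<rho>: "0 < \<rho>" "\<rho> < 1" using assms by (auto simp: \<rho>_def powr_less_one)
  have S0: "S \<ge> 0" by (auto simp: S_def intro!: sum_nonneg)
  have le: "d k \<le> \<rho> ^ k * S powr (1/q)" if "k \<le> m" for k
  proof -
    have "(2 powr (\<epsilon> * k) * d k) powr q = 2 powr (\<epsilon> * q * k) * d k powr q"
      using d[of k] by (simp add: powr_mult powr_powr mult_ac)
    also have "\<dots> \<le> S"
      unfolding S_def by (rule member_le_sum[where f = "\<lambda>k. 2 powr (\<epsilon> * q * real k) * d k powr q"])
        (use that in auto)
    finally have "((2 powr (\<epsilon> * k) * d k) powr q) powr (1/q) \<le> S powr (1/q)"
      using assms by (intro powr_mono2) auto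
    then have "2 powr (\<epsilon> * k) * d k \<le> S powr (1/q)"
      using assms d[of k] by (simp add: powr_powr)
    moreover have "\<rho> ^ k = 2 powr - (\<epsilon> * k)"
      by (simp add: \<rho>_def powr_power mult.commute)
    then have "d k = \<rho> ^ k * (2 powr (\<epsilon> * k) * d k)" by (simp add: powr_minus_divide)
    ultimately show ?thesis using \<rho>(1) by (metis mult_left_mono less_imp_le zero_less_power)
  qed
  have "(\<Sum>k\<le>m. d k) \<le> (\<Sum>k\<le>m. \<rho> ^ k * S powr (1/q))" by (intro sum_mono le) auto
  also have "\<dots> = (\<Sum>k\<le>m. \<rho> ^ k) * S powr (1/q)" by (simp add: sum_distrib_right)
  also have "\<dots> \<le> (1 / (1 - \<rho>)) * S powr (1/q)"
  proof (rule mult_right_mono)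
    have "(\<Sum>k\<in>{..m}. \<rho> ^ k) \<le> (\<Sum>k. \<rho> ^ k)"
      using \<rho> by (intro sum_le_suminf) (auto intro: summable_geometric)
    then show "(\<Sum>k\<le>m. \<rho> ^ k) \<le> 1 / (1 - \<rho>)" using \<rho> by (simp add: suminf_geometric)
  qed simp
  finally have "(\<Sum>k\<le>m. d k) powr q \<le> ((1 / (1 - \<rho>)) * S powr (1/q)) powr q"
    using assms by (intro powr_mono2) (auto intro: sum_nonneg)
  also have "\<dots> = (1 / (1 - \<rho>)) powr q * S"
    using \<rho> S0 assms by (subst powr_mult) (auto simp: powr_powr)
  finally show ?thesis by (simp add: S_def \<rho>_def)
qed

lemma sobolev_test:
  fixes q :: real
  assumes q: "q \<ge> 2" and sub: "DIM('a) * (q - 2) / 2 < q"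
  obtains C where "C \<ge> 0" "\<And>\<phi>. \<phi> \<in> test_functions \<Omega> \<Longrightarrow>
    (\<integral>\<^sup>+x. ennreal (\<bar>\<phi> x\<bar> powr q) \<partial>lborel) \<le> ennreal (C * norm (hc \<phi>) powr q)"
proof -
  define \<kappa> where "\<kappa> = q - DIM('a) * (q - 2) / 2"
  have \<kappa>: "\<kappa> > 0" using sub by (simp add: \<kappa>_def)
  \<comment> \<open>With this choice \<epsilon> * q = \<kappa>/2: the weights consume half of the
    decay 2^(-\<kappa> k) of the pieces, and the other half keeps the series summable.\<close>
  define \<epsilon> where "\<epsilon> = \<kappa> / (2 * q)"
  have \<epsilon>: "\<epsilon> > 0" "\<epsilon> * q = \<kappa> / 2" using \<kappa> q by (auto simp: \<epsilon>_def)
  define c where "c = (1 / (1 - 2 powr - \<epsilon>)) powr q"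
  define \<rho> where "\<rho> = (2::real) powr (- \<kappa> / 2)"
  have \<rho>: "0 < \<rho>" "\<rho> < 1" using \<kappa> by (auto simp: \<rho>_def powr_less_one)
  define B where "B = dconst powr (q/2)"
  define C where "C = c * (B * (1 / (1 - \<rho>)))"
  have c0: "c \<ge> 0" "B \<ge> 0" by (auto simp: c_def B_def)
  have C0: "C \<ge> 0" using c0 \<rho> by (simp add: C_def)
  show ?thesis
  proof (rule that[OF C0])
    fix \<phi> assume t: "\<phi> \<in> test_functions \<Omega>"
    have [measurable]: "\<phi> \<in> borel_measurable borel" "davg \<phi> k \<in> borel_measurable borel"
      "cube_avg k \<phi> \<in> borel_measurable borel" for k
      using t by (auto intro: test_borel cube_avg_measurable davg_measurable)
    define M where "M = norm (hc \<phi>) powr q"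
    have M0: "M \<ge> 0" by (simp add: M_def)
    have bound: "(\<integral>\<^sup>+x. ennreal (\<bar>cube_avg m \<phi> x\<bar> powr q) \<partial>lborel) \<le> ennreal (C * M)" for m
    proof -
      have "(\<integral>\<^sup>+x. ennreal (\<bar>cube_avg m \<phi> x\<bar> powr q) \<partial>lborel)
          \<le> (\<integral>\<^sup>+x. ennreal c * (\<Sum>k\<le>m. ennreal (2 powr (\<kappa> / 2 * k)) * ennreal (\<bar>davg \<phi> k x\<bar> powr q)) \<partial>lborel)"
      proof (rule nn_integral_mono)
        fix x
        have "\<bar>cube_avg m \<phi> x\<bar> \<le> (\<Sum>k\<le>m. \<bar>davg \<phi> k x\<bar>)"
          unfolding sum_davg[symmetric] by (rule sum_abs)
        then have "\<bar>cube_avg m \<phi> x\<bar> powr q \<le> (\<Sum>k\<le>m. \<bar>davg \<phi> k x\<bar>) powr q"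
          using q by (intro powr_mono2) auto
        also have "\<dots> \<le> c * (\<Sum>k\<le>m. 2 powr (\<epsilon> * q * k) * \<bar>davg \<phi> k x\<bar> powr q)"
          unfolding c_def by (rule sum_powr_le) (use q \<epsilon> in auto)
        finally have "ennreal (\<bar>cube_avg m \<phi> x\<bar> powr q) \<le> ennreal (c * (\<Sum>k\<le>m. 2 powr (\<kappa> / 2 * k) * \<bar>davg \<phi> k x\<bar> powr q))"
          unfolding \<epsilon>(2) by (rule ennreal_leI)
        also have "\<dots> = ennreal c * (\<Sum>k\<le>m. ennreal (2 powr (\<kappa> / 2 * k)) * ennreal (\<bar>davg \<phi> k x\<bar> powr q))"
          using c0 by (subst ennreal_mult) (auto intro!: sum_nonneg simp: sum_ennreal[symmetric] ennreal_mult)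
        finally show "ennreal (\<bar>cube_avg m \<phi> x\<bar> powr q)
          \<le> ennreal c * (\<Sum>k\<le>m. ennreal (2 powr (\<kappa> / 2 * k)) * ennreal (\<bar>davg \<phi> k x\<bar> powr q))" .
      qed
      also have "\<dots> = ennreal c * (\<Sum>k\<le>m. ennreal (2 powr (\<kappa> / 2 * k)) * (\<integral>\<^sup>+x. ennreal (\<bar>davg \<phi> k x\<bar> powr q) \<partial>lborel))"
        by (simp add: nn_integral_cmult nn_integral_sum)
      also have "\<dots> \<le> ennreal c * (\<Sum>k\<le>m. ennreal (2 powr (\<kappa> / 2 * k)) * ennreal (B * M * 2 powr (- \<kappa> * k)))"
        using davg_Lq[OF t q] by (intro mult_left_mono sum_mono) (auto simp: B_def M_def \<kappa>_def)
      also have "\<dots> = ennreal (c * (\<Sum>k\<le>m. 2 powr (\<kappa> / 2 * k) * (B * M * 2 powr (- \<kappa> * k))))"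
        using c0 M0 by (subst ennreal_mult) (auto intro!: sum_nonneg simp: sum_ennreal[symmetric] ennreal_mult)
      also have "\<dots> \<le> ennreal (C * M)"
      proof (rule ennreal_leI)
        have e: "2 powr (\<kappa> / 2 * k) * (B * M * 2 powr (- \<kappa> * k)) = B * M * \<rho> ^ k" for k
        proof -
          have "(2::real) powr (\<kappa> / 2 * k) * 2 powr (- \<kappa> * k) = 2 powr (- \<kappa> / 2 * k)"
            by (simp flip: powr_add)
          also have "\<dots> = \<rho> ^ k" by (simp add: \<rho>_def powr_power mult.commute)
          finally show ?thesis by (simp add: mult_ac)
        qed
        have "(\<Sum>k\<le>m. 2 powr (\<kappa> / 2 * k) * (B * M * 2 powr (- \<kappa> * k))) = B * M * (\<Sum>k\<le>m. \<rho> ^ k)"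
          unfolding e by (rule sum_distrib_left[symmetric])
        also have "\<dots> \<le> B * M * (1 / (1 - \<rho>))"
        proof (rule mult_left_mono)
          have "(\<Sum>k\<in>{..m}. \<rho> ^ k) \<le> (\<Sum>k. \<rho> ^ k)"
            using \<rho> by (intro sum_le_suminf) (auto intro: summable_geometric)
          then show "(\<Sum>k\<le>m. \<rho> ^ k) \<le> 1 / (1 - \<rho>)" using \<rho> by (simp add: suminf_geometric)
        qed (use c0 M0 in simp)
        finally have "c * (\<Sum>k\<le>m. 2 powr (\<kappa> / 2 * k) * (B * M * 2 powr (- \<kappa> * k))) \<le> c * (B * M * (1 / (1 - \<rho>)))"
          using c0 by (intro mult_left_mono)
        then show "c * (\<Sum>k\<le>m. 2 powr (\<kappa> / 2 * k) * (B * M * 2 powr (- \<kappa> * k))) \<le> C * M"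
          by (simp add: C_def mult_ac)
      qed
      finally show ?thesis .
    qed
    have "(\<integral>\<^sup>+x. ennreal (\<bar>\<phi> x\<bar> powr q) \<partial>lborel)
        = (\<integral>\<^sup>+x. liminf (\<lambda>m. ennreal (\<bar>cube_avg m \<phi> x\<bar> powr q)) \<partial>lborel)"
    proof (rule nn_integral_cong)
      fix x
      have "(\<lambda>m. ennreal (\<bar>cube_avg m \<phi> x\<bar> powr q)) \<longlonglongrightarrow> ennreal (\<bar>\<phi> x\<bar> powr q)"
        using q by (intro tendsto_ennrealI tendsto_powr' tendsto_rabs cube_avg_tendsto[OF t] tendsto_const) auto
      then show "ennreal (\<bar>\<phi> x\<bar> powr q) = liminf (\<lambda>m. ennreal (\<bar>cube_avg m \<phi> x\<bar> powr q))"
        by (rule lim_imp_Liminf[symmetric, rotated]) simp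
    qed
    also have "\<dots> \<le> liminf (\<lambda>m. \<integral>\<^sup>+x. ennreal (\<bar>cube_avg m \<phi> x\<bar> powr q) \<partial>lborel)"
      by (rule nn_integral_liminf) measurable
    also have "\<dots> \<le> ennreal (C * M)"
      by (rule Liminf_le) (auto intro: bound always_eventually)
    finally show "(\<integral>\<^sup>+x. ennreal (\<bar>\<phi> x\<bar> powr q) \<partial>lborel) \<le> ennreal (C * norm (hc \<phi>) powr q)"
      by (simp add: M_def)
  qed
qed

text \<open>Convergence in \<open>H10\<close> gives a subsequence of test functions converging
  almost everywhere, along which Fatou's lemma carries the inequality to the limit.\<close>

lemma sobolev:
  fixes q :: real
  assumes q: "q \<ge> 2" and sub: "DIM('a) * (q - 2) / 2 < q"
  obtains C where "C \<ge> 0" "\<And>u. u \<in> H10 \<Omega> \<Longrightarrow>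
    (\<integral>\<^sup>+x. ennreal (\<bar>u x\<bar> powr q) \<partial>lebesgue_on \<Omega>) \<le> ennreal (C * norm (hc u) powr q)"
proof -
  obtain C where C: "C \<ge> 0" "\<And>\<phi>. \<phi> \<in> test_functions \<Omega> \<Longrightarrow>
    (\<integral>\<^sup>+x. ennreal (\<bar>\<phi> x\<bar> powr q) \<partial>lborel) \<le> ennreal (C * norm (hc \<phi>) powr q)"
    using sobolev_test[OF q sub] by metis
  show ?thesis
  proof (rule that[OF C(1)])
    fix u assume u: "u \<in> H10 \<Omega>"
    then have "hc u \<in> HS" by (simp add: HS_def)
    then obtain \<phi> where \<phi>: "\<And>k. \<phi> k \<in> test_functions \<Omega>" "(\<lambda>k. hc (\<phi> k)) \<longlonglongrightarrow> hc u"
      using HS_sequence by metis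
    let ?M = "lebesgue_on \<Omega>"
    have L: "u \<in> L2 \<Omega>" "\<phi> k \<in> L2 \<Omega>" for k using u \<phi>(1) H1_L2 H10_H1 test_L2[OF \<Omega>(1)] by auto
    then have [measurable]: "u \<in> borel_measurable ?M" "\<phi> k \<in> borel_measurable ?M" for k
      by (auto simp: L2_def)
    have dL: "(\<lambda>x. \<phi> k x - u x) \<in> L2 \<Omega>" for k using L by (intro L2_diff)
    have int: "integrable ?M (\<lambda>x. (\<phi> k x - u x)\<^sup>2)" for k using dL[of k] by (simp add: L2_def)
    have "(\<integral>x. norm ((\<phi> k x - u x)\<^sup>2) \<partial>?M) = (norm (cls \<Omega> (\<phi> k) - cls \<Omega> u))\<^sup>2" for k
      using norm_cls[OF m\<Omega> dL[of k]] cls_diff[OF m\<Omega> L(2)[of k] L(1)] by (simp add: L2_norm_def)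
    moreover have "(\<lambda>k. (norm (cls \<Omega> (\<phi> k) - cls \<Omega> u))\<^sup>2) \<longlonglongrightarrow> 0\<^sup>2"
      using tendsto_fst[OF \<phi>(2)] by (intro tendsto_power tendsto_norm_zero LIM_zero) (simp add: hc_def)
    ultimately have "(\<lambda>k. \<integral>x. norm ((\<phi> k x - u x)\<^sup>2) \<partial>?M) \<longlonglongrightarrow> 0" by simp
    from tendsto_L1_AE_subseq[OF int this]
    obtain r where r: "strict_mono r" and ae: "AE x in ?M. (\<lambda>n. (\<phi> (r n) x - u x)\<^sup>2) \<longlonglongrightarrow> 0" by auto
    have "(\<integral>\<^sup>+x. ennreal (\<bar>u x\<bar> powr q) \<partial>?M) = (\<integral>\<^sup>+x. liminf (\<lambda>n. ennreal (\<bar>\<phi> (r n) x\<bar> powr q)) \<partial>?M)"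
    proof (rule nn_integral_cong_AE, use ae in eventually_elim)
      fix x assume "(\<lambda>n. (\<phi> (r n) x - u x)\<^sup>2) \<longlonglongrightarrow> 0"
      then have "(\<lambda>n. sqrt ((\<phi> (r n) x - u x)\<^sup>2)) \<longlonglongrightarrow> sqrt 0" by (rule tendsto_real_sqrt)
      then have "(\<lambda>n. \<phi> (r n) x - u x) \<longlonglongrightarrow> 0" by (simp add: tendsto_rabs_zero_iff)
      then have "(\<lambda>n. \<phi> (r n) x) \<longlonglongrightarrow> u x" by (simp add: LIM_zero_iff)
      then have "(\<lambda>n. ennreal (\<bar>\<phi> (r n) x\<bar> powr q)) \<longlonglongrightarrow> ennreal (\<bar>u x\<bar> powr q)"
        using q by (intro tendsto_ennrealI tendsto_powr' tendsto_rabs tendsto_const) auto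
      then show "ennreal (\<bar>u x\<bar> powr q) = liminf (\<lambda>n. ennreal (\<bar>\<phi> (r n) x\<bar> powr q))"
        by (rule lim_imp_Liminf[symmetric, rotated]) simp
    qed
    also have "\<dots> \<le> liminf (\<lambda>n. \<integral>\<^sup>+x. ennreal (\<bar>\<phi> (r n) x\<bar> powr q) \<partial>?M)"
      by (rule nn_integral_liminf) measurable
    also have "\<dots> \<le> liminf (\<lambda>n. ennreal (C * norm (hc (\<phi> (r n))) powr q))"
    proof (rule Liminf_mono, rule always_eventually, rule allI)
      fix n
      have [measurable]: "\<phi> (r n) \<in> borel_measurable borel" using \<phi>(1) by (rule test_borel)
      have "(\<integral>\<^sup>+x. ennreal (\<bar>\<phi> (r n) x\<bar> powr q) \<partial>?M) \<le> (\<integral>\<^sup>+x. ennreal (\<bar>\<phi> (r n) x\<bar> powr q) \<partial>lebesgue)"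
        using m\<Omega> by (subst nn_integral_restrict_space) (auto intro!: nn_integral_mono simp: indicator_def)
      also have "\<dots> = (\<integral>\<^sup>+x. ennreal (\<bar>\<phi> (r n) x\<bar> powr q) \<partial>lborel)" by (rule nn_integral_completion)
      also have "\<dots> \<le> ennreal (C * norm (hc (\<phi> (r n))) powr q)" by (rule C(2)[OF \<phi>(1)])
      finally show "(\<integral>\<^sup>+x. ennreal (\<bar>\<phi> (r n) x\<bar> powr q) \<partial>?M) \<le> ennreal (C * norm (hc (\<phi> (r n))) powr q)" .
    qed
    also have "\<dots> = ennreal (C * norm (hc u) powr q)"
    proof (rule lim_imp_Liminf)
      have "(\<lambda>n. norm (hc (\<phi> (r n)))) \<longlonglongrightarrow> norm (hc u)"
        using LIMSEQ_subseq_LIMSEQ[OF tendsto_norm[OF \<phi>(2)] r] by (simp add: o_def)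
      then show "(\<lambda>n. ennreal (C * norm (hc (\<phi> (r n))) powr q)) \<longlonglongrightarrow> ennreal (C * norm (hc u) powr q)"
        using q by (intro tendsto_ennrealI tendsto_mult tendsto_powr' tendsto_const) auto
    qed simp
    finally show "(\<integral>\<^sup>+x. ennreal (\<bar>u x\<bar> powr q) \<partial>lebesgue_on \<Omega>) \<le> ennreal (C * norm (hc u) powr q)" .
  qed
qed

end


subsection \<open>The nonlinearity\<close>

text \<open>A logarithm costs an arbitrarily small power, at infinity as at zero: bound ln(y^d) by
  y^d, and use the reciprocal for arguments below 1.\<close>

lemma abs_ln_le:
  fixes x d :: real
  assumes "x > 0" "d > 0"
  shows "x \<ge> 1 \<Longrightarrow> \<bar>ln x\<bar> \<le> x powr d / d" "x \<le> 1 \<Longrightarrow> \<bar>ln x\<bar> \<le> x powr (- d) / d"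
proof -
  have le: "ln y \<le> y powr d / d" if "y \<ge> 1" for y
  proof -
    have "ln (y powr d) \<le> y powr d" using that by (intro ln_bound) auto
    then show ?thesis using assms that by (simp add: ln_powr field_simps)
  qed
  show "x \<ge> 1 \<Longrightarrow> \<bar>ln x\<bar> \<le> x powr d / d" using le[of x] by simp
  assume "x \<le> 1"
  then have "inverse x \<ge> 1" using assms one_le_inverse by blast
  from le[OF this] show "\<bar>ln x\<bar> \<le> x powr (- d) / d"
    using assms \<open>x \<le> 1\<close> by (simp add: ln_inverse powr_minus inverse_powr abs_if ln_le_zero_iff)
qed

lemma DERIV_zero_at_zero:
  fixes g :: "real \<Rightarrow> real"
  assumes "g 0 = 0" and "\<And>h. h \<noteq> 0 \<Longrightarrow> \<bar>h\<bar> \<le> 1 \<Longrightarrow> \<bar>g h\<bar> \<le> K * (\<bar>h\<bar> * \<bar>h\<bar> powr e)" and "e > 0"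
  shows "(g has_real_derivative 0) (at 0)"
proof -
  have "(\<lambda>h. (g (0 + h) - g 0) / h) \<midarrow>0\<rightarrow> 0"
  proof (rule Lim_null_comparison[where g = "\<lambda>h. K * \<bar>h\<bar> powr e"])
    have "\<forall>\<^sub>F h in at (0::real). h \<noteq> 0 \<and> \<bar>h\<bar> \<le> 1"
      unfolding eventually_at by (intro exI[of _ 1]) (auto simp: dist_real_def)
    then show "\<forall>\<^sub>F h in at 0. norm ((g (0 + h) - g 0) / h) \<le> K * \<bar>h\<bar> powr e"
    proof eventually_elim
      case (elim h)
      then show ?case using assms(1) assms(2)[of h] by (simp add: field_simps)
    qed
    have "((\<lambda>h::real. \<bar>h\<bar> powr e) \<longlongrightarrow> \<bar>0\<bar> powr e) (at 0)"
      by (intro tendsto_powr' tendsto_rabs tendsto_ident_at tendsto_const) (use assms(3) in auto)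
    then have "(\<lambda>h. \<bar>h\<bar> powr e) \<midarrow>0\<rightarrow> (0::real)" by simp
    then show "(\<lambda>h. K * \<bar>h\<bar> powr e) \<midarrow>0\<rightarrow> 0" by (rule tendsto_mult_right_zero)
  qed
  then show ?thesis by (simp add: DERIV_def)
qed

lemma abs_powr_split: "s \<noteq> 0 \<Longrightarrow> \<bar>s\<bar> powr p = \<bar>s\<bar> powr (p - 2) * s\<^sup>2" for s p :: real
  using powr_add[of "\<bar>s\<bar>" "p - 2" 2] by simp

lemma has_real_derivative_abs: "s \<noteq> 0 \<Longrightarrow> (abs has_real_derivative sgn s) (at s)" for s :: real
proof -
  assume s: "s \<noteq> 0"
  show ?thesis
  proof (cases "s > 0")
    case True
    have "((\<lambda>s. s) has_real_derivative sgn s) (at s)" using True by (auto intro!: derivative_eq_intros)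
    then show ?thesis
      by (rule has_field_derivative_transform_within_open[of _ _ _ "{0<..}"]) (use True in auto)
  next
    case False
    have "((\<lambda>s. - s) has_real_derivative sgn s) (at s)" using False s by (auto intro!: derivative_eq_intros)
    then show ?thesis
      by (rule has_field_derivative_transform_within_open[of _ _ _ "{..<0}"]) (use False s in auto)
  qed
qed

lemma has_real_derivative_ln_abs: "s \<noteq> 0 \<Longrightarrow> ((\<lambda>s. ln \<bar>s\<bar>) has_real_derivative 1 / s) (at s)" for s :: real
  by (rule DERIV_cong[OF DERIV_chain2[OF DERIV_ln has_real_derivative_abs]]) (auto simp: sgn_if field_simps)

lemma has_real_derivative_abs_powr:
  fixes s p :: real
  assumes "s \<noteq> 0"
  shows "((\<lambda>s. \<bar>s\<bar> powr p) has_real_derivative p * \<bar>s\<bar> powr (p - 2) * s) (at s)"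
proof -
  have "((\<lambda>s. exp (p * ln \<bar>s\<bar>)) has_real_derivative exp (p * ln \<bar>s\<bar>) * (p * (1 / s))) (at s)"
    by (intro DERIV_chain2[OF DERIV_exp] DERIV_cmult has_real_derivative_ln_abs assms)
  then have "((\<lambda>s. \<bar>s\<bar> powr p) has_real_derivative exp (p * ln \<bar>s\<bar>) * (p * (1 / s))) (at s)"
    by (rule has_field_derivative_transform_within_open[of _ _ _ "- {0}"]) (use assms in \<open>auto simp: powr_def\<close>)
  moreover have "exp (p * ln \<bar>s\<bar>) = \<bar>s\<bar> powr (p - 2) * s\<^sup>2"
    using abs_powr_split[OF assms, of p] assms by (simp add: powr_def)
  ultimately show ?thesis using assms by (simp add: power2_eq_square mult_ac)
qed

lemma src_0 [simp]: "src g 0 = 0" by (simp add: src_def)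

lemma src_times: "src g s * s = \<bar>s\<bar> powr g * ln \<bar>s\<bar>"
proof (cases "s = 0")
  case False
  then show ?thesis by (simp add: src_def abs_powr_split[OF False, of g] power2_eq_square)
qed simp

definition src' :: "real \<Rightarrow> real \<Rightarrow> real" where
  "src' g s = \<bar>s\<bar> powr (g - 2) * ((g - 1) * ln \<bar>s\<bar> + 1)"

lemma src_has_derivative:
  assumes g: "g > 2" shows "(src g has_real_derivative src' g s) (at s)"
proof (cases "s = 0")
  case False
  have "((\<lambda>s. (\<bar>s\<bar> powr (g - 2) * s) * ln \<bar>s\<bar>) has_real_derivative
      (((g - 2) * \<bar>s\<bar> powr (g - 2 - 2) * s) * s + \<bar>s\<bar> powr (g - 2)) * ln \<bar>s\<bar> + (\<bar>s\<bar> powr (g - 2) * s) * (1 / s)) (at s)"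
    by (rule DERIV_cong[OF DERIV_mult[OF DERIV_mult[OF has_real_derivative_abs_powr[OF False] DERIV_ident]
          has_real_derivative_ln_abs[OF False]]]) simp
  moreover have "\<bar>s\<bar> powr (g - 2 - 2) * s * s = \<bar>s\<bar> powr (g - 2)"
    using abs_powr_split[OF False, of "g - 2"] by (simp add: power2_eq_square mult.assoc)
  then have "(((g - 2) * \<bar>s\<bar> powr (g - 2 - 2) * s) * s + \<bar>s\<bar> powr (g - 2)) * ln \<bar>s\<bar> + (\<bar>s\<bar> powr (g - 2) * s) * (1 / s) = src' g s"
    using False unfolding src'_def by (simp add: algebra_simps)
  ultimately show ?thesis unfolding src_def[abs_def] by simp
next
  case True
  define e where "e = (g - 2) / 2"
  have e: "e > 0" using g by (simp add: e_def)
  have "(src g has_real_derivative 0) (at 0)"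
  proof (rule DERIV_zero_at_zero[where K = "1 / e" and e = e])
    fix h :: real assume h: "h \<noteq> 0" "\<bar>h\<bar> \<le> 1"
    have "\<bar>src g h\<bar> = \<bar>h\<bar> powr (g - 2) * \<bar>h\<bar> * \<bar>ln \<bar>h\<bar>\<bar>" by (simp add: src_def abs_mult)
    also have "\<dots> \<le> \<bar>h\<bar> powr (g - 2) * \<bar>h\<bar> * (\<bar>h\<bar> powr (- e) / e)"
      using abs_ln_le(2)[of "\<bar>h\<bar>" e] h e by (intro mult_left_mono) auto
    also have "\<dots> = 1 / e * (\<bar>h\<bar> * (\<bar>h\<bar> powr (g - 2) * \<bar>h\<bar> powr (- e)))" by simp
    also have "\<bar>h\<bar> powr (g - 2) * \<bar>h\<bar> powr (- e) = \<bar>h\<bar> powr e"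
      unfolding powr_add[symmetric] by (rule arg_cong[where f = "\<lambda>y. \<bar>h\<bar> powr y"]) (simp add: e_def field_simps)
    finally show "\<bar>src g h\<bar> \<le> 1 / e * (\<bar>h\<bar> * \<bar>h\<bar> powr e)" .
  qed (use e in auto)
  then show ?thesis using True by (simp add: src'_def)
qed

lemma continuous_on_src: "g > 2 \<Longrightarrow> continuous_on A (src g)"
  using src_has_derivative DERIV_isCont by (meson continuous_at_imp_continuous_on)

text \<open>For |s| >= 1 the logarithm is absorbed by the surplus power \<sigma> - (g - 2), and for
  |s| <= 1 by the power g - 2 in front of it. These two exponents are the denominators in the
  constant, and the final 1 accounts for the term without logarithm.\<close>

lemma src'_bound:
  fixes g \<sigma> :: real
  assumes g: "g > 2" and \<sigma>: "\<sigma> > g - 2"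
  shows "\<bar>src' g s\<bar> \<le> ((g - 1) * (1 / (\<sigma> - (g - 2)) + 1 / (g - 2)) + 1) * (1 + \<bar>s\<bar>) powr \<sigma>"
proof (cases "s = 0")
  case False
  define x where "x = \<bar>s\<bar>"
  have x: "x > 0" using False by (simp add: x_def)
  define d where "d = \<sigma> - (g - 2)"
  have d: "d > 0" using \<sigma> by (simp add: d_def)
  define P where "P = (1 + x) powr \<sigma>"
  have P1: "P \<ge> 1" using x g \<sigma> by (auto simp: P_def intro: ge_one_powr_ge_zero)
  have xg: "x powr (g - 2) \<le> P"
  proof -
    have "x powr (g - 2) \<le> (1 + x) powr (g - 2)" using x g by (intro powr_mono2) auto
    also have "\<dots> \<le> P" unfolding P_def using x \<sigma> by (intro powr_mono) auto
    finally show ?thesis .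
  qed
  have l: "x powr (g - 2) * \<bar>ln x\<bar> \<le> (1 / d + 1 / (g - 2)) * P"
  proof (cases "x \<ge> 1")
    case True
    have "x powr (g - 2) * \<bar>ln x\<bar> \<le> x powr (g - 2) * (x powr d / d)"
      using abs_ln_le(1)[OF x d True] by (intro mult_left_mono) auto
    also have "\<dots> = x powr \<sigma> / d" by (simp add: d_def flip: powr_add)
    also have "\<dots> \<le> P / d" unfolding P_def using x d g \<sigma> by (intro divide_right_mono powr_mono2) auto
    also have "\<dots> \<le> (1 / d + 1 / (g - 2)) * P" using P1 g by (simp add: distrib_right)
    finally show ?thesis .
  next
    case False
    then have "x powr (g - 2) * \<bar>ln x\<bar> \<le> x powr (g - 2) * (x powr (- (g - 2)) / (g - 2))"
      using abs_ln_le(2)[OF x, of "g - 2"] g by (intro mult_left_mono) auto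
    also have "\<dots> = (x powr (g - 2) * x powr (- (g - 2))) / (g - 2)" by simp
    also have "x powr (g - 2) * x powr (- (g - 2)) = 1" using x unfolding powr_add[symmetric] by simp
    also have "1 / (g - 2) \<le> (1 / d + 1 / (g - 2)) * P"
    proof -
      have "1 / (g - 2) \<le> (1 / (g - 2)) * P" using P1 g by (simp add: divide_right_mono)
      also have "\<dots> \<le> (1 / d + 1 / (g - 2)) * P" using P1 d by (intro mult_right_mono) auto
      finally show ?thesis .
    qed
    finally show ?thesis .
  qed
  have "\<bar>src' g s\<bar> = x powr (g - 2) * \<bar>(g - 1) * ln x + 1\<bar>" by (simp add: src'_def abs_mult x_def)
  also have "\<dots> \<le> x powr (g - 2) * ((g - 1) * \<bar>ln x\<bar> + 1)"
    using g abs_triangle_ineq[of "(g - 1) * ln x" 1] by (intro mult_left_mono) (auto simp: abs_mult)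
  also have "\<dots> = (g - 1) * (x powr (g - 2) * \<bar>ln x\<bar>) + x powr (g - 2)" by (simp add: algebra_simps)
  also have "\<dots> \<le> (g - 1) * ((1 / d + 1 / (g - 2)) * P) + P"
    using l xg g by (intro add_mono mult_left_mono) auto
  finally show ?thesis by (simp add: P_def x_def d_def algebra_simps)
qed (use assms in \<open>auto simp: src'_def intro!: add_nonneg_nonneg mult_nonneg_nonneg\<close>)

text \<open>The closed form is differentiated everywhere, at the origin by comparison with |h|^2,
  and the fundamental theorem then identifies it with the integral defining
  \<open>Src\<close>.\<close>

lemma Src_closed_form:
  assumes g: "g > 2"
  shows "Src g s = 1 / g * (\<bar>s\<bar> powr g * ln \<bar>s\<bar>) - 1 / g\<^sup>2 * \<bar>s\<bar> powr g"
    and "(Src g has_real_derivative src g s) (at s)"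
proof -
  define G where "G = (\<lambda>s::real. 1 / g * (\<bar>s\<bar> powr g * ln \<bar>s\<bar>) - 1 / g\<^sup>2 * \<bar>s\<bar> powr g)"
  have G': "(G has_real_derivative src g s) (at s)" for s
  proof (cases "s = 0")
    case False
    note D = has_real_derivative_abs_powr[OF False, of g] and L = has_real_derivative_ln_abs[OF False]
    have "(G has_real_derivative 1 / g * ((g * \<bar>s\<bar> powr (g - 2) * s) * ln \<bar>s\<bar> + \<bar>s\<bar> powr g * (1 / s))
        - 1 / g\<^sup>2 * (g * \<bar>s\<bar> powr (g - 2) * s)) (at s)"
      unfolding G_def
      by (rule DERIV_cong[OF DERIV_diff[OF DERIV_cmult[OF DERIV_mult[OF D L]] DERIV_cmult[OF D]]]) simp
    moreover have "\<bar>s\<bar> powr g * (1 / s) = \<bar>s\<bar> powr (g - 2) * s"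
      using abs_powr_split[OF False, of g] False by (simp add: power2_eq_square)
    moreover have "1 / g * ((g * p * s) * l + p * s) - 1 / g\<^sup>2 * (g * p * s) = p * s * l" for p l :: real
      using g by (simp add: power2_eq_square field_simps)
    ultimately show ?thesis by (simp add: src_def)
  next
    case True
    have "(G has_real_derivative 0) (at 0)"
    proof (rule DERIV_zero_at_zero[where K = "1 / g * (1 / (g - 2)) + 1 / g\<^sup>2" and e = 1])
      fix h :: real assume h: "h \<noteq> 0" "\<bar>h\<bar> \<le> 1"
      have a: "\<bar>h\<bar> powr g \<le> \<bar>h\<bar> * \<bar>h\<bar> powr 1"
      proof -
        have "\<bar>h\<bar> powr g \<le> \<bar>h\<bar> powr 2" using h g by (intro powr_mono') auto
        then show ?thesis using h by (simp add: power2_eq_square)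
      qed
      have b: "\<bar>h\<bar> powr g * \<bar>ln \<bar>h\<bar>\<bar> \<le> 1 / (g - 2) * (\<bar>h\<bar> * \<bar>h\<bar> powr 1)"
      proof -
        have "\<bar>h\<bar> powr g * \<bar>ln \<bar>h\<bar>\<bar> \<le> \<bar>h\<bar> powr g * (\<bar>h\<bar> powr (- (g - 2)) / (g - 2))"
          using abs_ln_le(2)[of "\<bar>h\<bar>" "g - 2"] h g by (intro mult_left_mono) auto
        also have "\<dots> = (\<bar>h\<bar> powr g * \<bar>h\<bar> powr (- (g - 2))) / (g - 2)" by simp
        also have "\<bar>h\<bar> powr g * \<bar>h\<bar> powr (- (g - 2)) = \<bar>h\<bar> powr 2" unfolding powr_add[symmetric] by simp
        finally show ?thesis using h by (simp add: power2_eq_square)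
      qed
      have "\<bar>G h\<bar> \<le> 1 / g * (\<bar>h\<bar> powr g * \<bar>ln \<bar>h\<bar>\<bar>) + 1 / g\<^sup>2 * \<bar>h\<bar> powr g"
        unfolding G_def using abs_triangle_ineq4[of "1 / g * (\<bar>h\<bar> powr g * ln \<bar>h\<bar>)" "1 / g\<^sup>2 * \<bar>h\<bar> powr g"] g
        by (simp add: abs_mult)
      also have "\<dots> \<le> 1 / g * (1 / (g - 2) * (\<bar>h\<bar> * \<bar>h\<bar> powr 1)) + 1 / g\<^sup>2 * (\<bar>h\<bar> * \<bar>h\<bar> powr 1)"
        using a b g by (intro add_mono mult_left_mono) auto
      finally show "\<bar>G h\<bar> \<le> (1 / g * (1 / (g - 2)) + 1 / g\<^sup>2) * (\<bar>h\<bar> * \<bar>h\<bar> powr 1)"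
        by (simp add: distrib_right mult.assoc)
    qed (auto simp: G_def)
    then show ?thesis using True by simp
  qed
  have eq: "Src g = G"
  proof
    fix s
    have "(LBINT x=ereal 0..ereal s. src g x) = G s - G 0"
    proof (rule interval_integral_FTC_finite)
      show "continuous_on {min 0 s..max 0 s} (src g)" by (rule continuous_on_src[OF g])
      show "(G has_vector_derivative src g x) (at x within {min 0 s..max 0 s})" for x
        using G'[of x] by (simp add: has_real_derivative_iff_has_vector_derivative has_vector_derivative_at_within)
    qed
    then show "Src g s = G s" by (simp add: Src_def G_def zero_ereal_def)
  qed
  show "Src g s = 1 / g * (\<bar>s\<bar> powr g * ln \<bar>s\<bar>) - 1 / g\<^sup>2 * \<bar>s\<bar> powr g" by (simp add: eq G_def)
  show "(Src g has_real_derivative src g s) (at s)" by (simp add: eq G')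
qed

text \<open>The mean value theorem is used twice: for \<open>src\<close>, and then for
  \<open>Src\<close> minus its tangent part at r, whose derivative is a difference of
  \<open>src\<close> already estimated. Hence the remainder is quadratic in s - r.\<close>

lemma src_lipschitz:
  assumes g: "g > 2" and \<sigma>: "\<sigma> > g - 2"
  obtains C where "C \<ge> 0" "\<And>s r. \<bar>src g s - src g r\<bar> \<le> C * (\<bar>s - r\<bar> * (1 + \<bar>s\<bar> + \<bar>r\<bar>) powr \<sigma>)"
    "\<And>s r. \<bar>Src g s - Src g r - src g r * (s - r)\<bar> \<le> C * (\<bar>s - r\<bar> * (\<bar>s - r\<bar> * (1 + \<bar>s\<bar> + \<bar>r\<bar>) powr \<sigma>))"
proof -
  define C where "C = (g - 1) * (1 / (\<sigma> - (g - 2)) + 1 / (g - 2)) + 1"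
  have C: "C \<ge> 0" using g \<sigma> by (auto simp: C_def intro!: add_nonneg_nonneg mult_nonneg_nonneg)
  have mvt: "\<exists>z. \<bar>z\<bar> \<le> max \<bar>s\<bar> \<bar>r\<bar> \<and> \<bar>z - r\<bar> \<le> \<bar>s - r\<bar> \<and> \<bar>h s - h r\<bar> = \<bar>s - r\<bar> * \<bar>h' z\<bar>"
    if h: "\<And>x. (h has_real_derivative h' x) (at x)" for h h' :: "real \<Rightarrow> real" and s r
  proof -
    consider "s < r" | "s = r" | "r < s" by linarith
    then show ?thesis
    proof cases
      case 1
      obtain z where "z > s" "z < r" "h r - h s = (r - s) * h' z" using MVT2[OF 1, of h h'] h by metis
      then show ?thesis by (intro exI[of _ z]) (auto simp: abs_mult abs_minus_commute[of "h s"])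
    next
      case 3
      obtain z where "z > r" "z < s" "h s - h r = (s - r) * h' z" using MVT2[OF 3, of h h'] h by metis
      then show ?thesis by (intro exI[of _ z]) (auto simp: abs_mult)
    qed (auto intro: exI[of _ r])
  qed
  have lip: "\<bar>src g s - src g r\<bar> \<le> C * (\<bar>s - r\<bar> * (1 + \<bar>s\<bar> + \<bar>r\<bar>) powr \<sigma>)" for s r
  proof -
    obtain z where z: "\<bar>z\<bar> \<le> max \<bar>s\<bar> \<bar>r\<bar>" "\<bar>src g s - src g r\<bar> = \<bar>s - r\<bar> * \<bar>src' g z\<bar>"
      using mvt[OF src_has_derivative[OF g]] by metis
    have "\<bar>src' g z\<bar> \<le> C * (1 + \<bar>z\<bar>) powr \<sigma>" unfolding C_def by (rule src'_bound[OF g \<sigma>])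
    also have "\<dots> \<le> C * (1 + \<bar>s\<bar> + \<bar>r\<bar>) powr \<sigma>"
    proof (intro mult_left_mono powr_mono2)
      show "1 + \<bar>z\<bar> \<le> 1 + \<bar>s\<bar> + \<bar>r\<bar>" using z(1) by linarith
    qed (use C g \<sigma> in auto)
    finally have "\<bar>s - r\<bar> * \<bar>src' g z\<bar> \<le> \<bar>s - r\<bar> * (C * (1 + \<bar>s\<bar> + \<bar>r\<bar>) powr \<sigma>)"
      by (intro mult_left_mono) auto
    then show ?thesis using z by (simp add: mult_ac)
  qed
  \<comment> \<open>In the second estimate \<open>src\<close> is evaluated at an intermediate point
    z, and 1 + |z| + |r| is at most twice 1 + |s| + |r|. The factor 2 is raised to the power
    \<sigma>.\<close>
  define C2 where "C2 = C * 2 powr \<sigma>"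
  have "C * 1 \<le> C2" unfolding C2_def using C g \<sigma> by (intro mult_left_mono ge_one_powr_ge_zero) auto
  then have C2: "C \<le> C2" "C2 \<ge> 0" using C by auto
  show ?thesis
  proof (rule that[OF C2(2)])
    fix s r
    define P where "P = (1 + \<bar>s\<bar> + \<bar>r\<bar>) powr \<sigma>"
    have "C * (\<bar>s - r\<bar> * P) \<le> C2 * (\<bar>s - r\<bar> * P)"
      using C2 by (intro mult_right_mono) (auto simp: P_def)
    then show "\<bar>src g s - src g r\<bar> \<le> C2 * (\<bar>s - r\<bar> * (1 + \<bar>s\<bar> + \<bar>r\<bar>) powr \<sigma>)"
      using lip[of s r] by (simp add: P_def)
    let ?h = "\<lambda>x. Src g x - src g r * x"
    have "(?h has_real_derivative (src g x - src g r)) (at x)" for x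
      by (auto intro!: derivative_eq_intros Src_closed_form(2)[OF g])
    from mvt[OF this, of s r] obtain z where z: "\<bar>z\<bar> \<le> max \<bar>s\<bar> \<bar>r\<bar>" "\<bar>z - r\<bar> \<le> \<bar>s - r\<bar>"
      "\<bar>?h s - ?h r\<bar> = \<bar>s - r\<bar> * \<bar>src g z - src g r\<bar>" by auto
    have "\<bar>src g z - src g r\<bar> \<le> C * (\<bar>z - r\<bar> * (1 + \<bar>z\<bar> + \<bar>r\<bar>) powr \<sigma>)" by (rule lip)
    also have "\<dots> \<le> C * (\<bar>s - r\<bar> * (2 * (1 + \<bar>s\<bar> + \<bar>r\<bar>)) powr \<sigma>)"
    proof (intro mult_left_mono mult_mono powr_mono2)
      have "\<bar>z\<bar> \<le> \<bar>s\<bar> + \<bar>r\<bar>" using z(1) by linarith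
      then show "1 + \<bar>z\<bar> + \<bar>r\<bar> \<le> 2 * (1 + \<bar>s\<bar> + \<bar>r\<bar>)"
        using abs_ge_zero[of s] unfolding distrib_left by linarith
    qed (use z(2) C g \<sigma> in auto)
    also have "(2 * (1 + \<bar>s\<bar> + \<bar>r\<bar>)) powr \<sigma> = 2 powr \<sigma> * P" unfolding P_def by (rule powr_mult)
    also have "C * (\<bar>s - r\<bar> * (2 powr \<sigma> * P)) = C2 * (\<bar>s - r\<bar> * P)" by (simp add: C2_def)
    finally have "\<bar>s - r\<bar> * \<bar>src g z - src g r\<bar> \<le> \<bar>s - r\<bar> * (C2 * (\<bar>s - r\<bar> * P))"
      by (intro mult_left_mono) auto
    moreover have "\<bar>Src g s - Src g r - src g r * (s - r)\<bar> = \<bar>?h s - ?h r\<bar>"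
      by (rule arg_cong[where f = abs]) (simp add: algebra_simps)
    ultimately show "\<bar>Src g s - Src g r - src g r * (s - r)\<bar>
        \<le> C2 * (\<bar>s - r\<bar> * (\<bar>s - r\<bar> * (1 + \<bar>s\<bar> + \<bar>r\<bar>) powr \<sigma>))"
      using z(3) by (simp add: P_def mult_ac)
  qed
qed


section \<open>The source term as a map from \<open>H10\<close> to L2\<close>

locale subcritical = bounded_open_set \<Omega> for \<Omega> :: "'a::euclidean_space set" +
  fixes \<gamma> \<sigma> :: real
  assumes \<gamma>: "\<gamma> > 2" and \<sigma>: "\<sigma> > \<gamma> - 2" and sub: "real DIM('a) * \<sigma> < 2 * \<sigma> + 2"
begin

text \<open>The exponent at which a product v |u|^\<sigma> is square integrable. For it,
  \<open>sub\<close> is literally the subcriticality condition of \<open>sobolev\<close>.\<close>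

definition sq :: real where "sq = 2 * (\<sigma> + 1)"

lemma sq2: "sq > 2" using \<gamma> \<sigma> by (simp add: sq_def)

lemma \<sigma>_pos: "\<sigma> > 0" using \<gamma> \<sigma> by simp

abbreviation "M \<equiv> lebesgue_on \<Omega>"

lemma fin: "finite_measure M"
  by (rule finite_measure_lebesgue_on[OF bounded_set_imp_lmeasurable[OF \<Omega>(2) m\<Omega>]])

lemma measurable_H10: "u \<in> H10 \<Omega> \<Longrightarrow> u \<in> borel_measurable M"
  using H1_L2[OF H10_H1] by (auto simp: L2_def)

lemma sobolev_integral:
  obtains C where "C \<ge> 0" "\<And>u. u \<in> H10 \<Omega> \<Longrightarrow> integrable M (\<lambda>x. \<bar>u x\<bar> powr sq)"
    "\<And>u. u \<in> H10 \<Omega> \<Longrightarrow> (\<integral>x. \<bar>u x\<bar> powr sq \<partial>M) \<le> C * norm (hc u) powr sq"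
proof -
  have "real DIM('a) * (sq - 2) / 2 < sq" using sub by (simp add: sq_def algebra_simps)
  then obtain C where C: "C \<ge> 0" "\<And>u. u \<in> H10 \<Omega> \<Longrightarrow>
    (\<integral>\<^sup>+x. ennreal (\<bar>u x\<bar> powr sq) \<partial>M) \<le> ennreal (C * norm (hc u) powr sq)"
    using sobolev[of sq] sq2 by (metis less_imp_le)
  show ?thesis
  proof (rule that[OF C(1)])
    fix u assume u: "u \<in> H10 \<Omega>"
    have [measurable]: "u \<in> borel_measurable M" by (rule measurable_H10[OF u])
    have "(\<integral>\<^sup>+x. ennreal (\<bar>u x\<bar> powr sq) \<partial>M) < \<infinity>"
      using C(2)[OF u] by (rule le_less_trans) simp
    then show int: "integrable M (\<lambda>x. \<bar>u x\<bar> powr sq)"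
      by (subst integrable_iff_bounded) simp
    have "ennreal (\<integral>x. \<bar>u x\<bar> powr sq \<partial>M) \<le> ennreal (C * norm (hc u) powr sq)"
      using C(2)[OF u] nn_integral_eq_integral[OF int] by simp
    then show "(\<integral>x. \<bar>u x\<bar> powr sq \<partial>M) \<le> C * norm (hc u) powr sq"
      using C(1) by (subst (asm) ennreal_le_iff) auto
  qed
qed

lemma weight_powr_le:
  fixes a b :: real
  assumes "a \<ge> 0" "b \<ge> 0"
  shows "(1 + a + b) powr sq \<le> 3 powr sq * (1 + a powr sq + b powr sq)"
proof -
  define m where "m = max 1 (max a b)"
  have "(1 + a + b) powr sq \<le> (3 * m) powr sq"
    using assms sq2 by (intro powr_mono2) (auto simp: m_def)
  also have "\<dots> = 3 powr sq * m powr sq" using assms by (simp add: powr_mult m_def)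
  also have "m powr sq \<le> 1 + a powr sq + b powr sq"
    by (auto simp: m_def max_def)
  finally show ?thesis by simp
qed

definition weight :: "('a \<Rightarrow> real) \<Rightarrow> ('a \<Rightarrow> real) \<Rightarrow> 'a \<Rightarrow> real" where
  "weight u v x = 1 + \<bar>v x\<bar> + \<bar>u x\<bar>"

text \<open>Up to the constant \<open>lip\<close>, the pointwise bound for the difference of the
  source terms of v and u. All estimates on f(u) and F(u) reduce to its L2 norm.\<close>

definition wdiff :: "('a \<Rightarrow> real) \<Rightarrow> ('a \<Rightarrow> real) \<Rightarrow> 'a \<Rightarrow> real" where
  "wdiff u v x = \<bar>v x - u x\<bar> * weight u v x powr \<sigma>"

lemma weight_integrable:
  assumes "u \<in> H10 \<Omega>" "v \<in> H10 \<Omega>"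
  shows "integrable M (\<lambda>x. weight u v x powr sq)"
    "(\<integral>x. weight u v x powr sq \<partial>M)
      \<le> 3 powr sq * (measure M (space M) + (\<integral>x. \<bar>v x\<bar> powr sq \<partial>M) + (\<integral>x. \<bar>u x\<bar> powr sq \<partial>M))"
proof -
  interpret finite_measure M by (rule fin)
  have [measurable]: "u \<in> borel_measurable M" "v \<in> borel_measurable M" using assms measurable_H10 by auto
  have i: "integrable M (\<lambda>x. \<bar>u x\<bar> powr sq)" "integrable M (\<lambda>x. \<bar>v x\<bar> powr sq)"
    using assms by (metis sobolev_integral)+
  have i3: "integrable M (\<lambda>x. 3 powr sq * (1 + \<bar>v x\<bar> powr sq + \<bar>u x\<bar> powr sq))"
    using i by (intro integrable_mult_right Bochner_Integration.integrable_add integrable_const)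
  have le: "weight u v x powr sq \<le> 3 powr sq * (1 + \<bar>v x\<bar> powr sq + \<bar>u x\<bar> powr sq)" for x
    unfolding weight_def by (rule weight_powr_le) auto
  show i1: "integrable M (\<lambda>x. weight u v x powr sq)"
    using le by (intro Bochner_Integration.integrable_bound[OF i3]) (auto simp: weight_def abs_le_iff intro!: AE_I2 order_trans[OF le])
  have "(\<integral>x. weight u v x powr sq \<partial>M) \<le> (\<integral>x. 3 powr sq * (1 + \<bar>v x\<bar> powr sq + \<bar>u x\<bar> powr sq) \<partial>M)"
    by (rule integral_mono[OF i1 i3 le])
  also have "\<dots> = 3 powr sq * (measure M (space M) + (\<integral>x. \<bar>v x\<bar> powr sq \<partial>M) + (\<integral>x. \<bar>u x\<bar> powr sq \<partial>M))"
    using i by simp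
  finally show "(\<integral>x. weight u v x powr sq \<partial>M)
      \<le> 3 powr sq * (measure M (space M) + (\<integral>x. \<bar>v x\<bar> powr sq \<partial>M) + (\<integral>x. \<bar>u x\<bar> powr sq \<partial>M))" .
qed

text \<open>This elementary inequality replaces Hoelder's inequality.\<close>

lemma wdiff_square_le:
  assumes "\<eta> > 0"
  shows "(wdiff u v x)\<^sup>2 \<le> \<eta>\<^sup>2 * weight u v x powr sq + \<eta> powr (- 2 * \<sigma>) * \<bar>v x - u x\<bar> powr sq"
proof -
  define d S where "d = \<bar>v x - u x\<bar>" and "S = weight u v x"
  have S: "S \<ge> 1" and d: "d \<ge> 0" by (auto simp: S_def weight_def d_def)
  have e: "(wdiff u v x)\<^sup>2 = d\<^sup>2 * S powr (2 * \<sigma>)"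
    by (simp add: wdiff_def d_def S_def power_mult_distrib power2_eq_square[of "_ powr _"] flip: powr_add)
  have sp: "S powr sq = S\<^sup>2 * S powr (2 * \<sigma>)"
  proof -
    have "S powr (2 + 2 * \<sigma>) = S powr 2 * S powr (2 * \<sigma>)" by (rule powr_add)
    then show ?thesis using S by (simp add: sq_def algebra_simps)
  qed
  show ?thesis
  proof (cases "d \<le> \<eta> * S")
    case True
    have "d\<^sup>2 * S powr (2 * \<sigma>) \<le> (\<eta> * S)\<^sup>2 * S powr (2 * \<sigma>)"
      using True d by (intro mult_right_mono power_mono) auto
    also have "\<dots> = \<eta>\<^sup>2 * S powr sq" by (simp add: sp power_mult_distrib)
    also have "\<dots> \<le> \<eta>\<^sup>2 * S powr sq + \<eta> powr (- 2 * \<sigma>) * d powr sq" by simp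
    finally show ?thesis by (simp add: e d_def S_def)
  next
    case False
    then have d0: "d > 0" using S assms by (smt (verit) mult_pos_pos)
    have "d\<^sup>2 * S powr (2 * \<sigma>) \<le> d\<^sup>2 * (d / \<eta>) powr (2 * \<sigma>)"
      using False S assms \<sigma>_pos by (intro mult_left_mono powr_mono2) (auto simp: field_simps)
    also have "(d / \<eta>) powr (2 * \<sigma>) = \<eta> powr (- 2 * \<sigma>) * d powr (2 * \<sigma>)"
      using assms d by (simp add: powr_divide powr_minus_divide)
    also have "d\<^sup>2 * (\<eta> powr (- 2 * \<sigma>) * d powr (2 * \<sigma>)) = \<eta> powr (- 2 * \<sigma>) * d powr sq"
    proof -
      have "d powr (2 + 2 * \<sigma>) = d powr 2 * d powr (2 * \<sigma>)" by (rule powr_add)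
      then show ?thesis using d0 by (simp add: sq_def algebra_simps)
    qed
    also have "\<dots> \<le> \<eta>\<^sup>2 * S powr sq + \<eta> powr (- 2 * \<sigma>) * d powr sq" by simp
    finally show ?thesis by (simp add: e d_def S_def)
  qed
qed

lemma H10_diff: "u \<in> H10 \<Omega> \<Longrightarrow> v \<in> H10 \<Omega> \<Longrightarrow> (\<lambda>x. v x - u x) \<in> H10 \<Omega>"
  using H10_lincomb[of v u 1 "-1"] by simp

lemma H10_zero: "(\<lambda>x. 0) \<in> H10 \<Omega>"
  by (rule test_H10, rule test_functionsI[of _ "{}"]) auto

lemma wdiff_L2:
  assumes "u \<in> H10 \<Omega>" "v \<in> H10 \<Omega>"
  shows "wdiff u v \<in> L2 \<Omega>"
    "\<eta> > 0 \<Longrightarrow> (norm (cls \<Omega> (wdiff u v)))\<^sup>2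
      \<le> \<eta>\<^sup>2 * (\<integral>x. weight u v x powr sq \<partial>M) + \<eta> powr (- 2 * \<sigma>) * (\<integral>x. \<bar>v x - u x\<bar> powr sq \<partial>M)"
proof -
  have [measurable]: "u \<in> borel_measurable M" "v \<in> borel_measurable M" using assms measurable_H10 by auto
  have [measurable]: "wdiff u v \<in> borel_measurable M" unfolding wdiff_def weight_def by measurable
  have iv: "integrable M (\<lambda>x. \<bar>v x - u x\<bar> powr sq)"
    using H10_diff[OF assms] by (metis sobolev_integral)
  have ib: "integrable M (\<lambda>x. \<eta>\<^sup>2 * weight u v x powr sq + \<eta> powr (- 2 * \<sigma>) * \<bar>v x - u x\<bar> powr sq)" for \<eta>
    by (intro Bochner_Integration.integrable_add integrable_mult_right iv weight_integrable(1)[OF assms])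
  have i: "integrable M (\<lambda>x. (wdiff u v x)\<^sup>2)"
    by (rule Bochner_Integration.integrable_bound[OF ib[of 1]])
       (use wdiff_square_le[of 1 u v] in \<open>auto intro!: AE_I2 order_trans[OF _ abs_ge_self]\<close>)
  then show L: "wdiff u v \<in> L2 \<Omega>" by (simp add: L2_def)
  assume \<eta>: "\<eta> > 0"
  have "(norm (cls \<Omega> (wdiff u v)))\<^sup>2 = (\<integral>x. (wdiff u v x)\<^sup>2 \<partial>M)"
    by (simp add: norm_cls m\<Omega> L L2_norm_def)
  also have "\<dots> \<le> (\<integral>x. \<eta>\<^sup>2 * weight u v x powr sq + \<eta> powr (- 2 * \<sigma>) * \<bar>v x - u x\<bar> powr sq \<partial>M)"
    by (rule integral_mono[OF i ib wdiff_square_le[OF \<eta>]])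
  also have "\<dots> = \<eta>\<^sup>2 * (\<integral>x. weight u v x powr sq \<partial>M) + \<eta> powr (- 2 * \<sigma>) * (\<integral>x. \<bar>v x - u x\<bar> powr sq \<partial>M)"
    using iv weight_integrable(1)[OF assms] by simp
  finally show "(norm (cls \<Omega> (wdiff u v)))\<^sup>2
      \<le> \<eta>\<^sup>2 * (\<integral>x. weight u v x powr sq \<partial>M) + \<eta> powr (- 2 * \<sigma>) * (\<integral>x. \<bar>v x - u x\<bar> powr sq \<partial>M)" .
qed

text \<open>The two error terms compete: a small \<eta> tames the weight but enlarges the factor of
  the difference. So \<eta> is fixed by a bound on the weight valid on the whole unit ball around u,
  and only afterwards \<delta> is chosen against that factor. Each term gets e^2/2.\<close>

lemma wdiff_small:
  assumes u: "u \<in> H10 \<Omega>" and e: "e > 0"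
  shows "\<exists>\<delta>>0. \<forall>v\<in>H10 \<Omega>. norm (hc v - hc u) < \<delta> \<longrightarrow> norm (cls \<Omega> (wdiff u v)) \<le> e"
proof -
  obtain C where C: "C \<ge> 0" "\<And>u. u \<in> H10 \<Omega> \<Longrightarrow> (\<integral>x. \<bar>u x\<bar> powr sq \<partial>M) \<le> C * norm (hc u) powr sq"
    using sobolev_integral by metis
  \<comment> \<open>A bound for the integral of the weight over all v within distance 1 of u. This
    is why \<delta> will also be kept at most 1.\<close>
  define K where "K = 3 powr sq * (measure M (space M) + C * (norm (hc u) + 1) powr sq + C * norm (hc u) powr sq)"
  have K: "K \<ge> 0" using C(1) by (auto simp: K_def)
  define \<eta> where "\<eta> = e / sqrt (2 * (K + 1))"
  have \<eta>: "\<eta> > 0" using e K by (simp add: \<eta>_def)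
  have \<eta>K: "\<eta>\<^sup>2 * K \<le> e\<^sup>2 / 2"
  proof -
    have "\<eta>\<^sup>2 * K = (e\<^sup>2 / 2) * (K / (K + 1))" using K by (simp add: \<eta>_def power_divide field_simps)
    also have "\<dots> \<le> (e\<^sup>2 / 2) * 1" using K by (intro mult_left_mono) auto
    finally show ?thesis by simp
  qed
  define A where "A = \<eta> powr (- 2 * \<sigma>) * C"
  have A: "A \<ge> 0" using C(1) by (simp add: A_def)
  define X where "X = (e\<^sup>2 / 2) / (A + 1)"
  have X: "X > 0" "A * X \<le> e\<^sup>2 / 2"
  proof -
    show "X > 0" using e A by (simp add: X_def)
    have "A * X = (e\<^sup>2 / 2) * (A / (A + 1))" using A by (simp add: X_def field_simps)
    also have "\<dots> \<le> (e\<^sup>2 / 2) * 1" using A by (intro mult_left_mono) auto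
    finally show "A * X \<le> e\<^sup>2 / 2" by simp
  qed
  define \<delta> where "\<delta> = min 1 (X powr (1 / sq))"
  show ?thesis
  proof (intro exI conjI ballI impI)
    show "\<delta> > 0" using X by (simp add: \<delta>_def)
    fix v assume v: "v \<in> H10 \<Omega>" and close: "norm (hc v - hc u) < \<delta>"
    let ?d = "\<lambda>x. v x - u x"
    have "hc ?d = hc v - hc u" using hc_diff(2)[OF H10_H1[OF v] H10_H1[OF u]] by (simp add: fun_diff_def)
    then have "(\<integral>x. \<bar>?d x\<bar> powr sq \<partial>M) \<le> C * norm (hc v - hc u) powr sq"
      using C(2)[OF H10_diff[OF u v]] by simp
    also have "\<dots> \<le> C * \<delta> powr sq"
      using C(1) close sq2 by (intro mult_left_mono powr_mono2) auto
    also have "\<dots> \<le> C * X"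
    proof -
      have "\<delta> powr sq \<le> (X powr (1 / sq)) powr sq" using sq2 X by (intro powr_mono2) (auto simp: \<delta>_def)
      also have "\<dots> = X" using X sq2 by (simp add: powr_powr)
      finally show ?thesis using C(1) by (intro mult_left_mono)
    qed
    finally have 1: "\<eta> powr (- 2 * \<sigma>) * (\<integral>x. \<bar>?d x\<bar> powr sq \<partial>M) \<le> A * X"
      unfolding A_def mult.assoc by (intro mult_left_mono) auto
    have "norm (hc v) \<le> norm (hc u) + 1"
      using norm_triangle_ineq[of "hc v - hc u" "hc u"] close by (simp add: \<delta>_def)
    then have "C * norm (hc v) powr sq \<le> C * (norm (hc u) + 1) powr sq"
      using C(1) sq2 by (intro mult_left_mono powr_mono2) auto
    then have "(\<integral>x. weight u v x powr sq \<partial>M) \<le> K"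
      unfolding K_def using C(2)[OF u] C(2)[OF v]
      by (intro order_trans[OF weight_integrable(2)[OF u v]] mult_left_mono) auto
    then have "\<eta>\<^sup>2 * (\<integral>x. weight u v x powr sq \<partial>M) \<le> \<eta>\<^sup>2 * K" by (intro mult_left_mono) auto
    with 1 \<eta>K X(2) have "(norm (cls \<Omega> (wdiff u v)))\<^sup>2 \<le> e\<^sup>2"
      using wdiff_L2(2)[OF u v \<eta>] by linarith
    then show "norm (cls \<Omega> (wdiff u v)) \<le> e" by (rule power2_le_imp_le) (use e in simp)
  qed
qed

lemma L2_bound:
  fixes f h :: "'a \<Rightarrow> real"
  assumes "f \<in> borel_measurable M" "h \<in> L2 \<Omega>" "\<And>x. \<bar>f x\<bar> \<le> C * \<bar>h x\<bar>" "C \<ge> 0"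
  shows "f \<in> L2 \<Omega>" "norm (cls \<Omega> f) \<le> C * norm (cls \<Omega> h)"
proof -
  have sq: "(f x)\<^sup>2 \<le> C\<^sup>2 * (h x)\<^sup>2" for x
    using power_mono[OF assms(3)[of x], of 2] by (simp add: power_mult_distrib)
  have ih: "integrable M (\<lambda>x. C\<^sup>2 * (h x)\<^sup>2)" using assms(2) by (simp add: L2_def)
  have "integrable M (\<lambda>x. (f x)\<^sup>2)"
    by (rule Bochner_Integration.integrable_bound[OF ih]) (use assms(1) sq in \<open>auto\<close>)
  then show f: "f \<in> L2 \<Omega>" using assms(1) by (simp add: L2_def)
  have "(norm (cls \<Omega> f))\<^sup>2 \<le> C\<^sup>2 * (norm (cls \<Omega> h))\<^sup>2"
    using integral_mono[OF _ ih sq] \<open>integrable M (\<lambda>x. (f x)\<^sup>2)\<close> by (simp add: norm_cls m\<Omega> f assms(2) L2_norm_def)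
  then have "(norm (cls \<Omega> f))\<^sup>2 \<le> (C * norm (cls \<Omega> h))\<^sup>2" by (simp add: power_mult_distrib)
  then show "norm (cls \<Omega> f) \<le> C * norm (cls \<Omega> h)"
    by (rule power2_le_imp_le) (use assms(4) in simp)
qed

definition lip :: real where
  "lip = (SOME C. C \<ge> 0 \<and> (\<forall>s r. \<bar>src \<gamma> s - src \<gamma> r\<bar> \<le> C * (\<bar>s - r\<bar> * (1 + \<bar>s\<bar> + \<bar>r\<bar>) powr \<sigma>)) \<and>
    (\<forall>s r. \<bar>Src \<gamma> s - Src \<gamma> r - src \<gamma> r * (s - r)\<bar> \<le> C * (\<bar>s - r\<bar> * (\<bar>s - r\<bar> * (1 + \<bar>s\<bar> + \<bar>r\<bar>) powr \<sigma>))))"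

lemma lip: "lip \<ge> 0" "\<bar>src \<gamma> (v x) - src \<gamma> (u x)\<bar> \<le> lip * wdiff u v x"
  "\<bar>Src \<gamma> (v x) - Src \<gamma> (u x) - src \<gamma> (u x) * (v x - u x)\<bar> \<le> lip * (\<bar>v x - u x\<bar> * wdiff u v x)"
proof -
  have "\<exists>C. C \<ge> 0 \<and> (\<forall>s r. \<bar>src \<gamma> s - src \<gamma> r\<bar> \<le> C * (\<bar>s - r\<bar> * (1 + \<bar>s\<bar> + \<bar>r\<bar>) powr \<sigma>)) \<and>
    (\<forall>s r. \<bar>Src \<gamma> s - Src \<gamma> r - src \<gamma> r * (s - r)\<bar> \<le> C * (\<bar>s - r\<bar> * (\<bar>s - r\<bar> * (1 + \<bar>s\<bar> + \<bar>r\<bar>) powr \<sigma>)))"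
    using src_lipschitz[OF \<gamma> \<sigma>] by metis
  from someI_ex[OF this]
  have *: "lip \<ge> 0 \<and> (\<forall>s r. \<bar>src \<gamma> s - src \<gamma> r\<bar> \<le> lip * (\<bar>s - r\<bar> * (1 + \<bar>s\<bar> + \<bar>r\<bar>) powr \<sigma>)) \<and>
    (\<forall>s r. \<bar>Src \<gamma> s - Src \<gamma> r - src \<gamma> r * (s - r)\<bar> \<le> lip * (\<bar>s - r\<bar> * (\<bar>s - r\<bar> * (1 + \<bar>s\<bar> + \<bar>r\<bar>) powr \<sigma>)))"
    unfolding lip_def .
  then show "lip \<ge> 0" by blast
  show "\<bar>src \<gamma> (v x) - src \<gamma> (u x)\<bar> \<le> lip * wdiff u v x"
    using *[THEN conjunct2, THEN conjunct1, rule_format, of "v x" "u x"] by (simp add: wdiff_def weight_def)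
  show "\<bar>Src \<gamma> (v x) - Src \<gamma> (u x) - src \<gamma> (u x) * (v x - u x)\<bar> \<le> lip * (\<bar>v x - u x\<bar> * wdiff u v x)"
    using *[THEN conjunct2, THEN conjunct2, rule_format, of "v x" "u x"] by (simp add: wdiff_def weight_def)
qed

lemma Src_0: "Src \<gamma> 0 = 0" using Src_closed_form(1)[OF \<gamma>, of 0] by simp

lemma measurable_src: "u \<in> H10 \<Omega> \<Longrightarrow> (\<lambda>x. src \<gamma> (u x)) \<in> borel_measurable M"
  by (rule measurable_compose[OF measurable_H10 borel_measurable_continuous_onI[OF continuous_on_src[OF \<gamma>]]])

lemma measurable_Src: "u \<in> H10 \<Omega> \<Longrightarrow> (\<lambda>x. Src \<gamma> (u x)) \<in> borel_measurable M"
  using Src_closed_form(2)[OF \<gamma>] DERIV_isCont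
  by (intro measurable_compose[OF measurable_H10 borel_measurable_continuous_onI])
     (auto simp: continuous_on_eq_continuous_at)

lemma wdiff_nonneg: "wdiff u v x \<ge> 0" by (simp add: wdiff_def)

lemma src_L2: "u \<in> H10 \<Omega> \<Longrightarrow> (\<lambda>x. src \<gamma> (u x)) \<in> L2 \<Omega>"
  by (rule L2_bound(1)[OF measurable_src wdiff_L2(1)[OF H10_zero]])
     (use lip(1) lip(2)[where u = "\<lambda>x. 0"] in \<open>auto simp: wdiff_nonneg\<close>)

lemma src_diff_norm:
  assumes "u \<in> H10 \<Omega>" "v \<in> H10 \<Omega>"
  shows "norm (cls \<Omega> (\<lambda>x. src \<gamma> (v x)) - cls \<Omega> (\<lambda>x. src \<gamma> (u x))) \<le> lip * norm (cls \<Omega> (wdiff u v))"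
proof -
  have "norm (cls \<Omega> (\<lambda>x. src \<gamma> (v x) - src \<gamma> (u x))) \<le> lip * norm (cls \<Omega> (wdiff u v))"
    using assms lip by (intro L2_bound(2)) (auto simp: wdiff_nonneg wdiff_L2(1) intro!: measurable_src borel_measurable_diff)
  then show ?thesis using assms by (simp add: cls_diff m\<Omega> src_L2)
qed

lemma Src_integrable:
  assumes "u \<in> H10 \<Omega>" shows "integrable M (\<lambda>x. Src \<gamma> (u x))"
proof (rule Bochner_Integration.integrable_bound)
  show "integrable M (\<lambda>x. lip * (u x \<bullet> wdiff (\<lambda>x. 0) u x))"
    by (intro integrable_mult_right integrable_L2_inner H1_L2 H10_H1 assms wdiff_L2(1) H10_zero)
  show "AE x in M. norm (Src \<gamma> (u x)) \<le> norm (lip * (u x \<bullet> wdiff (\<lambda>x. 0) u x))"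
    using lip(3)[of u _ "\<lambda>x. 0"] lip(1) by (auto simp: Src_0 abs_mult wdiff_nonneg intro!: AE_I2)
qed (rule measurable_Src[OF assms])

lemma Src_expansion:
  assumes u: "u \<in> H10 \<Omega>" and v: "v \<in> H10 \<Omega>"
  shows "\<bar>(\<integral>x. Src \<gamma> (v x) \<partial>M) - (\<integral>x. Src \<gamma> (u x) \<partial>M) - cls \<Omega> (\<lambda>x. src \<gamma> (u x)) \<bullet> (cls \<Omega> v - cls \<Omega> u)\<bar>
    \<le> lip * (norm (cls \<Omega> v - cls \<Omega> u) * norm (cls \<Omega> (wdiff u v)))"
proof -
  have L: "u \<in> L2 \<Omega>" "v \<in> L2 \<Omega>" using u v H1_L2 H10_H1 by auto
  have dL: "(\<lambda>x. v x - u x) \<in> L2 \<Omega>" using L by (intro L2_diff)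
  have aL: "(\<lambda>x. \<bar>v x - u x\<bar>) \<in> L2 \<Omega>" and na: "norm (cls \<Omega> (\<lambda>x. \<bar>v x - u x\<bar>)) \<le> 1 * norm (cls \<Omega> (\<lambda>x. v x - u x))"
    using dL by (auto intro!: L2_bound(1)[OF _ dL, where C = 1] L2_bound(2)[OF _ dL, where C = 1, simplified] simp: L2_def)
  have wL: "wdiff u v \<in> L2 \<Omega>" by (rule wdiff_L2(1)[OF u v])
  have iS: "integrable M (\<lambda>x. Src \<gamma> (u x))" "integrable M (\<lambda>x. Src \<gamma> (v x))" using u v Src_integrable by auto
  have isr: "integrable M (\<lambda>x. src \<gamma> (u x) * (v x - u x))"
    using integrable_L2_inner[OF src_L2[OF u] dL] by simp
  have iw: "integrable M (\<lambda>x. \<bar>v x - u x\<bar> * wdiff u v x)"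
    using integrable_L2_inner[OF aL wL] by simp
  have "cls \<Omega> (\<lambda>x. src \<gamma> (u x)) \<bullet> (cls \<Omega> v - cls \<Omega> u) = (\<integral>x. src \<gamma> (u x) * (v x - u x) \<partial>M)"
    using inner_cls[OF m\<Omega> src_L2[OF u] dL] by (simp add: cls_diff[OF m\<Omega> L(2) L(1)] L2_inner_def)
  then have "(\<integral>x. Src \<gamma> (v x) \<partial>M) - (\<integral>x. Src \<gamma> (u x) \<partial>M) - cls \<Omega> (\<lambda>x. src \<gamma> (u x)) \<bullet> (cls \<Omega> v - cls \<Omega> u)
      = (\<integral>x. Src \<gamma> (v x) - Src \<gamma> (u x) - src \<gamma> (u x) * (v x - u x) \<partial>M)"
    using iS isr by simp
  also have "\<bar>\<dots>\<bar> \<le> (\<integral>x. \<bar>Src \<gamma> (v x) - Src \<gamma> (u x) - src \<gamma> (u x) * (v x - u x)\<bar> \<partial>M)"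
    by (rule integral_abs_bound)
  also have "\<dots> \<le> (\<integral>x. lip * (\<bar>v x - u x\<bar> * wdiff u v x) \<partial>M)"
    by (rule integral_mono) (use iS isr iw lip(3) in auto)
  also have "\<dots> = lip * (cls \<Omega> (\<lambda>x. \<bar>v x - u x\<bar>) \<bullet> cls \<Omega> (wdiff u v))"
    using inner_cls[OF m\<Omega> aL wL] by (simp add: L2_inner_def)
  also have "\<dots> \<le> lip * (norm (cls \<Omega> (\<lambda>x. \<bar>v x - u x\<bar>)) * norm (cls \<Omega> (wdiff u v)))"
    using lip(1) by (intro mult_left_mono norm_cauchy_schwarz)
  also have "\<dots> \<le> lip * (norm (cls \<Omega> v - cls \<Omega> u) * norm (cls \<Omega> (wdiff u v)))"
    using na lip(1) by (intro mult_left_mono mult_right_mono) (auto simp: cls_diff[OF m\<Omega> L(2) L(1)])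
  finally show ?thesis .
qed

definition hinv :: "('a, real) l2 \<times> ('a, 'a) l2 \<Rightarrow> 'a \<Rightarrow> real" where
  "hinv z = (SOME u. u \<in> H10 \<Omega> \<and> hc u = z)"

lemma hinv: "z \<in> HS \<Longrightarrow> hinv z \<in> H10 \<Omega>" "z \<in> HS \<Longrightarrow> hc (hinv z) = z"
proof -
  assume "z \<in> HS"
  then have "\<exists>u. u \<in> H10 \<Omega> \<and> hc u = z" by (auto simp: HS_def)
  from someI_ex[OF this] show "hinv z \<in> H10 \<Omega>" "hc (hinv z) = z" by (auto simp: hinv_def)
qed

text \<open>The Nemytskii operator of f, transported to pairs (function, gradient) through a chosen
  representative. Since f is applied pointwise, the class does not depend on that choice.\<close>

definition nem :: "('a, real) l2 \<times> ('a, 'a) l2 \<Rightarrow> ('a, real) l2" where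
  "nem z = cls \<Omega> (\<lambda>x. src \<gamma> (hinv z x))"

definition pot :: "('a, real) l2 \<times> ('a, 'a) l2 \<Rightarrow> real" where
  "pot z = (\<integral>x. Src \<gamma> (hinv z x) \<partial>M)"

lemma HS_hc: "u \<in> H10 \<Omega> \<Longrightarrow> hc u \<in> HS" by (simp add: HS_def)

lemma hinv_ae:
  assumes "u \<in> H10 \<Omega>" shows "AE x in M. hinv (hc u) x = u x"
proof -
  have h: "hinv (hc u) \<in> H10 \<Omega>" "hc (hinv (hc u)) = hc u" using hinv HS_hc[OF assms] by auto
  then show ?thesis using cls_eq_iff[OF m\<Omega>, of "hinv (hc u)" u] assms H1_L2 H10_H1 by (simp add: hc_def)
qed

lemma nem_hc: "u \<in> H10 \<Omega> \<Longrightarrow> nem (hc u) = cls \<Omega> (\<lambda>x. src \<gamma> (u x))"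
  unfolding nem_def using hinv_ae[of u] hinv(1)[OF HS_hc, of u]
  by (subst cls_eq_iff[OF m\<Omega>]) (auto intro: src_L2 elim!: eventually_mono)

lemma pot_hc: "u \<in> H10 \<Omega> \<Longrightarrow> pot (hc u) = (\<integral>x. Src \<gamma> (u x) \<partial>M)"
  unfolding pot_def using hinv_ae[of u] hinv(1)[OF HS_hc, of u]
  by (intro integral_cong_AE measurable_Src) (auto elim!: eventually_mono)

lemma nem_continuous: "continuous_on HS nem"
  unfolding continuous_on_iff
proof (intro ballI allI impI)
  fix z and e :: real assume z: "z \<in> HS" and e: "e > 0"
  obtain u where u: "u \<in> H10 \<Omega>" "z = hc u" using z by (auto simp: HS_def)
  obtain \<delta> where \<delta>: "\<delta> > 0" "\<And>v. v \<in> H10 \<Omega> \<Longrightarrow> norm (hc v - hc u) < \<delta> \<Longrightarrow> norm (cls \<Omega> (wdiff u v)) \<le> e / (2 * (lip + 1))"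
    using wdiff_small[OF u(1), of "e / (2 * (lip + 1))"] e lip(1) by auto
  show "\<exists>d>0. \<forall>y\<in>HS. dist y z < d \<longrightarrow> dist (nem y) (nem z) < e"
  proof (intro exI conjI ballI impI)
    fix y assume "y \<in> HS" "dist y z < \<delta>"
    then obtain v where v: "v \<in> H10 \<Omega>" "y = hc v" by (auto simp: HS_def)
    have "dist (nem y) (nem z) \<le> lip * norm (cls \<Omega> (wdiff u v))"
      using src_diff_norm[OF u(1) v(1)] by (simp add: u v nem_hc dist_norm)
    also have "\<dots> \<le> lip * (e / (2 * (lip + 1)))"
      using \<delta>(2)[OF v(1)] \<open>dist y z < \<delta>\<close> lip(1) by (intro mult_left_mono) (auto simp: dist_norm u v)
    also have "\<dots> = (e / 2) * (lip / (lip + 1))" by simp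
    also have "\<dots> \<le> (e / 2) * 1" using e lip(1) by (intro mult_left_mono) auto
    also have "\<dots> < e" using e by simp
    finally show "dist (nem y) (nem z) < e" .
  qed (rule \<delta>(1))
qed

text \<open>Closeness is asked in the full norm, but the remainder is small relative to the L2
  distance. This asymmetry is what permits differentiation along trajectories that are continuous in
  \<open>H10\<close> and differentiable only in L2.\<close>

lemma pot_expansion:
  assumes z: "z \<in> HS" and e: "e > 0"
  shows "\<exists>\<delta>>0. \<forall>y\<in>HS. norm (y - z) < \<delta> \<longrightarrow>
    \<bar>pot y - pot z - nem z \<bullet> (fst y - fst z)\<bar> \<le> e * norm (fst y - fst z)"
proof -
  obtain u where u: "u \<in> H10 \<Omega>" "z = hc u" using z by (auto simp: HS_def)
  obtain \<delta> where \<delta>: "\<delta> > 0" "\<And>v. v \<in> H10 \<Omega> \<Longrightarrow> norm (hc v - hc u) < \<delta> \<Longrightarrow> norm (cls \<Omega> (wdiff u v)) \<le> e / (lip + 1)"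
    using wdiff_small[OF u(1), of "e / (lip + 1)"] e lip(1) by auto
  show ?thesis
  proof (intro exI conjI ballI impI)
    fix y assume "y \<in> HS" "norm (y - z) < \<delta>"
    then obtain v where v: "v \<in> H10 \<Omega>" "y = hc v" by (auto simp: HS_def)
    have f: "fst (hc w) = cls \<Omega> w" for w by (simp add: hc_def)
    have "\<bar>pot y - pot z - nem z \<bullet> (fst y - fst z)\<bar> \<le> lip * (norm (fst y - fst z) * norm (cls \<Omega> (wdiff u v)))"
      using Src_expansion[OF u(1) v(1)] by (simp add: u v nem_hc pot_hc f)
    also have "\<dots> \<le> lip * (norm (fst y - fst z) * (e / (lip + 1)))"
      using \<delta>(2)[OF v(1)] \<open>norm (y - z) < \<delta>\<close> lip(1) by (intro mult_left_mono) (auto simp: u v)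
    also have "\<dots> = (e * norm (fst y - fst z)) * (lip / (lip + 1))" by simp
    also have "\<dots> \<le> (e * norm (fst y - fst z)) * 1" using e lip(1) by (intro mult_left_mono) auto
    finally show "\<bar>pot y - pot z - nem z \<bullet> (fst y - fst z)\<bar> \<le> e * norm (fst y - fst z)" by simp
  qed (rule \<delta>(1))
qed

lemma pot_continuous: "continuous_on HS pot"
  unfolding continuous_on_def
proof
  fix z assume z: "z \<in> HS"
  obtain \<delta> where \<delta>: "\<delta> > 0" "\<And>y. y \<in> HS \<Longrightarrow> norm (y - z) < \<delta> \<Longrightarrow>
      \<bar>pot y - pot z - nem z \<bullet> (fst y - fst z)\<bar> \<le> 1 * norm (fst y - fst z)"
    using pot_expansion[OF z, of 1] by auto
  have "((\<lambda>y. pot y - pot z) \<longlongrightarrow> 0) (at z within HS)"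
  proof (rule Lim_null_comparison)
    have "\<forall>\<^sub>F y in at z within HS. y \<in> HS \<and> norm (y - z) < \<delta>"
      unfolding eventually_at by (intro exI[of _ \<delta>]) (auto simp: \<delta>(1) dist_norm)
    then show "\<forall>\<^sub>F y in at z within HS. norm (pot y - pot z) \<le> (norm (nem z) + 1) * norm (fst y - fst z)"
    proof eventually_elim
      case (elim y)
      then show ?case
        using \<delta>(2)[of y] Cauchy_Schwarz_ineq2[of "nem z" "fst y - fst z"] by (simp add: algebra_simps; linarith)
    qed
    have "((\<lambda>y. (norm (nem z) + 1) * norm (fst y - fst z)) \<longlongrightarrow> (norm (nem z) + 1) * norm (fst z - fst z)) (at z within HS)"
      by (intro tendsto_intros)
    then show "((\<lambda>y. (norm (nem z) + 1) * norm (fst y - fst z)) \<longlongrightarrow> 0) (at z within HS)" by simp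
  qed
  then show "(pot \<longlongrightarrow> pot z) (at z within HS)" by (simp add: LIM_zero_iff)
qed

text \<open>Chain rule for such trajectories: dividing the expansion by s - t leaves a remainder
  proportional to the L2 difference quotient, which stays bounded near t.\<close>

lemma pot_has_derivative:
  assumes U: "\<And>s. s \<in> A \<Longrightarrow> U s \<in> HS" and t: "t \<in> A" and cont: "continuous (at t within A) U"
    and der: "((\<lambda>s. fst (U s)) has_vector_derivative D) (at t within A)"
  shows "((\<lambda>s. pot (U s)) has_real_derivative nem (U t) \<bullet> D) (at t within A)"
proof -
  let ?F = "at t within A" and ?d = "\<lambda>s. (fst (U s) - fst (U t)) /\<^sub>R (s - t)"
  have d: "(?d \<longlongrightarrow> D) ?F"
  proof -
    have "((\<lambda>s. (1 / norm (s - t)) *\<^sub>R (fst (U s) - (fst (U t) + (s - t) *\<^sub>R D))) \<longlongrightarrow> 0) ?F"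
      using der unfolding has_vector_derivative_def has_derivative_within by simp
    then have "((\<lambda>s. norm ((1 / norm (s - t)) *\<^sub>R (fst (U s) - (fst (U t) + (s - t) *\<^sub>R D)))) \<longlongrightarrow> 0) ?F"
      by (rule tendsto_norm_zero)
    then have "((\<lambda>s. ?d s - D) \<longlongrightarrow> 0) ?F"
    proof (rule Lim_null_comparison[rotated])
      have "\<forall>\<^sub>F s in ?F. s \<noteq> t" by (auto simp: eventually_at intro!: exI[of _ 1])
      then show "\<forall>\<^sub>F s in ?F. norm (?d s - D) \<le> norm ((1 / norm (s - t)) *\<^sub>R (fst (U s) - (fst (U t) + (s - t) *\<^sub>R D)))"
      proof eventually_elim
        case (elim s)
        have "?d s - D = (1 / (s - t)) *\<^sub>R (fst (U s) - (fst (U t) + (s - t) *\<^sub>R D))"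
        proof -
          have e: "fst (U s) - (fst (U t) + (s - t) *\<^sub>R D) = (fst (U s) - fst (U t)) - (s - t) *\<^sub>R D" by simp
          show ?thesis unfolding e scaleR_diff_right[of _ "fst (U s) - fst (U t)"] using elim by (simp add: divide_inverse)
        qed
        then show ?case by simp
      qed
    qed
    then show ?thesis by (simp add: LIM_zero_iff)
  qed
  have "((\<lambda>s. (pot (U s) - pot (U t)) / (s - t) - nem (U t) \<bullet> ?d s) \<longlongrightarrow> 0) ?F"
  proof (rule tendstoI)
    fix e :: real assume e: "e > 0"
    define e' where "e' = e / (norm D + 1)"
    have e': "e' > 0" using e by (simp add: e'_def add_nonneg_pos)
    obtain \<delta> where \<delta>: "\<delta> > 0" "\<And>y. y \<in> HS \<Longrightarrow> norm (y - U t) < \<delta> \<Longrightarrow>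
        \<bar>pot y - pot (U t) - nem (U t) \<bullet> (fst y - fst (U t))\<bar> \<le> e' * norm (fst y - fst (U t))"
      using pot_expansion[OF U[OF t] e'] by auto
    have "\<forall>\<^sub>F s in ?F. dist (U s) (U t) < \<delta>"
      using cont \<delta>(1) unfolding continuous_within by (rule tendstoD)
    moreover have "\<forall>\<^sub>F s in ?F. norm (?d s) < norm D + 1"
      using tendsto_norm[OF d] by (rule order_tendstoD) simp
    moreover have "\<forall>\<^sub>F s in ?F. s \<noteq> t \<and> s \<in> A" by (auto simp: eventually_at intro!: exI[of _ 1])
    ultimately show "\<forall>\<^sub>F s in ?F. dist ((pot (U s) - pot (U t)) / (s - t) - nem (U t) \<bullet> ?d s) 0 < e"
    proof eventually_elim
      case (elim s)
      have "(pot (U s) - pot (U t)) / (s - t) - nem (U t) \<bullet> ?d s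
          = (pot (U s) - pot (U t) - nem (U t) \<bullet> (fst (U s) - fst (U t))) / (s - t)"
        by (simp add: divide_inverse algebra_simps)
      then have "\<bar>(pot (U s) - pot (U t)) / (s - t) - nem (U t) \<bullet> ?d s\<bar>
          = \<bar>pot (U s) - pot (U t) - nem (U t) \<bullet> (fst (U s) - fst (U t))\<bar> / \<bar>s - t\<bar>" by simp
      also have "\<dots> \<le> e' * norm (fst (U s) - fst (U t)) / \<bar>s - t\<bar>"
        using \<delta>(2)[OF U, of s] elim by (intro divide_right_mono) (auto simp: dist_norm)
      also have "\<dots> = e' * norm (?d s)" by (simp add: divide_inverse mult.commute)
      also have "\<dots> < e' * (norm D + 1)" using elim e' by (intro mult_strict_left_mono) auto
      also have "\<dots> = e" by (simp add: e'_def add_nonneg_eq_0_iff)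
      finally show ?case by simp
    qed
  qed
  from tendsto_add[OF this tendsto_inner[OF tendsto_const d, of "nem (U t)"]]
  show ?thesis by (simp add: has_field_derivative_iff)
qed

subsection \<open>The potential well\<close>

definition Qf :: "('a, real) l2 \<times> ('a, 'a) l2 \<Rightarrow> ('a, real) l2 \<times> ('a, 'a) l2 \<Rightarrow> real \<Rightarrow> real" where
  "Qf y z \<alpha> = (norm (snd y))\<^sup>2 + (norm (snd z))\<^sup>2 + 2 * \<alpha> * (fst y \<bullet> fst z)"

lemma fst_hc: "fst (hc u) = cls \<Omega> u" by (simp add: hc_def)

lemma L2_norm_hc:
  assumes "u \<in> H10 \<Omega>"
  shows "L2_norm \<Omega> (grad \<Omega> u) = norm (snd (hc u))" "L2_norm \<Omega> u = norm (fst (hc u))"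
  using assms by (simp_all add: hc_def norm_cls m\<Omega> grad_props H10_H1 H1_L2)

lemma L2_inner_hc:
  assumes "u \<in> H10 \<Omega>" "v \<in> H10 \<Omega>"
  shows "L2_inner \<Omega> (grad \<Omega> u) (grad \<Omega> v) = snd (hc u) \<bullet> snd (hc v)" "L2_inner \<Omega> u v = fst (hc u) \<bullet> fst (hc v)"
  using assms by (simp_all add: hc_def inner_cls m\<Omega> grad_props H10_H1 H1_L2)

lemma Q_form_hc: "u \<in> H10 \<Omega> \<Longrightarrow> w \<in> H10 \<Omega> \<Longrightarrow> Q_form \<Omega> \<alpha> u w = Qf (hc u) (hc w) \<alpha>"
  by (simp add: Q_form_def Qf_def L2_norm_hc L2_inner_hc)

lemma log_term_hc:
  assumes u: "u \<in> H10 \<Omega>"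
  shows "(\<integral>x. \<bar>u x\<bar> powr \<gamma> * ln \<bar>u x\<bar> \<partial>M) = nem (hc u) \<bullet> fst (hc u)"
    "integrable M (\<lambda>x. \<bar>u x\<bar> powr \<gamma> * ln \<bar>u x\<bar>)"
  using inner_cls[OF m\<Omega> src_L2[OF u] H1_L2[OF H10_H1[OF u]]] integrable_L2_inner[OF src_L2[OF u] H1_L2[OF H10_H1[OF u]]]
  by (simp_all add: nem_hc[OF u] fst_hc L2_inner_def src_times)

lemma I_fun_hc: "u \<in> H10 \<Omega> \<Longrightarrow> w \<in> H10 \<Omega> \<Longrightarrow>
    I_fun \<Omega> \<alpha> \<gamma> u w = Qf (hc u) (hc w) \<alpha> - nem (hc u) \<bullet> fst (hc u)"
  by (simp add: I_fun_def Q_form_hc log_term_hc)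

lemma J_fun_hc:
  assumes u: "u \<in> H10 \<Omega>" and w: "w \<in> H10 \<Omega>"
  shows "J_fun \<Omega> \<alpha> \<gamma> u w = 1/2 * Qf (hc u) (hc w) \<alpha> - pot (hc u)"
proof -
  let ?p = "\<lambda>x. \<bar>u x\<bar> powr \<gamma>" and ?l = "\<lambda>x. \<bar>u x\<bar> powr \<gamma> * ln \<bar>u x\<bar>"
  \<comment> \<open>The closed form of \<open>Src\<close> solved for the pure power, whose
    integrability thereby follows from that of the two other terms.\<close>
  have p: "?p x = \<gamma>\<^sup>2 * (1 / \<gamma> * ?l x - Src \<gamma> (u x))" for x
    using \<gamma> by (simp add: Src_closed_form(1)[OF \<gamma>] algebra_simps)
  have "integrable M (\<lambda>x. \<gamma>\<^sup>2 * (1 / \<gamma> * ?l x - Src \<gamma> (u x)))"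
    using log_term_hc(2)[OF u] Src_integrable[OF u]
    by (intro integrable_mult_right Bochner_Integration.integrable_diff)
  then have ip: "integrable M ?p" by (simp only: p[symmetric])
  have "pot (hc u) = (\<integral>x. 1 / \<gamma> * ?l x - 1 / \<gamma>\<^sup>2 * ?p x \<partial>M)"
    by (simp add: pot_hc[OF u] Src_closed_form(1)[OF \<gamma>])
  also have "\<dots> = 1 / \<gamma> * (\<integral>x. ?l x \<partial>M) - 1 / \<gamma>\<^sup>2 * (\<integral>x. ?p x \<partial>M)"
    using ip log_term_hc(2)[OF u] by simp
  finally show ?thesis by (simp add: J_fun_def Q_form_hc[OF u w])
qed

text \<open>The coupling is at most |\<alpha>| times the sum of the squared L2 norms, which the
  Rayleigh inequality dominates since |\<alpha>| lies below the first eigenvalue.\<close>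

lemma Qf_nonneg:
  assumes "\<Omega> \<noteq> {}" "\<bar>\<alpha>\<bar> < first_dirichlet_eigenvalue \<Omega>" "y \<in> HS" "z \<in> HS"
  shows "Qf y z \<alpha> \<ge> 0"
proof -
  let ?l = "first_dirichlet_eigenvalue \<Omega>" and ?a = "norm (fst y)" and ?b = "norm (fst z)"
  have "\<bar>2 * \<alpha> * (fst y \<bullet> fst z)\<bar> \<le> \<bar>\<alpha>\<bar> * (2 * (?a * ?b))"
    using mult_left_mono[OF Cauchy_Schwarz_ineq2[of "fst y" "fst z"], of "\<bar>\<alpha>\<bar>"] by (simp add: abs_mult)
  also have "\<dots> \<le> \<bar>\<alpha>\<bar> * (?a\<^sup>2 + ?b\<^sup>2)"
    using sum_squares_bound[of ?a ?b] by (intro mult_left_mono) auto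
  also have "\<dots> \<le> ?l * (?a\<^sup>2 + ?b\<^sup>2)" using assms(2) by (intro mult_right_mono) auto
  also have "\<dots> \<le> (norm (snd y))\<^sup>2 + (norm (snd z))\<^sup>2"
    using rayleigh[OF assms(1,3)] rayleigh[OF assms(1,4)] by (simp add: distrib_left)
  finally show ?thesis unfolding Qf_def by linarith
qed

text \<open>A real infimum is a lower bound only for a set bounded below. On the Nehari set the
  logarithmic integral equals Q, so J becomes (1/2 - 1/\<gamma>) Q plus a nonnegative multiple of
  the integral of |u|^\<gamma>, and Q is nonnegative.\<close>

lemma well_depth_le:
  assumes ne: "\<Omega> \<noteq> {}" and \<alpha>: "\<bar>\<alpha>\<bar> < first_dirichlet_eigenvalue \<Omega>"
    and y: "y \<in> HS" and z: "z \<in> HS" and nz: "\<not> (y = 0 \<and> z = 0)"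
    and I: "Qf y z \<alpha> = nem y \<bullet> fst y"
  shows "well_depth \<Omega> \<alpha> \<gamma> \<le> 1/2 * Qf y z \<alpha> - pot y"
proof -
  have J0: "0 \<le> J_fun \<Omega> \<alpha> \<gamma> u w" if uw: "(u, w) \<in> nehari \<Omega> \<alpha> \<gamma>" for u w
  proof -
    have u: "u \<in> H10 \<Omega>" "w \<in> H10 \<Omega>" "I_fun \<Omega> \<alpha> \<gamma> u w = 0" using uw by (auto simp: nehari_def)
    define q where "q = Qf (hc u) (hc w) \<alpha>"
    have q: "q \<ge> 0" unfolding q_def by (rule Qf_nonneg[OF ne \<alpha> HS_hc[OF u(1)] HS_hc[OF u(2)]])
    have l: "(\<integral>x. \<bar>u x\<bar> powr \<gamma> * ln \<bar>u x\<bar> \<partial>M) = q"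
      using u by (simp add: I_fun_def q_def Q_form_hc)
    have "J_fun \<Omega> \<alpha> \<gamma> u w = (1/2 - 1/\<gamma>) * q + 1/\<gamma>\<^sup>2 * (\<integral>x. \<bar>u x\<bar> powr \<gamma> \<partial>M)"
      unfolding J_fun_def l Q_form_hc[OF u(1,2)] q_def[symmetric] by (simp add: algebra_simps)
    also have "\<dots> \<ge> 0"
      using q \<gamma> by (intro add_nonneg_nonneg mult_nonneg_nonneg integral_nonneg_AE) (auto simp: field_simps)
    finally show ?thesis .
  qed
  obtain u w where uw: "u \<in> H10 \<Omega>" "y = hc u" "w \<in> H10 \<Omega>" "z = hc w" using y z by (auto simp: HS_def)
  have zero: "hc v = 0" if "v \<in> H10 \<Omega>" "ae_eq \<Omega> v (\<lambda>x. 0)" for v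
  proof -
    have "fst (hc v) = fst 0"
      using that cls_eq_iff[OF m\<Omega> H1_L2[OF H10_H1[OF that(1)]] L2_zero] by (simp add: hc_def ae_eq_def cls_zero)
    then show ?thesis using HS_fst_inj[OF HS_hc[OF that(1)] subspace_0[OF HS_subspace]] by blast
  qed
  have "(u, w) \<in> nehari \<Omega> \<alpha> \<gamma>"
    using uw nz zero I by (auto simp: nehari_def I_fun_hc)
  then have "well_depth \<Omega> \<alpha> \<gamma> \<le> (case (u, w) of (u, w) \<Rightarrow> J_fun \<Omega> \<alpha> \<gamma> u w)"
    unfolding well_depth_def by (intro cINF_lower) (use J0 in \<open>auto intro!: bdd_belowI[of _ 0]\<close>)
  then show ?thesis using uw by (simp add: J_fun_hc)
qed

end


section \<open>Compactness tools\<close>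

lemma cluster_tendsto:
  fixes f :: "'t \<Rightarrow> 'x::metric_space"
  assumes K: "compact K" and fK: "\<forall>\<^sub>F t in F. f t \<in> K"
    and sep: "\<And>y. y \<in> K \<Longrightarrow> y \<noteq> l \<Longrightarrow>
      \<exists>g c. continuous_on K g \<and> ((\<lambda>t. g (f t)) \<longlongrightarrow> (c::real)) F \<and> g y \<noteq> c"
  shows "(f \<longlongrightarrow> l) F"
proof (rule topological_tendstoI)
  fix A assume A: "open A" "l \<in> A"
  \<comment> \<open>The values of f that stay outside the neighbourhood A. If this filter were
    proper, compactness would give it a cluster point x in K other than l. Along the filter refined
    at x, the separating function would tend both to its value at x and to c.\<close>
  define G where "G = inf (filtermap f F) (principal (- A))"
  show "\<forall>\<^sub>F t in F. f t \<in> A"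
  proof (cases "G = bot")
    case True
    then have "eventually (\<lambda>x. False) G" by simp
    then have "eventually (\<lambda>x. x \<in> - A \<longrightarrow> False) (filtermap f F)"
      unfolding G_def eventually_inf_principal .
    then show ?thesis by (simp add: eventually_filtermap)
  next
    case False
    have KG: "eventually (\<lambda>x. x \<in> K) G"
      using fK unfolding G_def eventually_inf_principal eventually_filtermap by (auto elim: eventually_mono)
    then obtain x where x: "x \<in> K" "inf (nhds x) G \<noteq> bot"
      using K False unfolding compact_filter by blast
    have "x \<notin> A"
    proof
      assume "x \<in> A"
      then have "eventually (\<lambda>y. y \<in> A) (inf (nhds x) G)"
        using A(1) eventually_nhds by (metis (mono_tags, lifting) inf_le1 filter_leD)
      moreover have "eventually (\<lambda>y. y \<in> - A) (inf (nhds x) G)"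
        by (rule filter_leD[of _ "principal (- A)"]) (auto simp: G_def eventually_principal le_infI2)
      ultimately have "eventually (\<lambda>y. False) (inf (nhds x) G)" by eventually_elim simp
      then show False using x(2) by (simp add: eventually_False)
    qed
    then have "x \<noteq> l" using A by blast
    from sep[OF x(1) this] obtain g c
      where g: "continuous_on K g" "((\<lambda>t. g (f t)) \<longlongrightarrow> (c::real)) F" "g x \<noteq> c" by auto
    let ?Q = "inf (nhds x) G"
    have 1: "(g \<longlongrightarrow> g x) ?Q"
    proof (rule topological_tendstoI)
      fix B assume B: "open B" "g x \<in> B"
      obtain C where C: "open C" "C \<inter> K = g -` B \<inter> K"
        using g(1) B(1) unfolding continuous_on_open_invariant by blast
      have "x \<in> C" using C B x by auto
      have "eventually (\<lambda>y. y \<in> C) ?Q"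
        using C(1) \<open>x \<in> C\<close> eventually_nhds by (metis (mono_tags, lifting) inf_le1 filter_leD)
      moreover have "eventually (\<lambda>y. y \<in> K) ?Q" using KG by (rule filter_leD[rotated]) simp
      ultimately show "eventually (\<lambda>y. g y \<in> B) ?Q" by eventually_elim (use C in auto)
    qed
    have 2: "(g \<longlongrightarrow> c) ?Q"
    proof (rule tendsto_mono)
      show "?Q \<le> filtermap f F" by (simp add: G_def le_infI2)
      show "(g \<longlongrightarrow> c) (filtermap f F)" using g(2) by (simp add: filterlim_def filtermap_filtermap)
    qed
    show ?thesis using tendsto_unique[OF x(2) 1 2] g(3) by blast
  qed
qed

text \<open>Pairs at distance at least e form a compact set, on which the distance of first
  components attains a minimum, positive by injectivity. On the compact hull of a trajectory this
  turns closeness in L2 into closeness of the gradients.\<close>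

lemma compact_fst_uniform:
  fixes K :: "('l::real_normed_vector \<times> 'g::real_normed_vector) set"
  assumes K: "compact K" and inj: "\<And>y z. y \<in> K \<Longrightarrow> z \<in> K \<Longrightarrow> fst y = fst z \<Longrightarrow> y = z" and e: "e > 0"
  shows "\<exists>d>0. \<forall>y\<in>K. \<forall>z\<in>K. norm (fst y - fst z) < d \<longrightarrow> norm (y - z) < e"
proof -
  define D where "D = (K \<times> K) \<inter> {p. e \<le> norm (fst p - snd p)}"
  have "closed {p :: ('l \<times> 'g) \<times> ('l \<times> 'g). e \<le> norm (fst p - snd p)}"
    by (intro closed_Collect_le continuous_intros)
  then have cD: "compact D" unfolding D_def by (intro compact_Int_closed compact_Times K)
  show ?thesis
  proof (cases "D = {}")
    case True
    have "norm (y - z) < e" if "y \<in> K" "z \<in> K" for y z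
    proof -
      have "(y, z) \<notin> D" using True by simp
      then show ?thesis using that by (auto simp: D_def)
    qed
    then show ?thesis by (intro exI[of _ 1]) auto
  next
    case False
    have "continuous_on D (\<lambda>p. norm (fst (fst p) - fst (snd p)))" by (intro continuous_intros)
    then obtain p where p: "p \<in> D" "\<And>q. q \<in> D \<Longrightarrow> norm (fst (fst p) - fst (snd p)) \<le> norm (fst (fst q) - fst (snd q))"
      using continuous_attains_inf[OF cD False] by blast
    have "fst (fst p) \<noteq> fst (snd p)"
    proof
      assume "fst (fst p) = fst (snd p)"
      then have "fst p = snd p" using p(1) inj by (auto simp: D_def)
      then show False using p(1) e by (auto simp: D_def)
    qed
    then have pos: "norm (fst (fst p) - fst (snd p)) > 0" by simp
    have "norm (y - z) < e" if "y \<in> K" "z \<in> K" "norm (fst y - fst z) < norm (fst (fst p) - fst (snd p))" for y z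
    proof -
      have "(y, z) \<notin> D" using p(2)[of "(y, z)"] that by auto
      then show ?thesis using that by (auto simp: D_def)
    qed
    then show ?thesis using pos by blast
  qed
qed

lemma has_vector_derivative_integral_identity:
  fixes x y :: "real \<Rightarrow> 'l::banach"
  assumes y: "continuous_on {0<..} y"
    and id: "\<And>s t. 0 < s \<Longrightarrow> s < t \<Longrightarrow> x t - x s = integral {s..t} y" and t: "t > 0"
  shows "(x has_vector_derivative y t) (at t)"
proof -
  \<comment> \<open>The identity is available at positive times only, so the primitive starts at
    t/2.\<close>
  have c: "continuous_on {t/2..t+1} y" by (rule continuous_on_subset[OF y]) (use t in auto)
  have "((\<lambda>u. x (t/2) + integral {t/2..u} y) has_vector_derivative y t) (at t within {t/2..t+1})"
    using has_vector_derivative_add[OF has_vector_derivative_const integral_has_vector_derivative[OF c, of t]] t by simp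
  moreover have "at t within {t/2..t+1} = at t" by (rule at_within_interior) (use t in simp)
  ultimately have "((\<lambda>u. x (t/2) + integral {t/2..u} y) has_vector_derivative y t) (at t)" by simp
  then show ?thesis
  proof (rule has_vector_derivative_transform_within_open[of _ _ _ "{t/2<..<t+1}"])
    show "x (t/2) + integral {t/2..u} y = x u" if "u \<in> {t/2<..<t+1}" for u
      using id[of "t/2" u] that t by (simp add: algebra_simps)
  qed (use t in auto)
qed

subsection \<open>Steklov averages\<close>

text \<open>Averaging forward stays at positive times, where the integral identities hold. For h <=
  0 the value is 0 by the conventions on empty intervals and division by zero, so continuity in time
  can be stated for every h.\<close>

definition avg :: "real \<Rightarrow> (real \<Rightarrow> 'l::banach) \<Rightarrow> real \<Rightarrow> 'l" where
  "avg h f r = (1 / h) *\<^sub>R integral {r..r + h} f"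

lemma avg_has_derivative:
  assumes f: "continuous_on {0<..} f" and "r > 0" "h > 0"
  shows "(avg h f has_vector_derivative (1 / h) *\<^sub>R (f (r + h) - f r)) (at r)"
proof -
  define \<Phi> where "\<Phi> = (\<lambda>u. integral {r/2..u} f)"
  have c: "continuous_on {r/2..r+h+1} f" by (rule continuous_on_subset[OF f]) (use assms in auto)
  have int: "f integrable_on {r/2..u}" if "u \<le> r + h + 1" for u
    by (rule integrable_continuous_real, rule continuous_on_subset[OF c]) (use that in auto)
  have \<Phi>: "(\<Phi> has_vector_derivative f u) (at u)" if "u \<in> {r/2<..<r+h+1}" for u
  proof -
    have "(\<Phi> has_vector_derivative f u) (at u within {r/2..r+h+1})"
      unfolding \<Phi>_def by (rule integral_has_vector_derivative[OF c]) (use that in auto)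
    moreover have "at u within {r/2..r+h+1} = at u"
      by (rule at_within_interior) (use that in simp)
    ultimately show ?thesis by simp
  qed
  have "((\<lambda>u. \<Phi> (u + h)) has_vector_derivative f (r + h)) (at r)"
  proof -
    have "((\<lambda>u. u + h) has_vector_derivative 1) (at r)"
      by (auto intro!: derivative_eq_intros simp flip: has_real_derivative_iff_has_vector_derivative)
    from vector_diff_chain_at[OF this, of \<Phi> "f (r + h)"] \<Phi>[of "r + h"] show ?thesis
      using assms by (simp add: o_def)
  qed
  then have "((\<lambda>u. (1 / h) *\<^sub>R (\<Phi> (u + h) - \<Phi> u)) has_vector_derivative (1 / h) *\<^sub>R (f (r + h) - f r)) (at r)"
    using \<Phi>[of r] assms by (intro bounded_linear.has_vector_derivative[OF bounded_linear_scaleR_right] has_vector_derivative_diff) auto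
  then show ?thesis
  proof (rule has_vector_derivative_transform_within_open[of _ _ _ "{r/2<..<r+1}"])
    show "(1 / h) *\<^sub>R (\<Phi> (u + h) - \<Phi> u) = avg h f u" if "u \<in> {r/2<..<r+1}" for u
    proof -
      have "integral {r/2..u} f + integral {u..u+h} f = integral {r/2..u+h} f"
        by (rule Henstock_Kurzweil_Integration.integral_combine[OF _ _ int]) (use that assms in auto)
      then show ?thesis by (simp add: avg_def \<Phi>_def algebra_simps flip: scaleR_diff_right)
    qed
  qed (use assms in auto)
qed

lemma avg_nonpos: "h \<le> 0 \<Longrightarrow> avg h f r = 0"
  by (cases "h = 0") (auto simp: avg_def)

lemma avg_continuous:
  assumes "continuous_on {0<..} f" shows "continuous_on {0<..} (avg h f)"
proof (cases "h > 0")
  case True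
  have "isCont (avg h f) r" if "r > 0" for r
    using avg_has_derivative[OF assms that True] has_vector_derivative_continuous by blast
  then show ?thesis by (intro continuous_at_imp_continuous_on) auto
qed (simp add: avg_nonpos)

lemma avg_FTC:
  assumes x: "\<And>t. t > 0 \<Longrightarrow> (x has_vector_derivative y t) (at t)" and "r > 0" "h > 0"
  shows "avg h y r = (1 / h) *\<^sub>R (x (r + h) - x r)"
proof -
  have "(y has_integral (x (r + h) - x r)) {r..r+h}"
    using assms by (intro fundamental_theorem_of_calculus) (auto intro: has_vector_derivative_at_within)
  then show ?thesis by (simp add: avg_def integral_unique)
qed

lemma avg_uniform:
  assumes f: "continuous_on {0<..} f" and s: "0 < s"
  shows "uniform_limit {s..t} (\<lambda>h. avg h f) f (at_right 0)"
proof (rule uniform_limitI)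
  fix e :: real assume e: "e > 0"
  have "uniformly_continuous_on {s..t+1} f"
    by (rule compact_uniformly_continuous[OF continuous_on_subset[OF f]]) (use s in auto)
  then obtain d where d: "d > 0" "\<And>q r. q \<in> {s..t+1} \<Longrightarrow> r \<in> {s..t+1} \<Longrightarrow> dist q r < d \<Longrightarrow> dist (f q) (f r) < e / 2"
    unfolding uniformly_continuous_on_def using e half_gt_zero by metis
  have "\<forall>\<^sub>F h in at_right 0. 0 < h \<and> h < min d 1"
    using d(1) by (auto simp: eventually_at_right[of 0 1] intro!: exI[of _ "min d 1"])
  then show "\<forall>\<^sub>F h in at_right 0. \<forall>r\<in>{s..t}. dist (avg h f r) (f r) < e"
  proof eventually_elim
    case (elim h)
    show ?case
    proof
      fix r assume r: "r \<in> {s..t}"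
      have c: "continuous_on {r..r+h} f" by (rule continuous_on_subset[OF f]) (use s r in auto)
      then have i: "f integrable_on {r..r+h}" by (rule integrable_continuous_real)
      have le: "norm (integral {r..r+h} (\<lambda>q. f q - f r)) \<le> (e / 2) * (r + h - r)"
      proof (rule integral_bound)
        show "continuous_on {r..r+h} (\<lambda>q. f q - f r)" by (intro continuous_intros c)
        show "norm (f q - f r) \<le> e / 2" if "q \<in> {r..r+h}" for q
          using d(2)[of q r] that r elim by (auto simp: dist_norm)
      qed (use elim in simp)
      moreover have "integral {r..r+h} (\<lambda>q. f q - f r) = integral {r..r+h} f - h *\<^sub>R f r"
        using integral_unique[OF has_integral_diff[OF integrable_integral[OF i] has_integral_const_real[of "f r" r "r + h"]]] elim
        by simp
      moreover have "avg h f r - f r = (1 / h) *\<^sub>R (integral {r..r+h} f - h *\<^sub>R f r)"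
        using elim by (simp add: avg_def scaleR_diff_right)
      ultimately have "norm (avg h f r - f r) = (1 / h) * norm (integral {r..r+h} (\<lambda>q. f q - f r))"
        using elim by simp
      also have "\<dots> \<le> (1 / h) * ((e / 2) * h)"
        using le elim by (intro mult_left_mono) auto
      also have "\<dots> = e / 2" using elim by simp
      finally show "dist (avg h f r) (f r) < e" using e elim by (simp add: dist_norm)
    qed
  qed
qed

lemma avg_tendsto:
  assumes "continuous_on {0<..} f" "0 < t"
  shows "((\<lambda>h. avg h f t) \<longlongrightarrow> f t) (at_right 0)"
  by (rule tendsto_uniform_limitI[OF avg_uniform[OF assms, of t]]) simp

lemma avg_inner_limit:
  fixes f g :: "real \<Rightarrow> 'l::{real_inner,banach}"
  assumes f: "continuous_on {0<..} f" and g: "continuous_on {0<..} g" and s: "0 < s"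
  shows "((\<lambda>h. integral {s..t} (\<lambda>r. avg h f r \<bullet> avg h g r)) \<longlongrightarrow> integral {s..t} (\<lambda>r. f r \<bullet> g r)) (at_right 0)"
proof -
  have sub: "{s..t} \<subseteq> {0<..}" using s by auto
  have bd: "bounded (f ` {s..t})" "bounded (g ` {s..t})"
    by (intro compact_imp_bounded compact_continuous_image continuous_on_subset[OF _ sub] f g compact_Icc)+
  have u: "uniform_limit {s..t} (\<lambda>h r. avg h f r \<bullet> avg h g r) (\<lambda>r. f r \<bullet> g r) (at_right 0)"
    by (rule bounded_bilinear.bounded_uniform_limit[OF bounded_bilinear_inner avg_uniform[OF f s] avg_uniform[OF g s] bd(2,1)])
  have c: "continuous_on {s..t} (\<lambda>r. avg h f r \<bullet> avg h g r)" for h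
    by (intro continuous_on_inner continuous_on_subset[OF avg_continuous sub] f g)
  obtain I J where IJ: "\<And>h. ((\<lambda>r. avg h f r \<bullet> avg h g r) has_integral I h) {s..t}"
    "((\<lambda>r. f r \<bullet> g r) has_integral J) {s..t}" "(I \<longlongrightarrow> J) (at_right 0)"
    by (rule uniform_limit_integral[OF u c trivial_limit_at_right_real]) (rule that)
  have "I = (\<lambda>h. integral {s..t} (\<lambda>r. avg h f r \<bullet> avg h g r))"
    using IJ(1) by (metis integral_unique)
  moreover have "J = integral {s..t} (\<lambda>r. f r \<bullet> g r)" using IJ(2) by (metis integral_unique)
  ultimately show ?thesis using IJ(3) by simp
qed

lemma integral_inner_derivative:
  fixes a :: "real \<Rightarrow> 'l::{real_inner,banach}"
  assumes a: "\<And>r. r > 0 \<Longrightarrow> (a has_vector_derivative a' r) (at r)" and "0 < s" "s \<le> t"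
  shows "((\<lambda>r. a r \<bullet> a' r) has_integral (norm (a t))\<^sup>2 / 2 - (norm (a s))\<^sup>2 / 2) {s..t}"
proof (rule fundamental_theorem_of_calculus[OF assms(3)])
  fix r assume "r \<in> {s..t}"
  then have r: "r > 0" using assms by auto
  have "((\<lambda>r. a r \<bullet> a r) has_derivative (\<lambda>h. a r \<bullet> (h *\<^sub>R a' r) + (h *\<^sub>R a' r) \<bullet> a r)) (at r)"
    using a[OF r] unfolding has_vector_derivative_def by (intro has_derivative_inner)
  then have "((\<lambda>r. a r \<bullet> a r) has_vector_derivative (2 * (a r \<bullet> a' r))) (at r)"
    unfolding has_vector_derivative_def by (rule has_derivative_eq_rhs) (intro ext, simp add: inner_commute[of "a' r" "a r"])
  then have d: "((\<lambda>r. (1/2) *\<^sub>R (a r \<bullet> a r)) has_vector_derivative (1/2) *\<^sub>R (2 * (a r \<bullet> a' r))) (at r)"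
    by (rule bounded_linear.has_vector_derivative[OF bounded_linear_scaleR_right])
  have e: "(norm (a r))\<^sup>2 / 2 = (1/2) *\<^sub>R (a r \<bullet> a r)" "a r \<bullet> a' r = (1/2) *\<^sub>R (2 * (a r \<bullet> a' r))" for r
    by (simp_all add: power2_norm_eq_inner)
  show "((\<lambda>r. (norm (a r))\<^sup>2 / 2) has_vector_derivative a r \<bullet> a' r) (at r within {s..t})"
    unfolding e(1) by (subst e(2)) (rule has_vector_derivative_at_within[OF d])
qed

text \<open>The weak equation, integrated over a window of length h and tested with the difference
  quotient of X, gives an exact identity between averages, since the first component of that
  quotient is the average of Y. Passing to the limit is safe for every term except the one with the
  gradient quotient, which is kept on the left and evaluated by the caller.\<close>

lemma energy_limit:
  fixes X :: "real \<Rightarrow> 'l::{real_inner,banach} \<times> 'g::{real_inner,banach}" and S :: "('l \<times> 'g) set"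
  assumes S: "subspace S" and X: "continuous_on {0<..} X" "\<And>t. t > 0 \<Longrightarrow> X t \<in> S"
    and Y: "\<And>t. t > 0 \<Longrightarrow> ((\<lambda>t. fst (X t)) has_vector_derivative Y t) (at t)" "continuous_on {0<..} Y"
    and Z: "continuous_on {0<..} Z" and G: "continuous_on {0<..} G"
    and weak: "\<And>z t. z \<in> S \<Longrightarrow> t > 0 \<Longrightarrow> ((\<lambda>t. Y t \<bullet> fst z) has_vector_derivative (G t \<bullet> fst z - Z t \<bullet> snd z)) (at t)"
    and st: "0 < s" "s \<le> t"
  shows "((\<lambda>h. integral {s..t} (\<lambda>r. avg h Z r \<bullet> ((1 / h) *\<^sub>R (snd (X (r + h)) - snd (X r)))))
    \<longlongrightarrow> integral {s..t} (\<lambda>r. G r \<bullet> Y r) - (norm (Y t))\<^sup>2 / 2 + (norm (Y s))\<^sup>2 / 2) (at_right 0)"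
proof (rule Lim_transform_eventually)
  let ?D = "\<lambda>h r. (1 / h) *\<^sub>R (snd (X (r + h)) - snd (X r))"
  show "((\<lambda>h. integral {s..t} (\<lambda>r. avg h G r \<bullet> avg h Y r) - (norm (avg h Y t))\<^sup>2 / 2 + (norm (avg h Y s))\<^sup>2 / 2)
    \<longlongrightarrow> integral {s..t} (\<lambda>r. G r \<bullet> Y r) - (norm (Y t))\<^sup>2 / 2 + (norm (Y s))\<^sup>2 / 2) (at_right 0)"
    using st by (intro tendsto_intros avg_inner_limit avg_tendsto G Y(2)) auto
  have "\<forall>\<^sub>F h in at_right (0::real). h > 0" by (simp add: eventually_at_right_less)
  then show "\<forall>\<^sub>F h in at_right 0. integral {s..t} (\<lambda>r. avg h G r \<bullet> avg h Y r) - (norm (avg h Y t))\<^sup>2 / 2 + (norm (avg h Y s))\<^sup>2 / 2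
      = integral {s..t} (\<lambda>r. avg h Z r \<bullet> ?D h r)"
  proof eventually_elim
    case h: (elim h)
    have sub: "{s..t} \<subseteq> {0<..}" using st by auto
    have key: "avg h Y r \<bullet> ((1 / h) *\<^sub>R (Y (r + h) - Y r)) = avg h G r \<bullet> avg h Y r - avg h Z r \<bullet> ?D h r" if r: "r > 0" for r
    proof -
      \<comment> \<open>An admissible test function: a difference quotient of elements of S.\<close>
      define z where "z = (1 / h) *\<^sub>R (X (r + h) - X r)"
      have zS: "z \<in> S" unfolding z_def using X(2)[of r] X(2)[of "r + h"] S r h
        by (intro subspace_scale subspace_diff) auto
      have fz: "fst z = avg h Y r" using avg_FTC[OF Y(1) r h] by (simp add: z_def)
      have ci: "continuous_on {r..r+h} Z" "continuous_on {r..r+h} G"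
        using r by (auto intro!: continuous_on_subset[OF Z] continuous_on_subset[OF G])
      then have i: "Z integrable_on {r..r+h}" "G integrable_on {r..r+h}" by (auto intro: integrable_continuous_real)
      have "((\<lambda>q. G q \<bullet> fst z - Z q \<bullet> snd z) has_integral (Y (r + h) \<bullet> fst z - Y r \<bullet> fst z)) {r..r+h}"
        using weak[OF zS] r h by (intro fundamental_theorem_of_calculus) (auto intro: has_vector_derivative_at_within)
      moreover have "((\<lambda>q. G q \<bullet> fst z - Z q \<bullet> snd z) has_integral (integral {r..r+h} G \<bullet> fst z - integral {r..r+h} Z \<bullet> snd z)) {r..r+h}"
        using has_integral_linear[OF integrable_integral[OF i(2)] bounded_linear_inner_left[of "fst z"]]
          has_integral_linear[OF integrable_integral[OF i(1)] bounded_linear_inner_left[of "snd z"]]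
        by (intro has_integral_diff) (auto simp: o_def)
      ultimately have eq: "(Y (r + h) - Y r) \<bullet> fst z = integral {r..r+h} G \<bullet> fst z - integral {r..r+h} Z \<bullet> snd z"
        unfolding inner_diff_left by (rule has_integral_unique)
      have "avg h Y r \<bullet> ((1 / h) *\<^sub>R (Y (r + h) - Y r)) = (1 / h) * ((Y (r + h) - Y r) \<bullet> fst z)"
        by (simp add: fz inner_commute)
      also have "\<dots> = avg h G r \<bullet> fst z - avg h Z r \<bullet> snd z"
        unfolding eq by (simp add: avg_def right_diff_distrib diff_divide_distrib)
      finally show ?thesis by (simp add: fz) (simp add: z_def)
    qed
    have "((\<lambda>r. avg h Y r \<bullet> ((1 / h) *\<^sub>R (Y (r + h) - Y r))) has_integral (norm (avg h Y t))\<^sup>2 / 2 - (norm (avg h Y s))\<^sup>2 / 2) {s..t}"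
      by (rule integral_inner_derivative[OF avg_has_derivative[OF Y(2) _ h] st])
    then have 1: "((\<lambda>r. avg h G r \<bullet> avg h Y r - avg h Z r \<bullet> ?D h r) has_integral (norm (avg h Y t))\<^sup>2 / 2 - (norm (avg h Y s))\<^sup>2 / 2) {s..t}"
      by (rule has_integral_eq[rotated]) (use key st in auto)
    have cX: "continuous_on {s..t} (\<lambda>r. ?D h r)"
      using st h by (intro continuous_intros continuous_on_subset[OF X(1) sub] continuous_on_compose2[OF X(1)]) auto
    have 2: "(\<lambda>r. avg h G r \<bullet> avg h Y r) integrable_on {s..t}" "(\<lambda>r. avg h Z r \<bullet> ?D h r) integrable_on {s..t}"
      by (intro integrable_continuous_real continuous_on_inner continuous_on_subset[OF avg_continuous sub] G Y(2) Z cX)+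
    have "integral {s..t} (\<lambda>r. avg h G r \<bullet> avg h Y r) - integral {s..t} (\<lambda>r. avg h Z r \<bullet> ?D h r)
        = (norm (avg h Y t))\<^sup>2 / 2 - (norm (avg h Y s))\<^sup>2 / 2"
      using integral_unique[OF 1] Henstock_Kurzweil_Integration.integral_diff[OF 2] by simp
    then show ?case by simp
  qed
qed

text \<open>Riemann sums are linear combinations of values of f, hence lie in the subspace, and they
  approximate the integral.\<close>

lemma integral_in_closed_subspace:
  fixes f :: "real \<Rightarrow> 'l::banach"
  assumes S: "subspace S" "closed S" and f: "continuous_on {a..b} f" "\<And>t. t \<in> {a..b} \<Longrightarrow> f t \<in> S"
  shows "integral {a..b} f \<in> S"
proof -
  have "(f has_integral integral {a..b} f) (cbox a b)"
    using integrable_integral[OF integrable_continuous_real[OF f(1)]] by simp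
  then have "\<exists>x\<in>S. dist x (integral {a..b} f) < e" if "e > 0" for e
  proof -
    obtain \<gamma> where \<gamma>: "gauge \<gamma>" "\<And>D. D tagged_division_of (cbox a b) \<Longrightarrow> \<gamma> fine D \<Longrightarrow>
        norm ((\<Sum>(x,k)\<in>D. measure lborel k *\<^sub>R f x) - integral {a..b} f) < e"
      using \<open>(f has_integral integral {a..b} f) (cbox a b)\<close> \<open>e > 0\<close> unfolding has_integral by metis
    obtain D where D: "D tagged_division_of (cbox a b)" "\<gamma> fine D" using fine_division_exists[OF \<gamma>(1)] by blast
    have "x \<in> {a..b}" if "(x, k) \<in> D" for x k
      using tagged_division_ofD(2,3)[OF D(1) that] by auto
    then have "(\<Sum>(x,k)\<in>D. measure lborel k *\<^sub>R f x) \<in> S"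
      using f(2) S(1) by (intro subspace_sum) (auto intro!: subspace_scale)
    then show ?thesis using \<gamma>(2)[OF D] by (auto simp: dist_norm)
  qed
  then have "integral {a..b} f \<in> closure S" by (simp add: closure_approachable)
  then show ?thesis using S(2) by simp
qed

text \<open>In every short interval after t the mean value theorem finds a point where the
  derivative is small, because the increment is; uniform continuity carries this back to t.
  Convergence of g is replaced by vanishing increments, which can be checked before any limit of the
  trajectory is known.\<close>

lemma barbalat:
  fixes g g' :: "real \<Rightarrow> real"
  assumes g: "\<And>t. t > 0 \<Longrightarrow> (g has_vector_derivative g' t) (at t)"
    and uc: "uniformly_continuous_on {0<..} g'"
    and lim: "\<And>d. d > 0 \<Longrightarrow> ((\<lambda>t. g (t + d) - g t) \<longlongrightarrow> 0) at_top"
  shows "(g' \<longlongrightarrow> 0) at_top"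
proof (rule tendstoI)
  fix e :: real assume e: "e > 0"
  then obtain d where d: "d > 0" "\<And>s t. s > 0 \<Longrightarrow> t > 0 \<Longrightarrow> dist s t < d \<Longrightarrow> dist (g' s) (g' t) < e / 2"
    using uc half_gt_zero[OF e] unfolding uniformly_continuous_on_def by (metis greaterThan_iff)
  define h where "h = d / 2"
  have h: "h > 0" "h < d" using d by (auto simp: h_def)
  have "\<forall>\<^sub>F t in at_top. dist (g (t + h) - g t) 0 < h * (e / 2)"
    using lim[OF h(1)] by (rule tendstoD) (use h e in simp)
  moreover have "\<forall>\<^sub>F t in at_top. t > (0::real)" by (rule eventually_gt_at_top)
  ultimately show "\<forall>\<^sub>F t in at_top. dist (g' t) 0 < e"
  proof eventually_elim
    case (elim t)
    obtain z where z: "z > t" "z < t + h" "g (t + h) - g t = (t + h - t) * g' z"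
      using MVT2[of t "t + h" g g'] g elim h by (auto simp: has_real_derivative_iff_has_vector_derivative)
    then have "h * \<bar>g' z\<bar> < h * (e / 2)" using elim h by (simp add: abs_mult dist_real_def)
    then have "\<bar>g' z\<bar> < e / 2" using h by simp
    moreover have "dist (g' z) (g' t) < e / 2" using z h elim by (intro d(2)) (auto simp: dist_real_def)
    moreover have "\<bar>g' t\<bar> \<le> \<bar>g' z\<bar> + \<bar>g' z - g' t\<bar>"
      using abs_triangle_ineq4[of "g' z" "g' z - g' t"] by simp
    ultimately show ?case by (simp add: dist_real_def)
  qed
qed

lemma lipschitz_from_derivative:
  fixes x :: "real \<Rightarrow> 'l::real_normed_vector"
  assumes x: "\<And>t. t > 0 \<Longrightarrow> (x has_vector_derivative y t) (at t)" and B: "\<And>t. t > 0 \<Longrightarrow> norm (y t) \<le> B" and "s > 0" "t > 0"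
  shows "norm (x s - x t) \<le> B * \<bar>s - t\<bar>"
proof -
  have "norm (x s - x t) \<le> B * norm (s - t)"
  proof (rule differentiable_bound[of "{0<..}"])
    show "(x has_derivative (\<lambda>h. h *\<^sub>R y r)) (at r within {0<..})" if "r \<in> {0<..}" for r
      using x[of r] that by (simp add: has_vector_derivative_def has_derivative_at_withinI)
    show "onorm (\<lambda>h. h *\<^sub>R y r) \<le> B" if "r \<in> {0<..}" for r
      using B[of r] that onorm_le[of "\<lambda>h. h *\<^sub>R y r" "norm (y r)"] by (simp add: mult.commute)
  qed (use assms in auto)
  then show ?thesis by simp
qed

lemma lipschitz_uniformly_continuous:
  fixes x :: "real \<Rightarrow> 'l::real_normed_vector"
  assumes "\<And>s t. s > 0 \<Longrightarrow> t > 0 \<Longrightarrow> norm (x s - x t) \<le> B * \<bar>s - t\<bar>"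
  shows "uniformly_continuous_on {0<..} x"
  unfolding uniformly_continuous_on_def
proof (intro allI impI)
  fix e :: real assume e: "e > 0"
  define C where "C = \<bar>B\<bar> + 1"
  have C: "C > 0" "B \<le> C" by (auto simp: C_def)
  show "\<exists>d>0. \<forall>s\<in>{0<..}. \<forall>t\<in>{0<..}. dist t s < d \<longrightarrow> dist (x t) (x s) < e"
  proof (intro exI conjI ballI impI)
    show "e / C > 0" using e C by simp
    fix s t :: real assume st: "s \<in> {0<..}" "t \<in> {0<..}" "dist t s < e / C"
    have "norm (x t - x s) \<le> B * \<bar>t - s\<bar>" using st by (intro assms) auto
    also have "\<dots> \<le> C * \<bar>t - s\<bar>" using C by (intro mult_right_mono) auto
    also have "\<dots> < e" using st C by (simp add: dist_real_def field_simps)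
    finally show "dist (x t) (x s) < e" by (simp add: dist_norm)
  qed
qed


lemma has_vector_derivative_inner_const:
  "(x has_vector_derivative y) F \<Longrightarrow> ((\<lambda>t. x t \<bullet> e) has_vector_derivative y \<bullet> e) F"
  using bounded_linear.has_vector_derivative[OF bounded_linear_inner_left] .

lemma uniformly_continuous_pair_inner:
  fixes x :: "real \<Rightarrow> 'l::real_inner"
  assumes "uniformly_continuous_on A x"
  shows "uniformly_continuous_on A (\<lambda>t. x t \<bullet> e)"
  using bounded_linear.uniformly_continuous_on[OF bounded_linear_inner_left assms] .

lemma uniformly_continuous_mono:
  fixes f :: "'x::metric_space \<Rightarrow> 'y::metric_space"
  shows "uniformly_continuous_on B f \<Longrightarrow> A \<subseteq> B \<Longrightarrow> uniformly_continuous_on A f"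
  unfolding uniformly_continuous_on_def subset_iff by meson

lemma compact_norm_bound:
  assumes "compact (f ` K)"
  obtains C where "\<And>q. q \<in> K \<Longrightarrow> norm (f q) \<le> C"
  using compact_imp_bounded[OF assms] by (auto simp: bounded_iff)

text \<open>Another cluster point y is told apart from x t by the functional given by y - x t
  itself, which lies in the space against which weak continuity is known.\<close>

lemma weak_compact_continuous:
  fixes x :: "real \<Rightarrow> 'l::real_inner"
  assumes L0_sub: "subspace L0" and K: "compact K" "K \<subseteq> L0" "\<And>t. t \<ge> 0 \<Longrightarrow> x t \<in> K"
    and w: "\<And>y. y \<in> L0 \<Longrightarrow> continuous_on {0..} (\<lambda>t. x t \<bullet> y)"
  shows "continuous_on {0..} x"
  unfolding continuous_on_def
proof
  fix t :: real assume t: "t \<in> {0..}"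
  show "(x \<longlongrightarrow> x t) (at t within {0..})"
  proof (rule cluster_tendsto[OF K(1)])
    show "\<forall>\<^sub>F s in at t within {0..}. x s \<in> K"
      using K(3) by (auto simp: eventually_at intro!: exI[of _ 1])
    fix y assume y: "y \<in> K" "y \<noteq> x t"
    then have e: "y - x t \<in> L0" using K t by (intro subspace_diff[OF L0_sub]) auto
    have "((\<lambda>s. x s \<bullet> (y - x t)) \<longlongrightarrow> x t \<bullet> (y - x t)) (at t within {0..})"
      using w[OF e] t by (auto simp: continuous_on_def)
    moreover have "y \<bullet> (y - x t) \<noteq> x t \<bullet> (y - x t)"
      using y by (metis inner_diff_left inner_eq_zero_iff right_minus_eq)
    ultimately show "\<exists>g c. continuous_on K g \<and> ((\<lambda>s. g (x s)) \<longlongrightarrow> (c::real)) (at t within {0..}) \<and> g y \<noteq> c"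
      by (intro exI[of _ "\<lambda>v. v \<bullet> (y - x t)"] exI[of _ "x t \<bullet> (y - x t)"]) (auto intro!: continuous_intros)
  qed
qed

text \<open>The same argument with functionals that see only the first component. They still
  separate, since the first component is injective on S, and the conclusion includes continuity of
  the gradients.\<close>

lemma weak_compact_continuous_fst:
  fixes X :: "real \<Rightarrow> 'l::real_inner \<times> 'g::real_inner"
  assumes S_inj: "\<And>y z. y \<in> S \<Longrightarrow> z \<in> S \<Longrightarrow> fst y = fst z \<Longrightarrow> y = z"
    and L0_sub: "subspace L0" and fst_S: "\<And>z. z \<in> S \<Longrightarrow> fst z \<in> L0"
    and K: "compact K" "K \<subseteq> S" "\<And>t. t \<ge> 0 \<Longrightarrow> X t \<in> K"
    and w: "\<And>y. y \<in> L0 \<Longrightarrow> continuous_on {0..} (\<lambda>t. fst (X t) \<bullet> y)"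
  shows "continuous_on {0..} X"
  unfolding continuous_on_def
proof
  fix t :: real assume t: "t \<in> {0..}"
  show "(X \<longlongrightarrow> X t) (at t within {0..})"
  proof (rule cluster_tendsto[OF K(1)])
    show "\<forall>\<^sub>F s in at t within {0..}. X s \<in> K"
      using K(3) by (auto simp: eventually_at intro!: exI[of _ 1])
    fix y assume y: "y \<in> K" "y \<noteq> X t"
    have yS: "y \<in> S" "X t \<in> S" using y K t by auto
    then have ne: "fst y \<noteq> fst (X t)" using S_inj y by blast
    let ?e = "fst y - fst (X t)"
    have e: "?e \<in> L0" using yS by (intro subspace_diff[OF L0_sub] fst_S)
    have "((\<lambda>s. fst (X s) \<bullet> ?e) \<longlongrightarrow> fst (X t) \<bullet> ?e) (at t within {0..})"
      using w[OF e] t by (auto simp: continuous_on_def)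
    moreover have "fst y \<bullet> ?e \<noteq> fst (X t) \<bullet> ?e"
      using ne by (metis inner_diff_left inner_eq_zero_iff right_minus_eq)
    ultimately show "\<exists>g c. continuous_on K g \<and> ((\<lambda>s. g (X s)) \<longlongrightarrow> (c::real)) (at t within {0..}) \<and> g y \<noteq> c"
      by (intro exI[of _ "\<lambda>v. fst v \<bullet> ?e"] exI[of _ "fst (X t) \<bullet> ?e"]) (auto intro!: continuous_intros)
  qed
qed

subsection \<open>Decay of precompact trajectories\<close>

text \<open>\<open>S\<close> is \<open>H10 \<Omega>\<close> as a space of pairs (function, gradient), \<open>L0\<close> is \<open>L2 \<Omega>\<close>, and \<open>nem\<close>, \<open>pot\<close> are \<open>f(u)\<close>
  and the integral of \<open>F(u)\<close>. The trajectories \<open>U\<close>, \<open>W\<close>, \<open>P\<close> stand for \<open>u\<close>, \<open>w\<close>, \<open>v\<^sub>t\<close>.\<close>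

locale wave_system =
  fixes S :: "('l::{real_inner,banach} \<times> 'g::{real_inner,banach}) set" and L0 :: "'l set"
    and nem :: "'l \<times> 'g \<Rightarrow> 'l" and pot :: "'l \<times> 'g \<Rightarrow> real" and \<alpha> b \<tau> p0 :: real
    and U W P :: "real \<Rightarrow> 'l \<times> 'g" and Ut Wt :: "real \<Rightarrow> 'l"
    and KU KW KP :: "('l \<times> 'g) set" and KUt KWt :: "'l set"
  assumes S_sub: "subspace S" and S_closed: "closed S"
    and S_inj: "\<And>y z. y \<in> S \<Longrightarrow> z \<in> S \<Longrightarrow> fst y = fst z \<Longrightarrow> y = z"
    and L0_sub: "subspace L0" and fst_S: "\<And>z. z \<in> S \<Longrightarrow> fst z \<in> L0"
    and dense: "\<And>e w. (\<And>z. z \<in> S \<Longrightarrow> e \<bullet> fst z = 0) \<Longrightarrow> w \<in> L0 \<Longrightarrow> e \<bullet> w = 0"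
    and p0: "p0 > 0" and poincare: "\<And>z. z \<in> S \<Longrightarrow> p0 * (norm (fst z))\<^sup>2 \<le> (norm (snd z))\<^sup>2"
    and nem_cont: "continuous_on S nem" and pot_cont: "continuous_on S pot" and pot_0: "pot 0 = 0"
    and pot_der: "\<And>V D t. (\<And>s. s \<in> {0<..} \<Longrightarrow> V s \<in> S) \<Longrightarrow> t \<in> {0<..} \<Longrightarrow> continuous (at t within {0<..}) V \<Longrightarrow>
      ((\<lambda>s. fst (V s)) has_vector_derivative D) (at t within {0<..}) \<Longrightarrow>
      ((\<lambda>s. pot (V s)) has_real_derivative nem (V t) \<bullet> D) (at t within {0<..})"
    and params: "b > \<tau>" "\<tau> > 0" "\<alpha> \<noteq> 0"
    and KU: "compact KU" "KU \<subseteq> S" "\<And>t. t \<ge> 0 \<Longrightarrow> U t \<in> KU"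
    and KW: "compact KW" "KW \<subseteq> S" "\<And>t. t \<ge> 0 \<Longrightarrow> W t \<in> KW"
    and KP: "compact KP" "KP \<subseteq> S" "\<And>t. t \<ge> 0 \<Longrightarrow> P t \<in> KP"
    and KUt: "compact KUt" "KUt \<subseteq> L0" "\<And>t. t \<ge> 0 \<Longrightarrow> Ut t \<in> KUt"
    and KWt: "compact KWt" "KWt \<subseteq> L0" "\<And>t. t \<ge> 0 \<Longrightarrow> Wt t \<in> KWt"
    and wU: "\<And>x. x \<in> L0 \<Longrightarrow> continuous_on {0..} (\<lambda>t. fst (U t) \<bullet> x)"
    and wW: "\<And>x. x \<in> L0 \<Longrightarrow> continuous_on {0..} (\<lambda>t. fst (W t) \<bullet> x)"
    and wP: "\<And>x. x \<in> L0 \<Longrightarrow> continuous_on {0..} (\<lambda>t. fst (P t) \<bullet> x)"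
    and wUt: "\<And>x. x \<in> L0 \<Longrightarrow> continuous_on {0..} (\<lambda>t. Ut t \<bullet> x)"
    and wWt: "\<And>x. x \<in> L0 \<Longrightarrow> continuous_on {0..} (\<lambda>t. Wt t \<bullet> x)"
    and iU: "\<And>z s t. z \<in> S \<Longrightarrow> 0 < s \<Longrightarrow> s < t \<Longrightarrow>
      fst (U t) \<bullet> fst z - fst (U s) \<bullet> fst z = integral {s..t} (\<lambda>r. Ut r \<bullet> fst z)"
    and iW: "\<And>z s t. z \<in> S \<Longrightarrow> 0 < s \<Longrightarrow> s < t \<Longrightarrow>
      fst (W t) \<bullet> fst z - fst (W s) \<bullet> fst z = integral {s..t} (\<lambda>r. Wt r \<bullet> fst z)"
    and iV: "\<And>z s t. z \<in> S \<Longrightarrow> 0 < s \<Longrightarrow> s < t \<Longrightarrow>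
      fst (W t - \<tau> *\<^sub>R P t) \<bullet> fst z - fst (W s - \<tau> *\<^sub>R P s) \<bullet> fst z = integral {s..t} (\<lambda>r. fst (P r) \<bullet> fst z)"
    and iUt: "\<And>z s t. z \<in> S \<Longrightarrow> 0 < s \<Longrightarrow> s < t \<Longrightarrow> Ut t \<bullet> fst z - Ut s \<bullet> fst z
      = integral {s..t} (\<lambda>r. (nem (U r) - \<alpha> *\<^sub>R fst (W r)) \<bullet> fst z - snd (U r) \<bullet> snd z)"
    and iWt: "\<And>z s t. z \<in> S \<Longrightarrow> 0 < s \<Longrightarrow> s < t \<Longrightarrow> Wt t \<bullet> fst z - Wt s \<bullet> fst z
      = integral {s..t} (\<lambda>r. - (\<alpha> *\<^sub>R fst (U r)) \<bullet> fst z - (snd (W r) + (b - \<tau>) *\<^sub>R snd (P r)) \<bullet> snd z)"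
begin

lemma cU: "continuous_on {0..} U" by (rule weak_compact_continuous_fst[OF S_inj L0_sub fst_S KU wU])
lemma cW: "continuous_on {0..} W" by (rule weak_compact_continuous_fst[OF S_inj L0_sub fst_S KW wW])
lemma cP: "continuous_on {0..} P" by (rule weak_compact_continuous_fst[OF S_inj L0_sub fst_S KP wP])
lemma cUt: "continuous_on {0..} Ut" by (rule weak_compact_continuous[OF L0_sub KUt wUt])
lemma cWt: "continuous_on {0..} Wt" by (rule weak_compact_continuous[OF L0_sub KWt wWt])

lemma pos: "continuous_on {0..} f \<Longrightarrow> continuous_on {0<..} f" for f :: "real \<Rightarrow> 'x::topological_space"
  by (erule continuous_on_subset) auto

lemma inS: "t \<ge> 0 \<Longrightarrow> U t \<in> S" "t \<ge> 0 \<Longrightarrow> W t \<in> S" "t \<ge> 0 \<Longrightarrow> P t \<in> S"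
  using KU KW KP by auto

lemma inL: "t \<ge> 0 \<Longrightarrow> Ut t \<in> L0" "t \<ge> 0 \<Longrightarrow> Wt t \<in> L0" "t \<ge> 0 \<Longrightarrow> fst (P t) \<in> L0"
  "t \<ge> 0 \<Longrightarrow> fst (U t) \<in> L0" "t \<ge> 0 \<Longrightarrow> fst (W t) \<in> L0"
  using KUt KWt inS fst_S by auto

lemma strong_derivative:
  assumes y: "continuous_on {0..} y" and L: "\<And>t. t \<ge> 0 \<Longrightarrow> x t \<in> L0" "\<And>t. t \<ge> 0 \<Longrightarrow> y t \<in> L0"
    and id: "\<And>z s t. z \<in> S \<Longrightarrow> 0 < s \<Longrightarrow> s < t \<Longrightarrow> x t \<bullet> fst z - x s \<bullet> fst z = integral {s..t} (\<lambda>r. y r \<bullet> fst z)"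
    and t: "t > 0"
  shows "(x has_vector_derivative y t) (at t)"
proof (rule has_vector_derivative_integral_identity[OF pos[OF y] _ t])
  fix s t :: real assume st: "0 < s" "s < t"
  define e where "e = x t - x s - integral {s..t} y"
  have int: "y integrable_on {s..t}"
    by (rule integrable_continuous_real, rule continuous_on_subset[OF y]) (use st in auto)
  have I: "integral {s..t} (\<lambda>r. y r \<bullet> v) = integral {s..t} y \<bullet> v" for v
    using integral_unique[OF has_integral_linear[OF integrable_integral[OF int] bounded_linear_inner_left[of v]]]
    by (simp add: o_def)
  have "e \<bullet> fst z = 0" if "z \<in> S" for z
    using id[OF that st] by (simp add: e_def inner_diff_left I)
  then have d: "e \<bullet> w = 0" if "w \<in> L0" for w using dense that by blast
  \<comment> \<open>The defect e is orthogonal to L0. Expanding one factor leaves the inner products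
    of e with x t - x s and, under the integral, with the values of y, all of which lie in
    L0.\<close>
  have "e \<bullet> e = e \<bullet> (x t - x s) - integral {s..t} y \<bullet> e"
    by (subst (2) e_def) (simp add: inner_diff_right inner_commute)
  also have "e \<bullet> (x t - x s) = 0" using L(1) st by (intro d subspace_diff[OF L0_sub]) auto
  also have "integral {s..t} y \<bullet> e = integral {s..t} (\<lambda>r. y r \<bullet> e)" by (rule I[symmetric])
  also have "\<dots> = integral {s..t} (\<lambda>r. 0)"
    using d L(2) st by (intro integral_cong) (auto simp: inner_commute[of _ e])
  finally have "e = 0" by simp
  then show "x t - x s = integral {s..t} y" by (simp add: e_def)
qed

lemma dU: "t > 0 \<Longrightarrow> ((\<lambda>t. fst (U t)) has_vector_derivative Ut t) (at t)"
  by (rule strong_derivative[OF cUt inL(4) inL(1) iU])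

lemma dW: "t > 0 \<Longrightarrow> ((\<lambda>t. fst (W t)) has_vector_derivative Wt t) (at t)"
  by (rule strong_derivative[OF cWt inL(5) inL(2) iW])

text \<open>The trajectory of v itself, recovered from w = v + \<tau>
  \<open>v\<^sub>t\<close>.\<close>

definition V :: "real \<Rightarrow> 'l \<times> 'g" where "V t = W t - \<tau> *\<^sub>R P t"

lemma V_S: "t \<ge> 0 \<Longrightarrow> V t \<in> S"
  unfolding V_def using inS S_sub by (intro subspace_diff subspace_scale) auto

lemma dV1: "t > 0 \<Longrightarrow> ((\<lambda>t. fst (V t)) has_vector_derivative fst (P t)) (at t)"
proof (rule strong_derivative[of "\<lambda>t. fst (P t)"])
  show "continuous_on {0..} (\<lambda>t. fst (P t))" by (intro continuous_on_fst cP)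
  show "fst (V r) \<bullet> fst z - fst (V s) \<bullet> fst z = integral {s..r} (\<lambda>r. fst (P r) \<bullet> fst z)"
    if "z \<in> S" "0 < s" "s < r" for z s r using iV[OF that] by (simp add: V_def)
qed (use V_S fst_S inL in auto)

text \<open>Unlike U and W, this trajectory is differentiable in the full norm of S: the derivative
  P is continuous with values in S, its integral stays in the closed subspace, and injectivity of
  the first component lifts the L2 identity. The dissipation in the energy depends on this.\<close>

lemma dV: assumes "t > 0" shows "(V has_vector_derivative P t) (at t)"
proof (rule has_vector_derivative_integral_identity[OF pos[OF cP] _ assms])
  fix s t :: real assume st: "0 < s" "s < t"
  have c: "continuous_on {s..t} P" by (rule continuous_on_subset[OF cP]) (use st in auto)
  have iP: "integral {s..t} P \<in> S"
    by (rule integral_in_closed_subspace[OF S_sub S_closed c]) (use inS st in auto)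
  have i1: "((\<lambda>r. fst (P r)) has_integral fst (V t) - fst (V s)) {s..t}"
    using dV1 st by (intro fundamental_theorem_of_calculus) (auto intro: has_vector_derivative_at_within)
  have i2: "((\<lambda>r. fst (P r)) has_integral fst (integral {s..t} P)) {s..t}"
    using has_integral_linear[OF integrable_integral[OF integrable_continuous_real[OF c]] bounded_linear_fst]
    by (simp add: o_def)
  show "V t - V s = integral {s..t} P"
  proof (rule S_inj[OF _ iP])
    show "V t - V s \<in> S" using V_S st by (intro subspace_diff[OF S_sub]) auto
    show "fst (V t - V s) = fst (integral {s..t} P)" using has_integral_unique[OF i1 i2] by simp
  qed
qed

text \<open>P is the quotient (W - V)/\<tau>, and both terms have known derivatives in L2.\<close>

lemma dP: assumes "t > 0" shows "((\<lambda>t. fst (P t)) has_vector_derivative (1/\<tau>) *\<^sub>R (Wt t - fst (P t))) (at t)"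
proof -
  have "((\<lambda>t. (1/\<tau>) *\<^sub>R (fst (W t) - fst (V t))) has_vector_derivative (1/\<tau>) *\<^sub>R (Wt t - fst (P t))) (at t)"
    by (intro bounded_linear.has_vector_derivative[OF bounded_linear_scaleR_right] has_vector_derivative_diff dW dV1 assms)
  moreover have "(1/\<tau>) *\<^sub>R (fst (W t) - fst (V t)) = fst (P t)" for t using params by (simp add: V_def)
  ultimately show ?thesis by simp
qed

text \<open>\<open>AU\<close> and \<open>AW\<close> are the second time derivatives of u and w as
  functionals on S, read off from the two equations.\<close>

definition AU :: "real \<Rightarrow> 'l \<times> 'g \<Rightarrow> real" where
  "AU r z = (nem (U r) - \<alpha> *\<^sub>R fst (W r)) \<bullet> fst z - snd (U r) \<bullet> snd z"

definition AW :: "real \<Rightarrow> 'l \<times> 'g \<Rightarrow> real" where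
  "AW r z = - (\<alpha> *\<^sub>R fst (U r)) \<bullet> fst z - (snd (W r) + (b - \<tau>) *\<^sub>R snd (P r)) \<bullet> snd z"

lemma c_nem: "continuous_on {0..} (\<lambda>r. nem (U r))"
  by (rule continuous_on_compose2[OF nem_cont cU]) (use inS in auto)

lemma dUt: "z \<in> S \<Longrightarrow> t > 0 \<Longrightarrow> ((\<lambda>t. Ut t \<bullet> fst z) has_vector_derivative AU t z) (at t)"
  unfolding AU_def
  by (rule has_vector_derivative_integral_identity)
     (auto simp: iUt intro!: continuous_intros pos[OF c_nem] pos[OF cU] pos[OF cW])

lemma dWt: "z \<in> S \<Longrightarrow> t > 0 \<Longrightarrow> ((\<lambda>t. Wt t \<bullet> fst z) has_vector_derivative AW t z) (at t)"
  unfolding AW_def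
  by (rule has_vector_derivative_integral_identity)
     (auto simp: iWt intro!: continuous_intros pos[OF cP] pos[OF cU] pos[OF cW])

subsection \<open>The energy identity\<close>

text \<open>\<open>Ut\<close> has a time derivative only in the dual space, so it is no admissible test function for its
  own equation; difference quotients of \<open>U\<close> are, and they are paired with Steklov averages.\<close>

lemma energy_U:
  assumes st: "0 < s" "s \<le> t"
  shows "(norm (snd (U t)))\<^sup>2 / 2 - (norm (snd (U s)))\<^sup>2 / 2 + (norm (Ut t))\<^sup>2 / 2 - (norm (Ut s))\<^sup>2 / 2
    = integral {s..t} (\<lambda>r. (nem (U r) - \<alpha> *\<^sub>R fst (W r)) \<bullet> Ut r)"
proof -
  have csU: "continuous_on {0<..} (\<lambda>r. snd (U r))" by (intro continuous_intros pos[OF cU])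
  have 1: "((\<lambda>h. integral {s..t} (\<lambda>r. avg h (\<lambda>r. snd (U r)) r \<bullet> ((1 / h) *\<^sub>R (snd (U (r + h)) - snd (U r)))))
    \<longlongrightarrow> integral {s..t} (\<lambda>r. (nem (U r) - \<alpha> *\<^sub>R fst (W r)) \<bullet> Ut r) - (norm (Ut t))\<^sup>2 / 2 + (norm (Ut s))\<^sup>2 / 2) (at_right 0)"
    by (rule energy_limit[OF S_sub pos[OF cU] _ dU pos[OF cUt] csU _ dUt[unfolded AU_def] st])
       (use inS in \<open>auto intro!: continuous_intros pos[OF c_nem] pos[OF cW]\<close>)
  have 2: "((\<lambda>h. (norm (avg h (\<lambda>r. snd (U r)) t))\<^sup>2 / 2 - (norm (avg h (\<lambda>r. snd (U r)) s))\<^sup>2 / 2)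
    \<longlongrightarrow> (norm (snd (U t)))\<^sup>2 / 2 - (norm (snd (U s)))\<^sup>2 / 2) (at_right 0)"
    using st by (intro tendsto_intros avg_tendsto[OF csU]) auto
  have "\<forall>\<^sub>F h in at_right (0::real). h > 0" by (simp add: eventually_at_right_less)
  then have "\<forall>\<^sub>F h in at_right 0. (norm (avg h (\<lambda>r. snd (U r)) t))\<^sup>2 / 2 - (norm (avg h (\<lambda>r. snd (U r)) s))\<^sup>2 / 2
      = integral {s..t} (\<lambda>r. avg h (\<lambda>r. snd (U r)) r \<bullet> ((1 / h) *\<^sub>R (snd (U (r + h)) - snd (U r))))"
    by eventually_elim
       (rule integral_unique[symmetric], rule integral_inner_derivative[OF avg_has_derivative[OF csU] st])
  from Lim_transform_eventually[OF 2 this] show ?thesis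
    using tendsto_unique[OF trivial_limit_at_right_real _ 1] by fastforce
qed

text \<open>Since w = v + \<tau> \<open>v\<^sub>t\<close>, the difference quotient of the gradient
  of W is p + \<tau> p', where p is the averaged gradient of P and p' its derivative. Pairing it
  with (b - \<tau>) p produces the dissipation (b - \<tau>) |p|^2 and an exact derivative, the
  gradient term of P in the energy.\<close>

lemma energy_W:
  assumes st: "0 < s" "s \<le> t"
  shows "(norm (snd (W t)))\<^sup>2 / 2 - (norm (snd (W s)))\<^sup>2 / 2 + (norm (Wt t))\<^sup>2 / 2 - (norm (Wt s))\<^sup>2 / 2
    + (b - \<tau>) * integral {s..t} (\<lambda>r. (norm (snd (P r)))\<^sup>2)
    + (b - \<tau>) * \<tau> * ((norm (snd (P t)))\<^sup>2 / 2 - (norm (snd (P s)))\<^sup>2 / 2)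
    = integral {s..t} (\<lambda>r. - (\<alpha> *\<^sub>R fst (U r)) \<bullet> Wt r)"
proof -
  have csW: "continuous_on {0<..} (\<lambda>r. snd (W r))" and csP: "continuous_on {0<..} (\<lambda>r. snd (P r))"
    by (intro continuous_intros pos[OF cW] pos[OF cP])+
  define a where "a = (\<lambda>h. avg h (\<lambda>r. snd (W r)))"
  define p where "p = (\<lambda>h. avg h (\<lambda>r. snd (P r)))"
  define Z where "Z = (\<lambda>r. snd (W r) + (b - \<tau>) *\<^sub>R snd (P r))"
  have cZ: "continuous_on {0<..} Z" unfolding Z_def by (intro continuous_intros csW csP)
  have 1: "((\<lambda>h. integral {s..t} (\<lambda>r. avg h Z r \<bullet> ((1 / h) *\<^sub>R (snd (W (r + h)) - snd (W r)))))
    \<longlongrightarrow> integral {s..t} (\<lambda>r. - (\<alpha> *\<^sub>R fst (U r)) \<bullet> Wt r) - (norm (Wt t))\<^sup>2 / 2 + (norm (Wt s))\<^sup>2 / 2) (at_right 0)"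
  proof (rule energy_limit[OF S_sub pos[OF cW] _ dW pos[OF cWt] cZ _ _ st])
    show "((\<lambda>t. Wt t \<bullet> fst z) has_vector_derivative (- (\<alpha> *\<^sub>R fst (U r)) \<bullet> fst z - Z r \<bullet> snd z)) (at r)"
      if "z \<in> S" "r > 0" for z r using dWt[OF that] by (simp add: AW_def Z_def)
  qed (use inS in \<open>auto intro!: continuous_intros pos[OF cU]\<close>)
  let ?R = "\<lambda>h. ((norm (a h t))\<^sup>2 / 2 - (norm (a h s))\<^sup>2 / 2) + ((b - \<tau>) * integral {s..t} (\<lambda>r. p h r \<bullet> p h r)
      + (b - \<tau>) * \<tau> * ((norm (p h t))\<^sup>2 / 2 - (norm (p h s))\<^sup>2 / 2))"
  have 2: "(?R \<longlongrightarrow> ((norm (snd (W t)))\<^sup>2 / 2 - (norm (snd (W s)))\<^sup>2 / 2) + ((b - \<tau>) * integral {s..t} (\<lambda>r. snd (P r) \<bullet> snd (P r))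
      + (b - \<tau>) * \<tau> * ((norm (snd (P t)))\<^sup>2 / 2 - (norm (snd (P s)))\<^sup>2 / 2))) (at_right 0)"
    unfolding a_def p_def using st by (intro tendsto_intros avg_tendsto csW csP avg_inner_limit) auto
  have "\<forall>\<^sub>F h in at_right (0::real). h > 0" by (simp add: eventually_at_right_less)
  then have "\<forall>\<^sub>F h in at_right 0. ?R h = integral {s..t} (\<lambda>r. avg h Z r \<bullet> ((1 / h) *\<^sub>R (snd (W (r + h)) - snd (W r))))"
  proof eventually_elim
    case h: (elim h)
    let ?a' = "\<lambda>r. (1 / h) *\<^sub>R (snd (W (r + h)) - snd (W r))" and ?p' = "\<lambda>r. (1 / h) *\<^sub>R (snd (P (r + h)) - snd (P r))"
    have da: "((\<lambda>r. a h r \<bullet> ?a' r) has_integral (norm (a h t))\<^sup>2 / 2 - (norm (a h s))\<^sup>2 / 2) {s..t}"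
      unfolding a_def by (rule integral_inner_derivative[OF avg_has_derivative[OF csW _ h] st])
    have dp: "((\<lambda>r. p h r \<bullet> ?p' r) has_integral (norm (p h t))\<^sup>2 / 2 - (norm (p h s))\<^sup>2 / 2) {s..t}"
      unfolding p_def by (rule integral_inner_derivative[OF avg_has_derivative[OF csP _ h] st])
    have cp: "continuous_on {s..t} (p h)"
      unfolding p_def by (rule continuous_on_subset[OF avg_continuous[OF csP]]) (use st in auto)
    have dpp: "((\<lambda>r. p h r \<bullet> p h r) has_integral integral {s..t} (\<lambda>r. p h r \<bullet> p h r)) {s..t}"
      by (intro integrable_integral integrable_continuous_real continuous_intros cp)
    have "((\<lambda>r. a h r \<bullet> ?a' r + ((b - \<tau>) * (p h r \<bullet> p h r) + (b - \<tau>) * \<tau> * (p h r \<bullet> ?p' r))) has_integral ?R h) {s..t}"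
      by (intro has_integral_add da has_integral_mult_right dp dpp)
    moreover have "avg h Z r \<bullet> ?a' r = a h r \<bullet> ?a' r + ((b - \<tau>) * (p h r \<bullet> p h r) + (b - \<tau>) * \<tau> * (p h r \<bullet> ?p' r))"
      if "r \<in> {s..t}" for r
    proof -
      have r: "r > 0" using that st by simp
      have "(\<lambda>r. snd (W r)) integrable_on {r..r+h}" "(\<lambda>r. snd (P r)) integrable_on {r..r+h}"
        using r by (auto intro!: integrable_continuous_real continuous_on_subset[OF csW] continuous_on_subset[OF csP])
      then have Zr: "avg h Z r = a h r + (b - \<tau>) *\<^sub>R p h r"
        unfolding avg_def Z_def a_def p_def
        by (simp add: Henstock_Kurzweil_Integration.integral_add integrable_cmul scaleR_add_right)
      have dsV: "((\<lambda>t. snd (V t)) has_vector_derivative snd (P t)) (at t)" if "t > 0" for t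
        using bounded_linear.has_vector_derivative[OF bounded_linear_snd dV[OF that]] .
      have "p h r = (1 / h) *\<^sub>R (snd (V (r + h)) - snd (V r))"
        unfolding p_def by (rule avg_FTC[OF dsV r h])
      moreover have "snd (W q) = snd (V q) + \<tau> *\<^sub>R snd (P q)" for q by (simp add: V_def)
      ultimately have a': "?a' r = p h r + \<tau> *\<^sub>R ?p' r" by (simp add: algebra_simps)
      have "avg h Z r \<bullet> ?a' r = a h r \<bullet> ?a' r + (b - \<tau>) * (p h r \<bullet> (p h r + \<tau> *\<^sub>R ?p' r))"
        unfolding Zr inner_add_left inner_scaleR_left a'[symmetric] ..
      also have "p h r \<bullet> (p h r + \<tau> *\<^sub>R ?p' r) = p h r \<bullet> p h r + \<tau> * (p h r \<bullet> ?p' r)"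
        by (simp only: inner_add_right inner_scaleR_right)
      finally show ?thesis by (simp only: distrib_left mult.assoc)
    qed
    ultimately have "((\<lambda>r. avg h Z r \<bullet> ?a' r) has_integral ?R h) {s..t}"
      by (subst has_integral_cong) auto
    then show ?case by (rule integral_unique[symmetric])
  qed
  from tendsto_unique[OF trivial_limit_at_right_real Lim_transform_eventually[OF 2 this] 1]
  show ?thesis by (simp add: power2_norm_eq_inner)
qed

definition En :: "'l \<times> 'g \<Rightarrow> 'l \<Rightarrow> 'l \<times> 'g \<Rightarrow> 'l \<Rightarrow> 'l \<times> 'g \<Rightarrow> real" where
  "En u ut w wt p = (norm ut)\<^sup>2 / 2 + (norm wt)\<^sup>2 / 2 + (b - \<tau>) * \<tau> * ((norm (snd p))\<^sup>2 / 2)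
    + (norm (snd u))\<^sup>2 / 2 + (norm (snd w))\<^sup>2 / 2 + \<alpha> * (fst u \<bullet> fst w) - pot u"

definition E :: "real \<Rightarrow> real" where "E t = En (U t) (Ut t) (W t) (Wt t) (P t)"

lemma E_continuous: "continuous_on {0..} E"
proof -
  have "continuous_on {0..} (\<lambda>t. pot (U t))"
    by (rule continuous_on_compose2[OF pot_cont cU]) (use inS in auto)
  then show ?thesis
    unfolding E_def[abs_def] En_def by (intro continuous_intros cU cW cP cUt cWt) auto
qed

text \<open>The coupling term and the potential are differentiable along the trajectory already with
  L2 velocities, so they obey the ordinary fundamental theorem. Their derivative cancels the
  right-hand sides of \<open>energy_U\<close> and \<open>energy_W\<close>.\<close>

lemma energy_identity_pos:
  assumes st: "0 < s" "s \<le> t"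
  shows "E t - E s = - (b - \<tau>) * integral {s..t} (\<lambda>r. (norm (snd (P r)))\<^sup>2)"
proof -
  let ?C = "\<lambda>r. \<alpha> * (fst (U r) \<bullet> fst (W r)) - pot (U r)"
  have sub: "{s..t} \<subseteq> {0..}" using st by auto
  have "((\<lambda>r. \<alpha> * (fst (U r) \<bullet> Wt r + Ut r \<bullet> fst (W r)) - nem (U r) \<bullet> Ut r) has_integral ?C t - ?C s) {s..t}"
  proof (rule fundamental_theorem_of_calculus[OF st(2)])
    fix r assume "r \<in> {s..t}"
    then have r: "r > 0" using st by simp
    have "((\<lambda>r. fst (U r) \<bullet> fst (W r)) has_derivative (\<lambda>h. fst (U r) \<bullet> (h *\<^sub>R Wt r) + (h *\<^sub>R Ut r) \<bullet> fst (W r))) (at r)"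
      using dU[OF r] dW[OF r] unfolding has_vector_derivative_def by (intro has_derivative_inner)
    then have 1: "((\<lambda>r. fst (U r) \<bullet> fst (W r)) has_vector_derivative (fst (U r) \<bullet> Wt r + Ut r \<bullet> fst (W r))) (at r)"
      unfolding has_vector_derivative_def by (rule has_derivative_eq_rhs) (auto simp: algebra_simps)
    have "((\<lambda>s. pot (U s)) has_real_derivative nem (U r) \<bullet> Ut r) (at r within {0<..})"
    proof (rule pot_der)
      show "continuous (at r within {0<..}) U"
        using pos[OF cU] r by (auto simp: continuous_on_eq_continuous_within)
      show "((\<lambda>s. fst (U s)) has_vector_derivative Ut r) (at r within {0<..})"
        by (rule has_vector_derivative_at_within[OF dU[OF r]])
    qed (use inS r in auto)
    moreover have "at r within {0<..} = at r" using r by (intro at_within_open) auto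
    ultimately have 2: "((\<lambda>s. pot (U s)) has_vector_derivative nem (U r) \<bullet> Ut r) (at r)"
      by (simp add: has_real_derivative_iff_has_vector_derivative)
    show "(?C has_vector_derivative \<alpha> * (fst (U r) \<bullet> Wt r + Ut r \<bullet> fst (W r)) - nem (U r) \<bullet> Ut r) (at r within {s..t})"
      using has_vector_derivative_diff[OF bounded_linear.has_vector_derivative[OF bounded_linear_mult_right 1] 2]
      by (rule has_vector_derivative_at_within)
  qed
  then have C: "?C t - ?C s = integral {s..t} (\<lambda>r. \<alpha> * (fst (U r) \<bullet> Wt r + Ut r \<bullet> fst (W r)) - nem (U r) \<bullet> Ut r)"
    by (rule integral_unique[symmetric])
  have c: "continuous_on {s..t} (\<lambda>r. (nem (U r) - \<alpha> *\<^sub>R fst (W r)) \<bullet> Ut r)"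
    "continuous_on {s..t} (\<lambda>r. - (\<alpha> *\<^sub>R fst (U r)) \<bullet> Wt r)"
    by (intro continuous_intros continuous_on_subset[OF _ sub] c_nem cU cW cUt cWt)+
  have "integral {s..t} (\<lambda>r. (nem (U r) - \<alpha> *\<^sub>R fst (W r)) \<bullet> Ut r) + integral {s..t} (\<lambda>r. - (\<alpha> *\<^sub>R fst (U r)) \<bullet> Wt r)
      = integral {s..t} (\<lambda>r. (nem (U r) - \<alpha> *\<^sub>R fst (W r)) \<bullet> Ut r + - (\<alpha> *\<^sub>R fst (U r)) \<bullet> Wt r)"
    by (rule Henstock_Kurzweil_Integration.integral_add[symmetric]) (intro integrable_continuous_real c)+
  also have "\<dots> = integral {s..t} (\<lambda>r. - (\<alpha> * (fst (U r) \<bullet> Wt r + Ut r \<bullet> fst (W r)) - nem (U r) \<bullet> Ut r))"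
    by (rule arg_cong[where f = "integral {s..t}"]) (auto simp: algebra_simps inner_commute)
  also have "\<dots> = - integral {s..t} (\<lambda>r. \<alpha> * (fst (U r) \<bullet> Wt r + Ut r \<bullet> fst (W r)) - nem (U r) \<bullet> Ut r)"
    by (rule integral_neg)
  also have "\<dots> = - (?C t - ?C s)" by (simp only: C)
  finally show ?thesis
    using energy_U[OF st] energy_W[OF st] unfolding E_def En_def by (simp add: algebra_simps)
qed


text \<open>The identity has a sign for positive times. Time 0, where the hypothesis on the energy
  lives, is reached by continuity.\<close>

lemma E_antimono: assumes "0 \<le> s" "s \<le> t" shows "E t \<le> E s"
proof -
  have pos: "E t \<le> E s" if "0 < s" "s \<le> t" for s t
  proof -
    have "0 \<le> integral {s..t} (\<lambda>r. (norm (snd (P r)))\<^sup>2)" 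
      by (intro Henstock_Kurzweil_Integration.integral_nonneg integrable_continuous_real continuous_intros continuous_on_subset[OF cP])
        (use that in auto)
    then have "0 \<le> (b - \<tau>) * integral {s..t} (\<lambda>r. (norm (snd (P r)))\<^sup>2)" using params by simp
    then show ?thesis using energy_identity_pos[OF that] by (simp add: left_diff_distrib)
  qed
  show ?thesis
  proof (cases "s > 0 \<or> s = t")
    case False
    then have s0: "s = 0" "t > 0" using assms by auto
    have "(E \<longlongrightarrow> E 0) (at 0 within {0..})" using E_continuous by (auto simp: continuous_on_def)
    then have lim: "(E \<longlongrightarrow> E 0) (at_right 0)" by (rule tendsto_within_subset) auto
    have "\<forall>\<^sub>F r in at_right 0. E t \<le> E r"
      using pos s0 by (auto simp: eventually_at_right[of 0 t] intro!: exI[of _ t])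
    then show ?thesis using tendsto_lowerbound[OF lim] s0 by (metis trivial_limit_at_right_real)
  qed (use pos assms in auto)
qed

lemma bounds: obtains B where "B \<ge> 0" "\<And>t. t \<ge> 0 \<Longrightarrow> norm (U t) \<le> B" "\<And>t. t \<ge> 0 \<Longrightarrow> norm (W t) \<le> B"
  "\<And>t. t \<ge> 0 \<Longrightarrow> norm (P t) \<le> B" "\<And>t. t \<ge> 0 \<Longrightarrow> norm (Ut t) \<le> B" "\<And>t. t \<ge> 0 \<Longrightarrow> norm (Wt t) \<le> B"
  "\<And>t. t \<ge> 0 \<Longrightarrow> norm (nem (U t)) \<le> B" "\<And>t. t \<ge> 0 \<Longrightarrow> \<bar>pot (U t)\<bar> \<le> B"
proof -
  have nK: "compact (nem ` KU)" "compact (pot ` KU)"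
    using KU by (auto intro!: compact_continuous_image continuous_on_subset[OF nem_cont] continuous_on_subset[OF pot_cont])
  obtain B1 where B1: "\<And>x. x \<in> KU \<Longrightarrow> norm x \<le> B1" using compact_imp_bounded[OF KU(1)] by (auto simp: bounded_iff)
  obtain B2 where B2: "\<And>x. x \<in> KW \<Longrightarrow> norm x \<le> B2" using compact_imp_bounded[OF KW(1)] by (auto simp: bounded_iff)
  obtain B3 where B3: "\<And>x. x \<in> KP \<Longrightarrow> norm x \<le> B3" using compact_imp_bounded[OF KP(1)] by (auto simp: bounded_iff)
  obtain B4 where B4: "\<And>x. x \<in> KUt \<Longrightarrow> norm x \<le> B4" using compact_imp_bounded[OF KUt(1)] by (auto simp: bounded_iff)
  obtain B5 where B5: "\<And>x. x \<in> KWt \<Longrightarrow> norm x \<le> B5" using compact_imp_bounded[OF KWt(1)] by (auto simp: bounded_iff)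
  obtain B6 where B6: "\<And>x. x \<in> KU \<Longrightarrow> norm (nem x) \<le> B6" using compact_imp_bounded[OF nK(1)] by (auto simp: bounded_iff)
  obtain B7 where B7: "\<And>x. x \<in> KU \<Longrightarrow> \<bar>pot x\<bar> \<le> B7" using compact_imp_bounded[OF nK(2)] by (auto simp: bounded_iff)
  define B where "B = \<bar>B1\<bar> + \<bar>B2\<bar> + \<bar>B3\<bar> + \<bar>B4\<bar> + \<bar>B5\<bar> + \<bar>B6\<bar> + \<bar>B7\<bar>"
  have le: "B1 \<le> B" "B2 \<le> B" "B3 \<le> B" "B4 \<le> B" "B5 \<le> B" "B6 \<le> B" "B7 \<le> B" "0 \<le> B"
    unfolding B_def using abs_ge_self abs_ge_zero
    by (simp_all add: add_increasing add_increasing2 add_nonneg_nonneg)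
  show ?thesis
    by (rule that[of B]) (use le B1 B2 B3 B4 B5 B6 B7 KU KW KP KUt KWt order_trans in metis)+
qed

text \<open>The lower bound comes from the compact range of the trajectory, which bounds the
  coupling and the potential. That the limit is at most the initial energy is what later places
  cluster points below the well depth.\<close>

lemma E_lim: obtains Ei where "(E \<longlongrightarrow> Ei) at_top" "Ei \<le> E 0"
proof -
  obtain B where B: "B \<ge> 0" "\<And>t. t \<ge> 0 \<Longrightarrow> norm (U t) \<le> B" "\<And>t. t \<ge> 0 \<Longrightarrow> norm (W t) \<le> B"
    "\<And>t. t \<ge> 0 \<Longrightarrow> \<bar>pot (U t)\<bar> \<le> B" using bounds by metis
  have lb: "E t \<ge> - (\<bar>\<alpha>\<bar> * (B * B)) - B" if t: "t \<ge> 0" for t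
  proof -
    have "\<bar>fst (U t) \<bullet> fst (W t)\<bar> \<le> norm (fst (U t)) * norm (fst (W t))" by (rule Cauchy_Schwarz_ineq2)
    also have "\<dots> \<le> B * B"
      using norm_fst_le[of "fst (U t)" "snd (U t)"] norm_fst_le[of "fst (W t)" "snd (W t)"] B(1) B(2,3)[OF t]
      by (intro mult_mono) simp_all
    finally have "\<bar>\<alpha> * (fst (U t) \<bullet> fst (W t))\<bar> \<le> \<bar>\<alpha>\<bar> * (B * B)"
      by (simp add: abs_mult mult_left_mono)
    moreover have "0 \<le> (norm (Ut t))\<^sup>2 / 2 + (norm (Wt t))\<^sup>2 / 2 + (b - \<tau>) * \<tau> * ((norm (snd (P t)))\<^sup>2 / 2)
      + (norm (snd (U t)))\<^sup>2 / 2 + (norm (snd (W t)))\<^sup>2 / 2" using params by simp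
    ultimately show ?thesis using B(4)[OF t] unfolding E_def En_def by linarith
  qed
  have bdd: "bdd_below (E ` {0..})" by (rule bdd_belowI[of _ "- (\<bar>\<alpha>\<bar> * (B * B)) - B"]) (use lb in auto)
  define Ei where "Ei = Inf (E ` {0..})"
  have le: "Ei \<le> E t" if "t \<ge> 0" for t unfolding Ei_def by (rule cInf_lower[OF _ bdd]) (use that in auto)
  have "(E \<longlongrightarrow> Ei) at_top"
  proof (rule decreasing_tendsto)
    show "\<forall>\<^sub>F t in at_top. Ei \<le> E t" using eventually_ge_at_top[of 0] by eventually_elim (rule le)
    fix x assume "Ei < x"
    then obtain t0 where t0: "t0 \<ge> 0" "E t0 < x"
      using cInf_lessD[of "E ` {0..}" x] by (auto simp: Ei_def)
    show "\<forall>\<^sub>F t in at_top. E t < x"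
      using eventually_ge_at_top[of t0] by eventually_elim (use E_antimono t0 in \<open>auto intro: le_less_trans\<close>)
  qed
  then show ?thesis using le[of 0] by (intro that) auto
qed

section \<open>Uniform continuity along the trajectory\<close>

lemma uc_S:
  assumes K: "compact K" "K \<subseteq> S" "\<And>t. t \<ge> 0 \<Longrightarrow> X t \<in> K"
    and d: "\<And>t. t > 0 \<Longrightarrow> ((\<lambda>t. fst (X t)) has_vector_derivative D t) (at t)" "\<And>t. t > 0 \<Longrightarrow> norm (D t) \<le> B"
  shows "uniformly_continuous_on {0<..} X"
  unfolding uniformly_continuous_on_def
proof (intro allI impI)
  fix e :: real assume e: "e > 0"
  have inj: "y = z" if "y \<in> K" "z \<in> K" "fst y = fst z" for y z using S_inj K(2) that by blast
  \<comment> \<open>Only the first component is known to be Lipschitz. On the compact set K this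
    suffices, because there it controls the full norm uniformly.\<close>
  obtain d1 where d1: "d1 > 0" "\<And>y z. y \<in> K \<Longrightarrow> z \<in> K \<Longrightarrow> norm (fst y - fst z) < d1 \<Longrightarrow> norm (y - z) < e"
    using compact_fst_uniform[OF K(1) inj e] by metis
  have "uniformly_continuous_on {0<..} (\<lambda>t. fst (X t))"
    by (rule lipschitz_uniformly_continuous[where B = B]) (rule lipschitz_from_derivative[OF d])
  then obtain d2 where d2: "d2 > 0" "\<And>s t. s \<in> {0<..} \<Longrightarrow> t \<in> {0<..} \<Longrightarrow> dist t s < d2 \<Longrightarrow> dist (fst (X t)) (fst (X s)) < d1"
    unfolding uniformly_continuous_on_def using d1(1) by metis
  show "\<exists>d>0. \<forall>s\<in>{0<..}. \<forall>t\<in>{0<..}. dist t s < d \<longrightarrow> dist (X t) (X s) < e"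
  proof (intro exI[of _ d2] conjI ballI impI)
    fix s t :: real assume "s \<in> {0<..}" "t \<in> {0<..}" "dist t s < d2"
    then show "dist (X t) (X s) < e" using d2(2)[of s t] K(3) by (auto simp: dist_norm intro!: d1(2))
  qed (rule d2(1))
qed

lemma ucU: "uniformly_continuous_on {0<..} U"
  using bounds uc_S[OF KU dU] by (metis less_imp_le)

lemma ucW: "uniformly_continuous_on {0<..} W"
  using bounds uc_S[OF KW dW] by (metis less_imp_le)

lemma ucP: "uniformly_continuous_on {0<..} P"
proof -
  obtain B where B: "\<And>t. t \<ge> 0 \<Longrightarrow> norm (P t) \<le> B" "\<And>t. t \<ge> 0 \<Longrightarrow> norm (Wt t) \<le> B" using bounds by metis
  show ?thesis
  proof (rule uc_S[OF KP dP, where B = "(1/\<tau>) * (B + B)"])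
    fix t :: real assume "t > 0"
    then have "norm (Wt t - fst (P t)) \<le> B + B"
      using norm_triangle_ineq4[of "Wt t" "fst (P t)"] B(1)[of t] B(2)[of t]
        norm_fst_le[of "fst (P t)" "snd (P t)"] by simp
    then show "norm ((1/\<tau>) *\<^sub>R (Wt t - fst (P t))) \<le> (1/\<tau>) * (B + B)"
      using params by (simp add: divide_right_mono)
  qed
qed

lemma uc_nem: "uniformly_continuous_on {0<..} (\<lambda>t. nem (U t))"
proof -
  have "uniformly_continuous_on KU nem"
    by (rule compact_uniformly_continuous[OF continuous_on_subset[OF nem_cont KU(2)] KU(1)])
  then have "uniformly_continuous_on (U ` {0<..}) nem" by (rule uniformly_continuous_mono) (use KU in auto)
  from uniformly_continuous_on_compose[OF ucU this] show ?thesis by (simp add: o_def)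
qed

lemma AU_bounded: "\<exists>C. \<forall>t\<in>{0<..}. norm (AU t z) \<le> C"
proof -
  have "compact ((\<lambda>q. (nem (fst q) - \<alpha> *\<^sub>R fst (snd q)) \<bullet> fst z - snd (fst q) \<bullet> snd z) ` (KU \<times> KW))"
    using KU KW
    by (intro compact_continuous_image compact_Times continuous_intros continuous_on_compose2[OF nem_cont]) auto
  from compact_norm_bound[OF this] obtain C where C: "\<And>q. q \<in> KU \<times> KW \<Longrightarrow> norm ((nem (fst q) - \<alpha> *\<^sub>R fst (snd q)) \<bullet> fst z - snd (fst q) \<bullet> snd z) \<le> C"
    by blast
  then have "norm (AU t z) \<le> C" if "t > 0" for t
    using C[of "(U t, W t)"] KU(3)[of t] KW(3)[of t] that by (simp add: AU_def)
  then show ?thesis by auto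
qed

lemma AW_bounded: "\<exists>C. \<forall>t\<in>{0<..}. norm (AW t z) \<le> C"
proof -
  have "compact ((\<lambda>q. - (\<alpha> *\<^sub>R fst (fst q)) \<bullet> fst z - (snd (fst (snd q)) + (b - \<tau>) *\<^sub>R snd (snd (snd q))) \<bullet> snd z) ` (KU \<times> (KW \<times> KP)))"
    using KU KW KP by (intro compact_continuous_image compact_Times continuous_intros) auto
  from compact_norm_bound[OF this] obtain C where C: "\<And>q. q \<in> KU \<times> (KW \<times> KP) \<Longrightarrow>
      norm (- (\<alpha> *\<^sub>R fst (fst q)) \<bullet> fst z - (snd (fst (snd q)) + (b - \<tau>) *\<^sub>R snd (snd (snd q))) \<bullet> snd z) \<le> C"
    by blast
  then have "norm (AW t z) \<le> C" if "t > 0" for t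
    using C[of "(U t, W t, P t)"] KU(3)[of t] KW(3)[of t] KP(3)[of t] that by (simp add: AW_def)
  then show ?thesis by auto
qed

lemma uc_fst: "uniformly_continuous_on A X \<Longrightarrow> uniformly_continuous_on A (\<lambda>t. fst (X t) \<bullet> e)"
  and uc_snd: "uniformly_continuous_on A X \<Longrightarrow> uniformly_continuous_on A (\<lambda>t. snd (X t) \<bullet> e')"
  for X :: "real \<Rightarrow> 'l \<times> 'g"
  by (intro uniformly_continuous_pair_inner bounded_linear.uniformly_continuous_on[OF bounded_linear_fst]
      bounded_linear.uniformly_continuous_on[OF bounded_linear_snd]; assumption)+

lemma AU_uc: "uniformly_continuous_on {0<..} (\<lambda>t. AU t z)"
  unfolding AU_def inner_diff_left inner_scaleR_left
  by (intro uniformly_continuous_on_diff uniformly_continuous_on_cmul_left uc_fst uc_snd ucU ucW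
      uniformly_continuous_pair_inner uc_nem)

lemma AW_uc: "uniformly_continuous_on {0<..} (\<lambda>t. AW t z)"
  unfolding AW_def inner_add_left inner_minus_left inner_scaleR_left
  by (intro uniformly_continuous_on_diff uniformly_continuous_on_add uniformly_continuous_on_minus
      uniformly_continuous_on_cmul_left uc_fst uc_snd ucU ucW ucP)

section \<open>Successive decay of the velocities\<close>

lemma P_lim: "(P \<longlongrightarrow> 0) at_top"
proof -
  obtain Ei where Ei: "(E \<longlongrightarrow> Ei) at_top" using E_lim by metis
  have shift: "((\<lambda>t. E (t + d) - E t) \<longlongrightarrow> 0) at_top" for d
  proof -
    have "filterlim (\<lambda>t::real. t + d) at_top at_top"
      by (rule filterlim_tendsto_add_at_top[of "\<lambda>_. d", OF tendsto_const filterlim_ident, simplified add.commute])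
    from tendsto_diff[OF filterlim_compose[OF Ei this] Ei] show ?thesis by simp
  qed
  have dE: "(E has_vector_derivative (- (b - \<tau>) * (norm (snd (P t)))\<^sup>2)) (at t)" if "t > 0" for t
  proof (rule has_vector_derivative_integral_identity[OF _ _ that])
    show "continuous_on {0<..} (\<lambda>t. - (b - \<tau>) * (norm (snd (P t)))\<^sup>2)" by (intro continuous_intros pos[OF cP])
    show "E t - E s = integral {s..t} (\<lambda>t. - (b - \<tau>) * (norm (snd (P t)))\<^sup>2)" if "0 < s" "s < t" for s t
      using energy_identity_pos[of s t] that by simp
  qed
  obtain B where B: "\<And>t. t \<ge> 0 \<Longrightarrow> norm (P t) \<le> B" using bounds by metis
  have "uniformly_continuous_on {0<..} (\<lambda>t. (norm (snd (P t)))\<^sup>2)"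
  proof -
    have "uniformly_continuous_on KP (\<lambda>z. (norm (snd z))\<^sup>2)"
      by (rule compact_uniformly_continuous[OF _ KP(1)]) (intro continuous_intros)
    then have "uniformly_continuous_on (P ` {0<..}) (\<lambda>z. (norm (snd z))\<^sup>2)"
      by (rule uniformly_continuous_mono) (use KP in auto)
    from uniformly_continuous_on_compose[OF ucP this] show ?thesis by (simp add: o_def)
  qed
  then have "uniformly_continuous_on {0<..} (\<lambda>t. - (b - \<tau>) * (norm (snd (P t)))\<^sup>2)"
    by (rule uniformly_continuous_on_cmul_left)
  \<comment> \<open>The energy is the one quantity already known to converge, so its increments
    vanish; its derivative is minus a positive multiple of the squared gradient of P.\<close>
  from barbalat[OF dE this shift]
  have "((\<lambda>t. - (b - \<tau>) * (norm (snd (P t)))\<^sup>2) \<longlongrightarrow> 0) at_top" by simp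
  then have lim: "((\<lambda>t. (norm (snd (P t)))\<^sup>2) \<longlongrightarrow> 0) at_top"
    using tendsto_mult_left_iff[of "- (b - \<tau>)" "\<lambda>t. (norm (snd (P t)))\<^sup>2" 0 at_top] params by simp
  show ?thesis
  proof (rule cluster_tendsto[OF KP(1)])
    show "\<forall>\<^sub>F t in at_top. P t \<in> KP" using eventually_ge_at_top[of 0] by eventually_elim (rule KP)
    fix y assume y: "y \<in> KP" "y \<noteq> 0"
    \<comment> \<open>By the Poincare inequality a vanishing gradient forces the function to vanish,
      so the squared gradient norm separates 0 from every other point of KP.\<close>
    have "snd y \<noteq> 0"
    proof
      assume "snd y = 0"
      then have "p0 * (norm (fst y))\<^sup>2 \<le> 0" using poincare[of y] y KP by auto
      then have "fst y = 0" using p0 by (simp add: mult_le_0_iff)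
      then show False using y \<open>snd y = 0\<close> by (simp add: prod_eq_iff)
    qed
    then show "\<exists>g c. continuous_on KP g \<and> ((\<lambda>t. g (P t)) \<longlongrightarrow> (c::real)) at_top \<and> g y \<noteq> c"
      using lim by (intro exI[of _ "\<lambda>z. (norm (snd z))\<^sup>2"] exI[of _ 0]) (auto intro!: continuous_intros)
  qed
qed

text \<open>By density a nonzero cluster point has a nonzero inner product with some first component
  from S, and that inner product is exactly what is assumed to tend to zero.\<close>

lemma weak_null_limit:
  fixes x :: "real \<Rightarrow> 'l"
  assumes K: "compact K" "K \<subseteq> L0" "\<And>t. t \<ge> 0 \<Longrightarrow> x t \<in> K" and lim: "\<And>z. z \<in> S \<Longrightarrow> ((\<lambda>t. x t \<bullet> fst z) \<longlongrightarrow> 0) at_top"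
  shows "(x \<longlongrightarrow> 0) at_top"
proof (rule cluster_tendsto[OF K(1)])
  show "\<forall>\<^sub>F t in at_top. x t \<in> K" using eventually_ge_at_top[of 0] by eventually_elim (rule K)
  fix y assume y: "y \<in> K" "y \<noteq> 0"
  have "\<exists>z\<in>S. y \<bullet> fst z \<noteq> 0"
  proof (rule ccontr)
    assume "\<not> ?thesis"
    then have "\<And>z. z \<in> S \<Longrightarrow> y \<bullet> fst z = 0" by blast
    from dense[OF this, of y] have "y \<bullet> y = 0" using y K(2) by blast
    then show False using y by simp
  qed
  then obtain z where "z \<in> S" "y \<bullet> fst z \<noteq> 0" by blast
  moreover have "continuous_on K (\<lambda>v. v \<bullet> fst z)" by (intro continuous_intros)
  ultimately show "\<exists>g c. continuous_on K g \<and> ((\<lambda>t. g (x t)) \<longlongrightarrow> (c::real)) at_top \<and> g y \<noteq> c"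
    using lim by blast
qed

lemma shift_limit:
  assumes "(f \<longlongrightarrow> (l :: 'x::real_normed_vector)) at_top"
  shows "((\<lambda>t::real. f (t + d)) \<longlongrightarrow> l) at_top" "((\<lambda>t. f (t + d) - f t) \<longlongrightarrow> 0) at_top"
proof -
  have "filterlim (\<lambda>t::real. t + d) at_top at_top"
    by (rule filterlim_tendsto_add_at_top[of "\<lambda>_. d", OF tendsto_const filterlim_ident, simplified add.commute])
  from filterlim_compose[OF assms this] show 1: "((\<lambda>t::real. f (t + d)) \<longlongrightarrow> l) at_top" .
  from tendsto_diff[OF 1 assms] show "((\<lambda>t. f (t + d) - f t) \<longlongrightarrow> 0) at_top" by simp
qed

lemma increment_limit:
  fixes x y :: "real \<Rightarrow> 'x::real_normed_vector"
  assumes x: "\<And>t. t > 0 \<Longrightarrow> (x has_vector_derivative y t) (at t)" and y: "(y \<longlongrightarrow> 0) at_top" and d: "d > 0"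
  shows "((\<lambda>t. x (t + d) - x t) \<longlongrightarrow> 0) at_top"
proof (rule tendstoI)
  fix e :: real assume e: "e > 0"
  have "\<forall>\<^sub>F t in at_top. norm (y t) < e / (2 * d)"
    using tendstoD[OF y, of "e / (2 * d)"] e d by simp
  then obtain T where T: "\<And>t. t \<ge> T \<Longrightarrow> norm (y t) < e / (2 * d)" by (auto simp: eventually_at_top_linorder)
  show "\<forall>\<^sub>F t in at_top. dist (x (t + d) - x t) 0 < e"
    using eventually_ge_at_top[of "max T 1"]
  proof eventually_elim
    case (elim t)
    have "norm (x (t + d) - x t) \<le> e / (2 * d) * norm (t + d - t)"
    proof (rule differentiable_bound[of "{t..t+d}"])
      show "(x has_derivative (\<lambda>h. h *\<^sub>R y r)) (at r within {t..t+d})" if "r \<in> {t..t+d}" for r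
        using x[of r] that elim by (simp add: has_vector_derivative_def has_derivative_at_withinI)
      show "onorm (\<lambda>h. h *\<^sub>R y r) \<le> e / (2 * d)" if "r \<in> {t..t+d}" for r
      proof (rule onorm_le)
        fix h :: real
        have "norm (y r) \<le> e / (2 * d)" using T[of r] that elim by simp
        then have "norm (y r) * norm h \<le> e / (2 * d) * norm h" by (rule mult_right_mono) simp
        then show "norm (h *\<^sub>R y r) \<le> e / (2 * d) * norm h" by (simp add: mult.commute)
      qed
    qed (use d in auto)
    also have "\<dots> = e / 2" using d by simp
    finally show ?case using e by simp
  qed
qed

text \<open>The increment of W is the increment of V plus \<tau> times that of P. The former
  vanishes because V has derivative P, which tends to 0; the latter because P does.\<close>

lemma Wt_lim: "(Wt \<longlongrightarrow> 0) at_top"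
proof (rule weak_null_limit[OF KWt])
  fix z assume z: "z \<in> S"
  obtain B where B: "\<And>t. t \<ge> 0 \<Longrightarrow> norm (Wt t) \<le> B" using bounds by metis
  show "((\<lambda>t. Wt t \<bullet> fst z) \<longlongrightarrow> 0) at_top"
  proof (rule barbalat)
    show "((\<lambda>t. fst (W t) \<bullet> fst z) has_vector_derivative Wt t \<bullet> fst z) (at t)" if "t > 0" for t
      by (rule has_vector_derivative_inner_const[OF dW[OF that]])
    obtain C where C: "\<And>t. t \<in> {0<..} \<Longrightarrow> norm (AW t z) \<le> C"
      using AW_bounded[of z] by metis
    show "uniformly_continuous_on {0<..} (\<lambda>t. Wt t \<bullet> fst z)"
      by (rule lipschitz_uniformly_continuous[where B = C], rule lipschitz_from_derivative[OF dWt[OF z]]) (use C in auto)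
    fix d :: real assume d: "d > 0"
    have "((\<lambda>t. fst (V (t + d)) - fst (V t)) \<longlongrightarrow> 0) at_top"
      using P_lim by (intro increment_limit[OF dV1 _ d]) (auto intro!: tendsto_eq_intros)
    moreover have "((\<lambda>t. fst (P (t + d)) - fst (P t)) \<longlongrightarrow> 0) at_top"
      using P_lim by (intro shift_limit(2)[of "\<lambda>t. fst (P t)" 0]) (auto intro!: tendsto_eq_intros)
    ultimately have "((\<lambda>t. ((fst (V (t + d)) - fst (V t)) + \<tau> *\<^sub>R (fst (P (t + d)) - fst (P t))) \<bullet> fst z) \<longlongrightarrow> (0 + \<tau> *\<^sub>R 0) \<bullet> fst z) at_top"
      by (intro tendsto_intros)
    then show "((\<lambda>t. fst (W (t + d)) \<bullet> fst z - fst (W t) \<bullet> fst z) \<longlongrightarrow> 0) at_top"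
      by (simp add: V_def algebra_simps inner_diff_left)
  qed
qed

lemma AW_lim: assumes z: "z \<in> S" shows "((\<lambda>t. AW t z) \<longlongrightarrow> 0) at_top"
proof (rule barbalat[OF dWt[OF z] AW_uc])
  have "((\<lambda>t. Wt t \<bullet> fst z) \<longlongrightarrow> 0) at_top" using Wt_lim by (auto intro!: tendsto_eq_intros)
  then show "((\<lambda>t. Wt (t + d) \<bullet> fst z - Wt t \<bullet> fst z) \<longlongrightarrow> 0) at_top" for d
    by (rule shift_limit(2))
qed

text \<open>The L2 increments vanish since \<open>Wt\<close> does, and compactness upgrades this to
  gradients. Gradients are required because W enters its own equation through them.\<close>

lemma W_increment: assumes d: "d > 0" shows "((\<lambda>t. W (t + d) - W t) \<longlongrightarrow> 0) at_top"
proof (rule tendstoI)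
  fix e :: real assume e: "e > 0"
  have inj: "y = z" if "y \<in> KW" "z \<in> KW" "fst y = fst z" for y z using S_inj KW(2) that by blast
  obtain d1 where d1: "d1 > 0" "\<And>y z. y \<in> KW \<Longrightarrow> z \<in> KW \<Longrightarrow> norm (fst y - fst z) < d1 \<Longrightarrow> norm (y - z) < e"
    using compact_fst_uniform[OF KW(1) inj e] by metis
  have "\<forall>\<^sub>F t in at_top. dist (fst (W (t + d)) - fst (W t)) 0 < d1"
    by (rule tendstoD[OF increment_limit[OF dW Wt_lim d] d1(1)])
  moreover have "\<forall>\<^sub>F t in at_top. t \<ge> (0::real)" by (rule eventually_ge_at_top)
  ultimately show "\<forall>\<^sub>F t in at_top. dist (W (t + d) - W t) 0 < e"
    by eventually_elim (use d KW(3) in \<open>auto intro!: d1(2)\<close>)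
qed

text \<open>The coupling lets the second equation be solved for u: the increments of u, tested with
  z, are -1/\<alpha> times increments of \<open>AW\<close> and of the gradients of W and P, all of
  which vanish.\<close>

lemma Ut_lim: "(Ut \<longlongrightarrow> 0) at_top"
proof (rule weak_null_limit[OF KUt])
  fix z assume z: "z \<in> S"
  show "((\<lambda>t. Ut t \<bullet> fst z) \<longlongrightarrow> 0) at_top"
  proof (rule barbalat)
    show "((\<lambda>t. fst (U t) \<bullet> fst z) has_vector_derivative Ut t \<bullet> fst z) (at t)" if "t > 0" for t
      by (rule has_vector_derivative_inner_const[OF dU[OF that]])
    obtain C where C: "\<And>t. t \<in> {0<..} \<Longrightarrow> norm (AU t z) \<le> C"
      using AU_bounded[of z] by metis
    show "uniformly_continuous_on {0<..} (\<lambda>t. Ut t \<bullet> fst z)"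
      by (rule lipschitz_uniformly_continuous[where B = C], rule lipschitz_from_derivative[OF dUt[OF z]]) (use C in auto)
    fix d :: real assume d: "d > 0"
    have 1: "((\<lambda>t. AW (t + d) z - AW t z) \<longlongrightarrow> 0) at_top" by (rule shift_limit(2)[OF AW_lim[OF z]])
    have 2: "((\<lambda>t. P (t + d) - P t) \<longlongrightarrow> 0) at_top" by (rule shift_limit(2)[OF P_lim])
    have "((\<lambda>t. (- 1 / \<alpha>) * ((AW (t + d) z - AW t z) + (snd (W (t + d) - W t) + (b - \<tau>) *\<^sub>R snd (P (t + d) - P t)) \<bullet> snd z))
      \<longlongrightarrow> (- 1 / \<alpha>) * (0 + (snd (0::'l \<times> 'g) + (b - \<tau>) *\<^sub>R snd (0::'l \<times> 'g)) \<bullet> snd z)) at_top"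
      by (intro tendsto_intros 1 tendsto_snd[OF 2] tendsto_snd[OF W_increment[OF d]])
    moreover have "(- 1 / \<alpha>) * ((AW (t + d) z - AW t z) + (snd (W (t + d) - W t) + (b - \<tau>) *\<^sub>R snd (P (t + d) - P t)) \<bullet> snd z)
      = fst (U (t + d)) \<bullet> fst z - fst (U t) \<bullet> fst z" for t
    proof -
      have "(AW (t + d) z - AW t z) + (snd (W (t + d) - W t) + (b - \<tau>) *\<^sub>R snd (P (t + d) - P t)) \<bullet> snd z
        = - (\<alpha> * (fst (U (t + d)) \<bullet> fst z - fst (U t) \<bullet> fst z))"
        by (simp add: AW_def inner_add_left inner_diff_left algebra_simps)
      then show ?thesis using params by simp
    qed
    ultimately show "((\<lambda>t. fst (U (t + d)) \<bullet> fst z - fst (U t) \<bullet> fst z) \<longlongrightarrow> 0) at_top" by simp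
  qed
qed

lemma AU_lim: assumes z: "z \<in> S" shows "((\<lambda>t. AU t z) \<longlongrightarrow> 0) at_top"
proof (rule barbalat[OF dUt[OF z] AU_uc])
  have "((\<lambda>t. Ut t \<bullet> fst z) \<longlongrightarrow> 0) at_top" using Ut_lim by (auto intro!: tendsto_eq_intros)
  then show "((\<lambda>t. Ut (t + d) \<bullet> fst z - Ut t \<bullet> fst z) \<longlongrightarrow> 0) at_top" for d
    by (rule shift_limit(2))
qed

definition Jf :: "'l \<times> 'g \<Rightarrow> 'l \<times> 'g \<Rightarrow> real" where
  "Jf y z = (norm (snd y))\<^sup>2 / 2 + (norm (snd z))\<^sup>2 / 2 + \<alpha> * (fst y \<bullet> fst z) - pot y"

text \<open>Whenever a continuous functional has a limit along the trajectory, every cluster point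
  takes that limit as its value. For the functionals of the two equations this makes cluster points
  stationary, and for the potential energy it places them at the limit energy, at most the initial
  one.\<close>

theorem decay:
  assumes stationary: "\<And>y z. y \<in> S \<Longrightarrow> z \<in> S \<Longrightarrow>
      (\<And>x. x \<in> S \<Longrightarrow> snd y \<bullet> snd x + \<alpha> * (fst z \<bullet> fst x) = nem y \<bullet> fst x) \<Longrightarrow>
      (\<And>x. x \<in> S \<Longrightarrow> snd z \<bullet> snd x + \<alpha> * (fst y \<bullet> fst x) = 0) \<Longrightarrow> Jf y z \<le> E 0 \<Longrightarrow> y = 0 \<and> z = 0"
  shows "(U \<longlongrightarrow> 0) at_top" "(W \<longlongrightarrow> 0) at_top" "(E \<longlongrightarrow> 0) at_top"
proof -
  obtain Ei where Ei: "(E \<longlongrightarrow> Ei) at_top" "Ei \<le> E 0" using E_lim by metis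
  \<comment> \<open>The velocity terms and the gradient of P have already been shown to vanish, so
    the limit of the energy is that of its static part.\<close>
  have "((\<lambda>t. E t - ((norm (Ut t))\<^sup>2 / 2 + (norm (Wt t))\<^sup>2 / 2 + (b - \<tau>) * \<tau> * ((norm (snd (P t)))\<^sup>2 / 2)))
      \<longlongrightarrow> Ei - ((norm (0::'l))\<^sup>2 / 2 + (norm (0::'l))\<^sup>2 / 2 + (b - \<tau>) * \<tau> * ((norm (snd (0 :: 'l \<times> 'g)))\<^sup>2 / 2))) at_top"
    by (intro tendsto_intros Ei Ut_lim Wt_lim P_lim) auto
  then have J: "((\<lambda>t. Jf (U t) (W t)) \<longlongrightarrow> Ei) at_top" by (simp add: E_def En_def Jf_def algebra_simps)
  have BW: "((\<lambda>t. snd (W t) \<bullet> snd x + \<alpha> * (fst (U t) \<bullet> fst x)) \<longlongrightarrow> 0) at_top" if x: "x \<in> S" for x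
  proof -
    have "((\<lambda>t. - AW t x - (b - \<tau>) * (snd (P t) \<bullet> snd x)) \<longlongrightarrow> - 0 - (b - \<tau>) * (snd (0::'l \<times> 'g) \<bullet> snd x)) at_top"
      by (intro tendsto_intros AW_lim[OF x] P_lim)
    then show ?thesis by (simp add: AW_def inner_add_left algebra_simps)
  qed
  have "((\<lambda>t. (U t, W t)) \<longlongrightarrow> (0, 0)) at_top"
  proof (rule cluster_tendsto[of "KU \<times> KW"])
    show "compact (KU \<times> KW)" using KU KW by (intro compact_Times)
    show "\<forall>\<^sub>F t in at_top. (U t, W t) \<in> KU \<times> KW"
      using eventually_ge_at_top[of 0] by eventually_elim (use KU KW in auto)
    fix p assume p: "p \<in> KU \<times> KW" "p \<noteq> (0, 0)"
    obtain y z where yz: "p = (y, z)" by (cases p)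
    have yzS: "y \<in> S" "z \<in> S" using p yz KU KW by auto
    have cfst: "continuous_on (KU \<times> KW) (\<lambda>q. f (fst q))" if "continuous_on S f" for f :: "'l \<times> 'g \<Rightarrow> 'x::topological_space"
      by (rule continuous_on_compose2[OF that continuous_on_fst[OF continuous_on_id]]) (use KU in auto)
    show "\<exists>g c. continuous_on (KU \<times> KW) g \<and> ((\<lambda>t. g (U t, W t)) \<longlongrightarrow> (c::real)) at_top \<and> g p \<noteq> c"
    proof (rule ccontr)
      assume "\<not> ?thesis"
      \<comment> \<open>If nothing separates p from the limit, then p attains the limit of every
        functional that converges along the trajectory.\<close>
      then have eq: "g p = c" if "continuous_on (KU \<times> KW) g" "((\<lambda>t. g (U t, W t)) \<longlongrightarrow> (c::real)) at_top" for g c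
        using that by blast
      have "y = 0 \<and> z = 0"
      proof (rule stationary[OF yzS])
        fix x assume x: "x \<in> S"
        have "(\<lambda>q. snd (snd q) \<bullet> snd x + \<alpha> * (fst (fst q) \<bullet> fst x)) p = 0"
          by (rule eq) (use BW[OF x] in \<open>auto intro!: continuous_intros\<close>)
        then show "snd z \<bullet> snd x + \<alpha> * (fst y \<bullet> fst x) = 0" by (simp add: yz)
        have "(\<lambda>q. (nem (fst q) - \<alpha> *\<^sub>R fst (snd q)) \<bullet> fst x - snd (fst q) \<bullet> snd x) p = 0"
          by (rule eq) (use AU_lim[OF x] cfst[OF nem_cont] in \<open>auto simp: AU_def intro!: continuous_intros\<close>)
        then show "snd y \<bullet> snd x + \<alpha> * (fst z \<bullet> fst x) = nem y \<bullet> fst x" by (simp add: yz inner_diff_left)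
      next
        have "(\<lambda>q. Jf (fst q) (snd q)) p = Ei"
          by (rule eq) (use J cfst[OF pot_cont] in \<open>auto simp: Jf_def intro!: continuous_intros\<close>)
        then show "Jf y z \<le> E 0" using Ei(2) by (simp add: yz)
      qed
      then show False using p yz by simp
    qed
  qed
  from tendsto_fst[OF this] tendsto_snd[OF this] show U0: "(U \<longlongrightarrow> 0) at_top" and W0: "(W \<longlongrightarrow> 0) at_top" by simp_all
  have "((\<lambda>t. pot (U t)) \<longlongrightarrow> pot 0) at_top"
  proof (rule continuous_on_tendsto_compose[OF pot_cont U0])
    show "0 \<in> S" using S_sub by (rule subspace_0)
    show "\<forall>\<^sub>F t in at_top. U t \<in> S" using eventually_ge_at_top[of 0] by eventually_elim (rule inS)
  qed
  then have "(E \<longlongrightarrow> En 0 0 0 0 0) at_top"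
    unfolding E_def[abs_def] En_def by (intro tendsto_intros U0 W0 P_lim Ut_lim Wt_lim) auto
  then show "(E \<longlongrightarrow> 0) at_top" by (simp add: En_def pot_0)
qed

end


subsection \<open>Distributional time derivatives\<close>

text \<open>Completeness of Lebesgue measure. It supplies the measurability of a tested weak
  derivative that agrees almost everywhere with a continuous function.\<close>

lemma measurable_lebesgue_on_AE:
  fixes f g :: "'a::euclidean_space \<Rightarrow> real"
  assumes S: "S \<in> sets lebesgue" and g: "g \<in> borel_measurable (lebesgue_on S)"
    and ae: "AE x in lebesgue_on S. f x = g x"
  shows "f \<in> borel_measurable (lebesgue_on S)"
proof (rule measurableI)
  fix B :: "real set" assume B: "B \<in> sets borel"
  have A: "{x\<in>S. g x \<in> B} \<in> sets lebesgue"
    using measurable_sets[OF g B] S by (auto simp: sets_restrict_space_iff vimage_def Int_def conj_commute)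
  have "AE x in lebesgue. x \<in> S \<longrightarrow> f x = g x" using ae S by (simp add: AE_restrict_space_iff)
  then have "AE x in lebesgue. x \<in> {x\<in>S. g x \<in> B} \<longleftrightarrow> x \<in> {x\<in>S. f x \<in> B}" by eventually_elim auto
  from completion.in_sets_AE[OF this A] have "{x\<in>S. f x \<in> B} \<in> sets lebesgue" by simp
  then show "f -` B \<inter> space (lebesgue_on S) \<in> sets (lebesgue_on S)"
    using S by (auto simp: sets_restrict_space_iff vimage_def Int_def conj_commute)
qed simp

lemma smooth_bump_difference:
  fixes c :: real
  assumes "smooth f" shows "smooth (\<lambda>t. f (m * (t - c)))"
proof -
  have "m * (t - c) = t \<bullet> m + (- m * c)" for t by (simp add: algebra_simps)
  then show ?thesis using smooth_affine[OF assms, of m "- m * c"] by simp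
qed

lemma integral_open_interval_support:
  fixes f :: "real \<Rightarrow> real"
  assumes "0 < a" "a \<le> b" "b < T" "continuous_on {a..b} f" "\<And>t. t \<notin> {a..b} \<Longrightarrow> f t = 0"
  shows "(\<integral>t. f t \<partial>lebesgue_on {0<..<T}) = integral {a..b} f"
proof -
  have "(\<integral>t. f t \<partial>lebesgue_on {0<..<T}) = (\<integral>t. indicator {0<..<T} t *\<^sub>R f t \<partial>lebesgue)"
    by (rule integral_restrict_space) auto
  also have "\<dots> = (\<integral>t. indicator {a..b} t *\<^sub>R f t \<partial>lebesgue)"
    using assms by (intro Bochner_Integration.integral_cong) (auto simp: indicator_def)
  also have "\<dots> = (\<integral>t. f t \<partial>lebesgue_on {a..b})"
    by (rule integral_restrict_space[symmetric]) auto
  also have "\<dots> = integral {a..b} f"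
    by (intro lebesgue_integral_eq_integral continuous_imp_integrable_real assms) auto
  finally show ?thesis .
qed

lemma approximate_identity:
  fixes H k :: "real \<Rightarrow> real"
  assumes k: "continuous_on {p..q} k" "\<And>t. k t \<ge> 0" "(k has_integral 1) {p..q}"
    and H: "continuous_on {p..q} H" "\<And>t. t \<in> {p..q} \<Longrightarrow> k t \<noteq> 0 \<Longrightarrow> \<bar>H t - h\<bar> \<le> e"
  shows "\<bar>integral {p..q} (\<lambda>t. H t * k t) - h\<bar> \<le> e"
proof -
  have "integral {p..q} (\<lambda>t. H t * k t) - h = integral {p..q} (\<lambda>t. H t * k t) - integral {p..q} (\<lambda>t. h * k t)"
    using k(3) by (simp add: integral_unique)
  also have "\<dots> = integral {p..q} (\<lambda>t. H t * k t - h * k t)"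
    by (rule Henstock_Kurzweil_Integration.integral_diff[symmetric])
      (intro integrable_continuous_real continuous_intros k H)+
  also have "norm \<dots> \<le> integral {p..q} (\<lambda>t. e * k t)"
  proof (rule integral_norm_bound_integral)
    fix t assume t: "t \<in> {p..q}"
    have "\<bar>H t - h\<bar> * k t \<le> e * k t"
      using H(2)[OF t] k(2)[of t] by (cases "k t = 0") (auto intro: mult_right_mono)
    then show "norm (H t * k t - h * k t) \<le> e * k t"
      using k(2)[of t] by (simp add: left_diff_distrib[symmetric] abs_mult)
  qed (intro integrable_continuous_real continuous_intros k H)+
  also have "\<dots> = e" using k(3) by (simp add: integral_unique)
  finally show ?thesis by simp
qed

text \<open>Subtracting the primitive \<Gamma> of g leaves a continuous H with vanishing
  distributional derivative. The test function rises smoothly just after a and falls just after b,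
  so its derivative is a difference of two mollifying kernels. Hence averages of H near a and near b
  agree, and continuity gives H a = H b.\<close>

lemma weak_derivative_integral:
  fixes G g :: "real \<Rightarrow> real"
  assumes G: "continuous_on {0<..<T} G" and g: "continuous_on {0<..<T} g"
    and weak: "\<And>\<theta>. \<theta> \<in> test_functions {0<..<T} \<Longrightarrow>
      (\<integral>t. G t * deriv \<theta> t \<partial>lebesgue_on {0<..<T}) = - (\<integral>t. g t * \<theta> t \<partial>lebesgue_on {0<..<T})"
    and ab: "0 < a" "a < b" "b < T"
  shows "G b - G a = integral {a..b} g"
proof -
  obtain \<Phi> \<rho> :: "real \<Rightarrow> real" where \<Phi>: "smooth \<Phi>" "\<And>t. (\<Phi> has_real_derivative \<rho> t) (at t)"
    "continuous_on UNIV \<rho>" "\<And>t. \<rho> t \<ge> 0" "\<And>t. t \<notin> {0<..<1} \<Longrightarrow> \<rho> t = 0"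
    "\<And>t. t \<le> 0 \<Longrightarrow> \<Phi> t = 0" "\<And>t. t \<ge> 1 \<Longrightarrow> \<Phi> t = 1"
    by (rule smooth_step_exists) (rule that)
  \<comment> \<open>Room to the right of b, still inside the open interval, where the test function
    can return to zero.\<close>
  define q where "q = (b + T) / 2"
  have q: "b < q" "q < T" using ab by (auto simp: q_def)
  have sub: "{a..q} \<subseteq> {0<..<T}" using ab q by auto
  have cG: "continuous_on {a..q} G" and cg: "continuous_on {a..q} g"
    using continuous_on_subset[OF G sub] continuous_on_subset[OF g sub] .
  define \<Gamma> where "\<Gamma> t = integral {a..t} g" for t
  have d\<Gamma>: "(\<Gamma> has_real_derivative g t) (at t within {a..q})" if "t \<in> {a..q}" for t
    unfolding \<Gamma>_def by (rule integral_has_real_derivative[OF cg that])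
  have c\<Gamma>: "continuous_on {a..q} \<Gamma>"
    using d\<Gamma> by (rule DERIV_continuous_on)
  define H where "H t = G t - \<Gamma> t" for t
  have cH: "continuous_on {a..q} H" unfolding H_def by (intro continuous_intros cG c\<Gamma>)
  have "\<bar>H b - H a\<bar> \<le> e" if e: "e > 0" for e
  proof -
    have c: "\<exists>d>0. \<forall>t\<in>{a..q}. dist t c < d \<longrightarrow> dist (H t) (H c) < e / 2" if "c \<in> {a..q}" for c
      using cH that e unfolding continuous_on_iff by (meson half_gt_zero)
    obtain da where da: "da > 0" "\<And>t. t \<in> {a..q} \<Longrightarrow> dist t a < da \<Longrightarrow> dist (H t) (H a) < e / 2"
      using c[of a] ab q by auto
    obtain db where db: "db > 0" "\<And>t. t \<in> {a..q} \<Longrightarrow> dist t b < db \<Longrightarrow> dist (H t) (H b) < e / 2"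
      using c[of b] ab q by auto
    \<comment> \<open>The width of the kernels: small enough for both continuity estimates, and for
      the kernel attached to b to end before q.\<close>
    define r where "r = min (min da db) (q - b)"
    have r: "r > 0" "r \<le> da" "r \<le> db" "r \<le> q - b" using da(1) db(1) q by (auto simp: r_def)
    define m where "m = 1 / r"
    have m: "m > 0" using r by (simp add: m_def)
    define k where "k c t = m * \<rho> (m * (t - c))" for c t
    have step: "((\<lambda>t. \<Phi> (m * (t - c))) has_real_derivative k c t) (at t)" for c t
      unfolding k_def by (rule DERIV_cong, rule DERIV_chain2[OF \<Phi>(2)]) (auto intro!: derivative_eq_intros)
    have ck: "continuous_on A (k c)" for A c
      unfolding k_def by (intro continuous_intros continuous_on_compose2[OF \<Phi>(3)]) auto
    have k0: "k c t \<ge> 0" for c t using m \<Phi>(4) by (simp add: k_def)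
    have ksupp: "0 < t - c \<and> t - c < r" if "k c t \<noteq> 0" for c t
    proof -
      have "m * (t - c) \<in> {0<..<1}" using that \<Phi>(5) by (auto simp: k_def)
      then show ?thesis using r by (simp add: m_def field_simps zero_less_mult_iff)
    qed
    have mge: "m * (t - c) \<ge> 1" if "t - c \<ge> r" for t c using that r by (simp add: m_def field_simps)
    have mle: "m * (t - c) \<le> 0" if "t \<le> c" for t c using that m by (simp add: mult_le_0_iff)
    have kint: "(k c has_integral 1) {a..q}" if "a \<le> c" "c \<le> b" for c
    proof -
      have "(k c has_integral \<Phi> (m * (q - c)) - \<Phi> (m * (a - c))) {a..q}"
        using ab q step[of c]
        by (intro fundamental_theorem_of_calculus) (auto simp: has_real_derivative_iff_has_vector_derivative[symmetric] intro: has_field_derivative_at_within)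
      moreover have "\<Phi> (m * (q - c)) = 1" using r that by (intro \<Phi>(7) mge) auto
      moreover have "\<Phi> (m * (a - c)) = 0" using that by (intro \<Phi>(6) mle) auto
      ultimately show ?thesis by simp
    qed
    \<comment> \<open>Vanishing at both ends of [a, q], it makes the boundary terms in the partial
      integration against \<Gamma> disappear.\<close>
    define \<theta> where "\<theta> t = \<Phi> (m * (t - a)) - \<Phi> (m * (t - b))" for t
    have d\<theta>: "(\<theta> has_real_derivative k a t - k b t) (at t)" for t
      unfolding \<theta>_def by (intro DERIV_diff step)
    then have deriv\<theta>: "deriv \<theta> t = k a t - k b t" for t by (rule DERIV_imp_deriv)
    have \<theta>0: "\<theta> t = 0" if "t \<notin> {a<..<q}" for t
    proof (cases "t \<le> a")
      case True then show ?thesis using mle[of t a] mle[of t b] ab by (simp add: \<theta>_def \<Phi>(6))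
    next
      case False
      then have "t \<ge> q" using that by simp
      then show ?thesis using mge[of t a] mge[of t b] ab r by (simp add: \<theta>_def \<Phi>(7))
    qed
    have c\<theta>: "continuous_on A \<theta>" for A
      using d\<theta> by (meson DERIV_isCont continuous_at_imp_continuous_on)
    have test: "\<theta> \<in> test_functions {0<..<T}"
    proof (rule test_functionsI[of _ "{a..q}"])
      have "\<theta> = (\<lambda>t. \<Phi> (m * (t - a)) + (- 1) * \<Phi> (m * (t - b)))" by (auto simp: \<theta>_def)
      then show "smooth \<theta>" by (simp only: smooth_add smooth_mult smooth_const smooth_bump_difference \<Phi>(1))
    qed (use sub \<theta>0 in auto)
    have kout: "k c t = 0" if "t \<notin> {a..q}" "c \<in> {a, b}" for c t
      using ksupp[of c t] that ab r by fastforce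
    have "integral {a..q} (\<lambda>t. G t * (k a t - k b t)) = - integral {a..q} (\<lambda>t. g t * \<theta> t)"
    proof -
      have "(\<integral>t. G t * deriv \<theta> t \<partial>lebesgue_on {0<..<T}) = integral {a..q} (\<lambda>t. G t * (k a t - k b t))"
        unfolding deriv\<theta> using ab q kout
        by (intro integral_open_interval_support continuous_intros cG ck) auto
      moreover have "(\<integral>t. g t * \<theta> t \<partial>lebesgue_on {0<..<T}) = integral {a..q} (\<lambda>t. g t * \<theta> t)"
        using ab q \<theta>0 by (intro integral_open_interval_support continuous_intros cg c\<theta>) auto
      ultimately show ?thesis using weak[OF test] by simp
    qed
    moreover have "integral {a..q} (\<lambda>t. g t * \<theta> t) + integral {a..q} (\<lambda>t. \<Gamma> t * (k a t - k b t)) = 0"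
    proof -
      have "((\<lambda>t. g t * \<theta> t + \<Gamma> t * (k a t - k b t)) has_integral \<Gamma> q * \<theta> q - \<Gamma> a * \<theta> a) {a..q}"
      proof (rule fundamental_theorem_of_calculus)
        fix t assume t: "t \<in> {a..q}"
        have "((\<lambda>t. \<Gamma> t * \<theta> t) has_real_derivative g t * \<theta> t + (k a t - k b t) * \<Gamma> t) (at t within {a..q})"
          by (rule DERIV_mult[OF d\<Gamma>[OF t] has_field_derivative_at_within[OF d\<theta>]])
        then show "((\<lambda>t. \<Gamma> t * \<theta> t) has_vector_derivative g t * \<theta> t + \<Gamma> t * (k a t - k b t)) (at t within {a..q})"
          by (simp add: has_real_derivative_iff_has_vector_derivative mult.commute)
      qed (use ab q in auto)
      then have "integral {a..q} (\<lambda>t. g t * \<theta> t + \<Gamma> t * (k a t - k b t)) = 0"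
        using \<theta>0 by (simp add: integral_unique)
      then show ?thesis
        by (subst Henstock_Kurzweil_Integration.integral_add[symmetric])
          (intro integrable_continuous_real continuous_intros cg c\<theta> c\<Gamma> ck | simp)+
    qed
    moreover have "integral {a..q} (\<lambda>t. G t * (k a t - k b t)) - integral {a..q} (\<lambda>t. \<Gamma> t * (k a t - k b t))
      = integral {a..q} (\<lambda>t. G t * (k a t - k b t) - \<Gamma> t * (k a t - k b t))"
      by (rule Henstock_Kurzweil_Integration.integral_diff[symmetric])
        (intro integrable_continuous_real continuous_intros cG c\<Gamma> ck)+
    moreover have "\<dots> = integral {a..q} (\<lambda>t. H t * k a t - H t * k b t)"
      by (rule arg_cong[where f = "integral {a..q}"]) (auto simp: H_def algebra_simps)
    moreover have "\<dots> = integral {a..q} (\<lambda>t. H t * k a t) - integral {a..q} (\<lambda>t. H t * k b t)"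
      by (rule Henstock_Kurzweil_Integration.integral_diff)
        (intro integrable_continuous_real continuous_intros cH ck)+
    ultimately have eq: "integral {a..q} (\<lambda>t. H t * k a t) = integral {a..q} (\<lambda>t. H t * k b t)" by simp
    have "\<bar>integral {a..q} (\<lambda>t. H t * k a t) - H a\<bar> \<le> e / 2"
    proof (rule approximate_identity[OF ck k0 kint cH])
      fix t assume t: "t \<in> {a..q}" "k a t \<noteq> 0"
      show "\<bar>H t - H a\<bar> \<le> e / 2" using ksupp[OF t(2)] da(2)[OF t(1)] r by (simp add: dist_real_def)
    qed (use ab in auto)
    moreover have "\<bar>integral {a..q} (\<lambda>t. H t * k b t) - H b\<bar> \<le> e / 2"
    proof (rule approximate_identity[OF ck k0 kint cH])
      fix t assume t: "t \<in> {a..q}" "k b t \<noteq> 0"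
      show "\<bar>H t - H b\<bar> \<le> e / 2" using ksupp[OF t(2)] db(2)[OF t(1)] r by (simp add: dist_real_def)
    qed (use ab in auto)
    ultimately show ?thesis using eq by linarith
  qed
  then have "\<bar>H b - H a\<bar> \<le> 0" by (rule field_le_epsilon[of _ 0, simplified])
  then show ?thesis by (simp add: H_def \<Gamma>_def)
qed


section \<open>From the seminorm topologies to the Hilbert spaces\<close>

lemma openin_seminorm_topology:
  "openin (seminorm_topology X N) V \<longleftrightarrow> V \<subseteq> X \<and> (\<forall>f\<in>V. \<exists>\<epsilon>>0. \<forall>g\<in>X. N (g - f) < \<epsilon> \<longrightarrow> g \<in> V)"
  by (simp add: seminorm_topology_def topology_inverse' istopology_seminorm)

lemma continuous_map_seminorm_topology:
  fixes h :: "('b \<Rightarrow> real) \<Rightarrow> 'x::real_normed_vector"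
  assumes N: "\<And>f g. f \<in> X \<Longrightarrow> g \<in> X \<Longrightarrow> norm (h g - h f) = N (g - f)"
  shows "continuous_map (seminorm_topology X N) euclidean h"
  unfolding continuous_map_def topspace_seminorm_topology
proof (intro conjI allI impI)
  fix V :: "'x set" assume "openin euclidean V"
  then have V: "open V" by simp
  have "\<exists>\<epsilon>>0. \<forall>g\<in>X. N (g - f) < \<epsilon> \<longrightarrow> g \<in> {x \<in> X. h x \<in> V}" if f: "f \<in> X" "h f \<in> V" for f
  proof -
    obtain e where e: "e > 0" "ball (h f) e \<subseteq> V" using V f(2) open_contains_ball by blast
    have "h g \<in> V" if "g \<in> X" "N (g - f) < e" for g
      using e(2) N[OF f(1) that(1)] that(2) by (auto simp: dist_norm norm_minus_commute subset_iff)
    then show ?thesis using e(1) by auto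
  qed
  then show "openin (seminorm_topology X N) {x \<in> X. h x \<in> V}"
    unfolding openin_seminorm_topology by auto
qed auto

lemma continuous_on_atLeast:
  fixes f :: "real \<Rightarrow> 'x::topological_space"
  assumes "\<And>T. T > 0 \<Longrightarrow> continuous_on {0..T} f"
  shows "continuous_on {0..} f"
  unfolding continuous_on_def
proof
  fix t :: real assume t: "t \<in> {0..}"
  have "(f \<longlongrightarrow> f t) (at t within {0..t+1})"
    using assms[of "t + 1"] t by (auto simp: continuous_on_def)
  moreover have "at t within {0..t+1} = at t within {0..}"
    by (rule at_within_nhd[of t "{..<t+1}"]) auto
  ultimately show "(f \<longlongrightarrow> f t) (at t within {0..})" by simp
qed

context bounded_open_set
begin

lemma continuous_map_hc: "continuous_map (H10_topology \<Omega>) euclidean hc"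
  by (rule continuous_map_seminorm_topology) (simp add: H10_H1 hc_diff norm_hc[symmetric])

lemma continuous_map_cls: "continuous_map (L2_topology \<Omega>) euclidean (cls \<Omega>)"
proof (rule continuous_map_seminorm_topology)
  fix f g :: "'a \<Rightarrow> real" assume fg: "f \<in> L2 \<Omega>" "g \<in> L2 \<Omega>"
  show "norm (cls \<Omega> g - cls \<Omega> f) = L2_norm \<Omega> (g - f)"
    using norm_cls[OF m\<Omega> L2_minus[OF fg(2,1)]] cls_diff[OF m\<Omega> fg(2,1)] by (simp add: fun_diff_def)
qed

definition LS :: "('a, real) l2 set" where "LS = cls \<Omega> ` L2 \<Omega>"

lemma LS_subspace: "subspace LS"
proof (rule subspaceI)
  show "0 \<in> LS"
    unfolding LS_def using cls_zero[of \<Omega>] by (intro image_eqI[of _ _ "\<lambda>x. 0"]) (auto simp: L2_zero)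
  show "x + y \<in> LS" if "x \<in> LS" "y \<in> LS" for x y
  proof -
    from that obtain f g where "f \<in> L2 \<Omega>" "g \<in> L2 \<Omega>" "x = cls \<Omega> f" "y = cls \<Omega> g" by (auto simp: LS_def)
    then show ?thesis unfolding LS_def by (intro image_eqI[of _ _ "\<lambda>x. f x + g x"]) (simp_all add: cls_add[OF m\<Omega>] L2_add)
  qed
  show "c *\<^sub>R x \<in> LS" if "x \<in> LS" for c x
  proof -
    from that obtain f where "f \<in> L2 \<Omega>" "x = cls \<Omega> f" by (auto simp: LS_def)
    then show ?thesis unfolding LS_def by (intro image_eqI[of _ _ "\<lambda>x. c * f x"]) (simp_all add: cls_cmult[OF m\<Omega>] L2_cmult)
  qed
qed

lemma fst_HS_LS: "z \<in> HS \<Longrightarrow> fst z \<in> LS"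
  using H1_L2[OF H10_H1] by (auto simp: HS_def LS_def hc_def)

text \<open>Here e is any class on the whole space. Only its restriction to \<Omega> matters for
  inner products with functions extended by zero, and that restriction vanishes by density of the
  test functions.\<close>

lemma LS_dense:
  assumes orth: "\<And>z. z \<in> HS \<Longrightarrow> e \<bullet> fst z = 0" and w: "w \<in> LS"
  shows "e \<bullet> w = 0"
proof -
  have sq: "square_integrable lebesgue (rep_l2 e)"
    using rep_l2_rel[of e] by (simp add: l2_rel_def)
  have "integrable lebesgue (\<lambda>x. indicator \<Omega> x *\<^sub>R (norm (rep_l2 e x))\<^sup>2)"
    using sq by (intro integrable_mult_indicator m\<Omega>) (simp add: square_integrable_def)
  then have f: "rep_l2 e \<in> L2 \<Omega>"
    using sq m\<Omega> by (simp add: L2_def integrable_restrict_space square_integrable_def measurable_restrict_space1)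
  have eq: "cls \<Omega> (rep_l2 e) \<bullet> cls \<Omega> g = e \<bullet> cls \<Omega> g" if g: "g \<in> L2 \<Omega>" for g :: "'a \<Rightarrow> real"
  proof -
    have "e \<bullet> cls \<Omega> g = abs_l2 (rep_l2 e) \<bullet> cls \<Omega> g" by (simp only: abs_rep_l2)
    also have "\<dots> = (\<integral>x. rep_l2 e x \<bullet> (indicator \<Omega> x *\<^sub>R g x) \<partial>lebesgue)"
      unfolding cls_def by (rule inner_l2.abs_eq[OF rep_l2_rel cls_rel[OF m\<Omega> g]])
    also have "\<dots> = (\<integral>x. (indicator \<Omega> x *\<^sub>R rep_l2 e x) \<bullet> (indicator \<Omega> x *\<^sub>R g x) \<partial>lebesgue)"
      by (rule Bochner_Integration.integral_cong) (auto simp: indicator_def)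
    also have "\<dots> = cls \<Omega> (rep_l2 e) \<bullet> cls \<Omega> g"
      unfolding cls_def by (rule inner_l2.abs_eq[OF cls_rel[OF m\<Omega> f] cls_rel[OF m\<Omega> g], symmetric])
    finally show ?thesis by simp
  qed
  have "cls \<Omega> (rep_l2 e) = 0"
  proof (rule HS_dense[OF f])
    fix z assume z: "z \<in> HS"
    then obtain g where "g \<in> L2 \<Omega>" "fst z = cls \<Omega> g" using fst_HS_LS[OF z] by (auto simp: LS_def)
    then show "cls \<Omega> (rep_l2 e) \<bullet> fst z = 0" using eq[of g] orth[OF z] by simp
  qed
  moreover obtain g where "g \<in> L2 \<Omega>" "w = cls \<Omega> g" using w by (auto simp: LS_def)
  ultimately show ?thesis using eq[of g] by simp
qed

text \<open>The equations determine the derivative only for almost every time. Integrals against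
  test functions do not see the exceptional times, so it may be replaced by the continuous function
  a.\<close>

lemma weak_time_derivative_integral:
  fixes G a :: "real \<Rightarrow> real"
  assumes wtd: "weak_time_derivative \<Omega> T g h" and \<phi>: "\<phi> \<in> H10 \<Omega>"
    and G: "continuous_on {0<..<T} G" "\<And>t. t \<in> {0<..<T} \<Longrightarrow> g t \<phi> = G t"
    and a: "continuous_on {0<..<T} a" "AE t in lebesgue_on {0<..<T}. h t \<phi> = a t"
    and st: "0 < s" "s < t" "t < T"
  shows "G t - G s = integral {s..t} a"
proof (rule weak_derivative_integral[OF G(1) a(1) _ st])
  fix \<theta> assume \<theta>: "\<theta> \<in> test_functions {0<..<T}"
  have ma: "a \<in> borel_measurable (lebesgue_on {0<..<T})"
    by (rule continuous_imp_measurable_on_sets_lebesgue[OF a(1)]) auto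
  have mh: "(\<lambda>t. h t \<phi>) \<in> borel_measurable (lebesgue_on {0<..<T})"
    by (rule measurable_lebesgue_on_AE[OF _ ma a(2)]) auto
  have m\<theta>: "\<theta> \<in> borel_measurable (lebesgue_on {0<..<T})"
    using continuous_on_subset[OF smooth_continuous[OF test_smooth[OF \<theta>]]]
    by (intro continuous_imp_measurable_on_sets_lebesgue) auto
  have "(\<integral>t. G t * deriv \<theta> t \<partial>lebesgue_on {0<..<T}) = (\<integral>t. g t \<phi> * deriv \<theta> t \<partial>lebesgue_on {0<..<T})"
    by (rule Bochner_Integration.integral_cong) (auto simp: G(2))
  also have "\<dots> = - (\<integral>t. h t \<phi> * \<theta> t \<partial>lebesgue_on {0<..<T})"
    using wtd \<phi> \<theta> by (simp add: weak_time_derivative_def)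
  also have "(\<integral>t. h t \<phi> * \<theta> t \<partial>lebesgue_on {0<..<T}) = (\<integral>t. a t * \<theta> t \<partial>lebesgue_on {0<..<T})"
    by (rule integral_cong_AE) (use a(2) in \<open>auto intro!: borel_measurable_times mh ma m\<theta>\<close>)
  finally show "(\<integral>t. G t * deriv \<theta> t \<partial>lebesgue_on {0<..<T}) = - (\<integral>t. a t * \<theta> t \<partial>lebesgue_on {0<..<T})" .
qed

end

subsection \<open>Relatively compact weak solutions\<close>

locale weak_trajectory = subcritical \<Omega> \<gamma> \<sigma> for \<Omega> :: "'a::euclidean_space set" and \<gamma> \<sigma> :: real +
  fixes \<alpha> b \<tau> :: real and u0 u1 v0 v1 v2 :: "'a \<Rightarrow> real"
    and u ut v vt wt w :: "real \<Rightarrow> 'a \<Rightarrow> real"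
  assumes sol: "global_weak_solution \<Omega> \<alpha> b \<tau> \<gamma> u0 u1 v0 v1 v2 u ut v vt wt"
    and w_def: "w = (\<lambda>t. w_comb \<tau> (v t) (vt t))"
    and relcompact: "relatively_compactin (phase_space \<Omega>) ((\<lambda>t. (u t, ut t, w t, wt t, vt t)) ` {0..})"
    and data: "u0 \<in> H10 \<Omega>" "v0 \<in> H10 \<Omega>" "v1 \<in> H10 \<Omega>" "u1 \<in> L2 \<Omega>" "v2 \<in> L2 \<Omega>"
    and params: "b > \<tau>" "\<tau> > 0" "\<alpha> \<noteq> 0"
    and \<Omega>_ne: "\<Omega> \<noteq> {}" and \<alpha>_small: "\<bar>\<alpha>\<bar> < first_dirichlet_eigenvalue \<Omega>"
    and below_well: "energy \<Omega> \<alpha> b \<tau> \<gamma> u0 u1 (w_comb \<tau> v0 v1) (w_comb \<tau> v1 v2) v1 < well_depth \<Omega> \<alpha> \<gamma>"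
begin

lemma sol_T: "T > 0 \<Longrightarrow> weak_solution \<Omega> \<alpha> b \<tau> \<gamma> u0 u1 v0 v1 v2 T u ut v vt wt"
  using sol by (simp add: global_weak_solution_def)

lemma sol_facts:
  assumes "T > 0"
  shows "u \<in> strongly_continuous (L2 \<Omega>) (L2_norm \<Omega>) T" "w \<in> strongly_continuous (L2 \<Omega>) (L2_norm \<Omega>) T"
    "ut \<in> weakly_continuous (L2 \<Omega>) (L2_norm \<Omega>) T" "wt \<in> weakly_continuous (L2 \<Omega>) (L2_norm \<Omega>) T"
    "vt \<in> weakly_continuous (H10 \<Omega>) (H1_norm \<Omega>) T"
    "weak_time_derivative \<Omega> T (L2_emb \<Omega> u) (L2_emb \<Omega> ut)"
    "weak_time_derivative \<Omega> T (L2_emb \<Omega> v) (L2_emb \<Omega> vt)"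
    "weak_time_derivative \<Omega> T (L2_emb \<Omega> w) (L2_emb \<Omega> wt)"
  using sol_T[OF assms] by (simp_all add: weak_solution_def Let_def w_def)

lemma members:
  assumes "t \<ge> 0"
  shows "u t \<in> H10 \<Omega>" "w t \<in> H10 \<Omega>" "vt t \<in> H10 \<Omega>" "ut t \<in> L2 \<Omega>" "wt t \<in> L2 \<Omega>"
  using relcompact assms
  by (auto simp: relatively_compactin_def phase_space_def topspace_seminorm_topology)

text \<open>The seminorm topologies are not Hausdorff, as functions equal almost everywhere cannot
  be separated. Compactness is therefore moved to a normed space by the continuous image of the
  closure, where the usual theory is available.\<close>

lemma compact_projection:
  assumes p: "continuous_map (phase_space \<Omega>) euclidean p"
    and Y: "\<And>z. z \<in> topspace (phase_space \<Omega>) \<Longrightarrow> p z \<in> Y"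
  shows "\<exists>K. compact K \<and> K \<subseteq> Y \<and> (\<forall>t\<ge>0. p (u t, ut t, w t, wt t, vt t) \<in> K)"
proof -
  define C where "C = (phase_space \<Omega>) closure_of ((\<lambda>t. (u t, ut t, w t, wt t, vt t)) ` {0..})"
  have C: "compactin (phase_space \<Omega>) C" "(\<lambda>t. (u t, ut t, w t, wt t, vt t)) ` {0..} \<subseteq> C"
    using relcompact closure_of_subset unfolding C_def relatively_compactin_def by auto
  show ?thesis
  proof (intro exI[of _ "p ` C"] conjI)
    show "compact (p ` C)" using image_compactin[OF C(1) p] by simp
    show "p ` C \<subseteq> Y" using compactin_subset_topspace[OF C(1)] Y by blast
  qed (use C(2) in auto)
qed

lemma compact_sets:
  obtains KU KW KP KUt KWt where
    "compact KU" "KU \<subseteq> HS" "\<And>t. t \<ge> 0 \<Longrightarrow> hc (u t) \<in> KU"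
    "compact KW" "KW \<subseteq> HS" "\<And>t. t \<ge> 0 \<Longrightarrow> hc (w t) \<in> KW"
    "compact KP" "KP \<subseteq> HS" "\<And>t. t \<ge> 0 \<Longrightarrow> hc (vt t) \<in> KP"
    "compact KUt" "KUt \<subseteq> LS" "\<And>t. t \<ge> 0 \<Longrightarrow> cls \<Omega> (ut t) \<in> KUt"
    "compact KWt" "KWt \<subseteq> LS" "\<And>t. t \<ge> 0 \<Longrightarrow> cls \<Omega> (wt t) \<in> KWt"
proof -
  have snd_map: "continuous_map (prod_topology X Y) euclidean (\<lambda>z. f (snd z))"
    if "continuous_map Y euclidean f" for X :: "'p topology" and Y :: "'q topology" and f :: "'q \<Rightarrow> 'r::topological_space"
    using continuous_map_compose[OF continuous_map_snd that, of X] by (simp add: o_def)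
  have fst_map: "continuous_map (prod_topology X Y) euclidean (\<lambda>z. f (fst z))"
    if "continuous_map X euclidean f" for X :: "'p topology" and Y :: "'q topology" and f :: "'p \<Rightarrow> 'r::topological_space"
    using continuous_map_compose[OF continuous_map_fst that, of Y] by (simp add: o_def)
  have maps:
    "continuous_map (phase_space \<Omega>) euclidean (\<lambda>z. hc (fst z))"
    "continuous_map (phase_space \<Omega>) euclidean (\<lambda>z. cls \<Omega> (fst (snd z)))"
    "continuous_map (phase_space \<Omega>) euclidean (\<lambda>z. hc (fst (snd (snd z))))"
    "continuous_map (phase_space \<Omega>) euclidean (\<lambda>z. cls \<Omega> (fst (snd (snd (snd z)))))"
    "continuous_map (phase_space \<Omega>) euclidean (\<lambda>z. hc (snd (snd (snd (snd z)))))"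
    unfolding phase_space_def
    by (intro fst_map snd_map continuous_map_hc continuous_map_cls)+
  have top: "topspace (phase_space \<Omega>) = H10 \<Omega> \<times> L2 \<Omega> \<times> H10 \<Omega> \<times> L2 \<Omega> \<times> H10 \<Omega>"
    by (simp add: phase_space_def topspace_seminorm_topology)
  have "\<And>z. z \<in> topspace (phase_space \<Omega>) \<Longrightarrow> hc (fst z) \<in> HS" by (auto simp: top HS_def)
  from compact_projection[OF maps(1) this] obtain K1 where K1: "compact K1" "K1 \<subseteq> HS" "\<And>t. t \<ge> 0 \<Longrightarrow> hc (u t) \<in> K1"
    by auto
  have "\<And>z. z \<in> topspace (phase_space \<Omega>) \<Longrightarrow> cls \<Omega> (fst (snd z)) \<in> LS" by (auto simp: top LS_def)
  from compact_projection[OF maps(2) this] obtain K2 where K2: "compact K2" "K2 \<subseteq> LS" "\<And>t. t \<ge> 0 \<Longrightarrow> cls \<Omega> (ut t) \<in> K2"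
    by auto
  have "\<And>z. z \<in> topspace (phase_space \<Omega>) \<Longrightarrow> hc (fst (snd (snd z))) \<in> HS" by (auto simp: top HS_def)
  from compact_projection[OF maps(3) this] obtain K3 where K3: "compact K3" "K3 \<subseteq> HS" "\<And>t. t \<ge> 0 \<Longrightarrow> hc (w t) \<in> K3"
    by auto
  have "\<And>z. z \<in> topspace (phase_space \<Omega>) \<Longrightarrow> cls \<Omega> (fst (snd (snd (snd z)))) \<in> LS" by (auto simp: top LS_def)
  from compact_projection[OF maps(4) this] obtain K4 where K4: "compact K4" "K4 \<subseteq> LS" "\<And>t. t \<ge> 0 \<Longrightarrow> cls \<Omega> (wt t) \<in> K4"
    by auto
  have "\<And>z. z \<in> topspace (phase_space \<Omega>) \<Longrightarrow> hc (snd (snd (snd (snd z)))) \<in> HS" by (auto simp: top HS_def)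
  from compact_projection[OF maps(5) this] obtain K5 where K5: "compact K5" "K5 \<subseteq> HS" "\<And>t. t \<ge> 0 \<Longrightarrow> hc (vt t) \<in> K5"
    by auto
  show ?thesis by (rule that[OF K1 K3 K5 K2 K4])
qed

lemma strongly_continuous_cls:
  assumes "\<And>T. T > 0 \<Longrightarrow> g \<in> strongly_continuous (L2 \<Omega>) (L2_norm \<Omega>) T"
  shows "continuous_on {0..} (\<lambda>t. cls \<Omega> (g t))"
proof (rule continuous_on_atLeast)
  fix T :: real assume "T > 0"
  note g = assms[OF this, unfolded strongly_continuous_def, simplified]
  show "continuous_on {0..T} (\<lambda>t. cls \<Omega> (g t))"
    unfolding continuous_on_def
  proof
    fix t assume t: "t \<in> {0..T}"
    have "norm (cls \<Omega> (g s) - cls \<Omega> (g t)) = L2_norm \<Omega> (g s - g t)" if "s \<in> {0..T}" for s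
      using g t that cls_diff[OF m\<Omega>, of "g s" "g t"] norm_cls[OF m\<Omega> L2_minus, of "g s" "g t"]
      by (simp add: fun_diff_def)
    moreover have "((\<lambda>s. L2_norm \<Omega> (g s - g t)) \<longlongrightarrow> 0) (at t within {0..T})" using g t by auto
    ultimately have "((\<lambda>s. norm (cls \<Omega> (g s) - cls \<Omega> (g t))) \<longlongrightarrow> 0) (at t within {0..T})"
      by (subst Lim_cong_within[OF refl refl refl]) auto
    then show "((\<lambda>t. cls \<Omega> (g t)) \<longlongrightarrow> cls \<Omega> (g t)) (at t within {0..T})"
      by (simp add: LIM_zero_iff tendsto_norm_zero_iff)
  qed
qed

lemma inner_dual_L2: "(\<phi> :: 'a \<Rightarrow> real) \<in> L2 \<Omega> \<Longrightarrow> (\<lambda>f. L2_inner \<Omega> f \<phi>) \<in> dual_space (L2 \<Omega>) (L2_norm \<Omega>)"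
  unfolding dual_space_def
proof (intro CollectI conjI ballI allI exI[of _ "norm (cls \<Omega> \<phi>)"])
  fix f g :: "'a \<Rightarrow> real" and a c :: real
  assume \<phi>: "\<phi> \<in> L2 \<Omega>" and f: "f \<in> L2 \<Omega>" and g: "g \<in> L2 \<Omega>"
  have "L2_inner \<Omega> (\<lambda>x. a * f x + c * g x) \<phi> = cls \<Omega> (\<lambda>x. a * f x + c * g x) \<bullet> cls \<Omega> \<phi>"
    using inner_cls[OF m\<Omega> L2_add[OF L2_cmult[OF f] L2_cmult[OF g]] \<phi>] by simp
  also have "\<dots> = a * L2_inner \<Omega> f \<phi> + c * L2_inner \<Omega> g \<phi>"
    unfolding cls_add[OF m\<Omega> L2_cmult[OF f] L2_cmult[OF g]] cls_cmult[OF m\<Omega> f] cls_cmult[OF m\<Omega> g]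
    by (simp add: inner_add_left inner_cls[OF m\<Omega>] f g \<phi>)
  finally show "L2_inner \<Omega> (\<lambda>x. a * f x + c * g x) \<phi> = a * L2_inner \<Omega> f \<phi> + c * L2_inner \<Omega> g \<phi>" .
next
  fix f :: "'a \<Rightarrow> real" assume "\<phi> \<in> L2 \<Omega>" "f \<in> L2 \<Omega>"
  then show "\<bar>L2_inner \<Omega> f \<phi>\<bar> \<le> norm (cls \<Omega> \<phi>) * L2_norm \<Omega> f"
    using Cauchy_Schwarz_ineq2[of "cls \<Omega> f" "cls \<Omega> \<phi>"]
    by (simp add: inner_cls[OF m\<Omega>] norm_cls[OF m\<Omega>] mult.commute)
qed

text \<open>Weak continuity of \<open>vt\<close> in \<open>H10\<close> is exploited only through
  functionals given by L2 functions; on the compact range of the trajectory these already separate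
  points.\<close>

lemma inner_dual_H10:
  fixes \<phi> :: "'a \<Rightarrow> real"
  assumes \<phi>: "\<phi> \<in> L2 \<Omega>"
  shows "(\<lambda>f. L2_inner \<Omega> f \<phi>) \<in> dual_space (H10 \<Omega>) (H1_norm \<Omega>)"
proof -
  note d = inner_dual_L2[OF \<phi>, unfolded dual_space_def, simplified]
  obtain C where C: "\<And>f. f \<in> L2 \<Omega> \<Longrightarrow> \<bar>L2_inner \<Omega> f \<phi>\<bar> \<le> C * L2_norm \<Omega> f" using conjunct2[OF d] by metis
  have "\<bar>L2_inner \<Omega> f \<phi>\<bar> \<le> \<bar>C\<bar> * H1_norm \<Omega> f" if f: "f \<in> H10 \<Omega>" for f
  proof -
    have n: "L2_norm \<Omega> f \<le> H1_norm \<Omega> f"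
      using norm_fst_le[of "fst (hc f)" "snd (hc f)"] L2_norm_hc(2)[OF f] norm_hc[OF H10_H1[OF f]] by simp
    have "\<bar>L2_inner \<Omega> f \<phi>\<bar> \<le> C * L2_norm \<Omega> f" by (rule C[OF H1_L2[OF H10_H1[OF f]]])
    also have "\<dots> \<le> \<bar>C\<bar> * L2_norm \<Omega> f" using L2_norm_hc(2)[OF f] by (intro mult_right_mono) auto
    also have "\<dots> \<le> \<bar>C\<bar> * H1_norm \<Omega> f" using n by (rule mult_left_mono) simp
    finally show ?thesis .
  qed
  then show ?thesis using d H1_L2[OF H10_H1] unfolding dual_space_def by blast
qed

lemma weak_continuity:
  assumes x: "x \<in> LS"
  shows "continuous_on {0..} (\<lambda>t. fst (hc (u t)) \<bullet> x)" "continuous_on {0..} (\<lambda>t. fst (hc (w t)) \<bullet> x)"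
    "continuous_on {0..} (\<lambda>t. fst (hc (vt t)) \<bullet> x)"
    "continuous_on {0..} (\<lambda>t. cls \<Omega> (ut t) \<bullet> x)" "continuous_on {0..} (\<lambda>t. cls \<Omega> (wt t) \<bullet> x)"
proof -
  obtain \<phi> where \<phi>: "\<phi> \<in> L2 \<Omega>" "x = cls \<Omega> \<phi>" using x by (auto simp: LS_def)
  show "continuous_on {0..} (\<lambda>t. fst (hc (u t)) \<bullet> x)" "continuous_on {0..} (\<lambda>t. fst (hc (w t)) \<bullet> x)"
    unfolding fst_hc
    by (intro continuous_intros strongly_continuous_cls sol_facts(1); assumption)
      (intro continuous_intros strongly_continuous_cls sol_facts(2); assumption)
  have weak: "continuous_on {0..} (\<lambda>t. cls \<Omega> (g t) \<bullet> x)"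
    if g: "\<And>T. T > 0 \<Longrightarrow> g \<in> weakly_continuous X N T" "X \<subseteq> L2 \<Omega>"
      and dual: "(\<lambda>f. L2_inner \<Omega> f \<phi>) \<in> dual_space X N" for g X N
  proof (rule continuous_on_atLeast)
    fix T :: real assume T: "T > 0"
    have "continuous_on {0..T} (\<lambda>t. L2_inner \<Omega> (g t) \<phi>)" "\<And>t. t \<in> {0..T} \<Longrightarrow> g t \<in> L2 \<Omega>"
      using g(1)[OF T] g(2) dual unfolding weakly_continuous_def by auto
    then show "continuous_on {0..T} (\<lambda>t. cls \<Omega> (g t) \<bullet> x)"
      using continuous_on_cong[of "{0..T}" "{0..T}" "\<lambda>t. cls \<Omega> (g t) \<bullet> x" "\<lambda>t. L2_inner \<Omega> (g t) \<phi>"]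
      by (simp add: \<phi> inner_cls[OF m\<Omega>])
  qed
  show "continuous_on {0..} (\<lambda>t. cls \<Omega> (ut t) \<bullet> x)" "continuous_on {0..} (\<lambda>t. cls \<Omega> (wt t) \<bullet> x)"
    by (rule weak[OF sol_facts(3) order_refl inner_dual_L2[OF \<phi>(1)]], assumption)
      (rule weak[OF sol_facts(4) order_refl inner_dual_L2[OF \<phi>(1)]])
  show "continuous_on {0..} (\<lambda>t. fst (hc (vt t)) \<bullet> x)"
    unfolding fst_hc
    by (rule weak[OF sol_facts(5) _ inner_dual_H10[OF \<phi>(1)]]) (auto intro: H1_L2 H10_H1)
qed

lemma strong_continuity:
  "continuous_on {0..} (\<lambda>t. hc (u t))" "continuous_on {0..} (\<lambda>t. hc (w t))" "continuous_on {0..} (\<lambda>t. hc (vt t))"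
proof -
  obtain KU KW KP KUt KWt where K:
    "compact KU" "KU \<subseteq> HS" "\<And>t. t \<ge> 0 \<Longrightarrow> hc (u t) \<in> KU"
    "compact KW" "KW \<subseteq> HS" "\<And>t. t \<ge> 0 \<Longrightarrow> hc (w t) \<in> KW"
    "compact KP" "KP \<subseteq> HS" "\<And>t. t \<ge> 0 \<Longrightarrow> hc (vt t) \<in> KP"
    by (rule compact_sets) (rule that)
  show "continuous_on {0..} (\<lambda>t. hc (u t))"
    by (rule weak_compact_continuous_fst[OF HS_fst_inj LS_subspace fst_HS_LS K(1-3) weak_continuity(1)])
  show "continuous_on {0..} (\<lambda>t. hc (w t))"
    by (rule weak_compact_continuous_fst[OF HS_fst_inj LS_subspace fst_HS_LS K(4-6) weak_continuity(2)])
  show "continuous_on {0..} (\<lambda>t. hc (vt t))"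
    by (rule weak_compact_continuous_fst[OF HS_fst_inj LS_subspace fst_HS_LS K(7-9) weak_continuity(3)])
qed

lemma L2_emb_cls: "g t \<in> L2 \<Omega> \<Longrightarrow> \<phi> \<in> H10 \<Omega> \<Longrightarrow> L2_emb \<Omega> g t \<phi> = cls \<Omega> (g t) \<bullet> fst (hc \<phi>)"
  by (simp add: L2_emb_def fst_hc inner_cls[OF m\<Omega>] H1_L2 H10_H1)

lemma v_eq:
  assumes "t \<ge> 0" shows "v t \<in> H10 \<Omega>" "hc (v t) = hc (w t) - \<tau> *\<^sub>R hc (vt t)"
proof -
  have v: "v t = (\<lambda>x. 1 * w t x + (- \<tau>) * vt t x)" by (simp add: w_def w_comb_def)
  show "v t \<in> H10 \<Omega>" unfolding v using members[OF assms] by (intro H10_lincomb)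
  show "hc (v t) = hc (w t) - \<tau> *\<^sub>R hc (vt t)"
    using hc_lincomb(2)[OF H10_H1[OF members(2)] H10_H1[OF members(3)], OF assms assms, of 1 "- \<tau>"]
    unfolding v[symmetric] by simp
qed

text \<open>These are the hypotheses of \<open>wave_system\<close> in the form of integral
  identities with continuous integrands. The third states \<open>v\<^sub>t\<close> as derivative of
  v, with v expressed by w and \<open>vt\<close>.\<close>

lemma integral_identities:
  assumes z: "z \<in> HS" and st: "0 < s" "s < t"
  shows "fst (hc (u t)) \<bullet> fst z - fst (hc (u s)) \<bullet> fst z = integral {s..t} (\<lambda>r. cls \<Omega> (ut r) \<bullet> fst z)"
    "fst (hc (w t)) \<bullet> fst z - fst (hc (w s)) \<bullet> fst z = integral {s..t} (\<lambda>r. cls \<Omega> (wt r) \<bullet> fst z)"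
    "fst (hc (w t) - \<tau> *\<^sub>R hc (vt t)) \<bullet> fst z - fst (hc (w s) - \<tau> *\<^sub>R hc (vt s)) \<bullet> fst z
      = integral {s..t} (\<lambda>r. fst (hc (vt r)) \<bullet> fst z)"
    "cls \<Omega> (ut t) \<bullet> fst z - cls \<Omega> (ut s) \<bullet> fst z
      = integral {s..t} (\<lambda>r. (nem (hc (u r)) - \<alpha> *\<^sub>R fst (hc (w r))) \<bullet> fst z - snd (hc (u r)) \<bullet> snd z)"
    "cls \<Omega> (wt t) \<bullet> fst z - cls \<Omega> (wt s) \<bullet> fst z
      = integral {s..t} (\<lambda>r. - (\<alpha> *\<^sub>R fst (hc (u r))) \<bullet> fst z - (snd (hc (w r)) + (b - \<tau>) *\<^sub>R snd (hc (vt r))) \<bullet> snd z)"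
proof -
  obtain \<phi> where \<phi>: "\<phi> \<in> H10 \<Omega>" "z = hc \<phi>" using z by (auto simp: HS_def)
  \<comment> \<open>The distributional identities live on an open interval, so its end must lie
    strictly beyond t.\<close>
  define T where "T = t + 1"
  have T: "T > 0" "t < T" using st by (auto simp: T_def)
  note f = sol_facts[OF T(1)]
  have sub: "{0<..<T} \<subseteq> {0..}" by auto
  note wc = weak_continuity[OF fst_HS_LS[OF z], THEN continuous_on_subset, OF sub]
  note sc = strong_continuity[THEN continuous_on_subset, OF sub]
  have cn: "continuous_on {0<..<T} (\<lambda>r. nem (hc (u r)))"
    by (rule continuous_on_compose2[OF nem_continuous sc(1)]) (use members HS_hc in auto)
  have L: "u r \<in> L2 \<Omega>" "w r \<in> L2 \<Omega>" "vt r \<in> L2 \<Omega>" "v r \<in> L2 \<Omega>" if "r \<in> {0<..<T}" for r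
    using members[of r] v_eq(1)[of r] that H1_L2[OF H10_H1] by auto
  note emb = L2_emb_cls[OF _ \<phi>(1), folded \<phi>(2)]
  show "fst (hc (u t)) \<bullet> fst z - fst (hc (u s)) \<bullet> fst z = integral {s..t} (\<lambda>r. cls \<Omega> (ut r) \<bullet> fst z)"
    by (rule weak_time_derivative_integral[OF f(6) \<phi>(1) wc(1) _ wc(4) _ st T(2)])
      (auto simp: emb L members fst_hc intro!: AE_I2)
  show "fst (hc (w t)) \<bullet> fst z - fst (hc (w s)) \<bullet> fst z = integral {s..t} (\<lambda>r. cls \<Omega> (wt r) \<bullet> fst z)"
    by (rule weak_time_derivative_integral[OF f(8) \<phi>(1) wc(2) _ wc(5) _ st T(2)])
      (auto simp: emb L members fst_hc intro!: AE_I2)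
  show "fst (hc (w t) - \<tau> *\<^sub>R hc (vt t)) \<bullet> fst z - fst (hc (w s) - \<tau> *\<^sub>R hc (vt s)) \<bullet> fst z
      = integral {s..t} (\<lambda>r. fst (hc (vt r)) \<bullet> fst z)"
  proof (rule weak_time_derivative_integral[OF f(7) \<phi>(1) _ _ wc(3) _ st T(2)])
    show "continuous_on {0<..<T} (\<lambda>t. fst (hc (w t) - \<tau> *\<^sub>R hc (vt t)) \<bullet> fst z)" by (intro continuous_intros sc)
  qed (auto simp: emb L v_eq(2)[symmetric] fst_hc intro!: AE_I2)
  obtain utt wtt where tt: "weak_time_derivative \<Omega> T (L2_emb \<Omega> ut) utt" "weak_time_derivative \<Omega> T (L2_emb \<Omega> wt) wtt"
    and eqs: "AE t in lebesgue_on {0<..<T}.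
          (\<forall>\<phi>\<in>H10 \<Omega>. utt t \<phi> + L2_inner \<Omega> (grad \<Omega> (u t)) (grad \<Omega> \<phi>) + \<alpha> * L2_inner \<Omega> (w t) \<phi>
             = L2_inner \<Omega> (\<lambda>x. src \<gamma> (u t x)) \<phi>) \<and>
          (\<forall>\<psi>\<in>H10 \<Omega>. wtt t \<psi> + L2_inner \<Omega> (grad \<Omega> (w t)) (grad \<Omega> \<psi>)
             + (b - \<tau>) * L2_inner \<Omega> (grad \<Omega> (vt t)) (grad \<Omega> \<psi>) + \<alpha> * L2_inner \<Omega> (u t) \<psi> = 0)"
    using sol_T[OF T(1)] unfolding weak_solution_def Let_def w_def by blast
  have pos: "AE r in lebesgue_on {0<..<T}. 0 \<le> r" by (rule AE_I2) auto
  \<comment> \<open>The first equation, valid for almost every time, identifies the abstract second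
    derivative with an expression that is continuous in time.\<close>
  have e1: "AE r in lebesgue_on {0<..<T}. utt r \<phi> = (nem (hc (u r)) - \<alpha> *\<^sub>R fst (hc (w r))) \<bullet> fst z - snd (hc (u r)) \<bullet> snd z"
    using eqs pos
  proof eventually_elim
    case (elim r)
    have "L2_inner \<Omega> (\<lambda>x. src \<gamma> (u r x)) \<phi> = nem (hc (u r)) \<bullet> fst z"
      using inner_cls[OF m\<Omega> src_L2 H1_L2[OF H10_H1[OF \<phi>(1)]]] members[OF elim(2)] by (simp add: nem_hc \<phi> fst_hc)
    then show ?case
      using bspec[OF conjunct1[OF elim(1)] \<phi>(1)] members[OF elim(2)] \<phi>
      by (simp add: L2_inner_hc inner_diff_left)
  qed
  show "cls \<Omega> (ut t) \<bullet> fst z - cls \<Omega> (ut s) \<bullet> fst z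
      = integral {s..t} (\<lambda>r. (nem (hc (u r)) - \<alpha> *\<^sub>R fst (hc (w r))) \<bullet> fst z - snd (hc (u r)) \<bullet> snd z)"
    by (rule weak_time_derivative_integral[OF tt(1) \<phi>(1) wc(4) _ _ e1 st T(2)])
      (auto simp: emb members intro!: continuous_intros cn sc)
  have e2: "AE r in lebesgue_on {0<..<T}. wtt r \<phi> = - (\<alpha> *\<^sub>R fst (hc (u r))) \<bullet> fst z
      - (snd (hc (w r)) + (b - \<tau>) *\<^sub>R snd (hc (vt r))) \<bullet> snd z"
    using eqs pos
  proof eventually_elim
    case (elim r)
    show ?case
      using bspec[OF conjunct2[OF elim(1)] \<phi>(1)] members[OF elim(2)] \<phi>
      by (simp add: L2_inner_hc inner_add_left)
  qed
  show "cls \<Omega> (wt t) \<bullet> fst z - cls \<Omega> (wt s) \<bullet> fst z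
      = integral {s..t} (\<lambda>r. - (\<alpha> *\<^sub>R fst (hc (u r))) \<bullet> fst z - (snd (hc (w r)) + (b - \<tau>) *\<^sub>R snd (hc (vt r))) \<bullet> snd z)"
    by (rule weak_time_derivative_integral[OF tt(2) \<phi>(1) wc(5) _ _ e2 st T(2)])
      (auto simp: emb members intro!: continuous_intros sc)
qed

end


section \<open>Initial energy and conclusion\<close>

context weak_trajectory
begin

lemma energy_hc:
  assumes "f \<in> H10 \<Omega>" "g \<in> H10 \<Omega>" "h \<in> H10 \<Omega>" "f' \<in> L2 \<Omega>" "g' \<in> L2 \<Omega>"
  shows "energy \<Omega> \<alpha> b \<tau> \<gamma> f f' g g' h =
    (norm (cls \<Omega> f'))\<^sup>2 / 2 + (norm (cls \<Omega> g'))\<^sup>2 / 2 + (b - \<tau>) * \<tau> * ((norm (snd (hc h)))\<^sup>2 / 2)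
    + (norm (snd (hc f)))\<^sup>2 / 2 + (norm (snd (hc g)))\<^sup>2 / 2 + \<alpha> * (fst (hc f) \<bullet> fst (hc g)) - pot (hc f)"
  using assms by (simp add: energy_def L2_norm_hc L2_inner_hc pot_hc norm_cls[OF m\<Omega>])

lemma hc_ae_eq: "f \<in> H10 \<Omega> \<Longrightarrow> g \<in> H10 \<Omega> \<Longrightarrow> ae_eq \<Omega> f g \<Longrightarrow> hc f = hc g"
  by (rule HS_fst_inj) (auto simp: HS_hc fst_hc cls_eq_iff[OF m\<Omega>] H1_L2 H10_H1 ae_eq_def)

text \<open>Initial velocities are prescribed only as weak limits at time 0 from the right. Weak
  continuity at 0 provides a second limit, and testing with the difference of the two candidates
  shows that they agree.\<close>

lemma cls_eq_weak_limit:
  assumes f: "f 0 \<in> L2 \<Omega>" "\<And>t. t \<ge> 0 \<Longrightarrow> f t \<in> L2 \<Omega>" and g: "g \<in> L2 \<Omega>"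
    and cont: "\<And>x. x \<in> LS \<Longrightarrow> continuous_on {0..} (\<lambda>t. cls \<Omega> (f t) \<bullet> x)"
    and lim: "\<And>\<phi>. \<phi> \<in> L2 \<Omega> \<Longrightarrow> ((\<lambda>t. L2_inner \<Omega> (f t) \<phi>) \<longlongrightarrow> L2_inner \<Omega> g \<phi>) (at_right (0::real))"
  shows "cls \<Omega> (f 0) = cls \<Omega> g"
proof -
  define \<phi> where "\<phi> = (\<lambda>x. f 0 x - g x)"
  have \<phi>: "\<phi> \<in> L2 \<Omega>" "cls \<Omega> \<phi> = cls \<Omega> (f 0) - cls \<Omega> g"
    unfolding \<phi>_def using L2_diff[OF f(1) g] cls_diff[OF m\<Omega> f(1) g] by auto
  have "((\<lambda>t. cls \<Omega> (f t) \<bullet> cls \<Omega> \<phi>) \<longlongrightarrow> cls \<Omega> (f 0) \<bullet> cls \<Omega> \<phi>) (at 0 within {0..})"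
    using cont[of "cls \<Omega> \<phi>"] \<phi>(1) by (auto simp: continuous_on_def LS_def)
  then have 1: "((\<lambda>t. cls \<Omega> (f t) \<bullet> cls \<Omega> \<phi>) \<longlongrightarrow> cls \<Omega> (f 0) \<bullet> cls \<Omega> \<phi>) (at_right 0)"
    by (rule tendsto_within_subset) auto
  have "((\<lambda>t. cls \<Omega> (f t) \<bullet> cls \<Omega> \<phi>) \<longlongrightarrow> cls \<Omega> g \<bullet> cls \<Omega> \<phi>) (at_right 0)"
  proof (rule Lim_transform_eventually)
    show "((\<lambda>t. L2_inner \<Omega> (f t) \<phi>) \<longlongrightarrow> cls \<Omega> g \<bullet> cls \<Omega> \<phi>) (at_right 0)"
      using lim[OF \<phi>(1)] by (simp add: inner_cls[OF m\<Omega> g \<phi>(1)])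
    show "\<forall>\<^sub>F t in at_right 0. L2_inner \<Omega> (f t) \<phi> = cls \<Omega> (f t) \<bullet> cls \<Omega> \<phi>"
      using eventually_at_right_less by eventually_elim (simp add: inner_cls[OF m\<Omega> f(2) \<phi>(1)])
  qed
  from tendsto_unique[OF trivial_limit_at_right_real 1 this]
  have "cls \<Omega> \<phi> \<bullet> cls \<Omega> \<phi> = 0" by (simp add: \<phi>(2) inner_diff_left)
  then show ?thesis using \<phi>(2) by simp
qed

text \<open>The abstract argument measures the energy of the trajectory at time 0, whereas the
  hypothesis concerns the prescribed data. Both depend only on classes, which coincide.\<close>

lemma initial_energy:
  "energy \<Omega> \<alpha> b \<tau> \<gamma> (u 0) (ut 0) (w 0) (wt 0) (vt 0)
    = energy \<Omega> \<alpha> b \<tau> \<gamma> u0 u1 (w_comb \<tau> v0 v1) (w_comb \<tau> v1 v2) v1"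
proof -
  note m = members[OF order_refl]
  have w0: "w_comb \<tau> v0 v1 \<in> H10 \<Omega>"
    using H10_lincomb[OF data(2,3), of 1 \<tau>] by (simp add: w_comb_def)
  have w1: "w_comb \<tau> v1 v2 \<in> L2 \<Omega>"
    unfolding w_comb_def by (intro L2_add L2_cmult data H1_L2 H10_H1)
  have init: "ae_eq \<Omega> (u 0) u0" "ae_eq \<Omega> (w 0) (w_comb \<tau> v0 v1)" "ae_eq \<Omega> (vt 0) v1"
    "\<And>\<phi>. \<phi> \<in> L2 \<Omega> \<Longrightarrow> ((\<lambda>t. L2_inner \<Omega> (ut t) \<phi>) \<longlongrightarrow> L2_inner \<Omega> u1 \<phi>) (at_right 0)"
    "\<And>\<phi>. \<phi> \<in> L2 \<Omega> \<Longrightarrow> ((\<lambda>t. L2_inner \<Omega> (wt t) \<phi>) \<longlongrightarrow> L2_inner \<Omega> (w_comb \<tau> v1 v2) \<phi>) (at_right 0)"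
    using sol_T[of 1] by (simp_all add: weak_solution_def Let_def w_def)
  have "hc (u 0) = hc u0" "hc (w 0) = hc (w_comb \<tau> v0 v1)" "hc (vt 0) = hc v1"
    by (rule hc_ae_eq[OF m(1) data(1) init(1)] hc_ae_eq[OF m(2) w0 init(2)] hc_ae_eq[OF m(3) data(3) init(3)])+
  moreover have "cls \<Omega> (ut 0) = cls \<Omega> u1"
    by (rule cls_eq_weak_limit[OF m(4) members(4) data(4) weak_continuity(4) init(4)])
  moreover have "cls \<Omega> (wt 0) = cls \<Omega> (w_comb \<tau> v1 v2)"
    by (rule cls_eq_weak_limit[OF m(5) members(5) w1 weak_continuity(5) init(5)])
  ultimately show ?thesis
    using m data w0 w1 by (simp add: energy_hc)
qed

theorem trajectory_decay:
  "((\<lambda>t. hc (u t)) \<longlongrightarrow> 0) at_top" "((\<lambda>t. hc (w t)) \<longlongrightarrow> 0) at_top" "((\<lambda>t. hc (vt t)) \<longlongrightarrow> 0) at_top"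
  "((\<lambda>t. cls \<Omega> (ut t)) \<longlongrightarrow> 0) at_top" "((\<lambda>t. cls \<Omega> (wt t)) \<longlongrightarrow> 0) at_top"
  "((\<lambda>t. energy \<Omega> \<alpha> b \<tau> \<gamma> (u t) (ut t) (w t) (wt t) (vt t)) \<longlongrightarrow> 0) at_top"
proof -
  let ?U = "\<lambda>t. hc (u t)" and ?W = "\<lambda>t. hc (w t)" and ?P = "\<lambda>t. hc (vt t)"
    and ?Ut = "\<lambda>t. cls \<Omega> (ut t)" and ?Wt = "\<lambda>t. cls \<Omega> (wt t)"
  obtain KU KW KP KUt KWt where K:
    "compact KU" "KU \<subseteq> HS" "\<And>t. t \<ge> 0 \<Longrightarrow> ?U t \<in> KU"
    "compact KW" "KW \<subseteq> HS" "\<And>t. t \<ge> 0 \<Longrightarrow> ?W t \<in> KW"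
    "compact KP" "KP \<subseteq> HS" "\<And>t. t \<ge> 0 \<Longrightarrow> ?P t \<in> KP"
    "compact KUt" "KUt \<subseteq> LS" "\<And>t. t \<ge> 0 \<Longrightarrow> ?Ut t \<in> KUt"
    "compact KWt" "KWt \<subseteq> LS" "\<And>t. t \<ge> 0 \<Longrightarrow> ?Wt t \<in> KWt"
    by (rule compact_sets) (rule that)
  have hc0: "hc (\<lambda>x. 0) = 0"
    using HS_fst_inj[OF HS_hc[OF H10_zero] subspace_0[OF HS_subspace]] by (simp add: fst_hc cls_zero)
  \<comment> \<open>It exceeds |\<alpha>|, hence is positive, and by the Rayleigh inequality it
    serves as the Poincare constant of the abstract system.\<close>
  have p0: "first_dirichlet_eigenvalue \<Omega> > 0" using \<alpha>_small by simp
  have pot0: "pot 0 = 0" using pot_hc[OF H10_zero] by (simp add: hc0 Src_0)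
  interpret wave: wave_system HS LS nem pot \<alpha> b \<tau> "first_dirichlet_eigenvalue \<Omega>" ?U ?W ?P ?Ut ?Wt KU KW KP KUt KWt
    by (rule wave_system.intro[OF HS_subspace HS_closed HS_fst_inj LS_subspace fst_HS_LS LS_dense p0 rayleigh[OF \<Omega>_ne]
          nem_continuous pot_continuous pot0 pot_has_derivative params K weak_continuity integral_identities])
  have E: "wave.E t = energy \<Omega> \<alpha> b \<tau> \<gamma> (u t) (ut t) (w t) (wt t) (vt t)" if "t \<ge> 0" for t
    using members[OF that] by (simp add: wave.E_def wave.En_def energy_hc)
  have stationary: "y = 0 \<and> z = 0"
    if y: "y \<in> HS" and z: "z \<in> HS"
      and 1: "\<And>x. x \<in> HS \<Longrightarrow> snd y \<bullet> snd x + \<alpha> * (fst z \<bullet> fst x) = nem y \<bullet> fst x"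
      and 2: "\<And>x. x \<in> HS \<Longrightarrow> snd z \<bullet> snd x + \<alpha> * (fst y \<bullet> fst x) = 0"
      and J: "wave.Jf y z \<le> wave.E 0" for y z
  proof (rule ccontr)
    assume nz: "\<not> (y = 0 \<and> z = 0)"
    \<comment> \<open>Testing the first stationary equation with y and the second with z and adding
      them gives the Nehari constraint.\<close>
    have "Qf y z \<alpha> = nem y \<bullet> fst y"
      using 1[OF y] 2[OF z] by (simp add: Qf_def power2_norm_eq_inner inner_commute)
    from well_depth_le[OF \<Omega>_ne \<alpha>_small y z nz this]
    have "well_depth \<Omega> \<alpha> \<gamma> \<le> wave.Jf y z" by (simp add: Qf_def wave.Jf_def algebra_simps)
    then show False using J below_well initial_energy E[of 0] by simp
  qed
  note decay = wave.decay[OF stationary]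
  show "(?U \<longlongrightarrow> 0) at_top" "(?W \<longlongrightarrow> 0) at_top" "(?P \<longlongrightarrow> 0) at_top" "(?Ut \<longlongrightarrow> 0) at_top" "(?Wt \<longlongrightarrow> 0) at_top"
    by (rule decay wave.P_lim wave.Ut_lim wave.Wt_lim; assumption)+
  show "((\<lambda>t. energy \<Omega> \<alpha> b \<tau> \<gamma> (u t) (ut t) (w t) (wt t) (vt t)) \<longlongrightarrow> 0) at_top"
    by (rule Lim_transform_eventually[OF decay(3) eventually_ge_at_top[of 0, THEN eventually_mono]]) (simp_all add: E)
qed

lemma limitin_H10:
  assumes f: "\<And>t. t \<ge> 0 \<Longrightarrow> f t \<in> H10 \<Omega>" and lim: "((\<lambda>t. hc (f t)) \<longlongrightarrow> 0) at_top"
  shows "limitin (H10_topology \<Omega>) f (\<lambda>x. 0) (at_top :: real filter)"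
  unfolding limitin_def topspace_seminorm_topology
proof (intro conjI allI impI H10_zero)
  fix V assume "openin (H10_topology \<Omega>) V \<and> (\<lambda>x. 0) \<in> V"
  then obtain e where e: "e > 0" "\<And>g. g \<in> H10 \<Omega> \<Longrightarrow> H1_norm \<Omega> (g - (\<lambda>x. 0)) < e \<Longrightarrow> g \<in> V"
    unfolding openin_seminorm_topology by metis
  have "\<forall>\<^sub>F t in at_top. dist (hc (f t)) 0 < e" by (rule tendstoD[OF lim e(1)])
  moreover have "\<forall>\<^sub>F t in at_top. t \<ge> (0::real)" by (rule eventually_ge_at_top)
  ultimately show "\<forall>\<^sub>F t in at_top. f t \<in> V"
  proof eventually_elim
    case (elim t)
    have "f t - (\<lambda>x. 0) = f t" by (simp add: fun_eq_iff)
    then show ?case using elim f[OF elim(2)] by (intro e(2)) (simp_all add: norm_hc H10_H1)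
  qed
qed

end

theorem theorem5p2:
  fixes \<Omega> :: "(real ^ 'n) set"
    and \<alpha> b \<tau> \<gamma> :: real
    and u0 u1 v0 v1 v2 w0 w1 :: "real ^ 'n \<Rightarrow> real"
    and u ut v vt w wt :: "real \<Rightarrow> real ^ 'n \<Rightarrow> real"
  assumes "CARD('n) \<ge> 3"
    and "smooth_bounded_domain \<Omega>"
    and "b > \<tau>" and "\<tau> > 0"
    and "0 < \<bar>\<alpha>\<bar>" and "\<bar>\<alpha>\<bar> < first_dirichlet_eigenvalue \<Omega>"
    and "2 < \<gamma>" and "\<gamma> < 2 * (real CARD('n) - 1) / (real CARD('n) - 2)"
    and "u0 \<in> H10 \<Omega>" and "v0 \<in> H10 \<Omega>" and "v1 \<in> H10 \<Omega>"
    and "u1 \<in> L2 \<Omega>" and "v2 \<in> L2 \<Omega>"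
    and "w0 = w_comb \<tau> v0 v1" and "w1 = w_comb \<tau> v1 v2"
    and "energy \<Omega> \<alpha> b \<tau> \<gamma> u0 u1 w0 w1 v1 < well_depth \<Omega> \<alpha> \<gamma>"
    and "I_fun \<Omega> \<alpha> \<gamma> u0 w0 > 0"
    and "global_weak_solution \<Omega> \<alpha> b \<tau> \<gamma> u0 u1 v0 v1 v2 u ut v vt wt"
    and "w = (\<lambda>t. w_comb \<tau> (v t) (vt t))"
    and "relatively_compactin (phase_space \<Omega>) ((\<lambda>t. (u t, ut t, w t, wt t, vt t)) ` {0..})"
  shows "((\<lambda>t. energy \<Omega> \<alpha> b \<tau> \<gamma> (u t) (ut t) (w t) (wt t) (vt t)) \<longlongrightarrow> 0) at_top \<and>
    ((\<lambda>t. (L2_norm \<Omega> (ut t))\<^sup>2 + (L2_norm \<Omega> (wt t))\<^sup>2 + (L2_norm \<Omega> (grad \<Omega> (vt t)))\<^sup>2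
         + (L2_norm \<Omega> (grad \<Omega> (u t)))\<^sup>2 + (L2_norm \<Omega> (grad \<Omega> (w t)))\<^sup>2) \<longlongrightarrow> 0) at_top \<and>
    limitin (prod_topology (H10_topology \<Omega>) (H10_topology \<Omega>)) (\<lambda>t. (u t, w t)) (\<lambda>x. 0, \<lambda>x. 0) at_top"
proof -
  define n where "n = real CARD('n)"
  have n: "n \<ge> 3" using assms(1) by (simp add: n_def)
  \<comment> \<open>The upper bound on \<gamma> rewritten for the growth exponent. Being strict, it
    leaves room for \<sigma>, whose surplus over \<gamma> - 2 absorbs the logarithm while \<sigma> <
    2/(n - 2) keeps the embedding subcritical.\<close>
  have "\<gamma> - 2 < 2 / (n - 2)"
    using assms(8) n by (simp add: n_def[symmetric] field_simps)
  then obtain \<sigma> where \<sigma>: "\<gamma> - 2 < \<sigma>" "\<sigma> < 2 / (n - 2)" using dense by blast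
  then have "n * \<sigma> < 2 * \<sigma> + 2" using n by (simp add: field_simps)
  then have sub: "real DIM(real ^ 'n) * \<sigma> < 2 * \<sigma> + 2" by (simp add: n_def)
  have \<alpha>: "\<alpha> \<noteq> 0" using assms(5) by simp
  have dom: "open \<Omega>" "bounded \<Omega>" "\<Omega> \<noteq> {}" using assms(2) by (auto simp: smooth_bounded_domain_def)
  have "subcritical \<Omega> \<gamma> \<sigma>" using dom \<sigma> sub assms(7) by unfold_locales
  then interpret weak_trajectory \<Omega> \<gamma> \<sigma> \<alpha> b \<tau> u0 u1 v0 v1 v2 u ut v vt wt w
    by (rule weak_trajectory.intro[OF _ weak_trajectory_axioms.intro])
      (rule assms(18) assms(19) assms(20) assms(9-13) assms(3,4,6) dom(3) assms(16)[unfolded assms(14,15)] \<alpha>)+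
  have "((\<lambda>t. (norm (cls \<Omega> (ut t)))\<^sup>2 + (norm (cls \<Omega> (wt t)))\<^sup>2 + (norm (snd (hc (vt t))))\<^sup>2
        + (norm (snd (hc (u t))))\<^sup>2 + (norm (snd (hc (w t))))\<^sup>2)
      \<longlongrightarrow> (norm (0 :: (real ^ 'n, real) l2))\<^sup>2 + (norm (0 :: (real ^ 'n, real) l2))\<^sup>2
        + (norm (snd (0 :: (real ^ 'n, real) l2 \<times> (real ^ 'n, real ^ 'n) l2)))\<^sup>2
        + (norm (snd (0 :: (real ^ 'n, real) l2 \<times> (real ^ 'n, real ^ 'n) l2)))\<^sup>2
        + (norm (snd (0 :: (real ^ 'n, real) l2 \<times> (real ^ 'n, real ^ 'n) l2)))\<^sup>2) at_top"
    by (intro tendsto_intros trajectory_decay)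
  then have "((\<lambda>t. (norm (cls \<Omega> (ut t)))\<^sup>2 + (norm (cls \<Omega> (wt t)))\<^sup>2 + (norm (snd (hc (vt t))))\<^sup>2
        + (norm (snd (hc (u t))))\<^sup>2 + (norm (snd (hc (w t))))\<^sup>2) \<longlongrightarrow> 0) at_top"
    by simp
  then have "((\<lambda>t. (L2_norm \<Omega> (ut t))\<^sup>2 + (L2_norm \<Omega> (wt t))\<^sup>2 + (L2_norm \<Omega> (grad \<Omega> (vt t)))\<^sup>2
         + (L2_norm \<Omega> (grad \<Omega> (u t)))\<^sup>2 + (L2_norm \<Omega> (grad \<Omega> (w t)))\<^sup>2) \<longlongrightarrow> 0) at_top"
    by (rule Lim_transform_eventually[OF _ eventually_ge_at_top[of 0, THEN eventually_mono]])
      (use members in \<open>simp add: L2_norm_hc norm_cls[OF m\<Omega>]\<close>)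
  moreover have "limitin (prod_topology (H10_topology \<Omega>) (H10_topology \<Omega>)) (\<lambda>t. (u t, w t)) (\<lambda>x. 0, \<lambda>x. 0) at_top"
    using limitin_H10[OF members(1) trajectory_decay(1)] limitin_H10[OF members(2) trajectory_decay(2)]
    by (simp add: limitin_pairwise o_def)
  ultimately show ?thesis using trajectory_decay(6) by blast
qed

end
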